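(* Let $d\ge 1$ and $\alpha>d$, let $(\xi(z)\colon z\in\mathbb{Z}^d)$ be independent and identically distributed with $\operatorname{Prob}(\xi(z)<x)=1-x^{-\alpha}$ for $x\ge 1$, and let $u\colon(0,\infty)\times\mathbb{Z}^d\to[0,\infty)$ be the (almost surely unique) nonnegative solution of $\partial_t u(t,z)=\Delta u(t,z)+\xi(z)u(t,z)$ for $(t,z)\in(0,\infty)\times\mathbb{Z}^d$, $u(0,z)=\mathbf{1}_{\{0\}}(z)$. Let $U(t)=\sum_{z\in\mathbb{Z}^d}u(t,z)$, and put $$q=\frac{d}{\alpha-d},\qquad \theta=\frac{2^dB(\alpha-d,d)}{q^d(d-1)!},$$ where $B(\cdot,\cdot)$ is the Beta function. Then there exist $\mathbb{Z}^d$-valued processes $(Z_t^{(1)}\colon t>0)$ and $(Z_t^{(2)}\colon t>0)$ with $Z_t^{(1)}\neq Z_t^{(2)}$ for all $t>0$ such that $$\lim_{t\to\infty}\frac{u(t,Z_t^{(1)})+u(t,Z_t^{(2)})}{U(t)}=1\ \text{ almost surely},\qquad \lim_{t\to\infty}\frac{u(t,Z_t^{(1)})}{U(t)}=1\ \text{ in probability},$$ and, as $t\to\infty$, $$Z_t^{(1)}\Big(\frac{\log t}{t}\Big)^{q+1}\Longrightarrow X^{(1)}\quad\text{in distribution},$$ where $X^{(1)}$ is an $\mathbb{R}^d$-valued random variable with density $$p^{(1)}(x_1)=\alpha\int_0^\infty\frac{\exp\{-\theta y^{d-\alpha}\}\,dy}{(y+q|x_1|)^{\alpha+1}},\qquad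 x_1\in\mathbb{R}^d.$$
   Context: $|\cdot|$ denotes the $\ell^1$-norm on $\mathbb{R}^d$. The discrete Laplacian is $(\Delta f)(z)=\sum_{y\sim z}[f(y)-f(z)]$ for $f\colon\mathbb{Z}^d\to\mathbb{R}$, where $y\sim z$ means that $y,z\in\mathbb{Z}^d$ are nearest neighbours. Probability statements refer to the law of the potential $\xi$; the processes $Z^{(1)},Z^{(2)}$ are random, defined on the probability space of $\xi$. It is known that $\alpha>d$ guarantees existence and uniqueness of the nonnegative solution, which is given by the Feynman--Kac formula $u(t,z)=\mathbb{E}_0[\exp\{\int_0^t\xi(X_s)\,ds\}\mathbf{1}\{X_t=z\}]$, where $(X_s)_{s\ge 0}$ is the continuous-time simple random walk on $\mathbb{Z}^d$ with generator $\Delta$ started at $0$. *)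

theory Defs
  imports "HOL-Probability.Probability"
begin

text \<open>The lattice \<open>\<int>^d\<close> is \<open>int ^ 'd\<close>, with \<open>d = CARD('d)\<close>; so \<open>d \<ge> 1\<close> holds automatically.\<close>

definition l1_norm :: "'a::linordered_idom ^ 'd::finite \<Rightarrow> 'a" where
  "l1_norm x = (\<Sum>i\<in>UNIV. \<bar>x $ i\<bar>)"

definition lattice_embed :: "int ^ 'd::finite \<Rightarrow> real ^ 'd" where
  "lattice_embed z = (\<chi> i. real_of_int (z $ i))"

definition nearest_neighbours :: "int ^ 'd::finite \<Rightarrow> int ^ 'd \<Rightarrow> bool" where
  "nearest_neighbours y z \<longleftrightarrow> l1_norm (y - z) = 1"

lemma finite_nearest_neighbours: "finite {y. nearest_neighbours y z}"
proof (rule finite_subset)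
  let ?F = "PiE (UNIV :: 'a set) (\<lambda>i. {z $ i - 1 .. z $ i + 1})"
  show "finite (vec_lambda ` ?F)"
    by (intro finite_imageI finite_PiE) auto
  show "{y. nearest_neighbours y z} \<subseteq> vec_lambda ` ?F"
  proof
    fix y assume "y \<in> {y. nearest_neighbours y z}"
    then have sum: "(\<Sum>i\<in>UNIV. \<bar>(y - z) $ i\<bar>) = 1"
      by (simp add: nearest_neighbours_def l1_norm_def)
    have "y $ i \<in> {z $ i - 1 .. z $ i + 1}" for i
      using member_le_sum[of i UNIV "\<lambda>i. \<bar>(y - z) $ i\<bar>"] sum by (simp add: abs_le_iff)
    then have "vec_nth y \<in> ?F"
      by (intro PiE_I) auto
    then show "y \<in> vec_lambda ` ?F"
      by (metis image_eqI vec_nth_inverse)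
  qed
qed

definition discrete_laplacian :: "(int ^ 'd::finite \<Rightarrow> real) \<Rightarrow> int ^ 'd \<Rightarrow> real" where
  "discrete_laplacian f z = (\<Sum>y | nearest_neighbours y z. f y - f z)"

text \<open>
  Nonnegative classical solutions of the Cauchy problem for the parabolic Anderson model with
  deterministic potential \<open>V\<close> and initial condition \<open>\<one>\<^sub>0\<close>. The equation itself only concerns \<open>t > 0\<close>;
  continuity on \<open>[0,\<infinity>)\<close> is what ties it to the initial condition.
\<close>

definition nonneg_pam_solution ::
    "(int ^ 'd::finite \<Rightarrow> real) \<Rightarrow> (real \<Rightarrow> int ^ 'd \<Rightarrow> real) \<Rightarrow> bool" where
  "nonneg_pam_solution V v \<longleftrightarrow>
     (\<forall>t\<ge>0. \<forall>z. v t z \<ge> 0) \<and>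
     (\<forall>z. continuous_on {0..} (\<lambda>t. v t z)) \<and>
     (\<forall>z. v 0 z = (if z = 0 then 1 else 0)) \<and>
     (\<forall>t>0. \<forall>z. ((\<lambda>s. v s z) has_real_derivative
                      discrete_laplacian (v t) z + V z * v t z) (at t))"

definition pam_q :: "nat \<Rightarrow> real \<Rightarrow> real" where
  "pam_q d \<alpha> = real d / (\<alpha> - real d)"

definition pam_theta :: "nat \<Rightarrow> real \<Rightarrow> real" where
  "pam_theta d \<alpha> = 2 ^ d * Beta (\<alpha> - real d) (real d) / (pam_q d \<alpha> ^ d * fact (d - 1))"

definition pam_density :: "real \<Rightarrow> real ^ 'd::finite \<Rightarrow> real" where
  "pam_density \<alpha> x =
     \<alpha> * (LBINT y:{0<..}. exp (- pam_theta CARD('d) \<alpha> * y powr (real CARD('d) - \<alpha>)) /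
            (y + pam_q CARD('d) \<alpha> * l1_norm x) powr (\<alpha> + 1))"

text \<open>
  Convergence as \<open>t \<rightarrow> \<infinity>\<close> of families indexed by \<open>t > 0\<close>; both notions include the measurability of
  the family, since \<open>measure\<close> and the Bochner integral are \<open>0\<close> on non-measurable arguments.
  For quantities built from the solution \<open>u\<close>, which the Cauchy problem determines only outside a
  null set, the former is to be used with the completed measure.
\<close>

definition converges_in_probability ::
    "'a measure \<Rightarrow> (real \<Rightarrow> 'a \<Rightarrow> real) \<Rightarrow> real \<Rightarrow> bool" where
  "converges_in_probability M Y c \<longleftrightarrow>
     (\<forall>t>0. Y t \<in> borel_measurable M) \<and>
     (\<forall>\<epsilon>>0. ((\<lambda>t. measure M {\<omega> \<in> space M. \<bar>Y t \<omega> - c\<bar> > \<epsilon>}) \<longlongrightarrow> 0) at_top)"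

definition converges_in_distribution ::
    "'a measure \<Rightarrow> (real \<Rightarrow> 'a \<Rightarrow> 'c::topological_space) \<Rightarrow> 'b measure \<Rightarrow> ('b \<Rightarrow> 'c) \<Rightarrow> bool" where
  "converges_in_distribution M Y N X \<longleftrightarrow>
     (\<forall>t>0. Y t \<in> borel_measurable M) \<and> X \<in> borel_measurable N \<and>
     (\<forall>f::'c \<Rightarrow> real. continuous_on UNIV f \<longrightarrow> bounded (range f) \<longrightarrow>
        ((\<lambda>t. \<integral>\<omega>. f (Y t \<omega>) \<partial>M) \<longlongrightarrow> (\<integral>\<omega>. f (X \<omega>) \<partial>N)) at_top)"

end

theory Submission
  imports Defs "HOL-Real_Asymp.Real_Asymp"
begin

text \<open>
  Multiplying a nonnegative solution by \<open>exp (2 d t)\<close> makes all its time derivatives nonnegative, so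
  by Bernstein's theorem it is the sum of its Taylor series at \<open>0\<close>. Hence \<open>u t z\<close> is
  \<open>exp (- 2 d t)\<close> times the exponential generating function of weighted lattice walks from \<open>0\<close> to
  \<open>z\<close>, and no Feynman--Kac formula is needed. Walks whose highest visited site is \<open>z\<close> are bounded by
  comparison with a product supersolution, and the shortest paths to \<open>z\<close> give a matching lower
  bound; both are \<open>exp (t \<Psi>\<^sub>t(z))\<close> up to factors \<open>exp (o(t \<Psi>\<^sub>t(z)))\<close>, where
  \<open>\<Psi>\<^sub>t(z) = \<xi>(z) - (\<bar>z\<bar> ln \<xi>(z) - \<eta>(z))\<^sup>+ / t\<close> and \<open>\<eta>(z)\<close> is, to leading order, the logarithm of
  the number of shortest paths to \<open>z\<close>. A walk sum restricted to
  end points other than its maximal site \<open>z\<close> is smaller than that at \<open>z\<close> by the potential gap.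

  Take \<open>Z1\<close> and \<open>Z2\<close> to be the two largest maximisers of \<open>\<Psi>\<^sub>t\<close> in a ball of radius a power of \<open>t\<close>.
  By independence the chance that three sites have \<open>\<Psi>\<^sub>t\<close> within a slightly smaller power of each other
  at some time in \<open>[T, 2 T]\<close> decays polynomially, which with Borel--Cantelli along \<open>T = 2 ^ k\<close> yields
  the almost sure statement; for two sites this holds at a fixed time only, which yields convergence
  in probability. For the limit law, the probability that all values of \<open>\<Psi>\<^sub>t\<close> lie below a level
  converges, and Fatou's lemma bounds \<open>liminf (E (f (Z1 / r)))\<close> from below by the integral of \<open>f\<close>
  against the density; as the density has total mass \<open>1\<close>, applying this to \<open>K + f\<close> and \<open>K - f\<close> suffices.
\<close>

section \<open>Uniqueness of nonnegative solutions\<close>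

text \<open>Only powers of \<open>t\<close> matter. Upper and lower bounds agree with
  \<open>exp (t * psi)\<close> up to factors whose logarithms are of smaller order than
  \<open>t powr (p - \<epsilon>')\<close>, where \<open>p = q + 1\<close>. So a site is negligible
  as soon as its value of \<open>psi\<close> is below the maximum by
  \<open>t powr (q - \<epsilon>')\<close>, which is slightly less than the natural scale
  \<open>t powr q\<close>. That two sites are needed comes from time. A union bound over levels and
  over n-tuples of sites shows that, at a fixed time, n sites lie within this distance of each other
  near the top with probability \<open>T powr (- (n - 1) * \<epsilon>')\<close>, up to an exponent
  of order \<epsilon>. To cover all times in \<open>[T, 2 * T]\<close>, this is used on a grid of
  about \<open>T powr \<epsilon>'\<close> times, again up to an exponent of order \<epsilon>. The
  union bound over the grid is useless for n = 2 and summable along powers of 2 for n = 3. In the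
  limit law the logarithms do matter: \<open>ln \<xi>\<close> is asymptotic to
  \<open>q * ln t\<close> at the relevant heights, which produces the factor q in front of the
  l1-norm in the density, whereas \<open>path_entropy\<close> is smaller by a factor
  \<open>ln t\<close> and disappears.\<close>

lemma absolutely_monotone_Taylor:
  fixes f :: "nat \<Rightarrow> real \<Rightarrow> real"
  assumes deriv: "\<And>k t. t > 0 \<Longrightarrow> (f k has_real_derivative f (Suc k) t) (at t)"
    and nonneg: "\<And>k t. t \<ge> 0 \<Longrightarrow> f k t \<ge> 0"
    and cont: "\<And>k. continuous_on {0..} (f k)"
    and t: "t \<ge> 0"
  shows "(\<lambda>k. f k 0 * t ^ k / fact k) sums f 0 t"
proof (cases "t = 0")
  case True
  have "(\<lambda>k. f k 0 * t ^ k / fact k) = (\<lambda>k. if k = 0 then f 0 0 else 0)"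
    using True by (auto simp: fun_eq_iff)
  then show ?thesis
    using True by (simp add: sums_single [of 0 "\<lambda>_. f 0 0"])
next
  case False
  with t have t: "t > 0" by simp
  have mono: "f k a \<le> f k b" if "0 < a" "a \<le> b" for k a b
    using that deriv nonneg
    by (intro DERIV_nonneg_imp_nondecreasing[OF that(2)]) (auto, meson dual_order.strict_trans1 less_imp_le)
  \<comment> \<open>The expansion is based at a point a > 0, because differentiability is assumed
    only there; continuity lets a tend to 0 at the end.\<close>
  have taylor: "\<exists>s. 0 < s \<and> s < h \<and> f 0 (a + h) = (\<Sum>k<n. f k a * h ^ k / fact k) + f n (a + s) * h ^ n / fact n"
    if "a > 0" "h > 0" "n > 0" for a h n
  proof -
    have "\<forall>m x. m < n \<and> 0 \<le> x \<and> x \<le> h \<longrightarrow>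
        ((\<lambda>x. f m (a + x)) has_real_derivative f (Suc m) (a + x)) (at x)"
    proof (intro allI impI)
      fix m x assume "m < n \<and> 0 \<le> x \<and> x \<le> h"
      then have "a + x > 0" using that by auto
      from DERIV_shift[of "f m" _ x a, THEN iffD1, of "f (Suc m) (a+x)"] deriv[OF this, of m]
      show "((\<lambda>x. f m (a + x)) has_real_derivative f (Suc m) (a + x)) (at x)"
        by (simp add: add.commute)
    qed
    from Maclaurin[OF \<open>h > 0\<close> \<open>n > 0\<close> _ this]
    show ?thesis by (auto simp: algebra_simps)
  qed
  have lower: "(\<Sum>k<n. f k a * h ^ k / fact k) + f n a * h ^ n / fact n \<le> f 0 (a + h)"
    and upper: "f 0 (a + h) \<le> (\<Sum>k<n. f k a * h ^ k / fact k) + f n (a + h) * h ^ n / fact n"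
    if "a > 0" "h > 0" "n > 0" for a h n
    using taylor[OF that] that
    by (auto intro!: divide_right_mono mult_right_mono mono)
  have lower': "(\<Sum>k<n. f k a * h ^ k / fact k) \<le> f 0 (a + h)" if "a > 0" "h > 0" "n > 0" for a h n
    using lower[OF that] nonneg[of a n] that
    by (smt (verit) divide_nonneg_pos fact_gt_zero mult_nonneg_nonneg zero_le_power)
  \<comment> \<open>Expand at a + h with the step 2 * h: all terms are nonnegative, so the n-th one
    alone is at most \<open>f 0 (a + 3 * h)\<close>. Going back to the step h gains
    \<open>2 ^ n\<close>, hence the Lagrange remainder vanishes as n grows.\<close>
  have rem: "f n (a + h) * h ^ n / fact n \<le> f 0 (a + 3 * h) / 2 ^ n"
    if "a > 0" "h > 0" "n > 0" for a h n
  proof -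
    have "f n (a + h) * (2 * h) ^ n / fact n \<le> f 0 ((a + h) + 2 * h)"
      using lower[of "a + h" "2 * h" n] that
        sum_nonneg[of "{..<n}" "\<lambda>k. f k (a + h) * (2 * h) ^ k / fact k"] nonneg
      by (smt (verit) divide_nonneg_pos fact_gt_zero mult_nonneg_nonneg zero_le_power)
    then have "f n (a + h) * h ^ n / fact n * 2 ^ n \<le> f 0 (a + 3 * h)"
      by (simp add: power_mult_distrib mult_ac add.assoc)
    then show ?thesis by (simp add: field_simps)
  qed
  have lim: "((\<lambda>a. f k (a + c)) \<longlongrightarrow> f k c) (at_right 0)" if "c \<ge> 0" for k c
  proof -
    have "(f k \<longlongrightarrow> f k c) (at c within {0..})"
      using cont[of k] that by (auto simp: continuous_on_def)
    then have 1: "(f k \<longlongrightarrow> f k c) (at_right c)"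
      by (rule tendsto_within_subset) (use that in auto)
    have "filtermap (\<lambda>a. a + c) (at_right 0) = at_right c"
      using filtermap_at_right_shift[of "-c" 0] by simp
    with 1 have "(f k \<longlongrightarrow> f k c) (filtermap (\<lambda>a. a + c) (at_right 0))" by simp
    then show ?thesis by (simp add: filterlim_filtermap)
  qed
  have bounds: "(\<Sum>k<n. f k 0 * t ^ k / fact k) \<le> f 0 t"
    "f 0 t \<le> (\<Sum>k<n. f k 0 * t ^ k / fact k) + f 0 (3 * t) / 2 ^ n" if "n > 0" for n
  proof -
    have s: "((\<lambda>a. \<Sum>k<n. f k a * t ^ k / fact k) \<longlongrightarrow> (\<Sum>k<n. f k 0 * t ^ k / fact k)) (at_right 0)"
      using lim[of 0] by (auto intro!: tendsto_intros)
    have ev: "\<forall>\<^sub>F a in at_right (0::real). a > 0"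
      by (simp add: eventually_at_right_less)
    show "(\<Sum>k<n. f k 0 * t ^ k / fact k) \<le> f 0 t"
      by (rule tendsto_le[OF _ lim s], simp, use t in simp)
        (use ev in eventually_elim, rule lower', use t that in auto)
    have "((\<lambda>a. (\<Sum>k<n. f k a * t ^ k / fact k) + f 0 (a + 3 * t) / 2 ^ n) \<longlongrightarrow>
       (\<Sum>k<n. f k 0 * t ^ k / fact k) + f 0 (3 * t) / 2 ^ n) (at_right 0)"
      using t by (intro tendsto_intros s lim) auto
    moreover have "\<forall>\<^sub>F a in at_right 0. f 0 (a + t) \<le> (\<Sum>k<n. f k a * t ^ k / fact k) + f 0 (a + 3 * t) / 2 ^ n"
      using ev
    proof eventually_elim
      case (elim a)
      show ?case using upper[OF elim t that] rem[OF elim t that] by linarith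
    qed
    ultimately show "f 0 t \<le> (\<Sum>k<n. f k 0 * t ^ k / fact k) + f 0 (3 * t) / 2 ^ n"
      by (intro tendsto_le[OF _ _ lim]) (use t in auto)
  qed
  have "(\<lambda>n. \<Sum>k<n. f k 0 * t ^ k / fact k) \<longlonglongrightarrow> f 0 t"
  proof (rule tendsto_sandwich)
    show "(\<lambda>n. f 0 t - f 0 (3 * t) * (1 / 2) ^ n) \<longlonglongrightarrow> f 0 t"
      by (rule tendsto_eq_intros LIMSEQ_realpow_zero refl | simp)+
    show "\<forall>\<^sub>F n in sequentially. f 0 t - f 0 (3 * t) * (1 / 2) ^ n \<le> (\<Sum>k<n. f k 0 * t ^ k / fact k)"
      using eventually_gt_at_top[of 0]
    proof eventually_elim
      case (elim n)
      show ?case using bounds(2)[OF elim] by (simp add: power_one_over)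
    qed
    show "\<forall>\<^sub>F n in sequentially. (\<Sum>k<n. f k 0 * t ^ k / fact k) \<le> f 0 t"
      using eventually_gt_at_top[of 0] by eventually_elim (rule bounds)
  qed simp
  then show ?thesis by (simp add: sums_def)
qed

section \<open>Weighted walks and nearest neighbours\<close>

abbreviation nbrs :: "int ^ 'd::finite \<Rightarrow> (int ^ 'd) set" where
  "nbrs z \<equiv> {y. nearest_neighbours y z}"

text \<open>
  \<open>walk V S k x\<close> is the total weight of the paths from \<open>0\<close> to \<open>x\<close> in \<open>S\<close> with \<open>k\<close> moves, each of
  which goes to a neighbour with weight \<open>1\<close> or stays at \<open>z\<close> with weight \<open>V z\<close>. The diagonal part
  \<open>- 2 d\<close> of the Laplacian is left out; it reappears as the factor \<open>exp (2 d t)\<close>.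
\<close>

fun walk :: "(int ^ 'd::finite \<Rightarrow> real) \<Rightarrow> (int ^ 'd) set \<Rightarrow> nat \<Rightarrow> int ^ 'd \<Rightarrow> real" where
  "walk V S 0 x = (if x = 0 \<and> 0 \<in> S then 1 else 0)"
| "walk V S (Suc k) x = (if x \<in> S then (\<Sum>y\<in>nbrs x. walk V S k y) + V x * walk V S k x else 0)"

lemma l1_norm_axis: "l1_norm (axis i c) = \<bar>c\<bar>"
proof -
  have "l1_norm (axis i c) = (\<Sum>j\<in>UNIV. if j = i then \<bar>c\<bar> else 0)"
    unfolding l1_norm_def by (intro sum.cong) (auto simp: axis_def)
  then show ?thesis by simp
qed

lemma nbrs_eq: "nbrs x = (\<lambda>i. x + axis i 1) ` UNIV \<union> (\<lambda>i. x - axis i 1) ` UNIV"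
proof (intro equalityI subsetI)
  fix y assume "y \<in> nbrs x"
  then have sum: "(\<Sum>i\<in>UNIV. \<bar>(y - x) $ i\<bar>) = 1"
    by (simp add: nearest_neighbours_def l1_norm_def)
  then obtain i where i: "(y - x) $ i \<noteq> 0"
    by (metis (no_types, lifting) abs_zero sum.neutral zero_neq_one)
  have "(\<Sum>j\<in>UNIV. \<bar>(y - x) $ j\<bar>) = \<bar>(y - x) $ i\<bar> + (\<Sum>j\<in>UNIV-{i}. \<bar>(y - x) $ j\<bar>)"
    by (simp add: sum.remove)
  moreover have "(\<Sum>j\<in>UNIV-{i}. \<bar>(y - x) $ j\<bar>) \<ge> 0" by (simp add: sum_nonneg)
  ultimately have 1: "\<bar>(y - x) $ i\<bar> = 1" "(\<Sum>j\<in>UNIV-{i}. \<bar>(y - x) $ j\<bar>) = 0"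
    using i sum by linarith+
  then have "\<forall>j\<in>UNIV-{i}. \<bar>(y - x) $ j\<bar> = 0"
    by (subst (asm) sum_nonneg_eq_0_iff) auto
  then have "y - x = axis i 1 \<or> y - x = - axis i 1"
    using 1(1) by (auto simp: vec_eq_iff axis_def)
  then show "y \<in> (\<lambda>i. x + axis i 1) ` UNIV \<union> (\<lambda>i. x - axis i 1) ` UNIV"
    by (auto simp: algebra_simps) 
qed (auto simp: nearest_neighbours_def l1_norm_axis, simp add: l1_norm_def,
     metis (no_types, lifting) abs_minus_cancel l1_norm_axis l1_norm_def sum.cong abs_one vector_uminus_component)

lemma sum_nbrs:
  fixes x :: "int ^ 'd::finite"
  shows "(\<Sum>y\<in>nbrs x. f y) = (\<Sum>i\<in>UNIV. f (x + axis i 1) + f (x - axis i (1::int)))"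
proof -
  have inj: "inj (\<lambda>i. x + axis i 1)" "inj (\<lambda>i. x - axis i 1)"
    by (auto simp: inj_def axis_eq_axis)
  have disj: "(\<lambda>i. x + axis i 1) ` UNIV \<inter> (\<lambda>i. x - axis i 1) ` UNIV = {}"
  proof -
    have False if "axis i (1::int) = - axis j 1" for i j :: 'd
      using arg_cong[OF that, of "\<lambda>v. v $ i"] by (simp add: axis_def split: if_splits)
    then show ?thesis by (auto simp: algebra_simps) (metis add.inverse_unique)
  qed
  show ?thesis
    unfolding nbrs_eq sum.union_disjoint[OF _ _ disj, simplified]
    by (simp add: sum.reindex inj sum.distrib)
qed

lemma nbrs_sym: "y \<in> nbrs x \<longleftrightarrow> x \<in> nbrs y"
  by (simp add: nearest_neighbours_def l1_norm_def abs_minus_commute)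

lemma card_nbrs: "card (nbrs (x :: int ^ 'd::finite)) = 2 * CARD('d)"
  using sum_nbrs[of "\<lambda>_. 1::nat" x] by simp

lemma finite_nbrs [simp]: "finite (nbrs x)"
  by (rule finite_nearest_neighbours)

text \<open>The operator \<open>H\<close> has only nonnegative coefficients, because the exponential
  factor cancels the diagonal of the Laplacian. As it involves finite sums only, \<open>W k\<close>
  is the k-th time derivative of \<open>W 0\<close>, and at time 0 it satisfies the recursion of
  \<open>walk\<close>. The series depends on \<open>V\<close> alone, so uniqueness is part of the
  statement.\<close>

theorem nonneg_pam_solution_sums:
  fixes V :: "int ^ 'd::finite \<Rightarrow> real" and t :: real
  assumes sol: "nonneg_pam_solution V v" and V: "\<And>z. V z \<ge> 0" and t: "t \<ge> 0"
  shows "(\<lambda>k. walk V UNIV k z * t ^ k / fact k) sums (exp (2 * real CARD('d) * t) * v t z)"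
proof -
  define H where "H = (\<lambda>f z. (\<Sum>y\<in>nbrs z. f y) + V z * f z)"
  define W where "W = (\<lambda>k (t::real). (H ^^ k) (\<lambda>z. exp (2 * real CARD('d) * t) * v t z))"
  have W_Suc: "W (Suc k) t z = (\<Sum>y\<in>nbrs z. W k t y) + V z * W k t z" for k t z
    by (simp add: W_def H_def)
  have W_0: "W 0 t z = exp (2 * real CARD('d) * t) * v t z" for t z by (simp add: W_def)
  have nonneg: "W k t z \<ge> 0" if "t \<ge> 0" for k t z
  proof (induction k arbitrary: z)
    case 0 then show ?case using sol that by (simp add: W_0 nonneg_pam_solution_def)
  next
    case (Suc k) then show ?case by (simp add: W_Suc V sum_nonneg)
  qed
  have cont: "continuous_on {0..} (\<lambda>t. W k t z)" for k z
  proof (induction k arbitrary: z)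
    case 0 then show ?case using sol unfolding W_0
      by (intro continuous_intros) (auto simp: nonneg_pam_solution_def)
  next
    case (Suc k) then show ?case unfolding W_Suc by (intro continuous_intros) auto
  qed
  have deriv: "((\<lambda>t. W k t z) has_real_derivative W (Suc k) t z) (at t)" if "t > 0" for k t z
  proof (induction k arbitrary: z)
    case 0
    have "((\<lambda>s. v s z) has_real_derivative discrete_laplacian (v t) z + V z * v t z) (at t)"
      using sol that by (simp add: nonneg_pam_solution_def)
    then show ?case unfolding W_0 W_Suc
      by (auto intro!: derivative_eq_intros
          simp: discrete_laplacian_def sum_subtractf card_nbrs algebra_simps sum_distrib_left sum_distrib_right)
  next
    case (Suc k)
    have "((\<lambda>t. (\<Sum>y\<in>nbrs z. W k t y) + V z * W k t z) has_real_derivative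
        (\<Sum>y\<in>nbrs z. W (Suc k) t y) + V z * W (Suc k) t z) (at t)"
      by (intro DERIV_add DERIV_sum DERIV_cmult Suc.IH)
    then show ?case by (simp add: W_Suc)
  qed
  have "W k 0 z = walk V UNIV k z" for k z
  proof (induction k arbitrary: z)
    case 0 then show ?case using sol by (simp add: W_0 nonneg_pam_solution_def)
  next
    case (Suc k) then show ?case by (simp add: W_Suc)
  qed
  then show ?thesis
    using absolutely_monotone_Taylor[of "\<lambda>k t. W k t z" t, OF deriv nonneg cont t] by (simp add: W_0)
qed

section \<open>Bounds on walk sums\<close>

lemma l1_norm_triangle: "l1_norm (x + y) \<le> l1_norm x + (l1_norm y :: 'a::linordered_idom)"
  by (simp add: l1_norm_def sum.distrib[symmetric] sum_mono abs_triangle_ineq)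

lemma l1_norm_nonneg [simp]: "l1_norm x \<ge> (0 :: 'a::linordered_idom)"
  by (simp add: l1_norm_def sum_nonneg)

lemma l1_norm_zero [simp]: "l1_norm 0 = (0 :: 'a::linordered_idom)"
  by (simp add: l1_norm_def)

lemma l1_norm_nbr_le: "y \<in> nbrs x \<Longrightarrow> l1_norm x \<le> l1_norm y + 1"
  using l1_norm_triangle[of y "x - y"] nbrs_sym[of y x]
  by (simp add: nearest_neighbours_def)

definition ballz :: "real \<Rightarrow> (int ^ 'd::finite) set" where
  "ballz r = {x. of_int (l1_norm x) \<le> r}"

lemma ballz_mono: "r \<le> s \<Longrightarrow> ballz r \<subseteq> ballz s"
  by (auto simp: ballz_def)

lemma walk_outside: "x \<notin> S \<Longrightarrow> walk V S k x = 0"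
  by (cases k) auto

lemma walk_nonneg: "(\<And>z. V z \<ge> 0) \<Longrightarrow> walk V S k x \<ge> 0"
  by (induction k arbitrary: x) (auto intro!: add_nonneg_nonneg sum_nonneg)

lemma walk_mono:
  assumes V: "\<And>z. V z \<ge> 0" and S: "S \<subseteq> S'"
  shows "walk V S k x \<le> walk V S' k x"
proof (induction k arbitrary: x)
  case 0 then show ?case using S by auto
next
  case (Suc k)
  then show ?case using S V walk_nonneg[OF V, where S=S' and k=k]
    by (auto intro!: add_mono sum_mono mult_left_mono add_nonneg_nonneg sum_nonneg)
qed

text \<open>A move changes the l1-norm by at most 1, so at most n moves do not leave the ball of
  radius n. The second conjunct carries the induction: it shows that sites outside \<open>S\<close>
  are not reached by unrestricted walks either.\<close>

lemma walk_eq_UNIV: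
  assumes "ballz (real n) \<subseteq> S" "k \<le> n"
  shows "walk V S k x = walk V UNIV k x \<and> (walk V UNIV k x \<noteq> 0 \<longrightarrow> l1_norm x \<le> int k)"
  using assms(2)
proof (induction k arbitrary: x)
  case 0
  have "0 \<in> ballz (real n)" by (simp add: ballz_def)
  then show ?case using assms(1) by auto
next
  case (Suc k)
  then have IH: "walk V S k y = walk V UNIV k y" "walk V UNIV k y \<noteq> 0 \<Longrightarrow> l1_norm y \<le> int k" for y
    by auto
  have far: "l1_norm x \<le> int (Suc k)" if "walk V UNIV (Suc k) x \<noteq> 0"
  proof -
    from that have "(\<exists>y\<in>nbrs x. walk V UNIV k y \<noteq> 0) \<or> walk V UNIV k x \<noteq> 0"
      by (auto dest: sum.not_neutral_contains_not_neutral)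
    then show ?thesis using IH(2) l1_norm_nbr_le[of _ x] by fastforce
  qed
  moreover have "walk V S (Suc k) x = walk V UNIV (Suc k) x"
  proof (cases "x \<in> S")
    case True then show ?thesis using IH by simp
  next
    case False
    have "int (Suc k) \<le> int n" using Suc.prems by simp
    then have "\<not> l1_norm x \<le> int (Suc k)" using False assms(1)
      by (auto simp: ballz_def subset_iff)
    then show ?thesis using far walk_outside[OF False] by metis
  qed
  ultimately show ?case by simp
qed

section \<open>Pairing walks with weight functions\<close>

lemma sum_nbrs_swap:
  fixes c \<phi> :: "int ^ 'd::finite \<Rightarrow> real"
  assumes "finite S" "\<And>y. y \<notin> S \<Longrightarrow> c y = 0" "T \<subseteq> S"
  shows "(\<Sum>x\<in>T. \<phi> x * (\<Sum>y\<in>nbrs x. c y)) = (\<Sum>y\<in>S. c y * (\<Sum>x\<in>nbrs y \<inter> T. \<phi> x))"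
proof -
  have fT: "finite T" using assms finite_subset by blast
  have "(\<Sum>x\<in>T. \<phi> x * (\<Sum>y\<in>nbrs x. c y)) = (\<Sum>x\<in>T. \<Sum>y\<in>S. if y \<in> nbrs x then \<phi> x * c y else 0)"
  proof (rule sum.cong[OF refl])
    fix x
    have "(\<Sum>y\<in>nbrs x. c y) = (\<Sum>y\<in>S \<inter> nbrs x. c y)"
      using assms by (intro sum.mono_neutral_right) auto
    also have "\<phi> x * \<dots> = (\<Sum>y\<in>S. if y \<in> nbrs x then \<phi> x * c y else 0)"
      using assms(1) by (simp add: sum_distrib_left sum.inter_restrict if_distrib cong: if_cong)
    finally show "\<phi> x * (\<Sum>y\<in>nbrs x. c y) = \<dots>" .
  qed
  also have "\<dots> = (\<Sum>y\<in>S. \<Sum>x\<in>T. if x \<in> nbrs y then \<phi> x * c y else 0)"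
    by (subst sum.swap) (simp only: nbrs_sym)
  also have "\<dots> = (\<Sum>y\<in>S. c y * (\<Sum>x\<in>nbrs y \<inter> T. \<phi> x))"
  proof (rule sum.cong[OF refl])
    fix y
    have "(\<Sum>x\<in>T. if x \<in> nbrs y then \<phi> x * c y else 0) = (\<Sum>x\<in>T \<inter> nbrs y. \<phi> x * c y)"
      using fT by (simp add: sum.inter_restrict)
    also have "\<dots> = c y * (\<Sum>x\<in>nbrs y \<inter> T. \<phi> x)"
      by (simp add: sum_distrib_left mult.commute Int_commute)
    finally show "(\<Sum>x\<in>T. if x \<in> nbrs y then \<phi> x * c y else 0) = \<dots>" .
  qed
  finally show ?thesis .
qed

text \<open>The one-step operator on \<open>S\<close> is symmetric and may therefore be moved from
  the walks to the weight \<phi>. If it maps a nonnegative \<phi> to at most l times \<phi>, the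
  paired sum grows by at most the factor l per step.\<close>

lemma walk_pairing:
  assumes "finite S"
  shows "(\<Sum>x\<in>S. \<phi> x * walk V S (Suc k) x) =
    (\<Sum>x\<in>S. walk V S k x * ((\<Sum>y\<in>nbrs x \<inter> S. \<phi> y) + V x * \<phi> x))"
proof -
  have "(\<Sum>x\<in>S. \<phi> x * walk V S (Suc k) x) =
      (\<Sum>x\<in>S. \<phi> x * (\<Sum>y\<in>nbrs x. walk V S k y)) + (\<Sum>x\<in>S. walk V S k x * (V x * \<phi> x))"
    by (simp add: algebra_simps sum.distrib)
  also have "(\<Sum>x\<in>S. \<phi> x * (\<Sum>y\<in>nbrs x. walk V S k y)) =
      (\<Sum>x\<in>S. walk V S k x * (\<Sum>y\<in>nbrs x \<inter> S. \<phi> y))"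
    by (rule sum_nbrs_swap) (auto simp: assms walk_outside)
  finally show ?thesis by (simp add: algebra_simps sum.distrib)
qed

lemma card_nbrs_Int_le: "card (nbrs (x :: int ^ 'd::finite) \<inter> S) \<le> 2 * CARD('d)"
  by (metis card_mono card_nbrs finite_nbrs inf_le1)

lemma sum_walk_le:
  fixes V :: "int ^ 'd::finite \<Rightarrow> real"
  assumes "finite S" "\<And>z. V z \<ge> 0" "\<And>x. x \<in> S \<Longrightarrow> V x \<le> h" "h \<ge> 0"
  shows "(\<Sum>x\<in>S. walk V S k x) \<le> (h + 2 * CARD('d)) ^ k"
proof (induction k)
  case 0
  then show ?case using assms(1) by (simp add: if_distrib sum.If_cases)
     (simp add: card_insert_if Int_def card_le_Suc0_iff_eq)
next
  case (Suc k)
  have "(\<Sum>x\<in>S. walk V S (Suc k) x) = (\<Sum>x\<in>S. walk V S k x * (card (nbrs x \<inter> S) + V x))"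
    using walk_pairing[OF assms(1), of "\<lambda>_. 1" V k] by simp
  also have "\<dots> \<le> (\<Sum>x\<in>S. walk V S k x * (h + 2 * CARD('d)))"
    using assms card_nbrs_Int_le[of _ S]
    by (intro sum_mono mult_left_mono walk_nonneg) (auto simp: add.commute intro!: add_mono, metis of_nat_le_iff of_nat_mult of_nat_numeral)
  also have "\<dots> \<le> (h + 2 * CARD('d)) ^ k * (h + 2 * CARD('d))"
    using Suc assms by (simp flip: sum_distrib_right add: mult_right_mono)
  finally show ?case by (simp add: mult.commute)
qed

text \<open>
  Pairing the walks that have avoided \<open>z\<close> with \<open>f\<close>, and counting those that have hit \<open>z\<close> with weight
  \<open>1 \<le> f z\<close>, gives a quantity that starts at \<open>f 0\<close> and grows by at most a factor \<open>l\<close> in each step.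
\<close>

lemma sum_walk_visiting_le:
  fixes V f :: "int ^ 'd::finite \<Rightarrow> real"
  assumes S: "finite S" and V: "\<And>z. V z \<ge> 0" and z: "z \<in> S" "z \<noteq> 0"
    and f: "\<And>x. f x \<ge> 0" "f z \<ge> 1"
    and super: "\<And>x. x \<in> S \<Longrightarrow> x \<noteq> z \<Longrightarrow> (\<Sum>y\<in>nbrs x \<inter> S. f y) + V x * f x \<le> l * f x"
    and l: "\<And>x. x \<in> S \<Longrightarrow> V x + 2 * CARD('d) \<le> l"
  shows "(\<Sum>x\<in>S. walk V S k x - walk V (S - {z}) k x) \<le> l ^ k * f 0"
proof -
  let ?T = "S - {z}"
  define C where "C = (\<lambda>k x. walk V S k x - walk V ?T k x)"
  have C0: "C k x \<ge> 0" for k x unfolding C_def using walk_mono[OF V, where S="?T" and S'=S and k=k and x=x] by auto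
  have l0: "l \<ge> 0" using l[OF z(1)] V[of z] by linarith
  have fT: "finite ?T" using S by simp
  have T_S: "(\<Sum>x\<in>?T. g x * walk V ?T k x) = (\<Sum>x\<in>S. g x * walk V ?T k x)" for g k
    using S by (intro sum.mono_neutral_left) (auto simp: walk_outside)
  define J where "J = (\<lambda>k. (\<Sum>x\<in>?T. f x * walk V ?T k x) + (\<Sum>x\<in>S. C k x))"
  have step: "J (Suc k) \<le> l * J k" for k
  proof -
    have "(\<Sum>x\<in>S. C (Suc k) x) = (\<Sum>x\<in>S. walk V S (Suc k) x) - (\<Sum>x\<in>?T. walk V ?T (Suc k) x)"
      unfolding C_def using T_S[of "\<lambda>_. 1" "Suc k"] by (simp only: sum_subtractf mult_1_left)
    also have "\<dots> = (\<Sum>x\<in>S. walk V S k x * (card (nbrs x \<inter> S) + V x))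
         - (\<Sum>x\<in>?T. walk V ?T k x * (card (nbrs x \<inter> ?T) + V x))"
      using walk_pairing[OF S, of "\<lambda>_. 1" V k] walk_pairing[OF fT, of "\<lambda>_. 1" V k] by simp
    also have "(\<Sum>x\<in>S. walk V S k x * (card (nbrs x \<inter> S) + V x)) =
        (\<Sum>x\<in>S. C k x * (card (nbrs x \<inter> S) + V x)) +
        (\<Sum>x\<in>?T. (card (nbrs x \<inter> S) + V x) * walk V ?T k x)"
      unfolding T_S by (simp add: C_def algebra_simps sum.distrib sum_subtractf)
    \<comment> \<open>The difference of the two cardinalities is 1 for neighbours of z and 0
      otherwise: it accounts for the walks that hit z for the first time in this step. Their weight
      1 is at most \<open>f z\<close>, the very term that the sum of f over the neighbours in
      \<open>S - {z}\<close> is missing.\<close>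
    finally have 1: "(\<Sum>x\<in>S. C (Suc k) x) = (\<Sum>x\<in>S. C k x * (card (nbrs x \<inter> S) + V x)) +
        (\<Sum>x\<in>?T. walk V ?T k x * (real (card (nbrs x \<inter> S)) - card (nbrs x \<inter> ?T)))"
      by (simp add: algebra_simps sum.distrib sum_subtractf)
    have 2: "(\<Sum>x\<in>?T. f x * walk V ?T (Suc k) x) =
       (\<Sum>x\<in>?T. walk V ?T k x * ((\<Sum>y\<in>nbrs x \<inter> ?T. f y) + V x * f x))"
      by (rule walk_pairing[OF fT])
    have 3: "walk V ?T k x * ((\<Sum>y\<in>nbrs x \<inter> ?T. f y) + V x * f x)
        + walk V ?T k x * (real (card (nbrs x \<inter> S)) - card (nbrs x \<inter> ?T)) \<le> l * (f x * walk V ?T k x)"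
      if "x \<in> ?T" for x
    proof -
      have "(\<Sum>y\<in>nbrs x \<inter> ?T. f y) + (real (card (nbrs x \<inter> S)) - card (nbrs x \<inter> ?T))
        \<le> (\<Sum>y\<in>nbrs x \<inter> S. f y)"
      proof (cases "z \<in> nbrs x")
        case True
        then have eq: "nbrs x \<inter> S = insert z (nbrs x \<inter> ?T)" using z by auto
        show ?thesis unfolding eq using f(2) by simp
      next
        case False
        then have eq: "nbrs x \<inter> S = nbrs x \<inter> ?T" by auto
        show ?thesis unfolding eq by simp
      qed
      then have "(\<Sum>y\<in>nbrs x \<inter> ?T. f y) + V x * f x + (real (card (nbrs x \<inter> S)) - card (nbrs x \<inter> ?T)) \<le> l * f x"
        using super[of x] that by auto
      from mult_left_mono[OF this walk_nonneg[OF V, where S="?T" and k=k and x=x]]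
      show ?thesis by (simp add: algebra_simps)
    qed
    have 4: "C k x * (card (nbrs x \<inter> S) + V x) \<le> l * C k x" if "x \<in> S" for x
    proof -
      have "real (card (nbrs x \<inter> S)) \<le> 2 * CARD('d)"
        using card_nbrs_Int_le[of x S] by (metis of_nat_le_iff of_nat_mult of_nat_numeral)
      then have "card (nbrs x \<inter> S) + V x \<le> l" using l[OF that] by linarith
      from mult_left_mono[OF this C0] show ?thesis by (simp add: mult.commute)
    qed
    have "J (Suc k) = (\<Sum>x\<in>?T. walk V ?T k x * ((\<Sum>y\<in>nbrs x \<inter> ?T. f y) + V x * f x)
        + walk V ?T k x * (real (card (nbrs x \<inter> S)) - card (nbrs x \<inter> ?T)))
        + (\<Sum>x\<in>S. C k x * (card (nbrs x \<inter> S) + V x))"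
      unfolding J_def 1 2 by (simp add: sum.distrib)
    also have "\<dots> \<le> (\<Sum>x\<in>?T. l * (f x * walk V ?T k x)) + (\<Sum>x\<in>S. l * C k x)"
      by (intro add_mono sum_mono 3 4)
    also have "\<dots> = l * J k" by (simp add: J_def algebra_simps sum_distrib_left)
    finally show ?thesis .
  qed
  have "J k \<le> l ^ k * f 0" for k
  proof (induction k)
    case 0
    have "J 0 = (\<Sum>x\<in>?T. f x * walk V ?T 0 x)"
      using z by (auto simp: J_def C_def intro!: sum.neutral)
    also have "\<dots> = (\<Sum>x\<in>?T. if x = 0 then f 0 else 0)"
      by (intro sum.cong) auto
    also have "\<dots> \<le> f 0" using fT f(1)[of 0] by simp
    finally show ?case by simp
  next
    case (Suc k)
    then show ?case using step[of k] mult_left_mono[OF Suc l0] by (simp add: mult.assoc)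
  qed
  from this[of k] have "(\<Sum>x\<in>?T. f x * walk V ?T k x) + (\<Sum>x\<in>S. C k x) \<le> l ^ k * f 0"
    by (simp only: J_def)
  moreover have "(\<Sum>x\<in>?T. f x * walk V ?T k x) \<ge> 0"
    using f V by (intro sum_nonneg mult_nonneg_nonneg walk_nonneg) auto
  ultimately show ?thesis unfolding C_def by linarith
qed

text \<open>Let E be the weight, away from z, of the walks that have visited z, and w the weight at
  z. One step gives at most \<open>(V z - g) * E + 2 * d * w\<close> for the new E and at least
  \<open>V z * w\<close> for the new w. The ratio \<open>2 * d / g\<close> of E to w is the fixed
  point of this recursion and is thus never exceeded.\<close>

lemma sum_walk_away_le:
  fixes V :: "int ^ 'd::finite \<Rightarrow> real"
  assumes S: "finite S" and V: "\<And>z. V z \<ge> 0" and z: "z \<in> S" "z \<noteq> 0"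
    and g: "g > 0" and gap: "\<And>x. x \<in> S \<Longrightarrow> x \<noteq> z \<Longrightarrow> V x + 2 * CARD('d) + g \<le> V z"
  shows "(\<Sum>x\<in>S - {z}. walk V S k x - walk V (S - {z}) k x) \<le> 2 * CARD('d) / g * walk V S k z"
proof (induction k)
  case 0
  then show ?case using z by (auto intro!: sum_nonpos)
next
  case (Suc k)
  let ?T = "S - {z}"
  let ?d = "real (2 * CARD('d))"
  define C where "C = (\<lambda>k x. walk V S k x - walk V ?T k x)"
  have C0: "C k x \<ge> 0" for k x unfolding C_def using walk_mono[OF V, where S="?T" and S'=S and k=k and x=x] by auto
  have C_out: "C k y = 0" if "y \<notin> S" for y k using that by (simp add: C_def walk_outside)
  have C_rec: "C (Suc k) x = (\<Sum>y\<in>nbrs x. C k y) + V x * C k x" if "x \<in> ?T" for x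
    using that by (simp add: C_def algebra_simps sum_subtractf)
  have Cz: "C k z = walk V S k z" by (simp add: C_def walk_outside)
  define E where "E = (\<Sum>x\<in>?T. C k x)"
  have "(\<Sum>x\<in>?T. C (Suc k) x) = (\<Sum>x\<in>?T. 1 * (\<Sum>y\<in>nbrs x. C k y)) + (\<Sum>x\<in>?T. V x * C k x)"
    by (simp add: C_rec sum.distrib del: walk.simps)
  also have "(\<Sum>x\<in>?T. 1 * (\<Sum>y\<in>nbrs x. C k y)) = (\<Sum>y\<in>S. C k y * (\<Sum>x\<in>nbrs y \<inter> ?T. 1))"
    by (rule sum_nbrs_swap) (use S C_out in auto)
  also have "\<dots> \<le> (\<Sum>y\<in>S. C k y * ?d)"
    using card_nbrs_Int_le[of _ ?T]
    by (intro sum_mono mult_left_mono C0) (simp, metis of_nat_le_iff of_nat_mult of_nat_numeral)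
  also have "\<dots> = ?d * E + ?d * walk V S k z"
    using S z by (simp add: E_def sum_distrib_left mult.commute sum.remove[of S z] Cz)
  also have "(\<Sum>x\<in>?T. V x * C k x) \<le> (\<Sum>x\<in>?T. (V z - g - ?d) * C k x)"
    using gap by (intro sum_mono mult_right_mono C0) (auto simp: algebra_simps)
  also have "\<dots> = (V z - g - ?d) * E"
    by (simp add: E_def sum_distrib_left)
  finally have 1: "(\<Sum>x\<in>?T. C (Suc k) x) \<le> (V z - g) * E + ?d * walk V S k z"
    by (simp add: algebra_simps)
  have E: "E \<le> ?d / g * walk V S k z"
    using Suc by (simp add: E_def C_def)
  have w: "V z * walk V S k z \<le> walk V S (Suc k) z"
    using z V by (simp add: sum_nonneg walk_nonneg)
  have "?d / g * walk V S k z \<ge> 0" using V g by (simp add: walk_nonneg)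
  then have "(V z - g) * E \<le> (V z - g) * (?d / g * walk V S k z)" if "V z \<ge> g"
    using E that by (intro mult_left_mono) auto
  \<comment> \<open>If z is the only site, the gap says nothing about \<open>V z\<close>, but then
    the sum to be bounded is empty.\<close>
  moreover have "V z \<ge> g \<or> ?T = {}"
  proof (cases "?T = {}")
    case False
    then obtain x where "x \<in> S" "x \<noteq> z" by blast
    then show ?thesis using gap[of x] V[of x] by auto
  qed auto
  ultimately consider "(\<Sum>x\<in>?T. C (Suc k) x) \<le> (V z - g) * (?d / g * walk V S k z) + ?d * walk V S k z" | "?T = {}"
    using 1 by linarith
  then show ?case
  proof cases
    case 1
    also have "(V z - g) * (?d / g * walk V S k z) + ?d * walk V S k z = ?d / g * (V z * walk V S k z)"
      using g by (simp add: field_simps)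
    also have "\<dots> \<le> ?d / g * walk V S (Suc k) z"
      using w g by (intro mult_left_mono) auto
    finally show ?thesis by (simp add: C_def)
  next
    case 2
    then show ?thesis using g V by (simp only: 2) (simp add: walk_nonneg sum_nonneg z)
  qed
qed

section \<open>Lower bound from shortest paths\<close>

definition nrm :: "int ^ 'd::finite \<Rightarrow> nat" where
  "nrm x = (\<Sum>i\<in>UNIV. nat \<bar>x $ i\<bar>)"

lemma of_nat_nrm: "int (nrm x) = l1_norm x"
  by (simp add: nrm_def l1_norm_def)

lemma nrm_remove: "nrm x = nat \<bar>x $ i\<bar> + (\<Sum>j\<in>UNIV - {i}. nat \<bar>x $ j\<bar>)"
  unfolding nrm_def by (rule sum.remove) auto

lemma nrm_eq_0: "nrm x = 0 \<longleftrightarrow> x = 0"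
  by (auto simp: nrm_def vec_eq_iff)

text \<open>Both sides are sums so that no truncated subtraction occurs;
  \<open>prod_add_axis\<close> avoids division in the same way.\<close>

lemma nrm_add_axis: "nrm (x + axis i c) + nat \<bar>x $ i\<bar> = nrm x + nat \<bar>x $ i + c\<bar>"
proof -
  have "(\<Sum>j\<in>UNIV - {i}. nat \<bar>(x + axis i c) $ j\<bar>) = (\<Sum>j\<in>UNIV - {i}. nat \<bar>x $ j\<bar>)"
    by (intro sum.cong) (auto simp: axis_def)
  then show ?thesis
    unfolding nrm_remove[of "x + axis i c" i] nrm_remove[of x i] by (simp add: axis_def)
qed

lemma prod_add_axis:
  fixes F :: "'d::finite \<Rightarrow> nat \<Rightarrow> real"
  shows "(\<Prod>j\<in>UNIV. F j (nat \<bar>(x + axis i c) $ j\<bar>)) * F i (nat \<bar>x $ i\<bar>) =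
    (\<Prod>j\<in>UNIV. F j (nat \<bar>x $ j\<bar>)) * F i (nat \<bar>x $ i + c\<bar>)"
proof -
  have "(\<Prod>j\<in>UNIV - {i}. F j (nat \<bar>(x + axis i c) $ j\<bar>)) = (\<Prod>j\<in>UNIV - {i}. F j (nat \<bar>x $ j\<bar>))"
    by (intro prod.cong) (auto simp: axis_def)
  moreover have "(x + axis i c) $ i = x $ i + c" by (simp add: axis_def)
  ultimately show ?thesis
    unfolding prod.remove[of UNIV i "\<lambda>j. F j (nat \<bar>(x + axis i c) $ j\<bar>)", OF finite UNIV_I]
      prod.remove[of UNIV i "\<lambda>j. F j (nat \<bar>x $ j\<bar>)", OF finite UNIV_I] by simp
qed

text \<open>The number of shortest lattice paths from 0 to \<open>x\<close>: orderings of the moves,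
  of which \<open>\<bar>x $ i\<bar>\<close> go in direction i.\<close>

definition multinom :: "int ^ 'd::finite \<Rightarrow> real" where
  "multinom x = fact (nrm x) / (\<Prod>i\<in>UNIV. fact (nat \<bar>x $ i\<bar>))"

lemma multinom_nonneg: "multinom x \<ge> 0"
  by (simp add: multinom_def prod_nonneg)

text \<open>Sorting shortest paths by their last move, \<open>multinom x\<close> is the sum over i
  of the value at the site one unit closer to 0 in direction i. This site is one of the two
  neighbours in direction i, and the other one contributes a nonnegative term.\<close>

lemma multinom_le_walk:
  assumes V: "\<And>z. V z \<ge> 0"
  shows "multinom x \<le> walk V UNIV (nrm x) x"
proof (induction "nrm x" arbitrary: x)
  case 0
  then have "x = 0" "nrm x = 0" by (simp_all add: nrm_eq_0)
  then show ?case by (simp add: multinom_def)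
next
  case (Suc n)
  let ?P = "\<lambda>x::int^'a. (\<Prod>i\<in>UNIV. fact (nat \<bar>x $ i\<bar>) :: real)"
  have summand: "fact n * \<bar>x $ i\<bar> / ?P x \<le> walk V UNIV n (x + axis i 1) + walk V UNIV n (x - axis i 1)" for i
  proof (cases "x $ i = 0")
    case True
    then show ?thesis by (simp add: walk_nonneg V)
  next
    case False
    define y where "y = x + axis i (- sgn (x $ i))"
    have xi: "nat \<bar>x $ i\<bar> = Suc (nat \<bar>x $ i + (- sgn (x $ i))\<bar>)"
      using False by (auto simp: sgn_if)
    then have "nrm y = n"
      using nrm_add_axis[of x i "- sgn (x $ i)"] Suc(2) by (simp add: y_def)
    then have "multinom y \<le> walk V UNIV n y" using Suc(1)[of y] by simp
    moreover have "multinom y = fact n * \<bar>x $ i\<bar> / ?P x"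
    proof -
      have "?P y * fact (nat \<bar>x $ i\<bar>) = ?P x * fact (nat \<bar>x $ i + (- sgn (x $ i))\<bar>)"
        unfolding y_def by (rule prod_add_axis[where F = "\<lambda>_ k. fact k"])
      then have "?P y * real (nat \<bar>x $ i\<bar>) = ?P x"
        unfolding xi by (simp add: fact_Suc)
      moreover have "real (nat \<bar>x $ i\<bar>) = \<bar>x $ i\<bar>" by simp
      moreover have "?P y > 0" by (intro prod_pos) auto
      ultimately show ?thesis using False \<open>nrm y = n\<close>
        by (simp add: multinom_def field_simps)
    qed
    moreover have "walk V UNIV n y \<le> walk V UNIV n (x + axis i 1) + walk V UNIV n (x - axis i 1)"
    proof -
      have "y = x + axis i 1 \<or> y = x - axis i 1"
        using False by (auto simp: y_def sgn_if vec_eq_iff axis_def)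
      then show ?thesis using V by (auto simp: walk_nonneg)
    qed
    ultimately show ?thesis by simp
  qed
  have "real (nrm x) = (\<Sum>i\<in>UNIV. real_of_int \<bar>x $ i\<bar>)"
    by (simp add: nrm_def)
  then have "multinom x = (\<Sum>i\<in>UNIV. fact n * \<bar>x $ i\<bar> / ?P x)"
    using Suc(2)[symmetric] by (simp add: multinom_def flip: sum_divide_distrib sum_distrib_left)
  also have "\<dots> \<le> (\<Sum>i\<in>UNIV. walk V UNIV n (x + axis i 1) + walk V UNIV n (x - axis i 1))"
    by (intro sum_mono summand)
  also have "\<dots> \<le> walk V UNIV (nrm x) x"
    using V unfolding Suc(2)[symmetric] by (simp add: sum_nbrs walk_nonneg)
  finally show ?case .
qed

text \<open>
  Terms with \<open>x $ i = 0\<close> vanish in spite of the junk value of the logarithm, because of the factor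
  in front of it. Up to polynomial factors \<open>exp (path_entropy x)\<close> is the number of shortest paths from
  \<open>0\<close> to \<open>x\<close>.
\<close>

definition path_entropy :: "int ^ 'd::finite \<Rightarrow> real" where
  "path_entropy x = (\<Sum>i\<in>UNIV. nat \<bar>x $ i\<bar> * ln (nrm x / nat \<bar>x $ i\<bar>))"

lemma nat_abs_le_nrm: "nat \<bar>x $ i\<bar> \<le> nrm x"
  unfolding nrm_remove[of x i] by simp

lemma path_entropy_nonneg: "path_entropy x \<ge> 0"
  unfolding path_entropy_def
proof (rule sum_nonneg)
  fix i
  show "real (nat \<bar>x $ i\<bar>) * ln (nrm x / nat \<bar>x $ i\<bar>) \<ge> 0"
    using nat_abs_le_nrm[of x i]
    by (cases "x $ i = 0") (auto intro!: mult_nonneg_nonneg ln_ge_zero simp: le_divide_eq)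
qed

text \<open>Each summand \<open>k * ln (n / k)\<close> is at most n since
  \<open>ln y \<le> y\<close>. Being linear in the distance, the entropy is dominated by
  \<open>nrm x * ln v\<close> once \<open>ln v\<close> is at least the dimension; from there on the
  positive part in \<open>psi\<close> has no effect.\<close>

lemma path_entropy_le: "path_entropy (x :: int ^ 'd::finite) \<le> CARD('d) * nrm x"
proof -
  have "real (nat \<bar>x $ i\<bar>) * ln (nrm x / nat \<bar>x $ i\<bar>) \<le> nrm x" for i
  proof (cases "x $ i = 0")
    case False
    then have pos: "real (nat \<bar>x $ i\<bar>) > 0" by simp
    then have "real (nrm x) > 0" using nat_abs_le_nrm[of x i] by linarith
    then have "ln (nrm x / nat \<bar>x $ i\<bar>) \<le> nrm x / nat \<bar>x $ i\<bar>"
      using pos by (intro ln_bound) auto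
    then show ?thesis using pos by (simp add: field_simps)
  qed simp
  from sum_mono[OF this, where K = UNIV] show ?thesis by (simp add: path_entropy_def)
qed

text \<open>The logarithmic form of
  \<open>(1 + 1 / n) ^ n \<le> e \<le> (1 + 1 / n) ^ (n + 1)\<close>, which is the induction step of
  the two Stirling bounds below.\<close>

lemma ln_Suc_diff_bounds:
  assumes "n > 0"
  shows "real n * (ln (Suc n) - ln n) \<le> 1" "(real n + 1) * (ln (Suc n) - ln n) \<ge> 1"
proof -
  have "1 + 1 / real n = Suc n / n" using assms by (simp add: field_simps)
  then have "ln (real (Suc n)) - ln n = ln (1 + 1 / n)"
    using assms by (simp add: ln_div)
  moreover have "ln (1 + 1 / real n) \<le> 1 / n" by (rule ln_add_one_self_le_self) simp
  ultimately show "real n * (ln (Suc n) - ln n) \<le> 1" using assms by (simp add: field_simps)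
  have "ln (real n / Suc n) \<le> real n / Suc n - 1" using assms by (intro ln_le_minus_one) auto
  moreover have "ln (real n / Suc n) = ln n - ln (Suc n)" using assms by (simp add: ln_div)
  ultimately have "1 - real n / Suc n \<le> ln (Suc n) - ln n" by linarith
  then have "(real n + 1) * (1 - real n / Suc n) \<le> (real n + 1) * (ln (Suc n) - ln n)"
    by (intro mult_left_mono) auto
  then show "(real n + 1) * (ln (Suc n) - ln n) \<ge> 1" by (simp add: field_simps)
qed

lemma ln_fact_lower: "real n * ln n - n \<le> ln (fact n)"
proof (induction n)
  case (Suc n)
  show ?case
  proof (cases "n = 0")
    case False
    have "ln (fact (Suc n) :: real) = ln (Suc n) + ln (fact n)"
      by (simp add: ln_mult)
    then show ?thesis using Suc ln_Suc_diff_bounds(1)[of n] False by (simp add: algebra_simps)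
  qed simp
qed simp

lemma ln_fact_upper: "ln (fact n) \<le> real n * ln n - n + 1 + ln (real n + 1)"
proof -
  have "ln (fact n) \<le> (real n + 1) * ln (real n + 1) - n"
  proof (induction n)
    case (Suc n)
    have "ln (fact (Suc n) :: real) = ln (Suc n) + ln (fact n)"
      by (simp add: ln_mult)
    then show ?case using Suc ln_Suc_diff_bounds(2)[of "Suc n"] by (simp add: algebra_simps)
  qed simp
  then show ?thesis
    using ln_Suc_diff_bounds(1)[of n] by (cases "n = 0") (auto simp: algebra_simps)
qed

text \<open>Insert the Stirling bounds into the logarithm of \<open>multinom x\<close>. The linear
  terms cancel because the \<open>\<bar>x $ i\<bar>\<close> add up to \<open>nrm x\<close>, and the
  terms \<open>k * ln k\<close> form the entropy. Each of the factorials in the denominator costs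
  \<open>1 + ln (nrm x + 1)\<close>, hence the power \<open>CARD('d)\<close>.\<close>

lemma path_entropy_le_multinom:
  fixes x :: "int ^ 'd::finite"
  shows "exp (path_entropy x) \<le> multinom x * (exp 1 * (nrm x + 1)) ^ CARD('d)"
proof -
  let ?k = "\<lambda>i. nat \<bar>x $ i\<bar>"
  have "ln (multinom x) = ln (fact (nrm x)) - (\<Sum>i\<in>UNIV. ln (fact (?k i)))"
    by (simp add: multinom_def ln_div prod_pos ln_prod)
  moreover have "(\<Sum>i\<in>UNIV. ln (fact (?k i) :: real)) \<le> (\<Sum>i\<in>UNIV. ?k i * ln (?k i) - ?k i + 1 + ln (real (nrm x) + 1))"
  proof (rule sum_mono)
    fix i
    have "ln (real (?k i) + 1) \<le> ln (real (nrm x) + 1)"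
      using nat_abs_le_nrm[of x i] by (intro ln_mono) auto
    then show "ln (fact (?k i) :: real) \<le> ?k i * ln (?k i) - ?k i + 1 + ln (real (nrm x) + 1)"
      using ln_fact_upper[of "?k i"] by linarith
  qed
  moreover have "\<dots> = (\<Sum>i\<in>UNIV. ?k i * ln (?k i)) - nrm x + CARD('d) * (1 + ln (real (nrm x) + 1))"
    by (simp add: sum.distrib sum_subtractf nrm_def algebra_simps)
  moreover have "path_entropy x = nrm x * ln (nrm x) - (\<Sum>i\<in>UNIV. ?k i * ln (?k i))"
  proof -
    have "path_entropy x = (\<Sum>i\<in>UNIV. ?k i * ln (nrm x) - ?k i * ln (?k i))"
      unfolding path_entropy_def
    proof (rule sum.cong[OF refl])
      fix i
      show "?k i * ln (nrm x / ?k i) = ?k i * ln (nrm x) - ?k i * ln (?k i)"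
        using nat_abs_le_nrm[of x i] by (cases "?k i = 0") (auto simp: ln_div algebra_simps)
    qed
    then show ?thesis by (simp add: sum_subtractf nrm_def sum_distrib_right)
  qed
  ultimately have 1: "path_entropy x \<le> ln (multinom x) + CARD('d) * (1 + ln (real (nrm x) + 1))"
    using ln_fact_lower[of "nrm x"] by linarith
  define P where "P = (exp 1 * (real (nrm x) + 1)) ^ CARD('d)"
  have pos: "multinom x > 0" "P > 0" by (simp_all add: multinom_def prod_pos P_def)
  have "CARD('d) * (1 + ln (real (nrm x) + 1)) = ln P"
    by (simp add: P_def ln_realpow ln_mult add.commute)
  with 1 have "exp (path_entropy x) \<le> exp (ln (multinom x * P))"
    using pos by (simp add: ln_mult)
  then show ?thesis using pos by (simp add: P_def add.commute)
qed

text \<open>By \<open>nonneg_pam_solution_sums\<close> this is \<open>exp (2 * d * t)\<close> times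
  the value at z of a nonnegative solution. The factor does not depend on z and cancels in all
  ratios.\<close>

definition wsum :: "(int ^ 'd::finite \<Rightarrow> real) \<Rightarrow> real \<Rightarrow> int ^ 'd \<Rightarrow> real" where
  "wsum V t z = (\<Sum>k. walk V UNIV k z * t ^ k / fact k)"

lemma exp_sums_real: "(\<lambda>k. x ^ k / fact k) sums exp (x :: real)"
  using exp_converges[of x] by (simp add: divide_inverse_commute)

text \<open>A Poisson variable with mean x is below \<open>x / 8\<close> with probability at most
  1/2. Comparison with the mean \<open>x / 4\<close> costs \<open>4 ^ n\<close>, which is at most
  \<open>exp (2 * n)\<close> and hence at most \<open>exp (x / 4)\<close>: this is the origin of the
  8.\<close>

lemma exp_tail_ge:
  assumes "x \<ge> 8 * real n" "n > 0"
  shows "(\<Sum>k<n. x ^ k / fact k) \<le> exp x / 2"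
proof -
  have x: "x \<ge> 8" using assms by linarith
  have "(\<Sum>k<n. x ^ k / fact k) \<le> (\<Sum>k<n. 4 ^ n * ((x / 4) ^ k / fact k))"
  proof (rule sum_mono)
    fix k assume "k \<in> {..<n}"
    then have "(4::real) ^ k \<le> 4 ^ n" by (intro power_increasing) auto
    then have "4 ^ k * ((x / 4) ^ k / fact k) \<le> 4 ^ n * ((x / 4) ^ k / fact k)"
      using x by (intro mult_right_mono) auto
    then show "x ^ k / fact k \<le> 4 ^ n * ((x / 4) ^ k / fact k)"
      by (simp add: power_divide)
  qed
  also have "\<dots> \<le> 4 ^ n * exp (x / 4)"
  proof -
    have "(\<Sum>k<n. (x / 4) ^ k / fact k) \<le> exp (x / 4)"
      using sum_le_suminf[OF sums_summable[OF exp_sums_real], of "{..<n}" "x / 4"] x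
      by (simp add: sums_unique[OF exp_sums_real, symmetric])
    from mult_left_mono[OF this, of "4 ^ n"] show ?thesis by (simp add: sum_distrib_left)
  qed
  also have "(4::real) ^ n \<le> exp (2 * real n)"
  proof -
    have "(2::real) \<le> exp 1" using exp_ge_add_one_self[of 1] by simp
    then have "(2::real) * 2 \<le> exp 1 * exp 1" by (intro mult_mono) auto
    then have "(4::real) \<le> exp 2" by (simp flip: exp_add)
    from power_mono[OF this, of n] show ?thesis by (simp add: exp_of_nat_mult mult.commute)
  qed
  then have "4 ^ n * exp (x / 4) \<le> exp (2 * real n) * exp (x / 4)" by simp
  also have "\<dots> \<le> exp (x / 2)"
    using assms by (simp flip: exp_add)
  also have "exp (x / 2) \<le> exp x / 2"
  proof -
    have "2 \<le> exp (x / 2)" using exp_ge_add_one_self[of "x / 2"] x by linarith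
    then have "2 * exp (x / 2) \<le> exp (x / 2) * exp (x / 2)" by (intro mult_right_mono) auto
    then show ?thesis by (simp flip: exp_add)
  qed
  finally show ?thesis .
qed

text \<open>Count only the walks that follow a shortest path to z and then stay there. With n =
  \<open>nrm z\<close>, those with n + j moves contribute \<open>multinom z * V z ^ j\<close>, which
  adds up to \<open>multinom z / V z ^ n\<close> times the exponential series of
  \<open>t * V z\<close> from its n-th term on. By the last hypothesis that remainder is at least
  half of the full series.\<close>

lemma wsum_lower:
  fixes z :: "int ^ 'd::finite"
  assumes V: "\<And>z. V z \<ge> 0" and sm: "summable (\<lambda>k. walk V UNIV k z * t ^ k / fact k)"
    and z: "z \<noteq> 0" and t: "t \<ge> 0" and m: "t * V z \<ge> 8 * real (nrm z)"
  shows "wsum V t z \<ge> exp (t * V z - nrm z * ln (V z) + path_entropy z) / (2 * (exp 1 * (nrm z + 1)) ^ CARD('d))"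
proof -
  let ?n = "nrm z"
  have n: "?n > 0" using z nrm_eq_0[of z] by auto
  have "t * V z > 0" using n m by (smt (verit) of_nat_0_less_iff)
  with t V[of z] have pos: "V z > 0" "t > 0" by (simp_all add: zero_less_mult_iff)
  have w: "multinom z * V z ^ j \<le> walk V UNIV (?n + j) z" for j
  proof (induction j)
    case 0 show ?case using multinom_le_walk[OF V, of z] by simp
  next
    case (Suc j)
    have "V z * (multinom z * V z ^ j) \<le> V z * walk V UNIV (?n + j) z"
      using Suc V by (intro mult_left_mono) auto
    also have "\<dots> \<le> walk V UNIV (?n + Suc j) z" using V by (simp add: sum_nonneg walk_nonneg)
    finally show ?case by (simp add: mult_ac)
  qed
  define a where "a = (\<lambda>k. walk V UNIV k z * t ^ k / fact k)"
  define x where "x = t * V z"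
  define e where "e = (\<lambda>k. x ^ k / fact k)"
  have se: "e sums exp x" unfolding e_def by (rule exp_sums_real)
  have le: "multinom z / V z ^ ?n * (if k < ?n then 0 else e k) \<le> a k" for k
  proof (cases "k < ?n")
    case True then show ?thesis using V t by (simp add: a_def walk_nonneg)
  next
    case False
    then obtain j where k: "k = ?n + j" using le_Suc_ex not_less by blast
    have "multinom z / V z ^ ?n * e k = multinom z * V z ^ j * (t ^ k / fact k)"
      using pos by (simp add: e_def x_def k power_add power_mult_distrib)
    also have "\<dots> \<le> walk V UNIV k z * (t ^ k / fact k)"
      using w[of j] t unfolding k by (intro mult_right_mono) auto
    finally show ?thesis using False by (simp add: a_def)
  qed
  have "(\<lambda>k. if k < ?n then 0 else e k) sums (exp x - (\<Sum>k<?n. e k))"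
  proof -
    have "(\<lambda>k. if k \<in> {..<?n} then e k else 0) sums (\<Sum>k<?n. e k)"
      by (rule sums_If_finite_set) simp
    from sums_diff[OF se this] show ?thesis by (rule back_subst[of "\<lambda>f. f sums _"]) auto
  qed
  from sums_mult[OF this, of "multinom z / V z ^ ?n"]
  have "multinom z / V z ^ ?n * (exp x - (\<Sum>k<?n. e k)) \<le> suminf a"
    by (rule sums_le[OF le _ summable_sums]) (simp add: a_def sm)
  moreover have "exp x - (\<Sum>k<?n. e k) \<ge> exp x / 2"
    using exp_tail_ge[of ?n x] m n by (simp add: e_def x_def)
  then have "multinom z / V z ^ ?n * (exp x / 2) \<le> multinom z / V z ^ ?n * (exp x - (\<Sum>k<?n. e k))"
    using pos by (intro mult_left_mono) (auto simp: multinom_nonneg)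
  ultimately have "multinom z / V z ^ ?n * (exp x / 2) \<le> wsum V t z"
    by (simp add: wsum_def a_def)
  moreover have "exp (x - ?n * ln (V z) + path_entropy z) / (2 * (exp 1 * (?n + 1)) ^ CARD('d))
    \<le> multinom z / V z ^ ?n * (exp x / 2)"
  proof -
    have "exp (x - ?n * ln (V z) + path_entropy z) = exp x / V z ^ ?n * exp (path_entropy z)"
      using pos by (simp add: exp_add exp_diff exp_of_nat_mult)
    also have "\<dots> \<le> exp x / V z ^ ?n * (multinom z * (exp 1 * (?n + 1)) ^ CARD('d))"
      using pos by (intro mult_left_mono path_entropy_le_multinom) auto
    finally have 1: "exp (x - ?n * ln (V z) + path_entropy z) \<le> \<dots>" .
    have "(exp 1 * (real ?n + 1)) ^ CARD('d) > 0" by (intro zero_less_power mult_pos_pos) auto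
    with 1 show ?thesis by (simp add: field_simps)
  qed
  ultimately show ?thesis by (simp add: x_def)
qed

section \<open>Upper bound for walks hitting their maximal site\<close>

text \<open>
  The supersolution is \<open>\<rho> ^ L(x) * (\<Prod>i. \<tau> i ^ \<bar>x $ i - z $ i\<bar>)\<close>, where \<open>L(x)\<close> is the number of
  spheres around \<open>z\<close>, of radius at most \<open>\<bar>x - z\<bar>\<close>, that contain a site higher than \<open>h\<close>: each of them
  costs a factor \<open>\<rho> = V z / h\<close> only once, so that few high sites have a negligible effect.
\<close>

lemma sum_walk_visiting_le_prod:
  fixes V :: "int ^ 'd::finite \<Rightarrow> real" and \<tau> :: "'d \<Rightarrow> real" and h :: real
  assumes S: "finite S" and V: "\<And>z. V z \<ge> 0" and z: "z \<in> S" "z \<noteq> 0"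
    and max: "\<And>x. x \<in> S \<Longrightarrow> V x \<le> V z"
    and h: "h \<ge> 2 * CARD('d)" and \<rho>: "\<rho> * h = V z" "\<rho> \<ge> 1"
    and \<tau>: "\<And>i. \<tau> i > 0" "\<And>i. \<rho> * \<tau> i \<le> 1" "(\<Sum>i\<in>UNIV. 1 / \<tau> i + \<rho>\<^sup>2 * \<tau> i) \<le> V z"
    and K: "card {x\<in>S. V x > h} \<le> K"
  shows "(\<Sum>x\<in>S. walk V S k x - walk V (S - {z}) k x)
    \<le> (V z + h) ^ k * (\<rho> ^ K * (\<Prod>i\<in>UNIV. \<tau> i ^ nat \<bar>z $ i\<bar>))"
proof -
  define A where "A = (\<lambda>l. \<exists>x\<in>S. V x > h \<and> nrm (x - z) = l)"
  define L where "L = (\<lambda>D. \<Sum>l=1..D. of_bool (A l) :: nat)"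
  have L_Suc: "L (Suc D) = L D + of_bool (A (Suc D))" for D
    by (simp add: L_def del: sum_of_bool_eq)
  have L_le: "L D \<le> K" for D
  proof -
    have "L D = card {l\<in>{1..D}. A l}" by (auto simp: L_def intro!: arg_cong[where f = card])
    also have "\<dots> \<le> card ((\<lambda>x. nrm (x - z)) ` {x\<in>S. V x > h})"
      using S by (intro card_mono) (auto simp: A_def)
    also have "\<dots> \<le> card {x\<in>S. V x > h}" using S by (intro card_image_le) auto
    finally show ?thesis using K by simp
  qed
  define P where "P = (\<lambda>u::int^'d. \<Prod>i\<in>UNIV. \<tau> i ^ nat \<bar>u $ i\<bar>)"
  have P_pos: "P u > 0" for u unfolding P_def using \<tau>(1) by (intro prod_pos) auto
  define f where "f = (\<lambda>x. \<rho> ^ L (nrm (x - z)) * P (x - z))"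
  have f_pos: "f x > 0" for x unfolding f_def using P_pos \<rho> by simp
  have fz: "f z = 1" by (simp add: f_def P_def L_def nrm_def)
  have "real (2 * CARD('d)) > 0" by simp
  with h have h0: "h > 0" by linarith
  \<comment> \<open>The bound uses \<open>L D\<close>, which ignores the sphere of x itself: a high
    x has one more factor \<rho> in \<open>f x\<close>. A neighbour farther out has radius
    \<open>D + 2\<close> and may have passed two more marked spheres, hence the square of \<rho> in
    front of \<open>\<tau> i\<close>.\<close>
  have nbr_sum: "(\<Sum>y\<in>nbrs x. f y) \<le> \<rho> ^ L D * P (x - z) * V z" if D: "nrm (x - z) = Suc D" for x D
  proof -
    define u where "u = x - z"
    have toward: "f (x + axis i s) \<le> \<rho> ^ L D * P u * (1 / \<tau> i)"
      if "nat \<bar>u $ i\<bar> = Suc (nat \<bar>u $ i + s\<bar>)" for i s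
    proof -
      have "nrm (u + axis i s) = D" using nrm_add_axis[of u i s] that D by (simp add: u_def)
      moreover have "P (u + axis i s) * \<tau> i ^ nat \<bar>u $ i\<bar> = P u * \<tau> i ^ nat \<bar>u $ i + s\<bar>"
        unfolding P_def by (rule prod_add_axis[where F = "\<lambda>i k. \<tau> i ^ k"])
      then have "P (u + axis i s) = P u * (1 / \<tau> i)" using \<tau>(1)[of i] that by (simp add: field_simps)
      moreover have e: "x + axis i s - z = u + axis i s" by (simp add: u_def)
      ultimately show ?thesis unfolding f_def e by simp
    qed
    have away: "f (x + axis i s) \<le> \<rho> ^ L D * P u * (\<rho>\<^sup>2 * \<tau> i)"
      if "nat \<bar>u $ i + s\<bar> = Suc (nat \<bar>u $ i\<bar>)" for i s
    proof -
      have "nrm (u + axis i s) = Suc (Suc D)" using nrm_add_axis[of u i s] that D by (simp add: u_def)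
      moreover have "P (u + axis i s) * \<tau> i ^ nat \<bar>u $ i\<bar> = P u * \<tau> i ^ nat \<bar>u $ i + s\<bar>"
        unfolding P_def by (rule prod_add_axis[where F = "\<lambda>i k. \<tau> i ^ k"])
      then have "P (u + axis i s) = P u * \<tau> i" using \<tau>(1)[of i] that by simp
      moreover have e: "x + axis i s - z = u + axis i s" by (simp add: u_def)
      ultimately have "f (x + axis i s) = \<rho> ^ L (Suc (Suc D)) * (P u * \<tau> i)" unfolding f_def e by simp
      also have "\<dots> \<le> \<rho> ^ (L D + 2) * (P u * \<tau> i)"
        using \<rho> P_pos[of u] \<tau>(1)[of i] by (intro mult_right_mono power_increasing) (auto simp: L_Suc)
      finally show ?thesis by (simp add: power_add mult_ac power2_eq_square)
    qed
    have dir: "f (x + axis i 1) + f (x - axis i 1) \<le> \<rho> ^ L D * P u * (1 / \<tau> i + \<rho>\<^sup>2 * \<tau> i)" for i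
    proof -
      have eq: "x - axis i 1 = x + axis i (-1)" by (simp add: vec_eq_iff axis_def)
      \<comment> \<open>If x and z agree in coordinate i, both moves in this direction lead away
        from z; this inequality trades one of the two terms for \<open>1 / \<tau> i\<close>.\<close>
      have small: "\<rho>\<^sup>2 * \<tau> i \<le> 1 / \<tau> i"
      proof -
        have "(\<rho> * \<tau> i) * (\<rho> * \<tau> i) \<le> 1 * 1" using \<tau>(1,2)[of i] \<rho> by (intro mult_mono) auto
        then show ?thesis using \<tau>(1)[of i] by (simp add: field_simps power2_eq_square)
      qed
      have pos: "\<rho> ^ L D * P u \<ge> 0" using \<rho> P_pos[of u] by simp
      consider "u $ i > 0" | "u $ i < 0" | "u $ i = 0" by linarith
      then show ?thesis
      proof cases
        case 1
        then show ?thesis unfolding eq using add_mono[OF away[of i 1] toward[of i "-1"]]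
          by (simp add: algebra_simps nat_eq_iff)
      next
        case 2
        then show ?thesis unfolding eq using add_mono[OF toward[of i 1] away[of i "-1"]]
          by (simp add: algebra_simps nat_eq_iff)
      next
        case 3
        then have "f (x + axis i 1) + f (x - axis i 1) \<le> \<rho> ^ L D * P u * (\<rho>\<^sup>2 * \<tau> i) + \<rho> ^ L D * P u * (\<rho>\<^sup>2 * \<tau> i)"
          unfolding eq by (intro add_mono away) auto
        also have "\<dots> \<le> \<rho> ^ L D * P u * (1 / \<tau> i) + \<rho> ^ L D * P u * (\<rho>\<^sup>2 * \<tau> i)"
          by (intro add_mono mult_left_mono small pos order_refl)
        finally show ?thesis by (simp add: algebra_simps)
      qed
    qed
    have "(\<Sum>y\<in>nbrs x. f y) \<le> (\<Sum>i\<in>UNIV. \<rho> ^ L D * P u * (1 / \<tau> i + \<rho>\<^sup>2 * \<tau> i))"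
      unfolding sum_nbrs by (intro sum_mono dir)
    also have "\<dots> \<le> \<rho> ^ L D * P u * V z"
      unfolding sum_distrib_left[symmetric] using \<tau>(3) \<rho> P_pos[of u] by (intro mult_left_mono) auto
    finally show ?thesis by (simp add: u_def)
  qed
  have super: "(\<Sum>y\<in>nbrs x \<inter> S. f y) + V x * f x \<le> (V z + h) * f x" if x: "x \<in> S" "x \<noteq> z" for x
  proof -
    obtain D where D: "nrm (x - z) = Suc D" using x nrm_eq_0[of "x - z"] by (cases "nrm (x - z)") auto
    have "(\<Sum>y\<in>nbrs x \<inter> S. f y) \<le> (\<Sum>y\<in>nbrs x. f y)"
      using f_pos by (intro sum_mono2) (auto intro: less_imp_le)
    also have "\<dots> \<le> \<rho> ^ L D * P (x - z) * V z" by (rule nbr_sum[OF D])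
    finally have 1: "(\<Sum>y\<in>nbrs x \<inter> S. f y) \<le> \<rho> ^ L D * P (x - z) * V z" .
    \<comment> \<open>The factor \<open>V z + h\<close> arises in two ways. At a high site the
      neighbours give \<open>h * f x\<close>, because \<open>\<rho> * h = V z\<close>, and the site
      itself at most \<open>V z * f x\<close>. At a low site the two roles are exchanged.\<close>
    show ?thesis
    proof (cases "V x > h")
      case True
      then have "A (Suc D)" using x D by (auto simp: A_def)
      then have "f x = \<rho> * (\<rho> ^ L D * P (x - z))" by (simp add: f_def D L_Suc)
      then have "\<rho> ^ L D * P (x - z) * V z = h * f x" using \<rho>(1)[symmetric] by simp
      moreover have "V x * f x \<le> V z * f x" using max[OF x(1)] f_pos[of x] by (intro mult_right_mono) auto
      ultimately show ?thesis using 1 by (simp add: algebra_simps)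
    next
      case False
      have "\<rho> ^ L D * P (x - z) \<le> f x"
        unfolding f_def D L_Suc using \<rho> P_pos[of "x - z"] by (intro mult_right_mono power_increasing) auto
      from mult_right_mono[OF this V[of z]] have "\<rho> ^ L D * P (x - z) * V z \<le> V z * f x"
        by (simp add: mult_ac)
      moreover have "V x * f x \<le> h * f x" using False f_pos[of x] by (intro mult_right_mono) auto
      ultimately show ?thesis using 1 by (simp add: algebra_simps)
    qed
  qed
  have "(\<Sum>x\<in>S. walk V S k x - walk V (S - {z}) k x) \<le> (V z + h) ^ k * f 0"
  proof (rule sum_walk_visiting_le[OF S V z _ _ super])
    show "V x + real (2 * CARD('d)) \<le> V z + h" if "x \<in> S" for x
      using max[OF that] h by simp
  qed (use f_pos fz in \<open>auto intro: less_imp_le\<close>)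
  also have "f 0 = \<rho> ^ L (nrm (- z)) * P z" by (simp add: f_def P_def)
  also have "(V z + h) ^ k * \<dots> \<le> (V z + h) ^ k * (\<rho> ^ K * P z)"
    using \<rho> P_pos[of z] V h0 L_le
    by (intro mult_left_mono mult_right_mono power_increasing zero_le_power add_nonneg_nonneg) (auto intro: less_imp_le)
  finally show ?thesis by (simp add: P_def)
qed

text \<open>
  Remove the highest site again and again until only sites lower than \<open>h\<close> are left.
\<close>

lemma sum_walk_telescope:
  fixes V :: "int ^ 'd::finite \<Rightarrow> real"
  assumes V: "\<And>z. V z \<ge> 0" and h: "h \<ge> 0" and A: "finite A"
    and inj: "\<And>x y. x \<in> B \<Longrightarrow> y \<in> B \<Longrightarrow> V x > h \<Longrightarrow> V y > h \<Longrightarrow> x \<noteq> y \<Longrightarrow> V x \<noteq> V y"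
    and step: "\<And>T z. T \<subseteq> B \<Longrightarrow> z \<in> T \<Longrightarrow> V z > h \<Longrightarrow> (\<And>x. x \<in> T \<Longrightarrow> x \<noteq> z \<Longrightarrow> V x < V z) \<Longrightarrow>
        (\<Sum>y\<in>A. walk V T k y - walk V (T - {z}) k y) \<le> b z"
    and S: "finite S" "S \<subseteq> B"
  shows "(\<Sum>y\<in>A. walk V S k y) \<le> (h + 2 * CARD('d)) ^ k + (\<Sum>z | z \<in> S \<and> V z > h. b z)"
  using S
proof (induction "card {z\<in>S. V z > h}" arbitrary: S)
  case 0
  then have "{z\<in>S. V z > h} = {}" by simp
  then have low: "\<And>x. x \<in> S \<Longrightarrow> V x \<le> h" and e: "{z. z \<in> S \<and> V z > h} = {}" by force+
  have "(\<Sum>y\<in>A. walk V S k y) = (\<Sum>y\<in>A \<inter> S. walk V S k y)"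
    using A by (intro sum.mono_neutral_right) (auto simp: walk_outside)
  also have "\<dots> \<le> (\<Sum>y\<in>S. walk V S k y)"
    using 0 V by (intro sum_mono2) (auto simp: walk_nonneg)
  also have "\<dots> \<le> (h + 2 * CARD('d)) ^ k"
    by (rule sum_walk_le[OF 0(2) V low h])
  finally show ?case unfolding e by simp
next
  case (Suc n)
  let ?H = "{z\<in>S. V z > h}"
  have fin: "finite ?H" using Suc by simp
  have ne: "?H \<noteq> {}" using Suc.hyps(2) by (metis card.empty nat.distinct(1))
  have "Max (V ` ?H) \<in> V ` ?H" using fin ne by (intro Max_in) auto
  then obtain z where zH: "z \<in> ?H" and z: "V z = Max (V ` ?H)" by force
  have max: "V x \<le> V z" if "x \<in> ?H" for x
    unfolding z using that fin by (intro Max_ge) auto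
  have strict: "V x < V z" if "x \<in> S" "x \<noteq> z" for x
  proof (cases "V x > h")
    case True
    then have "V x \<le> V z" "V x \<noteq> V z" using max[of x] inj[of x z] that zH Suc by auto
    then show ?thesis by simp
  qed (use zH in auto)
  have eq: "{y\<in>S - {z}. V y > h} = ?H - {z}" by auto
  have "(\<Sum>y\<in>A. walk V (S - {z}) k y) \<le> (h + 2 * CARD('d)) ^ k + (\<Sum>y | y \<in> S - {z} \<and> V y > h. b y)"
  proof (rule Suc.hyps(1))
    show "n = card {y\<in>S - {z}. V y > h}"
      unfolding eq using Suc.hyps(2) zH fin by (simp only: card_Diff_singleton)
  qed (use Suc in auto)
  moreover have "(\<Sum>y\<in>A. walk V S k y - walk V (S - {z}) k y) \<le> b z"
    using zH Suc strict by (intro step) auto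
  moreover have "(\<Sum>y\<in>?H. b y) = b z + (\<Sum>y | y \<in> S - {z} \<and> V y > h. b y)"
    using fin zH by (subst sum.remove[of _ z]) (auto simp: eq intro!: arg_cong[where f = "sum b"])
  ultimately show ?case by (simp add: sum_subtractf)
qed

section \<open>Summation over the number of moves\<close>

lemma finite_ballz: "finite (ballz r :: (int ^ 'd::finite) set)"
proof -
  let ?m = "\<lfloor>r\<rfloor>"
  have "ballz r \<subseteq> vec_lambda ` (PiE (UNIV :: 'd set) (\<lambda>i. {- ?m..?m}))"
  proof
    fix x :: "int ^ 'd" assume x: "x \<in> ballz r"
    have "\<bar>x $ i\<bar> \<le> l1_norm x" for i unfolding l1_norm_def by (rule member_le_sum) auto
    moreover have "l1_norm x \<le> ?m" using x by (simp add: ballz_def le_floor_iff)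
    ultimately have "\<bar>x $ i\<bar> \<le> ?m" for i by (meson order_trans)
    then have "vec_nth x \<in> PiE UNIV (\<lambda>i. {- ?m..?m})" by (auto simp: abs_le_iff) (metis minus_le_iff)
    then show "x \<in> vec_lambda ` (PiE UNIV (\<lambda>i. {- ?m..?m}))" by (metis image_eqI vec_nth_inverse)
  qed
  then show ?thesis by (rule finite_subset) (intro finite_imageI finite_PiE, auto)
qed

text \<open>Walks with more than r moves are bounded crudely by the maximum of V in the ball of
  radius k; there \<open>fact k\<close> wins, and the geometric series yields the final 2. Shorter
  walks stay in the ball of radius r and are sorted by their highest site. If there is none above h
  they give the first term. If it is in \<open>Zs\<close>, then their end point, being outside
  \<open>Zs\<close>, differs from it and \<open>sum_walk_away_le\<close> compares them with the
  weight at that site. Otherwise \<open>visit\<close> applies.\<close>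

lemma sum_wsum_le:
  fixes V :: "int ^ 'd::finite \<Rightarrow> real" and v :: "nat \<Rightarrow> real" and h t g r :: real
  assumes V: "\<And>z. V z \<ge> 0" and h: "h \<ge> 0" and t: "t \<ge> 0"
    and sm: "\<And>z. summable (\<lambda>k. walk V UNIV k z * t ^ k / fact k)"
    and A: "finite A" "A \<inter> Zs = {}" and Zs: "finite Zs" "Zs \<subseteq> ballz r"
    and growth: "\<And>k x. real k > r \<Longrightarrow> x \<in> ballz (real k) \<Longrightarrow> V x \<le> v k"
      "\<And>k. real k > r \<Longrightarrow> (v k + 2 * CARD('d)) ^ k * t ^ k / fact k \<le> (1 / 2) ^ k"
    and origin: "V 0 \<le> h"
    and g: "g > 0" and gap: "\<And>x y. x \<in> ballz r \<Longrightarrow> y \<in> ballz r \<Longrightarrow> V x > h \<Longrightarrow> x \<noteq> y \<Longrightarrow> V y \<le> V x \<Longrightarrow>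
        V y + 2 * CARD('d) + g \<le> V x"
    and visit: "\<And>k T z. T \<subseteq> ballz r \<Longrightarrow> z \<in> T \<Longrightarrow> V z > h \<Longrightarrow> (\<And>x. x \<in> T \<Longrightarrow> V x \<le> V z) \<Longrightarrow>
        (\<Sum>y\<in>T. walk V T k y - walk V (T - {z}) k y) \<le> (V z + h) ^ k * F z"
    and F: "\<And>z. F z \<ge> 0"
  shows "(\<Sum>z\<in>A. wsum V t z) \<le> exp (t * (h + 2 * CARD('d))) +
     (\<Sum>z | z \<in> ballz r - Zs \<and> V z > h. exp (t * (V z + h)) * F z) +
     2 * CARD('d) / g * (\<Sum>z\<in>Zs. wsum V t z) + 2"
proof -
  let ?B = "ballz r :: (int ^ 'd) set" and ?d = "real (2 * CARD('d))"
  define G where "G = (\<Sum>z | z \<in> ?B - Zs \<and> V z > h. F z)"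
  have tk: "t ^ k / fact k \<ge> 0" for k using t by simp
  define a where "a = (\<lambda>k. (h + ?d) ^ k * (t ^ k / fact k) +
      (\<Sum>z | z \<in> ?B - Zs \<and> V z > h. F z * ((V z + h) ^ k * (t ^ k / fact k))) +
      ?d / g * (\<Sum>z\<in>Zs. walk V UNIV k z * (t ^ k / fact k)))"
  have a0: "a k \<ge> 0" for k
    unfolding a_def using V h F g tk
    by (intro add_nonneg_nonneg sum_nonneg mult_nonneg_nonneg zero_le_power walk_nonneg) auto
  have bound: "(\<Sum>y\<in>A. walk V UNIV k y) * (t ^ k / fact k) \<le> a k + (1 / 2) ^ k" for k
  proof (cases "real k > r")
    case True
    have le: "?B \<subseteq> ballz (real k)" using True by (intro ballz_mono) auto
    have "V 0 \<le> v k" by (rule growth(1)[OF True]) (simp add: ballz_def)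
    then have vk: "v k \<ge> 0" using V[of 0] by linarith
    have "(\<Sum>y\<in>A. walk V UNIV k y) = (\<Sum>y\<in>A. walk V (ballz (real k)) k y)"
      using walk_eq_UNIV[of k "ballz (real k)" k V] by simp
    also have "\<dots> = (\<Sum>y\<in>A \<inter> ballz (real k). walk V (ballz (real k)) k y)"
      using A by (intro sum.mono_neutral_right) (auto simp: walk_outside)
    also have "\<dots> \<le> (\<Sum>y\<in>ballz (real k). walk V (ballz (real k)) k y)"
      using V by (intro sum_mono2 finite_ballz) (auto simp: walk_nonneg)
    also have "\<dots> \<le> (v k + ?d) ^ k"
      by (rule sum_walk_le[OF finite_ballz V growth(1)[OF True] vk])
    finally have "(\<Sum>y\<in>A. walk V UNIV k y) * (t ^ k / fact k) \<le> (v k + ?d) ^ k * (t ^ k / fact k)"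
      by (intro mult_right_mono tk)
    also have "\<dots> \<le> (1 / 2) ^ k" using growth(2)[OF True] by simp
    finally show ?thesis using a0[of k] by linarith
  next
    case False
    define b where "b = (\<lambda>z. if z \<in> Zs then ?d / g * walk V UNIV k z else (V z + h) ^ k * F z)"
    have b: "b z \<ge> 0" for z using V h F g by (simp add: b_def walk_nonneg)
    have "ballz (real k) \<subseteq> ?B" using False by (intro ballz_mono) auto
    then have eqw: "walk V UNIV k y = walk V ?B k y" for y
      using walk_eq_UNIV[of k ?B k V y] by simp
    have "(\<Sum>y\<in>A. walk V ?B k y) \<le> (h + ?d) ^ k + (\<Sum>z | z \<in> ?B \<and> V z > h. b z)"
    proof (rule sum_walk_telescope[where B = "?B"])
      fix x y assume "x \<in> ?B" "y \<in> ?B" "V x > h" "V y > h" "x \<noteq> y"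
      then show "V x \<noteq> V y" using gap[of x y] g by (auto simp: not_le)
    next
      fix T z assume T: "T \<subseteq> ?B" "z \<in> T" "V z > h" and mx: "\<And>x. x \<in> T \<Longrightarrow> x \<noteq> z \<Longrightarrow> V x < V z"
      have fT: "finite T" using T finite_ballz finite_subset by blast
      let ?C = "\<lambda>y. walk V T k y - walk V (T - {z}) k y"
      have C0: "?C y \<ge> 0" for y using walk_mono[OF V, where S="T - {z}" and S'=T and k=k and x=y] by auto
      have z0: "z \<noteq> 0" using T origin by auto
      show "(\<Sum>y\<in>A. ?C y) \<le> b z"
      proof (cases "z \<in> Zs")
        case True
        have "(\<Sum>y\<in>A. ?C y) = (\<Sum>y\<in>A \<inter> T. ?C y)"
          using A by (intro sum.mono_neutral_right) (auto simp: walk_outside)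
        also have "\<dots> \<le> (\<Sum>y\<in>T - {z}. ?C y)"
          using fT True A by (intro sum_mono2 C0) auto
        also have "\<dots> \<le> ?d / g * walk V T k z"
        proof (rule sum_walk_away_le[OF fT V T(2) z0 g])
          show "V x + ?d + g \<le> V z" if "x \<in> T" "x \<noteq> z" for x
            using gap[of z x] mx[OF that] T that by auto
        qed
        also have "\<dots> \<le> ?d / g * walk V UNIV k z"
          using g by (intro mult_left_mono walk_mono V) auto
        finally show ?thesis using True by (simp add: b_def)
      next
        case False
        have "(\<Sum>y\<in>A. ?C y) = (\<Sum>y\<in>A \<inter> T. ?C y)"
          using A by (intro sum.mono_neutral_right) (auto simp: walk_outside)
        also have "\<dots> \<le> (\<Sum>y\<in>T. ?C y)" using fT by (intro sum_mono2 C0) auto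
        also have "\<dots> \<le> (V z + h) ^ k * F z"
          using mx by (intro visit T) (metis less_imp_le order_refl)
        finally show ?thesis using False by (simp add: b_def)
      qed
    qed (use V h A finite_ballz in auto)
    also have "(\<Sum>z | z \<in> ?B \<and> V z > h. b z) \<le> (\<Sum>z \<in> {z. z \<in> ?B - Zs \<and> V z > h} \<union> Zs. b z)"
      using Zs by (intro sum_mono2 b) (auto intro: finite_subset[OF _ finite_ballz[of r]])
    also have "\<dots> = (\<Sum>z | z \<in> ?B - Zs \<and> V z > h. b z) + (\<Sum>z\<in>Zs. b z)"
      using Zs by (intro sum.union_disjoint) (auto intro: finite_subset[OF _ finite_ballz[of r]])
    also have "\<dots> = (\<Sum>z | z \<in> ?B - Zs \<and> V z > h. (V z + h) ^ k * F z) + ?d / g * (\<Sum>z\<in>Zs. walk V UNIV k z)"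
      by (simp add: b_def sum_distrib_left)
    finally have 1: "(\<Sum>y\<in>A. walk V UNIV k y) \<le> (h + ?d) ^ k +
        ((\<Sum>z | z \<in> ?B - Zs \<and> V z > h. (V z + h) ^ k * F z) + ?d / g * (\<Sum>z\<in>Zs. walk V UNIV k z))"
      using eqw by simp
    define w where "w = t ^ k / fact k"
    have "((h + ?d) ^ k + ((\<Sum>z | z \<in> ?B - Zs \<and> V z > h. (V z + h) ^ k * F z) +
        ?d / g * (\<Sum>z\<in>Zs. walk V UNIV k z))) * w = a k"
    proof -
      have "(\<Sum>z | z \<in> ?B - Zs \<and> V z > h. F z * ((V z + h) ^ k * w)) =
          (\<Sum>z | z \<in> ?B - Zs \<and> V z > h. (V z + h) ^ k * F z) * w"
        unfolding sum_distrib_right by (intro sum.cong refl) (simp add: mult_ac)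
      moreover have "(\<Sum>z\<in>Zs. walk V UNIV k z * w) = (\<Sum>z\<in>Zs. walk V UNIV k z) * w"
        by (simp add: sum_distrib_right)
      ultimately show ?thesis unfolding a_def w_def[symmetric] by (simp only: distrib_right mult.assoc add.assoc)
    qed
    then have "(\<Sum>y\<in>A. walk V UNIV k y) * w \<le> a k"
      using mult_right_mono[OF 1 tk[of k]] by (simp only: w_def)
    moreover have "(1 / 2 :: real) ^ k \<ge> 0" by simp
    ultimately show ?thesis unfolding w_def by linarith
  qed
  have e: "(\<lambda>k. c ^ k * (t ^ k / fact k)) sums exp (t * c)" for c
    using exp_sums_real[of "t * c"] by (simp add: power_mult_distrib mult.commute)
  have w: "(\<lambda>k. walk V UNIV k z * (t ^ k / fact k)) sums wsum V t z" for z
    using summable_sums[OF sm[of z]] by (simp add: wsum_def)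
  have l: "(\<lambda>k. (\<Sum>y\<in>A. walk V UNIV k y) * (t ^ k / fact k)) sums (\<Sum>z\<in>A. wsum V t z)"
    unfolding sum_distrib_right by (intro sums_sum w)
  have r: "(\<lambda>k. a k + (1 / 2) ^ k) sums
      (exp (t * (h + ?d)) + (\<Sum>z | z \<in> ?B - Zs \<and> V z > h. F z * exp (t * (V z + h))) +
      ?d / g * (\<Sum>z\<in>Zs. wsum V t z) + 1 / (1 - 1 / 2))"
    unfolding a_def by (intro sums_add sums_sum sums_mult w e geometric_sums) auto
  show ?thesis using sums_le[OF bound l r] by (simp add: mult.commute[of "F _"])
qed

section \<open>The bounds expressed by \<open>psi\<close>\<close>

lemma ballz_iff: "x \<in> ballz r \<longleftrightarrow> real (nrm x) \<le> r"
  using of_nat_nrm[of x] by (metis ballz_def mem_Collect_eq of_int_of_nat_eq)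

text \<open>
  With \<open>c = 1 / t\<close> and \<open>v = \<xi> z\<close> this is \<open>\<Psi>\<^sub>t(z)\<close>.
\<close>

definition psi :: "real \<Rightarrow> int ^ 'd::finite \<Rightarrow> real \<Rightarrow> real" where
  "psi c z v = v - c * max 0 (nrm z * ln v - path_entropy z)"

text \<open>Without backward moves the best weights are \<open>\<tau> i = 1 / (V z * p i)\<close>
  with \<open>p i\<close> the proportion of steps in direction i, and the product over the
  coordinates is then exactly \<open>exp (path_entropy z - nrm z * ln (V z))\<close>. The
  proportions are mixed with \<kappa>, since a vanishing one would make \<open>\<tau> i\<close>
  infinite. The normalisation costs \<open>ln (1 + d * \<kappa>) \<le> d * \<kappa>\<close> per
  step.\<close>

lemma sum_walk_visiting_le_exp:
  fixes V :: "int ^ 'd::finite \<Rightarrow> real" and h \<kappa> :: real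
  assumes S: "finite S" and V: "\<And>z. V z \<ge> 0" and z: "z \<in> S" "z \<noteq> 0"
    and max: "\<And>x. x \<in> S \<Longrightarrow> V x \<le> V z"
    and h: "h \<ge> 2 * CARD('d)" "V z > h"
    and K: "card {x\<in>S. V x > h} \<le> K"
    and \<kappa>: "0 < \<kappa>" "\<kappa> \<le> 1" "(V z / h)\<^sup>2 * (2 * CARD('d) * (1 + CARD('d))) \<le> V z * \<kappa>"
  shows "(\<Sum>x\<in>S. walk V S k x - walk V (S - {z}) k x)
    \<le> (V z + h) ^ k * exp (path_entropy z - nrm z * ln (V z) + K * ln (V z / h) + nrm z * (CARD('d) * \<kappa> + 2 / V z))"
proof -
  let ?d = "real CARD('d)" and ?m = "V z" and ?n = "real (nrm z)" and ?k = "\<lambda>i. nat \<bar>z $ i\<bar>"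
  have d: "?d \<ge> 1" by (simp add: Suc_leI)
  have m: "h \<ge> 2" "?m > 2" using h d by linarith+
  have n: "?n > 0" using z nrm_eq_0[of z] by auto
  define p where "p = (\<lambda>i. (?k i / ?n + \<kappa>) / (1 + ?d * \<kappa>))"
  have q: "1 + ?d * \<kappa> > 0" using mult_nonneg_nonneg[of ?d \<kappa>] \<kappa>(1) by linarith
  have p_pos: "p i > 0" for i using \<kappa> n q by (simp add: p_def add_nonneg_pos)
  have p_sum: "(\<Sum>i\<in>UNIV. p i) = 1"
  proof -
    have "(\<Sum>i\<in>UNIV. real (?k i)) = ?n" by (simp add: nrm_def)
    then have "(\<Sum>i\<in>UNIV. ?k i / ?n + \<kappa>) = 1 + ?d * \<kappa>"
      using n by (simp add: sum.distrib flip: sum_divide_distrib)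
    then show ?thesis using q by (simp add: p_def flip: sum_divide_distrib)
  qed
  have p_low: "p i \<ge> \<kappa> / (1 + ?d)" for i
    unfolding p_def using \<kappa> n d q by (intro frac_le) (auto simp: mult_left_le)
  \<comment> \<open>The forward moves use up \<open>V z - 1\<close> of the allowed total
    \<open>V z\<close>; the remaining 1 pays for the backward moves, at most \<open>1 / d\<close> in
    each direction. Replacing \<open>V z\<close> by \<open>V z - 1\<close> costs at most
    \<open>2 / V z\<close> per step in the exponent.\<close>
  define \<tau> where "\<tau> = (\<lambda>i. 1 / ((?m - 1) * p i))"
  define \<rho> where "\<rho> = ?m / h"
  have \<rho>1: "\<rho> \<ge> 1" using h m by (simp add: \<rho>_def)
  have \<tau>_pos: "\<tau> i > 0" for i using p_pos[of i] m by (simp add: \<tau>_def)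
  have small: "\<rho>\<^sup>2 * \<tau> i \<le> 1 / ?d" for i
  proof -
    have "\<rho>\<^sup>2 * (2 * ?d * (1 + ?d)) \<le> ?m * \<kappa>" using \<kappa>(3) by (simp add: \<rho>_def algebra_simps)
    then have "\<rho>\<^sup>2 * ?d \<le> ?m / 2 * (\<kappa> / (1 + ?d))" using d by (simp add: field_simps)
    also have "\<dots> \<le> (?m - 1) * p i" using m \<kappa> d by (intro mult_mono p_low) auto
    finally show ?thesis using p_pos[of i] m d by (simp add: \<tau>_def field_simps)
  qed
  have \<tau>_le: "\<rho> * \<tau> i \<le> 1" for i
  proof -
    have "\<rho> * \<tau> i \<le> \<rho>\<^sup>2 * \<tau> i" using \<rho>1 \<tau>_pos[of i] by (intro mult_right_mono self_le_power) auto
    also have "\<dots> \<le> 1" using d by (intro order_trans[OF small]) simp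
    finally show ?thesis .
  qed
  have \<tau>_sum: "(\<Sum>i\<in>UNIV. 1 / \<tau> i + \<rho>\<^sup>2 * \<tau> i) \<le> ?m"
  proof -
    have "(\<Sum>i\<in>UNIV. 1 / \<tau> i + \<rho>\<^sup>2 * \<tau> i) \<le> (\<Sum>i\<in>UNIV. (?m - 1) * p i + 1 / ?d)"
      using small by (intro sum_mono add_mono) (auto simp: \<tau>_def)
    also have "\<dots> = ?m" using d by (simp add: sum.distrib p_sum flip: sum_distrib_left)
    finally show ?thesis .
  qed
  have "(\<Sum>x\<in>S. walk V S k x - walk V (S - {z}) k x)
      \<le> (V z + h) ^ k * (\<rho> ^ K * (\<Prod>i\<in>UNIV. \<tau> i ^ ?k i))"
    using m by (intro sum_walk_visiting_le_prod[OF S V z max h(1) _ \<rho>1 \<tau>_pos \<tau>_le \<tau>_sum K]) (simp_all add: \<rho>_def)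
  also have "\<dots> \<le> (V z + h) ^ k * exp (path_entropy z - ?n * ln ?m + K * ln \<rho> + ?n * (?d * \<kappa> + 2 / ?m))"
  proof (rule mult_left_mono)
    have "exp (real (?k i) * ln (\<tau> i)) = \<tau> i ^ ?k i" for i
      by (subst exp_of_nat_mult) (simp add: \<tau>_pos)
    moreover have "exp (real K * ln \<rho>) = \<rho> ^ K"
      using \<rho>1 by (subst exp_of_nat_mult) simp
    ultimately have "\<rho> ^ K * (\<Prod>i\<in>UNIV. \<tau> i ^ ?k i) = exp (K * ln \<rho> + (\<Sum>i\<in>UNIV. ?k i * ln (\<tau> i)))"
      by (simp only: exp_add exp_sum finite)
    also have "(\<Sum>i\<in>UNIV. ?k i * ln (\<tau> i)) \<le> (\<Sum>i\<in>UNIV. ?k i * ln (?n / ?k i) + ?k i * (?d * \<kappa> + 2 / ?m - ln ?m))"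
    proof (rule sum_mono)
      fix i
      show "?k i * ln (\<tau> i) \<le> ?k i * ln (?n / ?k i) + ?k i * (?d * \<kappa> + 2 / ?m - ln ?m)"
      proof (cases "?k i = 0")
        case False
        then have ki: "real (?k i) > 0" by linarith
        have "p i \<ge> ?k i / ?n / (1 + ?d * \<kappa>)"
          unfolding p_def using \<kappa> d by (intro divide_right_mono) auto
        then have "ln (?k i / ?n / (1 + ?d * \<kappa>)) \<le> ln (p i)"
          using ki n \<kappa> d by (intro ln_mono) (auto simp: add_pos_nonneg)
        moreover have "ln (?k i / ?n / (1 + ?d * \<kappa>)) = ln (?k i / ?n) - ln (1 + ?d * \<kappa>)"
          using ki n q by (intro ln_divide_pos) auto
        moreover have "ln (?k i / ?n) = - ln (?n / ?k i)" using ki n by (simp add: ln_div)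
        moreover have "ln (1 + ?d * \<kappa>) \<le> ?d * \<kappa>" using \<kappa> d by (intro ln_add_one_self_le_self) auto
        ultimately have 1: "- ln (p i) \<le> ln (?n / ?k i) + ?d * \<kappa>" by linarith
        have "ln (?m / (?m - 1)) \<le> ?m / (?m - 1) - 1" using m by (intro ln_le_minus_one) auto
        also have "\<dots> \<le> 2 / ?m" using m by (simp add: field_simps)
        finally have 2: "- ln (?m - 1) \<le> 2 / ?m - ln ?m" using m by (simp add: ln_div)
        have "ln (\<tau> i) = - ln (?m - 1) - ln (p i)"
          using m p_pos[of i] by (simp add: \<tau>_def ln_div ln_mult)
        with 1 2 have "ln (\<tau> i) \<le> ln (?n / ?k i) + (?d * \<kappa> + 2 / ?m - ln ?m)" by linarith
        from mult_left_mono[OF this, of "?k i"] show ?thesis by (simp add: distrib_left)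
      qed simp
    qed
    also have "\<dots> = path_entropy z + ?n * (?d * \<kappa> + 2 / ?m - ln ?m)"
      by (simp add: sum.distrib path_entropy_def nrm_def sum_distrib_right)
    finally show "\<rho> ^ K * (\<Prod>i\<in>UNIV. \<tau> i ^ ?k i) \<le> exp (path_entropy z - ?n * ln ?m + K * ln \<rho> + ?n * (?d * \<kappa> + 2 / ?m))"
      by (simp add: algebra_simps)
  qed (use V m in simp)
  finally show ?thesis by (simp add: \<rho>_def)
qed

text \<open>Since \<open>fact k \<ge> (k / e) ^ k\<close>, it suffices that t times the base is at
  most \<open>k / (2 * e)\<close>. The base is at most \<open>(2 * C + D) * k powr \<gamma>\<close>,
  so this is the hypothesis \<open>le\<close>; it needs \<gamma> < 1 to hold for large k.\<close>

lemma growth_bound: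
  fixes C t \<gamma> D :: real
  assumes k: "k > 0" and \<gamma>: "0 < \<gamma>" "\<gamma> < 1" and C: "C \<ge> 0" and D: "D \<ge> 0" and t: "t \<ge> 0"
    and le: "2 * exp 1 * (2 * C + D) * t \<le> real k powr (1 - \<gamma>)"
  shows "(C * (1 + real k) powr \<gamma> + D) ^ k * t ^ k / fact k \<le> (1 / 2) ^ k"
proof -
  have k1: "real k \<ge> 1" using k by simp
  have "(1 + real k) powr \<gamma> \<le> (2 * real k) powr \<gamma>" using k1 \<gamma> by (intro powr_mono2) auto
  also have "\<dots> = 2 powr \<gamma> * real k powr \<gamma>" by (simp add: powr_mult)
  also have "\<dots> \<le> 2 powr 1 * real k powr \<gamma>" using \<gamma> by (intro mult_right_mono powr_mono) auto
  finally have "C * (1 + real k) powr \<gamma> \<le> 2 * C * real k powr \<gamma>"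
    using C by (simp add: mult_left_mono mult.assoc mult.left_commute)
  moreover have "D \<le> D * real k powr \<gamma>" using D k1 \<gamma> by (simp add: mult_le_cancel_left1 ge_one_powr_ge_zero)
  ultimately have 1: "C * (1 + real k) powr \<gamma> + D \<le> (2 * C + D) * real k powr \<gamma>"
    by (simp add: algebra_simps)
  have "(C * (1 + real k) powr \<gamma> + D) * t \<le> (2 * C + D) * real k powr \<gamma> * t"
    using 1 t by (rule mult_right_mono)
  also have "\<dots> = (2 * exp 1 * (2 * C + D) * t) * real k powr \<gamma> / (2 * exp 1)" by simp
  also have "\<dots> \<le> real k powr (1 - \<gamma>) * real k powr \<gamma> / (2 * exp 1)"
    by (intro divide_right_mono mult_right_mono le) auto
  also have "\<dots> = real k / (2 * exp 1)" using k1 by (simp flip: powr_add)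
  finally have 2: "(C * (1 + real k) powr \<gamma> + D) * t \<le> real k / (2 * exp 1)" .
  have "(C * (1 + real k) powr \<gamma> + D) ^ k * t ^ k \<le> (real k / (2 * exp 1)) ^ k"
    unfolding power_mult_distrib[symmetric] using C D t 2 by (intro power_mono) auto
  moreover have "(real k / exp 1) ^ k \<le> fact k"
  proof -
    have "exp (real k * ln k) = real k ^ k" "exp (real k) = exp 1 ^ k"
      using k1 exp_of_nat_mult[of k 1] by (simp_all add: exp_of_nat_mult)
    then have "(real k / exp 1) ^ k = exp (real k * ln k - k)"
      by (simp add: exp_diff power_divide)
    also have "\<dots> \<le> exp (ln (fact k))" using ln_fact_lower[of k] by (simp only: exp_le_cancel_iff)
    finally show ?thesis by simp
  qed
  then have "(real k / (2 * exp 1)) ^ k \<le> (1 / 2) ^ k * fact k"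
    by (simp add: power_divide power_mult_distrib divide_right_mono field_simps)
  ultimately have "(C * (1 + real k) powr \<gamma> + D) ^ k * t ^ k \<le> (1 / 2) ^ k * fact k" by linarith
  then show ?thesis by (simp add: divide_le_eq)
qed

text \<open>The deterministic core. Let X = \<open>exp (t * psi (1 / t) Z (V Z))\<close>. The weight
  of \<open>Zs\<close> is at least X up to a polynomial factor, whereas each of the four terms of
  \<open>sum_wsum_le\<close> is at most \<open>e / 4\<close> times that weight. The quantifiers over
  \<open>V\<close>, \<open>Zs\<close>, \<open>Z\<close> and \<open>A\<close> stand inside, so that
  the threshold for t depends on the potential only through C.\<close>

lemma concentration:
  fixes C p q \<epsilon> \<epsilon>' \<delta> \<gamma> \<kappa> \<sigma> e :: real
  assumes e: "e > 0" and C: "C > 0" and pq: "p = q + 1" "q > 0"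
    and ex: "0 < \<epsilon>" "0 < \<epsilon>'" "\<epsilon> + \<epsilon>' < \<delta>" "3 * \<delta> + \<epsilon> < q" "0 < \<sigma>" "0 < \<kappa>" "\<kappa> < p - \<epsilon>'"
    and \<gamma>: "0 < \<gamma>" "\<gamma> < 1" "(p + \<epsilon>) * (1 - \<gamma>) > 1" "(p + \<epsilon>) * \<gamma> < q + \<epsilon>"
  shows "\<forall>\<^sub>F t in at_top. \<forall>(V :: int ^ 'd::finite \<Rightarrow> real) Zs Z A.
    (\<forall>x. V x \<ge> 0 \<and> V x \<le> C * (1 + nrm x) powr \<gamma>) \<longrightarrow>
    (\<forall>z. summable (\<lambda>k. walk V UNIV k z * t ^ k / fact k)) \<longrightarrow>
    card {x\<in>ballz (t powr (p + \<epsilon>)). V x > t powr (q - \<delta>)} \<le> t powr \<kappa> \<longrightarrow>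
    (\<forall>x\<in>ballz (t powr (p + \<epsilon>)). \<forall>y\<in>ballz (t powr (p + \<epsilon>)).
        V x > t powr (q - \<delta>) \<longrightarrow> x \<noteq> y \<longrightarrow> V y \<le> V x \<longrightarrow> V y + t powr \<sigma> \<le> V x) \<longrightarrow>
    Z \<in> Zs \<longrightarrow> finite Zs \<longrightarrow> Zs \<subseteq> ballz (t powr (p + \<epsilon>)) \<longrightarrow>
    psi (1 / t) Z (V Z) \<ge> t powr (q - \<epsilon>) \<longrightarrow>
    (\<forall>z\<in>ballz (t powr (p + \<epsilon>)) - Zs. psi (1 / t) z (V z) \<le> psi (1 / t) Z (V Z) - t powr (q - \<epsilon>')) \<longrightarrow>
    finite A \<longrightarrow> A \<inter> Zs = {} \<longrightarrow> (\<Sum>z\<in>A. wsum V t z) \<le> e * (\<Sum>z\<in>Zs. wsum V t z)"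
proof -
  define d where "d = real CARD('d)"
  have d: "d \<ge> 1" by (simp add: d_def Suc_leI)
  let ?R = "\<lambda>t::real. t powr (p + \<epsilon>)" and ?h = "\<lambda>t::real. t powr (q - \<delta>)"
    and ?l = "\<lambda>t::real. t powr (q - \<epsilon>)" and ?g = "\<lambda>t::real. t powr (q - \<epsilon>')"
    and ?P = "\<lambda>t::real. 2 * (exp 1 * (t powr (p + \<epsilon>) + 1)) ^ CARD('d)"
  have q\<delta>: "q - \<delta> > 0" using ex by linarith
  have E1: "\<forall>\<^sub>F t in at_top. (t::real) \<ge> 1" by (rule eventually_ge_at_top)
  have E2: "\<forall>\<^sub>F t in at_top. ?h t \<ge> exp (d + 8) + 2 * d + C" using q\<delta> by real_asymp
  have E3: "\<forall>\<^sub>F t in at_top. C * (1 + ?R t) powr \<gamma> \<le> t powr (q + \<epsilon>)"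
    using \<gamma> ex pq C by real_asymp
  have E4: "\<forall>\<^sub>F t in at_top. 2 * exp 1 * (2 * C + 2 * d) * t \<le> t powr ((p + \<epsilon>) * (1 - \<gamma>))"
  proof -
    have "2 * exp 1 * (2 * C + 2 * d) > 0" using C d by simp
    moreover define c where "c = 2 * exp 1 * (2 * C + 2 * d)"
    moreover define a where "a = (p + \<epsilon>) * (1 - \<gamma>)"
    ultimately have "c > 0" "a > 1" using \<gamma> by auto
    then have "\<forall>\<^sub>F t in at_top. c * t \<le> t powr a" by real_asymp
    then show ?thesis by (simp add: c_def a_def)
  qed
  \<comment> \<open>With perturbation \<open>t powr (- \<delta>)\<close>, values up to
    \<open>t powr (q + \<epsilon>)\<close> and low level \<open>t powr (q - \<delta>)\<close>, this
    is the last hypothesis of \<open>sum_walk_visiting_le_exp\<close>; it holds because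
    \<open>3 * \<delta> + \<epsilon> < q\<close>.\<close>
  have E5: "\<forall>\<^sub>F t in at_top. (2 * d * (1 + d)) * t powr (- q + \<epsilon> + 2 * \<delta>) \<le> t powr (- \<delta>)"
  proof -
    define c where "c = 2 * d * (1 + d)"
    have "- q + \<epsilon> + 2 * \<delta> < - \<delta>" "c > 0" using ex d by (auto simp: c_def)
    then have "\<forall>\<^sub>F t in at_top. c * t powr (- q + \<epsilon> + 2 * \<delta>) \<le> t powr (- \<delta>)" by real_asymp
    then show ?thesis by (simp add: c_def)
  qed
  \<comment> \<open>Half of the gap has to absorb all errors in the exponent: the low level, the
    passages over high sites, and the two losses per step times the radius. Their exponents are
    \<open>p - \<delta>\<close>, \<kappa> (with a logarithm),
    \<open>p + \<epsilon> - \<delta>\<close> and \<open>p + \<epsilon> + \<delta> - q\<close>, all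
    smaller than \<open>p - \<epsilon>'\<close>.\<close>
  have E6: "\<forall>\<^sub>F t in at_top. t * ?h t + t powr \<kappa> * ln (t powr (\<epsilon> + \<delta>)) +
      ?R t * (d * t powr (- \<delta>) + 2 * t powr (\<delta> - q)) \<le> t * ?g t / 2"
  proof -
    have "\<forall>\<^sub>F t in at_top. t * ?h t \<le> t * ?g t / 8" using ex by real_asymp
    moreover have "\<forall>\<^sub>F t in at_top. t powr \<kappa> * ln (t powr (\<epsilon> + \<delta>)) \<le> t * ?g t / 8"
    proof -
      define b where "b = p - \<epsilon>'" 
      have "\<forall>\<^sub>F t in at_top. t powr \<kappa> * ln (t powr (\<epsilon> + \<delta>)) \<le> t powr b / 8"
        using ex by (fold b_def) real_asymp
      then show ?thesis using eventually_gt_at_top[of 0]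
        by eventually_elim (simp add: b_def pq powr_add powr_diff mult.commute)
    qed
    moreover have "\<forall>\<^sub>F t in at_top. ?R t * (d * t powr (- \<delta>)) \<le> t * ?g t / 8"
    proof -
      have "p + \<epsilon> - \<delta> < p - \<epsilon>'" using ex by simp
      moreover define a b where "a = p + \<epsilon> - \<delta>" "b = p - \<epsilon>'" 
      ultimately have "\<forall>\<^sub>F t in at_top. d * t powr a \<le> t powr b / 8"
        using d by (fold a_b_def) real_asymp
      then show ?thesis using eventually_gt_at_top[of 0]
        by eventually_elim (simp add: a_b_def pq powr_add powr_diff powr_minus field_simps)
    qed
    moreover have "\<forall>\<^sub>F t in at_top. ?R t * (2 * t powr (\<delta> - q)) \<le> t * ?g t / 8"
    proof -
      have "p + \<epsilon> + (\<delta> - q) < p - \<epsilon>'" using ex by simp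
      moreover define a b where "a = p + \<epsilon> + (\<delta> - q)" "b = p - \<epsilon>'" 
      ultimately have "\<forall>\<^sub>F t in at_top. 2 * t powr a \<le> t powr b / 8"
        by (fold a_b_def) real_asymp
      then show ?thesis using eventually_gt_at_top[of 0]
        by eventually_elim (simp add: a_b_def pq powr_add powr_diff powr_minus field_simps)
    qed
    ultimately show ?thesis by eventually_elim (simp add: distrib_left)
  qed
  have E7: "\<forall>\<^sub>F t in at_top. exp (t * (?h t + 2 * d) - t * ?l t) * ?P t \<le> e / 4"
  proof -
    have "((\<lambda>t. exp (t * (?h t + 2 * d) - t * ?l t) * ?P t) \<longlongrightarrow> 0) at_top"
      using ex pq d q\<delta> by real_asymp
    from order_tendstoD(2)[OF this, of "e / 4"] e show ?thesis by (auto elim: eventually_mono)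
  qed
  have E8: "\<forall>\<^sub>F t in at_top. t powr \<kappa> * exp (- (t * ?g t / 2)) * ?P t \<le> e / 4"
  proof -
    have "q - \<epsilon>' > 0" using ex by simp
    then have "((\<lambda>t. t powr \<kappa> * exp (- (t * ?g t / 2)) * ?P t) \<longlongrightarrow> 0) at_top"
      using ex pq by real_asymp
    from order_tendstoD(2)[OF this, of "e / 4"] e show ?thesis by (auto elim: eventually_mono)
  qed
  have E9: "\<forall>\<^sub>F t in at_top. 2 * exp (- (t * ?l t)) * ?P t \<le> e / 4"
  proof -
    have "q - \<epsilon> > 0" using ex by simp
    then have "((\<lambda>t. 2 * exp (- (t * ?l t)) * ?P t) \<longlongrightarrow> 0) at_top"
      using ex pq by real_asymp
    from order_tendstoD(2)[OF this, of "e / 4"] e show ?thesis by (auto elim: eventually_mono)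
  qed
  have E10: "\<forall>\<^sub>F t in at_top. t powr \<sigma> \<ge> 2 * d + 8 * d / e"
    using ex by real_asymp
  have E11: "\<forall>\<^sub>F t in at_top. ?h t \<le> ?l t" using ex by real_asymp
  show ?thesis
    using E1 E2 E3 E4 E5 E6 E7 E8 E9 E10 E11
  proof eventually_elim
    case (elim t)
    show ?case
    proof (intro allI impI)
      fix V :: "int ^ 'd \<Rightarrow> real" and Zs Z A
      let ?B = "ballz (t powr (p + \<epsilon>)) :: (int ^ 'd) set"
      assume V: "\<forall>x. V x \<ge> 0 \<and> V x \<le> C * (1 + nrm x) powr \<gamma>"
        and sm: "\<forall>z. summable (\<lambda>k. walk V UNIV k z * t ^ k / fact k)"
        and K: "card {x\<in>?B. V x > ?h t} \<le> t powr \<kappa>"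
        and gap: "\<forall>x\<in>?B. \<forall>y\<in>?B. V x > ?h t \<longrightarrow> x \<noteq> y \<longrightarrow> V y \<le> V x \<longrightarrow> V y + t powr \<sigma> \<le> V x"
        and Z: "Z \<in> Zs" "finite Zs" "Zs \<subseteq> ?B" "psi (1 / t) Z (V Z) \<ge> ?l t"
        and rest: "\<forall>z\<in>?B - Zs. psi (1 / t) z (V z) \<le> psi (1 / t) Z (V Z) - ?g t"
        and A: "finite A" "A \<inter> Zs = {}"
      show "(\<Sum>z\<in>A. wsum V t z) \<le> e * (\<Sum>z\<in>Zs. wsum V t z)"
      proof -
        define h where "h = ?h t"
        define K where "K = nat \<lfloor>t powr \<kappa>\<rfloor>"
        define \<kappa>' where "\<kappa>' = t powr (- \<delta>)"
        define X where "X = exp (t * psi (1 / t) Z (V Z))"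
        define W where "W = (\<Sum>z\<in>Zs. wsum V t z)"
        have t: "t \<ge> 1" by (rule elim)
        have h: "h \<ge> exp (d + 8)" "h \<ge> 2 * d" "h \<ge> C" "h > 0"
          using elim(2) d C exp_gt_zero[of "d + 8"] unfolding h_def by linarith+
        have V0: "V x \<ge> 0" for x using V by simp
        have vmax: "V x \<le> t powr (q + \<epsilon>)" if "x \<in> ?B" for x
        proof -
          have "V x \<le> C * (1 + nrm x) powr \<gamma>" using V by simp
          also have "\<dots> \<le> C * (1 + ?R t) powr \<gamma>"
            using that C \<gamma> by (intro mult_left_mono powr_mono2) (auto simp: ballz_iff)
          finally show ?thesis using elim(3) by linarith
        qed
        have Kt: "real K \<le> t powr \<kappa>" using of_nat_floor[of "t powr \<kappa>"] by (simp add: K_def)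
        have lnV: "ln (V z) \<ge> d + 8" if "V z > h" for z
        proof -
          have "ln (exp (d + 8)) \<le> ln (V z)" using that h by (intro ln_mono) auto
          then show ?thesis by simp
        qed
        have psi_high: "t * psi (1 / t) z (V z) = t * V z - nrm z * ln (V z) + path_entropy z" if "V z > h" for z
        proof -
          have "path_entropy z \<le> d * nrm z" using path_entropy_le[of z] by (simp add: d_def)
          also have "\<dots> \<le> ln (V z) * nrm z" using lnV[OF that] by (intro mult_right_mono) auto
          finally show ?thesis using t by (simp add: psi_def mult.commute right_diff_distrib)
        qed
        define F where "F = (\<lambda>z. exp (path_entropy z - nrm z * ln (V z) + K * ln (V z / h) + nrm z * (d * \<kappa>' + 2 / V z)))"
        have gs: "t powr \<sigma> - 2 * d > 0" using elim(10) d e by (smt (verit) divide_pos_pos)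
        have main: "(\<Sum>z\<in>A. wsum V t z) \<le> exp (t * (h + real (2 * CARD('d)))) +
           (\<Sum>z | z \<in> ?B - Zs \<and> V z > h. exp (t * (V z + h)) * F z) +
           real (2 * CARD('d)) / (t powr \<sigma> - 2 * d) * (\<Sum>z\<in>Zs. wsum V t z) + 2"
        proof (rule sum_wsum_le[where v = "\<lambda>k. C * (1 + real k) powr \<gamma>"])
          fix k :: nat and x :: "int ^ 'd" assume "x \<in> ballz (real k)"
          then have "C * (1 + nrm x) powr \<gamma> \<le> C * (1 + real k) powr \<gamma>"
            using C \<gamma> by (intro mult_left_mono powr_mono2) (auto simp: ballz_iff)
          then show "V x \<le> C * (1 + real k) powr \<gamma>" using V by (meson order_trans)
        next
          fix k :: nat assume k: "?R t < real k"
          then have "k > 0" by (cases k) (auto simp: not_less[symmetric])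
          moreover have "2 * exp 1 * (2 * C + 2 * d) * t \<le> real k powr (1 - \<gamma>)"
          proof -
            have "t powr ((p + \<epsilon>) * (1 - \<gamma>)) = ?R t powr (1 - \<gamma>)" by (simp add: powr_powr)
            also have "\<dots> \<le> real k powr (1 - \<gamma>)" using k \<gamma> by (intro powr_mono2) auto
            finally show ?thesis using elim(4) by linarith
          qed
          ultimately show "(C * (1 + real k) powr \<gamma> + real (2 * CARD('d))) ^ k * t ^ k / fact k \<le> (1 / 2) ^ k"
            using \<gamma> C d t by (intro growth_bound) (auto simp: d_def)
        next
          show "V 0 \<le> h" using V[rule_format, of 0] h by (simp add: nrm_def)
        next
          fix x y assume "x \<in> ?B" "y \<in> ?B" "h < V x" "x \<noteq> y" "V y \<le> V x"
          then have "V y + t powr \<sigma> \<le> V x" using gap unfolding h_def by blast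
          then show "V y + real (2 * CARD('d)) + (t powr \<sigma> - 2 * d) \<le> V x" by (simp add: d_def)
        next
          fix k T z assume T: "T \<subseteq> ?B" "z \<in> T" "h < V z" "\<And>x. x \<in> T \<Longrightarrow> V x \<le> V z"
          have "card {x\<in>T. V x > h} \<le> card {x\<in>?B. V x > h}"
            using T by (intro card_mono finite_subset[OF _ finite_ballz[of "?R t"]]) auto
          also have "\<dots> \<le> K" using K unfolding K_def h_def by (simp add: le_nat_floor)
          finally have cK: "card {x\<in>T. V x > h} \<le> K" .
          have cond: "(V z / h)\<^sup>2 * (2 * d * (1 + d)) \<le> V z * \<kappa>'"
          proof -
            have "V z / h\<^sup>2 \<le> t powr (q + \<epsilon>) / h\<^sup>2"
              using vmax[of z] T by (intro divide_right_mono) auto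
            also have "t powr (q + \<epsilon>) / h\<^sup>2 = t powr (- q + \<epsilon> + 2 * \<delta>)"
            proof -
              have "h\<^sup>2 = t powr (2 * q - 2 * \<delta>)"
                by (simp add: h_def power2_eq_square flip: powr_add)
              then show ?thesis by (simp add: algebra_simps flip: powr_diff)
            qed
            finally have "(2 * d * (1 + d)) * (V z / h\<^sup>2) \<le> (2 * d * (1 + d)) * t powr (- q + \<epsilon> + 2 * \<delta>)"
              using d by (intro mult_left_mono) auto
            also have "\<dots> \<le> \<kappa>'" using elim(5) by (simp add: \<kappa>'_def)
            finally have "V z * ((2 * d * (1 + d)) * (V z / h\<^sup>2)) \<le> V z * \<kappa>'"
              using V0 by (intro mult_left_mono)
            then show ?thesis by (simp add: power2_eq_square power_divide mult_ac)
          qed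
          have z0: "z \<noteq> 0" using V[rule_format, of 0] h T by (auto simp: nrm_def)
          have fT: "finite T" using T(1) finite_ballz finite_subset by blast
          have "t powr (- \<delta>) \<le> t powr 0" using t ex by (intro powr_mono) auto
          then have k1: "\<kappa>' \<le> 1" "\<kappa>' > 0" using t by (auto simp: \<kappa>'_def)
          show "(\<Sum>y\<in>T. walk V T k y - walk V (T - {z}) k y) \<le> (V z + h) ^ k * F z"
            using h cond unfolding F_def d_def
            by (intro sum_walk_visiting_le_exp[OF fT V0 T(2) z0 T(4) _ T(3) cK]) (simp_all add: k1 d_def algebra_simps)
        qed (use V0 h t sm A Z gs in \<open>auto simp: F_def\<close>)
        have pZ: "psi (1 / t) Z (V Z) \<le> V Z" using t by (simp add: psi_def)
        have hZ: "V Z > h \<or> V Z = h" using pZ Z(4) elim(11) unfolding h_def by linarith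
        have term2: "(\<Sum>z | z \<in> ?B - Zs \<and> V z > h. exp (t * (V z + h)) * F z) \<le> t powr \<kappa> * (X * exp (- (t * ?g t / 2)))"
        proof -
          have "exp (t * (V z + h)) * F z \<le> X * exp (- (t * ?g t / 2))" if z: "z \<in> ?B - Zs" "V z > h" for z
          proof -
            have "V z / h \<le> t powr (q + \<epsilon>) / h" using vmax[of z] z h by (intro divide_right_mono) auto
            also have "\<dots> = t powr (\<epsilon> + \<delta>)" by (simp add: h_def algebra_simps flip: powr_diff)
            finally have "ln (V z / h) \<le> ln (t powr (\<epsilon> + \<delta>))" using z h by (intro ln_mono) auto
            moreover have "ln (V z / h) \<ge> 0" using z h by (intro ln_ge_zero) auto
            ultimately have 1: "K * ln (V z / h) \<le> t powr \<kappa> * ln (t powr (\<epsilon> + \<delta>))"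
              using Kt by (intro mult_mono) auto
            have "2 / V z \<le> 2 / h" using z h by (intro divide_left_mono) auto
            also have "2 / h = 2 * t powr (\<delta> - q)" by (simp add: h_def powr_diff)
            finally have "nrm z * (d * \<kappa>' + 2 / V z) \<le> ?R t * (d * t powr (- \<delta>) + 2 * t powr (\<delta> - q))"
              using z d V0[of z] by (intro mult_mono) (auto simp: ballz_iff \<kappa>'_def)
            then have "t * h + K * ln (V z / h) + nrm z * (d * \<kappa>' + 2 / V z) \<le> t * ?g t / 2"
              using 1 elim(6) unfolding h_def by linarith
            moreover have "t * psi (1 / t) z (V z) \<le> t * (psi (1 / t) Z (V Z) - ?g t)"
              using rest z t by (intro mult_left_mono) auto
            ultimately have "t * (V z + h) + (path_entropy z - nrm z * ln (V z) + K * ln (V z / h) + nrm z * (d * \<kappa>' + 2 / V z))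
               \<le> t * psi (1 / t) Z (V Z) - t * ?g t / 2"
              using psi_high[OF z(2)] distrib_left[of t "V z" h] right_diff_distrib[of t "psi (1 / t) Z (V Z)" "?g t"]
              by linarith
            then show ?thesis unfolding F_def X_def by (simp flip: exp_add)
          qed
          then have "(\<Sum>z | z \<in> ?B - Zs \<and> V z > h. exp (t * (V z + h)) * F z)
             \<le> card {z. z \<in> ?B - Zs \<and> V z > h} * (X * exp (- (t * ?g t / 2)))"
            by (intro sum_bounded_above) auto
          also have "\<dots> \<le> t powr \<kappa> * (X * exp (- (t * ?g t / 2)))"
          proof (rule mult_right_mono)
            have "card {z. z \<in> ?B - Zs \<and> V z > h} \<le> card {x\<in>?B. V x > h}"
              by (intro card_mono finite_subset[OF _ finite_ballz[of "?R t"]]) auto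
            then show "real (card {z. z \<in> ?B - Zs \<and> V z > h}) \<le> t powr \<kappa>" using K unfolding h_def by linarith
          qed (simp add: X_def)
          finally show ?thesis .
        qed
        have lnZ: "ln (V Z) \<ge> d + 8"
        proof -
          have "ln (exp (d + 8)) \<le> ln (V Z)" using hZ h by (intro ln_mono) auto
          then show ?thesis by simp
        qed
        have entZ: "path_entropy Z \<le> d * nrm Z" using path_entropy_le[of Z] by (simp add: d_def)
        have lnZ': "nrm Z * ln (V Z) \<ge> nrm Z * d + nrm Z * 8"
          using mult_left_mono[OF lnZ, of "real (nrm Z)"] by (simp add: distrib_left)
        have psiZ: "t * psi (1 / t) Z (V Z) = t * V Z - nrm Z * ln (V Z) + path_entropy Z"
        proof -
          have "real (nrm Z) * ln (V Z) - path_entropy Z \<ge> 0" using lnZ' entZ by (simp add: mult.commute)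
          then show ?thesis using t by (simp add: psi_def right_diff_distrib)
        qed
        have P0: "?P t > 0" by (simp add: add_pos_nonneg add_nonneg_pos)
        have "X / ?P t \<le> wsum V t Z"
        proof -
          have "t * psi (1 / t) Z (V Z) \<ge> 0" using Z(4) t by (smt (verit) mult_nonneg_nonneg powr_ge_zero)
          then have "t * V Z \<ge> 8 * real (nrm Z)" using psiZ lnZ' entZ by (simp add: mult.commute)
          moreover have "Z \<noteq> 0"
          proof
            assume "Z = 0"
            then have "V Z \<le> C" using V[rule_format, of 0] by (simp add: nrm_def)
            moreover have "h \<ge> C + exp (d + 8)" using elim(2) d unfolding h_def by linarith
            ultimately show False using hZ exp_gt_zero[of "d + 8"] by linarith
          qed
          ultimately have "exp (t * V Z - nrm Z * ln (V Z) + path_entropy Z) / (2 * (exp 1 * (nrm Z + 1)) ^ CARD('d)) \<le> wsum V t Z"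
            using t sm by (intro wsum_lower V0) auto
          moreover have "X / ?P t \<le> X / (2 * (exp 1 * (nrm Z + 1)) ^ CARD('d))"
          proof (intro divide_left_mono mult_left_mono power_mono)
            show "real (nrm Z + 1) \<le> ?R t + 1" using Z by (auto simp: ballz_iff)
            have "(exp 1 * real (nrm Z + 1)) ^ CARD('d) > 0" by (intro zero_less_power mult_pos_pos) auto
            then show "0 < ?P t * (2 * (exp 1 * (nrm Z + 1)) ^ CARD('d))" using P0 by simp
          qed (auto simp: X_def)
          ultimately show ?thesis by (simp add: X_def psiZ)
        qed
        also have "wsum V t z \<ge> 0" for z
          unfolding wsum_def using sm t V0 by (intro suminf_nonneg) (auto simp: walk_nonneg)
        then have "wsum V t Z \<le> W"
          unfolding W_def using Z by (intro member_le_sum) auto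
        finally have XW: "X \<le> W * ?P t" using P0 by (simp add: pos_divide_le_eq)
        have X_ge: "exp (t * ?l t) \<le> X" unfolding X_def using Z(4) t by (simp add: mult_left_mono)
        have small: "a * X \<le> e / 4 * W" if "a * ?P t \<le> e / 4" "a \<ge> 0" for a
        proof -
          have "a * X \<le> a * (W * ?P t)" using XW that by (intro mult_left_mono)
          also have "\<dots> = (a * ?P t) * W" by (simp add: mult_ac)
          also have "\<dots> \<le> e / 4 * W"
          proof (rule mult_right_mono[OF that(1)])
            have "0 < W * ?P t" using XW X_def by (smt (verit) exp_gt_zero)
            from zero_less_mult_pos2[OF this P0] show "W \<ge> 0" by (rule less_imp_le)
          qed
          finally show ?thesis .
        qed
        have "exp (t * (h + real (2 * CARD('d)))) \<le> exp (t * (?h t + 2 * d) - t * ?l t) * X"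
        proof -
          have "exp (t * (h + real (2 * CARD('d)))) = exp (t * (?h t + 2 * d) - t * ?l t) * exp (t * ?l t)"
            by (simp add: h_def d_def flip: exp_add)
          then show ?thesis using X_ge by simp
        qed
        also have "\<dots> \<le> e / 4 * W" using elim(7) by (intro small) auto
        finally have t1: "exp (t * (h + real (2 * CARD('d)))) \<le> e / 4 * W" .
        have t2: "(\<Sum>z | z \<in> ?B - Zs \<and> V z > h. exp (t * (V z + h)) * F z) \<le> e / 4 * W"
          using term2 small[OF elim(8)] by (simp add: mult_ac)
        have W0: "W \<ge> 0"
          using \<open>\<And>z. wsum V t z \<ge> 0\<close> unfolding W_def by (intro sum_nonneg)
        have "real (2 * CARD('d)) / (t powr \<sigma> - 2 * d) \<le> e / 4"
          using elim(10) gs e by (simp add: d_def field_simps)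
        then have t3: "real (2 * CARD('d)) / (t powr \<sigma> - 2 * d) * W \<le> e / 4 * W"
          using W0 by (rule mult_right_mono)
        have "2 \<le> (2 * exp (- (t * ?l t))) * X"
        proof -
          have "(2 * exp (- (t * ?l t))) * exp (t * ?l t) = 2" by (simp flip: exp_add)
          then show ?thesis using mult_left_mono[OF X_ge, of "2 * exp (- (t * ?l t))"] by simp
        qed
        also have "\<dots> \<le> e / 4 * W" using elim(9) by (intro small) auto
        finally have t4: "2 \<le> e / 4 * W" .
        show ?thesis using main t1 t2 t3 t4 unfolding W_def[symmetric] by linarith
      qed
    qed
  qed
qed

section \<open>Clusters of a Pareto field\<close>

lemma card_ballz_le:
  assumes "r \<ge> 1"
  shows "real (card (ballz r :: (int ^ 'd::finite) set)) \<le> (3 * r) ^ CARD('d)"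
proof -
  let ?m = "\<lfloor>r\<rfloor>"
  let ?E = "PiE (UNIV :: 'd set) (\<lambda>i. {- ?m..?m})"
  have "vec_nth ` (ballz r :: (int ^ 'd) set) \<subseteq> ?E"
  proof safe
    fix x :: "int ^ 'd" and i assume x: "x \<in> ballz r"
    have "\<bar>x $ i\<bar> \<le> l1_norm x" unfolding l1_norm_def by (rule member_le_sum) auto
    moreover have "l1_norm x \<le> ?m" using x by (simp add: ballz_def le_floor_iff)
    ultimately show "x $ i \<in> {- ?m..?m}" by auto
  qed auto
  moreover have "finite ?E" by (intro finite_PiE) auto
  moreover have "inj_on vec_nth (ballz r :: (int ^ 'd) set)" by (auto simp: inj_on_def vec_nth_inject)
  ultimately have "card (ballz r :: (int ^ 'd) set) \<le> card ?E" by (metis card_inj_on_le)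
  also have "card ?E = nat (2 * ?m + 1) ^ CARD('d)" by (simp add: card_PiE)
  finally have "real (card (ballz r :: (int ^ 'd) set)) \<le> real (nat (2 * ?m + 1)) ^ CARD('d)"
    by (metis of_nat_le_iff of_nat_power)
  also have "\<dots> \<le> (3 * r) ^ CARD('d)"
  proof (rule power_mono)
    have "2 * real_of_int ?m + 1 \<le> 3 * r" using assms of_int_floor_le[of r] by linarith
    then show "real (nat (2 * ?m + 1)) \<le> 3 * r" using assms by simp
  qed simp
  finally show ?thesis .
qed

lemma card_ballz_ge:
  assumes "r \<ge> 0"
  shows "(r / CARD('d)) ^ CARD('d) \<le> real (card (ballz r :: (int ^ 'd::finite) set))"
proof -
  let ?d = "real CARD('d)"
  let ?m = "\<lfloor>r / ?d\<rfloor>"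
  let ?E = "PiE (UNIV :: 'd set) (\<lambda>i. {0..?m})"
  have m0: "?m \<ge> 0" using assms by simp
  have "vec_lambda ` ?E \<subseteq> (ballz r :: (int ^ 'd) set)"
  proof safe
    fix f assume f: "f \<in> ?E"
    have "l1_norm (vec_lambda f) \<le> (\<Sum>i\<in>(UNIV::'d set). ?m)"
      unfolding l1_norm_def using f by (intro sum_mono) (auto simp: PiE_iff)
    then have "real_of_int (l1_norm (vec_lambda f)) \<le> ?d * real_of_int ?m"
      by (metis of_int_le_iff of_int_mult of_int_of_nat_eq sum_constant)
    also have "\<dots> \<le> ?d * (r / ?d)" by (intro mult_left_mono) auto
    also have "\<dots> = r" by simp
    finally show "vec_lambda f \<in> ballz r" by (simp add: ballz_def)
  qed
  moreover have "inj_on vec_lambda ?E" by (auto simp: inj_on_def vec_lambda_inject)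
  ultimately have "card ?E \<le> card (ballz r :: (int ^ 'd) set)"
    using finite_ballz by (metis card_inj_on_le)
  moreover have "card ?E = nat (?m + 1) ^ CARD('d)" by (simp add: card_PiE)
  ultimately have "real (nat (?m + 1)) ^ CARD('d) \<le> real (card (ballz r :: (int ^ 'd) set))"
    by (metis of_nat_le_iff of_nat_power)
  moreover have "(r / ?d) ^ CARD('d) \<le> real (nat (?m + 1)) ^ CARD('d)"
    using assms m0 real_of_int_floor_add_one_ge[of "r / ?d"] by (intro power_mono) auto
  ultimately show ?thesis by linarith
qed

text \<open>Where \<open>psi\<close> is at least l it has slope at least 1/2. There
  \<open>c * (nrm z * ln v - path_entropy z) \<le> v\<close>, and the bracket is at least
  \<open>2 * nrm z\<close> because \<open>ln v\<close> is at least the dimension plus 2; so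
  \<open>c * nrm z \<le> v / 2\<close>, while the slope is \<open>1 - c * nrm z / v\<close>.\<close>

lemma psi_window:
  fixes z :: "int ^ 'd::finite"
  assumes c: "c \<ge> 0" and l: "l \<ge> exp (real CARD('d) + 2)"
    and v: "psi c z v \<in> {l..l + w}" "psi c z v' \<in> {l..l + w}" "v \<le> v'"
  shows "v' - v \<le> 2 * w"
proof -
  let ?n = "real (nrm z)" and ?d = "real CARD('d)"
  have l0: "l > 0" using l by (smt (verit) exp_gt_zero)
  have vl: "v \<ge> l" using v(1) c by (auto simp: psi_def) (smt (verit) mult_nonneg_nonneg)
  have big: "?n * ln x - path_entropy z \<ge> 2 * ?n" if "x \<ge> l" for x
  proof -
    have "ln (exp (?d + 2)) \<le> ln x" using that l l0 by (intro ln_mono) auto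
    then have "?n * (?d + 2) \<le> ?n * ln x" by (intro mult_left_mono) auto
    moreover have "path_entropy z \<le> ?d * ?n" using path_entropy_le[of z] by simp
    ultimately show ?thesis by (simp add: algebra_simps)
  qed
  have psi_eq: "psi c z x = x - c * (?n * ln x - path_entropy z)" if "x \<ge> l" for x
  proof -
    have "?n * ln x - path_entropy z \<ge> 0" using big[OF that] by (smt (verit) of_nat_0_le_iff)
    then show ?thesis by (simp add: psi_def)
  qed
  have "c * (2 * ?n) \<le> c * (?n * ln v - path_entropy z)" using big[OF vl] c by (rule mult_left_mono)
  also have "\<dots> \<le> v" using v(1) l0 psi_eq[OF vl] by simp
  finally have cn: "c * ?n \<le> v / 2" by simp
  have v0: "v > 0" "v' > 0" using vl l0 v by auto
  have "ln (v' / v) \<le> v' / v - 1" using v0 by (intro ln_le_minus_one) auto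
  then have "ln v' - ln v \<le> (v' - v) / v" using v0 by (simp add: ln_divide_pos diff_divide_distrib)
  then have "c * ?n * (ln v' - ln v) \<le> c * ?n * ((v' - v) / v)" using c by (intro mult_left_mono) auto
  also have "\<dots> \<le> v / 2 * ((v' - v) / v)" using cn v v0 by (intro mult_right_mono) auto
  also have "\<dots> = (v' - v) / 2" using v0 by simp
  finally have "c * ?n * (ln v' - ln v) \<le> (v' - v) / 2" .
  moreover have "psi c z v' - psi c z v = v' - v - c * ?n * (ln v' - ln v)"
    using psi_eq[OF vl] psi_eq[of v'] vl v(3) by (simp add: algebra_simps)
  moreover define X where "X = c * ?n * (ln v' - ln v)"
  ultimately have "psi c z v' - psi c z v \<ge> (v' - v) / 2" 
    unfolding X_def[symmetric] by (simp add: field_simps)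
  moreover have "psi c z v' - psi c z v \<le> w" using v by auto
  ultimately show ?thesis by simp
qed

lemma psi_le: "c \<ge> 0 \<Longrightarrow> psi c z v \<le> v"
  by (simp add: psi_def)

lemma psi_measurable [measurable]: "psi c z \<in> borel_measurable borel"
  unfolding psi_def by measurable

section \<open>Independent sites with Pareto tails\<close>

locale pareto_field = prob_space M for M :: "'a measure" +
  fixes \<alpha> :: real and \<xi> :: "int ^ 'd::finite \<Rightarrow> 'a \<Rightarrow> real"
  assumes \<alpha>: "\<alpha> > real CARD('d)"
    and indep: "indep_vars (\<lambda>_. borel) \<xi> UNIV"
    and tail: "\<And>z x. x \<ge> 1 \<Longrightarrow> prob {\<omega> \<in> space M. \<xi> z \<omega> < x} = 1 - x powr (- \<alpha>)"
begin

lemma \<xi>_measurable [measurable]: "\<xi> z \<in> borel_measurable M"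
  using indep by (simp add: indep_vars_def)

lemma \<alpha>_pos: "\<alpha> > 1"
  using \<alpha> by (metis One_nat_def Suc_leI dual_order.strict_trans2 less_le_not_le of_nat_1 of_nat_le_iff zero_less_card_finite)

lemma AE_ge_1: "AE \<omega> in M. \<forall>z. \<xi> z \<omega> \<ge> 1"
proof (subst AE_all_countable, rule allI)
  fix z
  have "prob {\<omega> \<in> space M. \<xi> z \<omega> < 1} = 0" using tail[of 1 z] by simp
  then have "emeasure M {\<omega> \<in> space M. \<xi> z \<omega> < 1} = 0" by (simp add: emeasure_eq_measure)
  then show "AE \<omega> in M. 1 \<le> \<xi> z \<omega>"
    by (subst AE_iff_measurable[where N = "{\<omega> \<in> space M. \<xi> z \<omega> < 1}"]) (auto simp: not_le)
qed

lemma prob_ge: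
  assumes "x \<ge> 1" shows "prob {\<omega> \<in> space M. \<xi> z \<omega> \<ge> x} = x powr (- \<alpha>)"
proof -
  have "{\<omega> \<in> space M. \<xi> z \<omega> \<ge> x} = space M - {\<omega> \<in> space M. \<xi> z \<omega> < x}" by auto
  then have "prob {\<omega> \<in> space M. \<xi> z \<omega> \<ge> x} = 1 - prob {\<omega> \<in> space M. \<xi> z \<omega> < x}"
    by (simp add: prob_compl)
  then show ?thesis using tail[OF assms] by simp
qed

text \<open>The set lies in a half-open interval that starts at its infimum. Such an interval has as
  its probability a difference of two values given by \<open>tail\<close>, which the mean value
  theorem bounds by the density at the left end. The length is doubled so that the right end point
  may be excluded.\<close>

lemma prob_window:
  assumes a: "a \<ge> 1" and w: "w > 0" and A: "A \<in> sets borel" "\<And>v. v \<in> A \<Longrightarrow> v \<ge> a"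
    "\<And>v v'. v \<in> A \<Longrightarrow> v' \<in> A \<Longrightarrow> v \<le> v' \<Longrightarrow> v' - v \<le> w"
  shows "prob {\<omega> \<in> space M. \<xi> z \<omega> \<in> A} \<le> 2 * \<alpha> * w * a powr (- \<alpha> - 1)"
proof (cases "A = {}")
  case True
  then show ?thesis using \<alpha>_pos w by simp
next
  case False
  define b where "b = Inf A"
  have bdd: "bdd_below A" using A(2) by (meson bdd_belowI)
  have b: "b \<ge> a" unfolding b_def using False A(2) by (intro cInf_greatest)
  have sub: "A \<subseteq> {b..<b + 2 * w}"
  proof
    fix v assume v: "v \<in> A"
    have "b \<le> v" unfolding b_def using v bdd by (rule cInf_lower)
    moreover have "v - w \<le> b" unfolding b_def
    proof (rule cInf_greatest[OF False])
      fix x assume "x \<in> A"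
      then show "v - w \<le> x" using A(3)[of x v] v w by (cases "x \<le> v") auto
    qed
    ultimately show "v \<in> {b..<b + 2 * w}" using w by auto
  qed
  have "prob {\<omega> \<in> space M. \<xi> z \<omega> \<in> A} \<le> prob {\<omega> \<in> space M. \<xi> z \<omega> \<in> {b..<b + 2 * w}}"
    using sub A(1) by (intro finite_measure_mono) auto
  also have "{\<omega> \<in> space M. \<xi> z \<omega> \<in> {b..<b + 2 * w}} = {\<omega> \<in> space M. \<xi> z \<omega> < b + 2 * w} - {\<omega> \<in> space M. \<xi> z \<omega> < b}"
    by auto
  also have "prob \<dots> = prob {\<omega> \<in> space M. \<xi> z \<omega> < b + 2 * w} - prob {\<omega> \<in> space M. \<xi> z \<omega> < b}"
    using w by (intro finite_measure_Diff) auto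
  also have "\<dots> = b powr (- \<alpha>) - (b + 2 * w) powr (- \<alpha>)"
    using a b w by (simp add: tail)
  also have "\<dots> \<le> 2 * w * (\<alpha> * b powr (- \<alpha> - 1))"
  proof -
    have "\<exists>x. b < x \<and> x < b + 2 * w \<and> (b + 2 * w) powr (- \<alpha>) - b powr (- \<alpha>) = (b + 2 * w - b) * (- \<alpha> * x powr (- \<alpha> - 1))"
      using a b w by (intro MVT2) (auto intro!: derivative_eq_intros)
    then obtain x where x: "b < x" "(b + 2 * w) powr (- \<alpha>) - b powr (- \<alpha>) = 2 * w * (- \<alpha> * x powr (- \<alpha> - 1))"
      by auto
    have "x powr (- \<alpha> - 1) \<le> b powr (- \<alpha> - 1)" using x a b \<alpha>_pos by (intro powr_mono2') auto
    then have "2 * w * (\<alpha> * x powr (- \<alpha> - 1)) \<le> 2 * w * (\<alpha> * b powr (- \<alpha> - 1))"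
      using w \<alpha>_pos by (intro mult_left_mono) auto
    then show ?thesis using x(2) by simp
  qed
  also have "\<dots> \<le> 2 * w * (\<alpha> * a powr (- \<alpha> - 1))"
    using w \<alpha>_pos a b by (intro mult_left_mono powr_mono2') auto
  finally show ?thesis by (simp add: mult_ac)
qed

lemma prob_psi_window:
  assumes "c \<ge> 0" "l \<ge> exp (real CARD('d) + 2)" "w > 0"
  shows "prob {\<omega> \<in> space M. psi c z (\<xi> z \<omega>) \<in> {l..l + w}} \<le> 4 * \<alpha> * w * l powr (- \<alpha> - 1)"
proof -
  let ?A = "psi c z -` {l..l + w}"
  have "l \<ge> 1" using assms(2) one_le_exp_iff[of "real CARD('d) + 2"] by linarith
  have "prob {\<omega> \<in> space M. \<xi> z \<omega> \<in> ?A} \<le> 2 * \<alpha> * (2 * w) * l powr (- \<alpha> - 1)"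
  proof (rule prob_window)
    show "?A \<in> sets borel" using measurable_sets[OF psi_measurable, of "{l..l + w}"] by simp
    show "v \<ge> l" if "v \<in> ?A" for v using that psi_le[OF assms(1), of z v] by auto
    show "v' - v \<le> 2 * w" if "v \<in> ?A" "v' \<in> ?A" "v \<le> v'" for v v'
      using psi_window[OF assms(1,2)] that by auto
  qed (use assms \<open>l \<ge> 1\<close> in auto)
  then show ?thesis by (simp add: mult_ac)
qed

lemma prob_Ball:
  assumes "finite J" "\<And>x. x \<in> J \<Longrightarrow> A x \<in> sets borel"
  shows "prob {\<omega> \<in> space M. \<forall>x\<in>J. \<xi> x \<omega> \<in> A x} = (\<Prod>x\<in>J. prob {\<omega> \<in> space M. \<xi> x \<omega> \<in> A x})"
proof (cases "J = {}")
  case True then show ?thesis by (simp add: prob_space)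
next
  case False
  have "{\<omega> \<in> space M. \<forall>x\<in>J. \<xi> x \<omega> \<in> A x} = (\<Inter>x\<in>J. \<xi> x -` A x \<inter> space M)" using False by auto
  also have "prob \<dots> = (\<Prod>x\<in>J. prob (\<xi> x -` A x \<inter> space M))"
    by (rule indep_varsD[OF indep False assms(1)]) (use assms in auto)
  also have "\<dots> = (\<Prod>x\<in>J. prob {\<omega> \<in> space M. \<xi> x \<omega> \<in> A x})"
    by (intro prod.cong refl arg_cong[where f = prob]) auto
  finally show ?thesis .
qed

text \<open>
  The window \<open>{a..a + w}\<close> is contained in one of the windows of length \<open>2 * w\<close> that start at the grid
  points \<open>l0 + i * w\<close>; so a union bound covers all real \<open>a\<close>.
\<close>

lemma psi_cluster:
  assumes B: "finite B" and c: "c \<ge> 0" and l: "l0 \<ge> exp (real CARD('d) + 2)" "l0 \<le> l1" and w: "w > 0"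
  shows "\<exists>G\<in>events. prob G \<le> (l1 / w + 1) * (card B * (8 * \<alpha> * w * l0 powr (- \<alpha> - 1))) ^ n \<and>
    (\<forall>\<omega>\<in>space M. \<forall>J a. J \<subseteq> B \<longrightarrow> card J = n \<longrightarrow> l0 \<le> a \<longrightarrow> a \<le> l1 \<longrightarrow>
       (\<forall>z\<in>J. psi c z (\<xi> z \<omega>) \<in> {a..a + w}) \<longrightarrow> \<omega> \<in> G)"
proof -
  define E where "E = (\<lambda>i J. {\<omega> \<in> space M. \<forall>z\<in>J. \<xi> z \<omega> \<in> psi c z -` {l0 + i * w..l0 + i * w + 2 * w}})"
  define \<pi> where "\<pi> = 8 * \<alpha> * w * l0 powr (- \<alpha> - 1)"
  define N where "N = nat \<lfloor>(l1 - l0) / w\<rfloor>"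
  define Js where "Js = {J. J \<subseteq> B \<and> card J = n}"
  define G where "G = (\<Union>i\<in>{..N}. \<Union>J\<in>Js. E i J)"
  have fJs: "finite Js" unfolding Js_def using B by auto
  have fJ: "finite J" if "J \<in> Js" for J using that B finite_subset by (auto simp: Js_def)
  have l00: "l0 > 0" using l(1) by (smt (verit) exp_gt_zero)
  have Aset: "psi c z -` {x..y} \<in> sets borel" for z x y
    using measurable_sets[OF psi_measurable, of "{x..y}"] by simp
  have E_meas: "E i J \<in> events" if "J \<in> Js" for i :: real and J
    unfolding E_def using fJ[OF that] Aset by measurable
  have \<pi>0: "\<pi> \<ge> 0" using \<alpha>_pos w by (simp add: \<pi>_def)
  have E_le: "prob (E i J) \<le> \<pi> ^ n" if "J \<in> Js" "i \<ge> 0" for i :: real and J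
  proof -
    have "prob (E i J) = (\<Prod>z\<in>J. prob {\<omega> \<in> space M. \<xi> z \<omega> \<in> psi c z -` {l0 + i * w..l0 + i * w + 2 * w}})"
      unfolding E_def by (rule prob_Ball) (use fJ[OF that(1)] Aset in auto)
    also have "\<dots> \<le> (\<Prod>z\<in>J. \<pi>)"
    proof (intro prod_mono conjI)
      fix z
      have il: "l0 + i * w \<ge> l0" using that w by simp
      have "prob {\<omega> \<in> space M. \<xi> z \<omega> \<in> psi c z -` {l0 + i * w..l0 + i * w + 2 * w}}
        \<le> 4 * \<alpha> * (2 * w) * (l0 + i * w) powr (- \<alpha> - 1)"
        using prob_psi_window[OF c, of "l0 + i * w" "2 * w" z] il l w by simp
      also have "\<dots> \<le> 4 * \<alpha> * (2 * w) * l0 powr (- \<alpha> - 1)"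
        using il l00 \<alpha>_pos w by (intro mult_left_mono powr_mono2') auto
      finally show "prob {\<omega> \<in> space M. \<xi> z \<omega> \<in> psi c z -` {l0 + i * w..l0 + i * w + 2 * w}} \<le> \<pi>"
        by (simp add: \<pi>_def)
    qed simp
    also have "\<dots> = \<pi> ^ n" using that by (simp add: Js_def)
    finally show ?thesis .
  qed
  have "card Js \<le> card B ^ n"
    unfolding Js_def n_subsets[OF B] by (cases "n \<le> card B") (auto simp: binomial_le_pow binomial_eq_0)
  then have cJs: "real (card Js) \<le> real (card B) ^ n" by (metis of_nat_le_iff of_nat_power)
  have "prob G \<le> (\<Sum>i\<in>{..N}. prob (\<Union>J\<in>Js. E i J))"
    unfolding G_def using E_meas fJs by (intro finite_measure_subadditive_finite) auto
  also have "\<dots> \<le> (\<Sum>i\<in>{..N}. \<Sum>J\<in>Js. prob (E i J))"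
    using E_meas fJs by (intro sum_mono finite_measure_subadditive_finite) auto
  also have "\<dots> \<le> (\<Sum>i\<in>{..N}. \<Sum>J\<in>Js. \<pi> ^ n)"
    using E_le by (intro sum_mono) auto
  also have "\<dots> = (real N + 1) * (real (card Js) * \<pi> ^ n)" by simp
  also have "\<dots> \<le> (l1 / w + 1) * (real (card B) ^ n * \<pi> ^ n)"
  proof (intro mult_mono mult_right_mono cJs)
    have "real N \<le> (l1 - l0) / w" using l w by (simp add: N_def of_nat_floor)
    also have "\<dots> \<le> l1 / w" using l00 w by (intro divide_right_mono) auto
    finally show "real N + 1 \<le> l1 / w + 1" by simp
  qed (use \<pi>0 l l00 w in auto)
  finally have 1: "prob G \<le> (l1 / w + 1) * (card B * \<pi>) ^ n" by (simp add: power_mult_distrib)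
  have 2: "\<omega> \<in> G" if \<omega>: "\<omega> \<in> space M" and J: "J \<subseteq> B" "card J = n" and a: "l0 \<le> a" "a \<le> l1"
      and cl: "\<forall>z\<in>J. psi c z (\<xi> z \<omega>) \<in> {a..a + w}" for \<omega> J a
  proof -
    define i where "i = nat \<lfloor>(a - l0) / w\<rfloor>"
    have "(a - l0) / w \<ge> 0" using a w by simp
    then have i: "real i \<le> (a - l0) / w" "(a - l0) / w < real i + 1"
      by (auto simp: i_def of_nat_floor)
    have "(a - l0) / w \<le> (l1 - l0) / w" using a w by (intro divide_right_mono) auto
    then have "i \<le> N" unfolding i_def N_def by (intro nat_mono floor_mono)
    moreover have "J \<in> Js" using J by (simp add: Js_def)
    moreover have "\<omega> \<in> E i J"
    proof -
      have "l0 + i * w \<le> a" "a \<le> l0 + i * w + w" using i w by (simp_all add: field_simps)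
      then show ?thesis using cl \<omega> by (fastforce simp: E_def)
    qed
    ultimately show ?thesis unfolding G_def by blast
  qed
  have "G \<in> events" unfolding G_def using E_meas fJs by auto
  with 1 2 show ?thesis unfolding \<pi>_def by blast
qed

text \<open>Borel-Cantelli with a geometric series. Only the exceptional sets have to be events;
  \<open>P\<close> is arbitrary, which matters for conditions that quantify over a continuum of
  times and levels.\<close>

lemma AE_eventually_dyadic:
  assumes x: "x > 0"
    and ev: "\<forall>\<^sub>F T in at_top. \<exists>G\<in>events. prob G \<le> T powr (- x) \<and> (\<forall>\<omega>\<in>space M. \<omega> \<notin> G \<longrightarrow> P T \<omega>)"
  shows "AE \<omega> in M. \<forall>\<^sub>F k in sequentially. P (2 ^ k :: real) \<omega>"
proof -
  obtain T0 where T0: "\<And>T. T \<ge> T0 \<Longrightarrow> \<exists>G\<in>events. prob G \<le> T powr (- x) \<and> (\<forall>\<omega>\<in>space M. \<omega> \<notin> G \<longrightarrow> P T \<omega>)"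
    using ev by (auto simp: eventually_at_top_linorder)
  obtain k0 where k0: "(2::real) ^ k0 \<ge> T0" using real_arch_pow[of 2 T0] by (auto intro: less_imp_le)
  have ge: "(2::real) ^ (k + k0) \<ge> T0" for k
  proof -
    have "(2::real) ^ k0 \<le> 2 ^ (k + k0)" by (intro power_increasing) auto
    then show ?thesis using k0 by linarith
  qed
  obtain G where G: "\<And>k. G k \<in> events" "\<And>k. prob (G k) \<le> (2 ^ (k + k0)) powr (- x)"
    "\<And>k \<omega>. \<omega> \<in> space M \<Longrightarrow> \<omega> \<notin> G k \<Longrightarrow> P (2 ^ (k + k0)) \<omega>"
    using T0[OF ge] by metis
  have "summable (\<lambda>k. prob (G k))"
  proof (rule summable_comparison_test[of _ "\<lambda>k. (2 powr (- x)) ^ k"])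
    show "summable (\<lambda>k. (2 powr (- x)) ^ k)" using x by (intro summable_geometric) (simp add: powr_less_one)
    have "(2 ^ (k + k0)) powr (- x) \<le> (2 powr (- x)) ^ k" for k
    proof -
      have "((2::real) ^ (k + k0)) powr (- x) \<le> (2 ^ k) powr (- x)" using x by (intro powr_mono2') auto
      also have "\<dots> = (2 powr (- x)) ^ k"
        by (simp add: powr_powr mult.commute flip: powr_realpow)
      finally show ?thesis .
    qed
    then show "\<exists>N. \<forall>n\<ge>N. norm (prob (G n)) \<le> (2 powr (- x)) ^ n" using G(2) by (auto intro: order_trans)
  qed
  then have "AE \<omega> in M. eventually (\<lambda>k. \<omega> \<in> space M - G k) sequentially"
    using G(1) by (intro borel_cantelli_AE1) (auto simp: emeasure_eq_measure)
  then show ?thesis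
  proof eventually_elim
    case (elim \<omega>)
    then have "eventually (\<lambda>k. P (2 ^ (k + k0)) \<omega>) sequentially"
      by eventually_elim (use G(3) in auto)
    then show ?case by (rule eventually_sequentially_seg[THEN iffD1])
  qed
qed

lemma AE_eventually_block:
  assumes x: "x > 0"
    and ev: "\<forall>\<^sub>F T in at_top. \<exists>G\<in>events. prob G \<le> T powr (- x) \<and>
      (\<forall>\<omega>\<in>space M. \<omega> \<notin> G \<longrightarrow> (\<forall>t\<in>{T..2 * T}. P t \<omega>))"
  shows "AE \<omega> in M. \<forall>\<^sub>F t in at_top. P (t::real) \<omega>"
proof -
  have "AE \<omega> in M. \<forall>\<^sub>F k in sequentially. \<forall>t\<in>{2 ^ k..2 * 2 ^ k}. P t \<omega>"
    by (rule AE_eventually_dyadic[OF x ev])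
  then show ?thesis
  proof eventually_elim
    case (elim \<omega>)
    then obtain K where K: "\<And>k t. k \<ge> K \<Longrightarrow> t \<in> {2 ^ k..2 * 2 ^ k} \<Longrightarrow> P t \<omega>"
      unfolding eventually_sequentially by blast
    have "P t \<omega>" if t: "t \<ge> 2 ^ K" for t
    proof -
      define k where "k = nat \<lfloor>log 2 t\<rfloor>"
      have t0: "t > 0" using t by (smt (verit) zero_less_power)
      have lK: "log 2 t \<ge> K" using t t0 by (simp add: le_log_iff powr_realpow)
      then have k: "real k \<le> log 2 t" "log 2 t < real k + 1" unfolding k_def by linarith+
      have "K \<le> k" using lK unfolding k_def by (simp add: le_nat_iff le_floor_iff)
      moreover have "2 ^ k \<le> t" using k(1) t0 by (simp add: le_log_iff powr_realpow)
      moreover have "t \<le> 2 * 2 ^ k" using k(2) t0 by (simp add: log_less_iff powr_add powr_realpow)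
      ultimately show ?thesis using K by auto
    qed
    then show ?case by (auto simp: eventually_at_top_linorder)
  qed
qed

end

section \<open>Typical behaviour on polynomial scales\<close>

lemma eventually_powr_le:
  assumes "a < (b::real)" "c \<ge> 0"
  shows "\<forall>\<^sub>F T in at_top. c * T powr a \<le> T powr b"
proof (cases "c = 0")
  case False
  with assms have "c > 0" by simp
  with assms show ?thesis by real_asymp
qed simp

text \<open>
  Exponents of powers of \<open>t\<close>: typically \<open>\<bar>Z1\<bar>\<close> is of order \<open>p\<close> and \<open>\<xi> Z1\<close> of order \<open>q\<close>; sites
  outside the ball of exponent \<open>p + \<epsilon>\<close> are too far away, a site is high above exponent \<open>q - \<delta>\<close>, there are
  at most \<open>t powr \<kappa>\<close> high sites and their values differ by \<open>t powr \<sigma>\<close>, \<open>\<Psi>\<^sub>t\<close> has its maximum above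
  exponent \<open>q - \<epsilon>\<close>, and \<open>q - \<epsilon>'\<close> is the exponent of the gap of \<open>\<Psi>\<^sub>t\<close>. The potential grows at most
  like \<open>\<bar>z\<bar> powr \<gamma>\<close>, and the exponent \<open>p - \<epsilon> - \<theta>\<close> is that of the smaller ball in which a large value
  of \<open>\<Psi>\<^sub>t\<close> is found.
\<close>

locale pam_params = pareto_field M \<alpha> \<xi>
  for M :: "'a measure" and \<alpha> and \<xi> :: "int ^ 'd::finite \<Rightarrow> 'a \<Rightarrow> real" +
  fixes d p q \<epsilon> \<epsilon>' \<delta> \<gamma> \<kappa> \<sigma> \<theta> :: real
  assumes d_eq: "d = real CARD('d)"
    and pq: "p = q + 1" "0 < q" "q * \<alpha> = p * d"
    and ex: "0 < \<epsilon>" "0 < \<epsilon>'" "\<epsilon> + \<epsilon>' < \<delta>" "3 * \<delta> + \<epsilon> < q" "0 < \<sigma>" "0 < \<kappa>" "\<kappa> < p - \<epsilon>'"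
    and \<gamma>: "0 < \<gamma>" "\<gamma> < 1" "(p + \<epsilon>) * (1 - \<gamma>) > 1" "(p + \<epsilon>) * \<gamma> < q + \<epsilon>" "\<gamma> * \<alpha> > d"
    and ex_card: "\<epsilon> * d + \<delta> * \<alpha> < \<kappa>"
    and ex_gap: "\<epsilon> * (1 + 2 * d) + 2 * \<delta> * (\<alpha> + 1) + \<sigma> < q"
    and ex_cluster: "\<epsilon> * (3 * d + 3 * \<alpha> + 6) < \<epsilon>'"
    and ex_max: "0 < \<theta>" "\<theta> * d < \<epsilon> * (\<alpha> - d)" "\<epsilon> + \<theta> < p"
begin

lemma d_ge_1: "d \<ge> 1" by (simp add: d_eq Suc_leI)

lemma \<alpha>_gt_d: "\<alpha> > d" using \<alpha> by (simp add: d_eq)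

abbreviation Bl :: "real \<Rightarrow> (int ^ 'd) set" where
  "Bl t \<equiv> ballz (t powr (p + \<epsilon>))"

lemma Bl_mono: "0 \<le> s \<Longrightarrow> s \<le> t \<Longrightarrow> Bl s \<subseteq> Bl t"
  using pq ex by (intro ballz_mono powr_mono2) auto

lemma card_Bl:
  assumes "T \<ge> 1"
  shows "real (card (Bl (2 * T))) \<le> (3 * 2 powr (p + \<epsilon>)) powr d * T powr ((p + \<epsilon>) * d)"
proof -
  have "1 \<le> (2 * T) powr (p + \<epsilon>)" using assms pq ex by (intro ge_one_powr_ge_zero) auto
  then have "real (card (Bl (2 * T))) \<le> (3 * (2 * T) powr (p + \<epsilon>)) ^ CARD('d)"
    by (rule card_ballz_le)
  also have "\<dots> = (3 * (2 * T) powr (p + \<epsilon>)) powr d"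
    using assms by (subst powr_realpow[symmetric]) (auto simp: d_eq)
  also have "\<dots> = (3 * 2 powr (p + \<epsilon>)) powr d * T powr ((p + \<epsilon>) * d)"
    using assms by (simp add: powr_mult powr_powr)
  finally show ?thesis .
qed

text \<open>\<open>psi_cluster\<close> on polynomial scales: about \<open>T powr (a1 - a2)\<close>
  windows and, for each of the n sites, \<open>T powr ((p + \<epsilon>) * d)\<close> positions and a
  window probability of order \<open>T powr (a2 - a0 * (\<alpha> + 1))\<close>. The slope c is
  quantified after T, so that one threshold serves all times of a grid.\<close>

lemma cluster_ev:
  assumes a: "0 < a0" "a0 < a1" "a2 < a1" and c: "0 < c0" "c0 \<le> 1" "0 < cw"
    and x: "(a1 - a2) + n * ((p + \<epsilon>) * d + a2 - a0 * (\<alpha> + 1)) < - x"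
  shows "\<forall>\<^sub>F T in at_top. \<forall>c\<ge>0. \<exists>G\<in>events. prob G \<le> T powr (- x) \<and>
    (\<forall>\<omega>\<in>space M. \<forall>J b. J \<subseteq> Bl (2 * T) \<longrightarrow> card J = n \<longrightarrow> c0 * T powr a0 \<le> b \<longrightarrow> b \<le> T powr a1 \<longrightarrow>
       (\<forall>z\<in>J. psi c z (\<xi> z \<omega>) \<in> {b..b + cw * T powr a2}) \<longrightarrow> \<omega> \<in> G)"
proof -
  define cB where "cB = (3 * 2 powr (p + \<epsilon>)) powr d"
  define C where "C = (1 / cw + 1) * (cB * (8 * \<alpha> * cw * c0 powr (- \<alpha> - 1))) ^ n"
  have "C \<ge> 0" using c \<alpha>_pos by (simp add: C_def cB_def)
  with x have "\<forall>\<^sub>F T in at_top. C * T powr ((a1 - a2) + n * ((p + \<epsilon>) * d + a2 - a0 * (\<alpha> + 1))) \<le> T powr (- x)"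
    by (intro eventually_powr_le)
  moreover have "\<forall>\<^sub>F T in at_top. c0 * T powr a0 \<ge> exp (real CARD('d) + 2)"
    using a c by real_asymp
  moreover have "\<forall>\<^sub>F T in at_top. (T::real) \<ge> 1" by (rule eventually_ge_at_top)
  ultimately show ?thesis
  proof eventually_elim
    case (elim T)
    show ?case
    proof (intro allI impI)
      fix c' :: real assume c': "c' \<ge> 0"
      define w where "w = cw * T powr a2"
      define \<pi> where "\<pi> = 8 * \<alpha> * w * (c0 * T powr a0) powr (- \<alpha> - 1)"
      have w: "w > 0" using c elim by (simp add: w_def)
      have "c0 * T powr a0 \<le> 1 * T powr a1" using elim a c by (intro mult_mono powr_mono) auto
      then have le: "c0 * T powr a0 \<le> T powr a1" by simp
      from psi_cluster[OF finite_ballz c' elim(2) le w, of "(2 * T) powr (p + \<epsilon>)" n]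
      obtain G where G: "G \<in> events" "prob G \<le> (T powr a1 / w + 1) * (card (Bl (2 * T)) * \<pi>) ^ n"
        "\<And>\<omega> J b. \<omega> \<in> space M \<Longrightarrow> J \<subseteq> Bl (2 * T) \<Longrightarrow> card J = n \<Longrightarrow> c0 * T powr a0 \<le> b \<Longrightarrow> b \<le> T powr a1 \<Longrightarrow>
          \<forall>z\<in>J. psi c' z (\<xi> z \<omega>) \<in> {b..b + w} \<Longrightarrow> \<omega> \<in> G"
        unfolding \<pi>_def by blast
      have "T powr a1 / w + 1 \<le> 1 / cw * T powr (a1 - a2) + T powr (a1 - a2)"
        using elim a c by (intro add_mono) (auto simp: w_def powr_diff ge_one_powr_ge_zero field_simps intro!: powr_mono)
      then have 1: "T powr a1 / w + 1 \<le> (1 / cw + 1) * T powr (a1 - a2)" by (simp add: algebra_simps)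
      have "card (Bl (2 * T)) * \<pi> \<le> cB * T powr ((p + \<epsilon>) * d) * \<pi>"
        unfolding cB_def using card_Bl[OF elim(3)] \<alpha>_pos w by (intro mult_right_mono) (auto simp: \<pi>_def)
      also have "\<dots> = (cB * (8 * \<alpha> * cw * c0 powr (- \<alpha> - 1))) * T powr ((p + \<epsilon>) * d + a2 - a0 * (\<alpha> + 1))"
        using elim c by (simp add: \<pi>_def w_def powr_mult powr_powr powr_add powr_diff algebra_simps powr_minus divide_simps)
      finally have "(card (Bl (2 * T)) * \<pi>) ^ n \<le> ((cB * (8 * \<alpha> * cw * c0 powr (- \<alpha> - 1))) * T powr ((p + \<epsilon>) * d + a2 - a0 * (\<alpha> + 1))) ^ n"
        using \<alpha>_pos w by (intro power_mono) (auto simp: \<pi>_def)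
      also have "\<dots> = (cB * (8 * \<alpha> * cw * c0 powr (- \<alpha> - 1))) ^ n * T powr (n * ((p + \<epsilon>) * d + a2 - a0 * (\<alpha> + 1)))"
        using elim by (simp add: power_mult_distrib powr_powr mult.commute flip: powr_realpow)
      finally have 2: "(card (Bl (2 * T)) * \<pi>) ^ n \<le> \<dots>" .
      have "prob G \<le> ((1 / cw + 1) * T powr (a1 - a2)) * ((cB * (8 * \<alpha> * cw * c0 powr (- \<alpha> - 1))) ^ n * T powr (n * ((p + \<epsilon>) * d + a2 - a0 * (\<alpha> + 1))))"
        using c elim w \<alpha>_pos by (intro order_trans[OF G(2)] mult_mono[OF 1 2]) (auto simp: \<pi>_def)
      also have "\<dots> = C * T powr ((a1 - a2) + n * ((p + \<epsilon>) * d + a2 - a0 * (\<alpha> + 1)))"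
        by (simp add: C_def powr_add mult_ac)
      also have "\<dots> \<le> T powr (- x)" by (rule elim)
      finally show "\<exists>G\<in>events. prob G \<le> T powr (- x) \<and>
        (\<forall>\<omega>\<in>space M. \<forall>J b. J \<subseteq> Bl (2 * T) \<longrightarrow> card J = n \<longrightarrow> c0 * T powr a0 \<le> b \<longrightarrow> b \<le> T powr a1 \<longrightarrow>
       (\<forall>z\<in>J. psi c' z (\<xi> z \<omega>) \<in> {b..b + cw * T powr a2}) \<longrightarrow> \<omega> \<in> G)"
        using G(1,3) unfolding w_def by blast
    qed
  qed
qed

section \<open>Exceptional events on a block of times\<close>

lemma prob_exceed:
  assumes "finite B" "h \<ge> 1"
  shows "prob {\<omega> \<in> space M. \<exists>z\<in>B. \<xi> z \<omega> \<ge> h} \<le> card B * h powr (- \<alpha>)"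
proof -
  have "{\<omega> \<in> space M. \<exists>z\<in>B. \<xi> z \<omega> \<ge> h} = (\<Union>z\<in>B. {\<omega> \<in> space M. \<xi> z \<omega> \<ge> h})" by auto
  then have "prob {\<omega> \<in> space M. \<exists>z\<in>B. \<xi> z \<omega> \<ge> h} \<le> (\<Sum>z\<in>B. prob {\<omega> \<in> space M. \<xi> z \<omega> \<ge> h})"
    using assms by (simp only:) (intro finite_measure_subadditive_finite, auto)
  then show ?thesis using assms by (simp add: prob_ge)
qed

text \<open>By \<open>q * \<alpha> = p * d\<close> the union bound over the ball has the exponent
  \<open>- \<epsilon> * (\<alpha> - d)\<close>. Half of it is given away to absorb the constant, as
  in the later estimates of this kind.\<close>

lemma max_ev:
  "\<forall>\<^sub>F T in at_top. \<exists>G\<in>events. prob G \<le> T powr (- (\<epsilon> * (\<alpha> - d) / 2)) \<and>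
    (\<forall>\<omega>\<in>space M. \<omega> \<notin> G \<longrightarrow> (\<forall>z\<in>Bl (2 * T). \<xi> z \<omega> \<le> T powr (q + \<epsilon>)))"
proof -
  define cB where "cB = (3 * 2 powr (p + \<epsilon>)) powr d"
  have "(p + \<epsilon>) * d - (q + \<epsilon>) * \<alpha> = - (\<epsilon> * (\<alpha> - d))" using pq by (simp add: algebra_simps)
  also have "\<dots> < - (\<epsilon> * (\<alpha> - d) / 2)" using ex \<alpha>_gt_d by simp
  finally have "\<forall>\<^sub>F T in at_top. cB * T powr ((p + \<epsilon>) * d - (q + \<epsilon>) * \<alpha>) \<le> T powr (- (\<epsilon> * (\<alpha> - d) / 2))"
    by (rule eventually_powr_le) (simp add: cB_def)
  then show ?thesis using eventually_ge_at_top[of 1]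
  proof eventually_elim
    case (elim T)
    let ?G = "{\<omega> \<in> space M. \<exists>z\<in>Bl (2 * T). \<xi> z \<omega> \<ge> T powr (q + \<epsilon>)}"
    have "prob ?G \<le> card (Bl (2 * T)) * (T powr (q + \<epsilon>)) powr (- \<alpha>)"
      using elim pq ex by (intro prob_exceed finite_ballz ge_one_powr_ge_zero) auto
    also have "\<dots> \<le> (cB * T powr ((p + \<epsilon>) * d)) * (T powr (q + \<epsilon>)) powr (- \<alpha>)"
      unfolding cB_def by (intro mult_right_mono card_Bl elim) auto
    also have "\<dots> = cB * T powr ((p + \<epsilon>) * d - (q + \<epsilon>) * \<alpha>)"
      by (simp add: powr_powr powr_diff powr_minus divide_simps)
    also have "\<dots> \<le> T powr (- (\<epsilon> * (\<alpha> - d) / 2))" by (rule elim)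
    finally have "prob ?G \<le> \<dots>" .
    moreover have "?G \<in> events" using finite_ballz by measurable
    ultimately show ?case by (intro bexI[of _ ?G]) (auto simp: not_le intro: less_imp_le)
  qed
qed

text \<open>The mean number of sites in the larger ball above the lower level has exponent
  \<open>\<epsilon> * d + \<delta> * \<alpha>\<close>, and Markov's inequality applies. Ball and
  level are monotone in t, so that one event serves the whole block.\<close>

lemma card_ev:
  "\<forall>\<^sub>F T in at_top. \<exists>G\<in>events. prob G \<le> T powr (- ((\<kappa> - (\<epsilon> * d + \<delta> * \<alpha>)) / 2)) \<and>
    (\<forall>\<omega>\<in>space M. \<omega> \<notin> G \<longrightarrow> (\<forall>t\<in>{T..2 * T}. card {x\<in>Bl t. \<xi> x \<omega> > t powr (q - \<delta>)} \<le> t powr \<kappa>))"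
proof -
  define cB where "cB = (3 * 2 powr (p + \<epsilon>)) powr d"
  have "(p + \<epsilon>) * d - (q - \<delta>) * \<alpha> - \<kappa> = - (\<kappa> - (\<epsilon> * d + \<delta> * \<alpha>))" using pq by (simp add: algebra_simps)
  also have "\<dots> < - ((\<kappa> - (\<epsilon> * d + \<delta> * \<alpha>)) / 2)" using ex_card by (simp add: field_simps)
  finally have "\<forall>\<^sub>F T in at_top. cB * T powr ((p + \<epsilon>) * d - (q - \<delta>) * \<alpha> - \<kappa>) \<le> T powr (- ((\<kappa> - (\<epsilon> * d + \<delta> * \<alpha>)) / 2))"
    by (rule eventually_powr_le) (simp add: cB_def)
  then show ?thesis using eventually_ge_at_top[of 1]
  proof eventually_elim
    case (elim T)
    let ?h = "T powr (q - \<delta>)" and ?B = "Bl (2 * T)"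
    have h1: "?h \<ge> 1" using elim ex by (intro ge_one_powr_ge_zero) auto
    define N where "N = (\<lambda>\<omega>. \<Sum>x\<in>?B. indicator {\<omega>' \<in> space M. \<xi> x \<omega>' \<ge> ?h} \<omega> :: real)"
    have N_int: "integrable M N" unfolding N_def
      by (intro Bochner_Integration.integrable_sum integrable_real_indicator) (auto simp: emeasure_eq_measure)
    have EN: "(\<integral>\<omega>. N \<omega> \<partial>M) = card ?B * ?h powr (- \<alpha>)"
      unfolding N_def using h1 by (subst Bochner_Integration.integral_sum) (auto simp: prob_ge emeasure_eq_measure)
    let ?G = "{\<omega> \<in> space M. N \<omega> \<ge> T powr \<kappa>}"
    have "prob ?G \<le> (\<integral>\<omega>. N \<omega> \<partial>M) / T powr \<kappa>"
      using elim by (intro integral_Markov_inequality_measure[where A = "space M"] N_int) (auto simp: N_def sum_nonneg)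
    also have "\<dots> = card ?B * (?h powr (- \<alpha>) / T powr \<kappa>)" unfolding EN by simp
    also have "\<dots> \<le> (cB * T powr ((p + \<epsilon>) * d)) * (?h powr (- \<alpha>) / T powr \<kappa>)"
      unfolding cB_def by (intro mult_right_mono card_Bl elim) auto
    also have "\<dots> = cB * T powr ((p + \<epsilon>) * d - (q - \<delta>) * \<alpha> - \<kappa>)"
    proof -
      have "?h powr (- \<alpha>) / T powr \<kappa> = T powr ((q - \<delta>) * (- \<alpha>) - \<kappa>)"
        by (simp only: powr_powr powr_diff[of T "(q - \<delta>) * (- \<alpha>)" \<kappa>])
      then show ?thesis by (simp add: mult.assoc flip: powr_add) (simp add: algebra_simps)
    qed
    also note elim(1)
    finally have "prob ?G \<le> T powr (- ((\<kappa> - (\<epsilon> * d + \<delta> * \<alpha>)) / 2))" .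
    moreover have "card {x\<in>Bl t. \<xi> x \<omega> > t powr (q - \<delta>)} \<le> t powr \<kappa>"
      if \<omega>: "\<omega> \<in> space M" "\<omega> \<notin> ?G" and t: "t \<in> {T..2 * T}" for \<omega> t
    proof -
      have "?h \<le> t powr (q - \<delta>)" using t elim ex by (intro powr_mono2) auto
      moreover have "Bl t \<subseteq> ?B" using t elim by (intro Bl_mono) auto
      ultimately have "card {x\<in>Bl t. \<xi> x \<omega> > t powr (q - \<delta>)} \<le> card {x\<in>?B. \<xi> x \<omega> \<ge> ?h}"
        by (intro card_mono) (auto simp: finite_ballz)
      also have "real (card {x\<in>?B. \<xi> x \<omega> \<ge> ?h}) = N \<omega>"
      proof -
        have "N \<omega> = (\<Sum>x\<in>?B. if \<xi> x \<omega> \<ge> ?h then 1 else 0)"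
          unfolding N_def using \<omega> by (intro sum.cong) (auto simp: indicator_def)
        also have "\<dots> = card {x\<in>?B. \<xi> x \<omega> \<ge> ?h}"
          by (subst sum.inter_filter[symmetric]) (auto simp: finite_ballz)
        finally show ?thesis by simp
      qed
      finally have "real (card {x\<in>Bl t. \<xi> x \<omega> > t powr (q - \<delta>)}) \<le> N \<omega>" by simp
      also have "\<dots> \<le> T powr \<kappa>" using \<omega> by auto
      also have "\<dots> \<le> t powr \<kappa>" using t elim ex by (intro powr_mono2) auto
      finally show ?thesis .
    qed
    moreover have "?G \<in> events"
    proof -
      have [measurable]: "N \<in> borel_measurable M" using N_int by auto
      show ?thesis by measurable
    qed
    ultimately show ?case by blast
  qed
qed

text \<open>The cluster estimate for pairs with c = 0, where \<open>psi\<close> is the potential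
  itself; its exponent is negative by \<open>ex_gap\<close>. The upper level comes from
  \<open>max_ev\<close>, and the lower level is halved because the smaller value of a pair may be
  slightly below the high level.\<close>

lemma gap_ev:
  "\<exists>x>0. \<forall>\<^sub>F T in at_top. \<exists>G\<in>events. prob G \<le> T powr (- x) \<and>
    (\<forall>\<omega>\<in>space M. \<omega> \<notin> G \<longrightarrow> (\<forall>t\<in>{T..2 * T}. \<forall>x\<in>Bl t. \<forall>y\<in>Bl t.
        \<xi> x \<omega> > t powr (q - \<delta>) \<longrightarrow> x \<noteq> y \<longrightarrow> \<xi> y \<omega> \<le> \<xi> x \<omega> \<longrightarrow> \<xi> y \<omega> + t powr \<sigma> \<le> \<xi> x \<omega>))"
proof -
  define x1 where "x1 = \<epsilon> * (\<alpha> - d) / 2"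
  define x2 where "x2 = (q - (\<epsilon> * (1 + 2 * d) + 2 * \<delta> * (\<alpha> + 1) + \<sigma>)) / 2"
  define x where "x = min x1 x2 / 2"
  have x12: "x1 > 0" "x2 > 0" using ex \<alpha>_gt_d ex_gap by (auto simp: x1_def x2_def)
  have \<sigma>q: "\<sigma> < q - \<delta>"
  proof -
    have "\<delta> * 1 \<le> \<delta> * (2 * (\<alpha> + 1))" using ex \<alpha>_pos by (intro mult_left_mono) auto
    moreover have "\<epsilon> * (1 + 2 * d) \<ge> 0" using ex d_ge_1 by simp
    ultimately show ?thesis using ex_gap by (simp add: mult_ac)
  qed
  have "(q + \<epsilon> - \<sigma>) + real 2 * ((p + \<epsilon>) * d + \<sigma> - (q - \<delta>) * (\<alpha> + 1)) = - (2 * x2)"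
  proof -
    have "2 * x2 = q - (\<epsilon> * (1 + 2 * d) + 2 * \<delta> * (\<alpha> + 1) + \<sigma>)" by (simp add: x2_def)
    then show ?thesis using pq(3) by (simp add: algebra_simps)
  qed
  also have "\<dots> < - x2" using x12 by simp
  finally have ex1: "(q + \<epsilon> - \<sigma>) + real 2 * ((p + \<epsilon>) * d + \<sigma> - (q - \<delta>) * (\<alpha> + 1)) < - x2" .
  have cl: "\<forall>\<^sub>F T in at_top. \<forall>c\<ge>0. \<exists>G\<in>events. prob G \<le> T powr (- x2) \<and>
    (\<forall>\<omega>\<in>space M. \<forall>J b. J \<subseteq> Bl (2 * T) \<longrightarrow> card J = 2 \<longrightarrow> 1 / 2 * T powr (q - \<delta>) \<le> b \<longrightarrow> b \<le> T powr (q + \<epsilon>) \<longrightarrow>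
       (\<forall>z\<in>J. psi c z (\<xi> z \<omega>) \<in> {b..b + 2 powr \<sigma> * T powr \<sigma>}) \<longrightarrow> \<omega> \<in> G)"
    by (rule cluster_ev[OF _ _ _ _ _ _ ex1]) (use ex \<sigma>q in auto)
  have "\<forall>\<^sub>F T in at_top. T powr (- x1) + T powr (- x2) \<le> T powr (- x)"
  proof -
    have "- x1 < - x" "- x2 < - x" using x12 by (auto simp: x_def min_def)
    then have "\<forall>\<^sub>F T in at_top. 2 * T powr (- x1) \<le> T powr (- x)" "\<forall>\<^sub>F T in at_top. 2 * T powr (- x2) \<le> T powr (- x)"
      by (intro eventually_powr_le; simp)+
    then show ?thesis by eventually_elim linarith
  qed
  moreover have "\<forall>\<^sub>F T in at_top. 2 powr \<sigma> * T powr \<sigma> \<le> 1 / 2 * T powr (q - \<delta>)"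
  proof -
    from eventually_powr_le[OF \<sigma>q, of "2 * 2 powr \<sigma>"]
    have "\<forall>\<^sub>F T in at_top. 2 * 2 powr \<sigma> * T powr \<sigma> \<le> T powr (q - \<delta>)" by simp
    then show ?thesis by eventually_elim simp
  qed
  ultimately have "\<forall>\<^sub>F T in at_top. \<exists>G\<in>events. prob G \<le> T powr (- x) \<and>
    (\<forall>\<omega>\<in>space M. \<omega> \<notin> G \<longrightarrow> (\<forall>t\<in>{T..2 * T}. \<forall>x\<in>Bl t. \<forall>y\<in>Bl t.
        \<xi> x \<omega> > t powr (q - \<delta>) \<longrightarrow> x \<noteq> y \<longrightarrow> \<xi> y \<omega> \<le> \<xi> x \<omega> \<longrightarrow> \<xi> y \<omega> + t powr \<sigma> \<le> \<xi> x \<omega>))"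
    using max_ev[folded x1_def] cl eventually_ge_at_top[of 1]
  proof eventually_elim
    case (elim T)
    obtain G1 where G1: "G1 \<in> events" "prob G1 \<le> T powr (- x1)"
      "\<And>\<omega> z. \<omega> \<in> space M \<Longrightarrow> \<omega> \<notin> G1 \<Longrightarrow> z \<in> Bl (2 * T) \<Longrightarrow> \<xi> z \<omega> \<le> T powr (q + \<epsilon>)"
      using elim(3) by blast
    from elim(4)[rule_format, of 0]
    obtain G2 where G2: "G2 \<in> events" "prob G2 \<le> T powr (- x2)"
      "\<And>\<omega> J b. \<omega> \<in> space M \<Longrightarrow> J \<subseteq> Bl (2 * T) \<Longrightarrow> card J = 2 \<Longrightarrow> 1 / 2 * T powr (q - \<delta>) \<le> b \<Longrightarrow> b \<le> T powr (q + \<epsilon>) \<Longrightarrow>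
       \<forall>z\<in>J. psi 0 z (\<xi> z \<omega>) \<in> {b..b + 2 powr \<sigma> * T powr \<sigma>} \<Longrightarrow> \<omega> \<in> G2" by auto
    have "prob (G1 \<union> G2) \<le> T powr (- x)"
      using measure_Un_le[OF G1(1) G2(1)] G1(2) G2(2) elim(1) by linarith
    moreover have "\<xi> y \<omega> + t powr \<sigma> \<le> \<xi> x \<omega>"
      if \<omega>: "\<omega> \<in> space M" "\<omega> \<notin> G1 \<union> G2" and t: "t \<in> {T..2 * T}" and xy: "x \<in> Bl t" "y \<in> Bl t"
        "\<xi> x \<omega> > t powr (q - \<delta>)" "x \<noteq> y" "\<xi> y \<omega> \<le> \<xi> x \<omega>" for \<omega> t x y
    proof (rule ccontr)
      assume *: "\<not> \<xi> y \<omega> + t powr \<sigma> \<le> \<xi> x \<omega>"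
      have sub: "Bl t \<subseteq> Bl (2 * T)" using t elim by (intro Bl_mono) auto
      have "t powr \<sigma> \<le> (2 * T) powr \<sigma>" using t elim ex by (intro powr_mono2) auto
      also have "\<dots> = 2 powr \<sigma> * T powr \<sigma>" using elim by (simp add: powr_mult)
      finally have ts: "t powr \<sigma> \<le> 2 powr \<sigma> * T powr \<sigma>" .
      have "T powr (q - \<delta>) \<le> t powr (q - \<delta>)" using t elim ex by (intro powr_mono2) auto
      then have "1 / 2 * T powr (q - \<delta>) \<le> \<xi> y \<omega>" using * ts xy(3) elim(2) by linarith
      then have "\<omega> \<in> G2" using \<omega> xy sub G1(3)[of \<omega> y] * ts
        by (intro G2(3)[of \<omega> "{x, y}" "\<xi> y \<omega>"]) (auto simp: psi_def)
      then show False using \<omega> by simp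
    qed
    ultimately show ?case using G1(1) G2(1) by (intro bexI[of _ "G1 \<union> G2"]) auto
  qed
  moreover have "x > 0" using x12 by (simp add: x_def)
  ultimately show ?thesis by blast
qed

text \<open>At a single time the exponent for two sites is
  \<open>\<epsilon> * (2 * d + 2 * \<alpha> + 3) - \<epsilon>'\<close>, which is negative since
  \<epsilon>' exceeds a large multiple of \<epsilon>. Nothing remains for a union over
  times.\<close>

lemma pair_ev:
  "\<exists>x>0. \<forall>\<^sub>F t in at_top. \<exists>G\<in>events. prob G \<le> t powr (- x) \<and>
    (\<forall>\<omega>\<in>space M. \<omega> \<notin> G \<longrightarrow> (\<forall>J A. J \<subseteq> Bl t \<longrightarrow> card J = 2 \<longrightarrow> t powr (q - \<epsilon>) \<le> A \<longrightarrow>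
        \<not> (\<forall>z\<in>J. psi (1 / t) z (\<xi> z \<omega>) \<in> {A - t powr (q - \<epsilon>')..A})))"
proof -
  define x1 where "x1 = \<epsilon> * (\<alpha> - d) / 2"
  define x2 where "x2 = (\<epsilon>' - \<epsilon> * (3 * d + 3 * \<alpha> + 6)) / 2"
  define x where "x = min x1 x2 / 2"
  have x12: "x1 > 0" "x2 > 0" using ex \<alpha>_gt_d ex_cluster by (auto simp: x1_def x2_def)
  have \<epsilon>\<epsilon>': "\<epsilon> < \<epsilon>'"
  proof -
    have "\<epsilon> * 1 \<le> \<epsilon> * (3 * d + 3 * \<alpha> + 6)" using ex \<alpha>_pos d_ge_1 by (intro mult_left_mono) auto
    then show ?thesis using ex_cluster by simp
  qed
  have "(q + \<epsilon> - (q - \<epsilon>')) + real 2 * ((p + \<epsilon>) * d + (q - \<epsilon>') - (q - \<epsilon>) * (\<alpha> + 1))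
      = \<epsilon> * (2 * d + 2 * \<alpha> + 3) - \<epsilon>'"
    using pq(3) by (simp add: algebra_simps)
  also have "\<dots> \<le> - (2 * x2)"
  proof -
    have "\<epsilon> * (2 * d + 2 * \<alpha> + 3) \<le> \<epsilon> * (3 * d + 3 * \<alpha> + 6)"
      using ex \<alpha>_pos d_ge_1 by (intro mult_left_mono) auto
    moreover have "2 * x2 = \<epsilon>' - \<epsilon> * (3 * d + 3 * \<alpha> + 6)" by (simp add: x2_def)
    ultimately show ?thesis by linarith
  qed
  also have "\<dots> < - x2" using x12 by simp
  finally have ex1: "(q + \<epsilon> - (q - \<epsilon>')) + real 2 * ((p + \<epsilon>) * d + (q - \<epsilon>') - (q - \<epsilon>) * (\<alpha> + 1)) < - x2" .
  have cl: "\<forall>\<^sub>F T in at_top. \<forall>c\<ge>0. \<exists>G\<in>events. prob G \<le> T powr (- x2) \<and>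
    (\<forall>\<omega>\<in>space M. \<forall>J b. J \<subseteq> Bl (2 * T) \<longrightarrow> card J = 2 \<longrightarrow> 1 / 2 * T powr (q - \<epsilon>) \<le> b \<longrightarrow> b \<le> T powr (q + \<epsilon>) \<longrightarrow>
       (\<forall>z\<in>J. psi c z (\<xi> z \<omega>) \<in> {b..b + 1 * T powr (q - \<epsilon>')}) \<longrightarrow> \<omega> \<in> G)"
    by (rule cluster_ev[OF _ _ _ _ _ _ ex1]) (use ex in auto)
  have "\<forall>\<^sub>F T in at_top. T powr (- x1) + T powr (- x2) \<le> T powr (- x)"
  proof -
    have "- x1 < - x" "- x2 < - x" using x12 by (auto simp: x_def min_def)
    then have "\<forall>\<^sub>F T in at_top. 2 * T powr (- x1) \<le> T powr (- x)" "\<forall>\<^sub>F T in at_top. 2 * T powr (- x2) \<le> T powr (- x)"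
      by (intro eventually_powr_le; simp)+
    then show ?thesis by eventually_elim linarith
  qed
  moreover have "\<forall>\<^sub>F T in at_top. 2 * T powr (q - \<epsilon>') \<le> T powr (q - \<epsilon>)"
    using \<epsilon>\<epsilon>' by (intro eventually_powr_le) auto
  ultimately have "\<forall>\<^sub>F t in at_top. \<exists>G\<in>events. prob G \<le> t powr (- x) \<and>
    (\<forall>\<omega>\<in>space M. \<omega> \<notin> G \<longrightarrow> (\<forall>J A. J \<subseteq> Bl t \<longrightarrow> card J = 2 \<longrightarrow> t powr (q - \<epsilon>) \<le> A \<longrightarrow>
        \<not> (\<forall>z\<in>J. psi (1 / t) z (\<xi> z \<omega>) \<in> {A - t powr (q - \<epsilon>')..A})))"
    using max_ev[folded x1_def] cl eventually_ge_at_top[of 1]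
  proof eventually_elim
    case (elim t)
    obtain G1 where G1: "G1 \<in> events" "prob G1 \<le> t powr (- x1)"
      "\<And>\<omega> z. \<omega> \<in> space M \<Longrightarrow> \<omega> \<notin> G1 \<Longrightarrow> z \<in> Bl (2 * t) \<Longrightarrow> \<xi> z \<omega> \<le> t powr (q + \<epsilon>)"
      using elim(3) by blast
    from elim(4)[rule_format, of "1 / t"] elim(5)
    obtain G2 where G2: "G2 \<in> events" "prob G2 \<le> t powr (- x2)"
      "\<And>\<omega> J b. \<omega> \<in> space M \<Longrightarrow> J \<subseteq> Bl (2 * t) \<Longrightarrow> card J = 2 \<Longrightarrow> 1 / 2 * t powr (q - \<epsilon>) \<le> b \<Longrightarrow> b \<le> t powr (q + \<epsilon>) \<Longrightarrow>
       \<forall>z\<in>J. psi (1 / t) z (\<xi> z \<omega>) \<in> {b..b + 1 * t powr (q - \<epsilon>')} \<Longrightarrow> \<omega> \<in> G2" by auto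
    have "prob (G1 \<union> G2) \<le> t powr (- x)"
      using measure_Un_le[OF G1(1) G2(1)] G1(2) G2(2) elim(1) by linarith
    moreover have False
      if \<omega>: "\<omega> \<in> space M" "\<omega> \<notin> G1 \<union> G2" and J: "J \<subseteq> Bl t" "card J = 2" "t powr (q - \<epsilon>) \<le> A"
        "\<forall>z\<in>J. psi (1 / t) z (\<xi> z \<omega>) \<in> {A - t powr (q - \<epsilon>')..A}" for \<omega> J A
    proof -
      have sub: "Bl t \<subseteq> Bl (2 * t)" using elim by (intro Bl_mono) auto
      obtain z where z: "z \<in> J" using J by fastforce
      then have "A - t powr (q - \<epsilon>') \<le> \<xi> z \<omega>"
        using J(4) psi_le[of "1 / t" z "\<xi> z \<omega>"] elim by fastforce
      also have "\<dots> \<le> t powr (q + \<epsilon>)" using G1(3)[of \<omega> z] \<omega> z J sub by auto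
      finally have "\<omega> \<in> G2" using \<omega> J sub elim(2)
        by (intro G2(3)[of \<omega> J "A - t powr (q - \<epsilon>')"]) auto
      then show False using \<omega> by simp
    qed
    ultimately show ?case using G1(1) G2(1) by (intro bexI[of _ "G1 \<union> G2"]) blast+
  qed
  moreover have "x > 0" using x12 by (simp add: x_def)
  ultimately show ?thesis by blast
qed

text \<open>Each time t of the block is compared with the last grid time \<open>s j\<close> not
  after it. Moving back to \<open>s j\<close> lowers \<open>psi\<close> by at most
  \<open>T powr (q - \<epsilon>')\<close>, so a cluster of three at time t is a slightly wider
  cluster at time \<open>s j\<close>. The union over the grid costs \<open>T powr \<beta>\<close>,
  which the estimate for triples can afford.\<close>

lemma triple_ev:
  "\<exists>x>0. \<forall>\<^sub>F T in at_top. \<exists>G\<in>events. prob G \<le> T powr (- x) \<and>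
    (\<forall>\<omega>\<in>space M. \<omega> \<notin> G \<longrightarrow> (\<forall>t\<in>{T..2 * T}. \<forall>J A. J \<subseteq> Bl t \<longrightarrow> card J = 3 \<longrightarrow> t powr (q - \<epsilon>) \<le> A \<longrightarrow>
        \<not> (\<forall>z\<in>J. psi (1 / t) z (\<xi> z \<omega>) \<in> {A - t powr (q - \<epsilon>')..A})))"
proof -
  define x1 where "x1 = \<epsilon> * (\<alpha> - d) / 2"
  define x4 where "x4 = (\<epsilon>' - \<epsilon> * (3 * d + 3 * \<alpha> + 6)) / 2"
  \<comment> \<open>A grid of mesh \<open>T powr (1 - \<beta>)\<close> changes \<open>1 / t\<close>
    by at most \<open>T powr (- 1 - \<beta>)\<close> and thus \<open>psi\<close> by this times the
    radius and a logarithm. The exponents add up to \<open>q - \<epsilon>' - \<epsilon>\<close>, and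
    the spare \<epsilon> absorbs the logarithm.\<close>
  define \<beta> where "\<beta> = \<epsilon>' + 2 * \<epsilon>"
  define x where "x = min x1 x4 / 2"
  \<comment> \<open>The power of 2 is for times up to \<open>2 * T\<close>, and the 1 is for the
    shift to the grid time.\<close>
  define cw where "cw = 2 powr (q - \<epsilon>') + 1"
  have x14: "x1 > 0" "x4 > 0" using ex \<alpha>_gt_d ex_cluster by (auto simp: x1_def x4_def)
  have cw: "cw > 0" by (simp add: cw_def add_pos_pos)
  have \<epsilon>\<epsilon>': "\<epsilon> < \<epsilon>'"
  proof -
    have "\<epsilon> * 1 \<le> \<epsilon> * (3 * d + 3 * \<alpha> + 6)" using ex \<alpha>_pos d_ge_1 by (intro mult_left_mono) auto
    then show ?thesis using ex_cluster by simp
  qed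
  have "(q + \<epsilon> - (q - \<epsilon>')) + real 3 * ((p + \<epsilon>) * d + (q - \<epsilon>') - (q - \<epsilon>) * (\<alpha> + 1))
      = \<epsilon> * (3 * d + 3 * \<alpha> + 6) - 2 * \<epsilon>' - 2 * \<epsilon>"
    using pq(3) by (simp add: algebra_simps)
  also have "\<dots> = - (\<beta> + 2 * x4)"
  proof -
    have "2 * x4 = \<epsilon>' - \<epsilon> * (3 * d + 3 * \<alpha> + 6)" by (simp add: x4_def)
    then show ?thesis unfolding \<beta>_def by linarith
  qed
  also have "\<dots> < - (\<beta> + x4)" using x14 by simp
  finally have ex1: "(q + \<epsilon> - (q - \<epsilon>')) + real 3 * ((p + \<epsilon>) * d + (q - \<epsilon>') - (q - \<epsilon>) * (\<alpha> + 1)) < - (\<beta> + x4)" .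
  have cl: "\<forall>\<^sub>F T in at_top. \<forall>c\<ge>0. \<exists>G\<in>events. prob G \<le> T powr (- (\<beta> + x4)) \<and>
    (\<forall>\<omega>\<in>space M. \<forall>J b. J \<subseteq> Bl (2 * T) \<longrightarrow> card J = 3 \<longrightarrow> 1 / 2 * T powr (q - \<epsilon>) \<le> b \<longrightarrow> b \<le> T powr (q + \<epsilon>) \<longrightarrow>
       (\<forall>z\<in>J. psi c z (\<xi> z \<omega>) \<in> {b..b + cw * T powr (q - \<epsilon>')}) \<longrightarrow> \<omega> \<in> G)"
    by (rule cluster_ev[OF _ _ _ _ _ _ ex1]) (use ex cw in auto)
  have "\<forall>\<^sub>F T in at_top. T powr (- x1) + 2 * T powr (- x4) \<le> T powr (- x)"
  proof -
    have "- x1 < - x" "- x4 < - x" using x14 by (auto simp: x_def min_def)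
    then have "\<forall>\<^sub>F T in at_top. 2 * T powr (- x1) \<le> T powr (- x)" "\<forall>\<^sub>F T in at_top. 4 * T powr (- x4) \<le> T powr (- x)"
      by (intro eventually_powr_le; simp)+
    then show ?thesis by eventually_elim linarith
  qed
  moreover have "\<forall>\<^sub>F T in at_top. 2 * cw * T powr (q - \<epsilon>') \<le> T powr (q - \<epsilon>)"
    using \<epsilon>\<epsilon>' cw by (intro eventually_powr_le) auto
  moreover have "\<forall>\<^sub>F T in at_top. T powr (- 1 - \<beta>) * ((2 * T) powr (p + \<epsilon>) * ln (T powr (q + \<epsilon>))) \<le> T powr (q - \<epsilon>')"
  proof -
    define b where "b = q - \<epsilon>'"
    have "\<forall>\<^sub>F T in at_top. 2 powr (p + \<epsilon>) * (T powr (b - \<epsilon>) * ln (T powr (q + \<epsilon>))) \<le> T powr b"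
      using ex by real_asymp
    then show ?thesis using eventually_gt_at_top[of 0]
    proof eventually_elim
      case (elim T)
      define L where "L = ln (T powr (q + \<epsilon>))"
      have eq: "T powr (- 1 - \<beta>) * T powr (p + \<epsilon>) = T powr (b - \<epsilon>)"
        by (simp add: \<beta>_def b_def pq algebra_simps flip: powr_add)
      have "T powr (- 1 - \<beta>) * ((2 * T) powr (p + \<epsilon>) * L) =
          2 powr (p + \<epsilon>) * ((T powr (- 1 - \<beta>) * T powr (p + \<epsilon>)) * L)"
        using elim(2) by (simp add: powr_mult mult_ac)
      also have "\<dots> = 2 powr (p + \<epsilon>) * (T powr (b - \<epsilon>) * L)" by (simp only: eq)
      finally show ?case using elim(1) by (simp only: L_def b_def)
    qed
  qed
  moreover have "\<forall>\<^sub>F T in at_top. 1 / 2 * T powr (q - \<epsilon>) \<ge> 1" using ex by real_asymp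
  ultimately have "\<forall>\<^sub>F T in at_top. \<exists>G\<in>events. prob G \<le> T powr (- x) \<and>
    (\<forall>\<omega>\<in>space M. \<omega> \<notin> G \<longrightarrow> (\<forall>t\<in>{T..2 * T}. \<forall>J A. J \<subseteq> Bl t \<longrightarrow> card J = 3 \<longrightarrow> t powr (q - \<epsilon>) \<le> A \<longrightarrow>
        \<not> (\<forall>z\<in>J. psi (1 / t) z (\<xi> z \<omega>) \<in> {A - t powr (q - \<epsilon>')..A})))"
    using max_ev[folded x1_def] cl eventually_ge_at_top[of 1]
  proof eventually_elim
    case (elim T)
    have T: "T \<ge> 1" by (rule elim)
    obtain G1 where G1: "G1 \<in> events" "prob G1 \<le> T powr (- x1)"
      "\<And>\<omega> z. \<omega> \<in> space M \<Longrightarrow> \<omega> \<notin> G1 \<Longrightarrow> z \<in> Bl (2 * T) \<Longrightarrow> \<xi> z \<omega> \<le> T powr (q + \<epsilon>)"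
      using elim(5) by blast
    define s where "s = (\<lambda>j::nat. T * (1 + j * T powr (- \<beta>)))"
    have s_ge: "s j \<ge> T" for j using T by (simp add: s_def)
    have "\<forall>j. \<exists>G\<in>events. prob G \<le> T powr (- (\<beta> + x4)) \<and>
      (\<forall>\<omega>\<in>space M. \<forall>J b. J \<subseteq> Bl (2 * T) \<longrightarrow> card J = 3 \<longrightarrow> 1 / 2 * T powr (q - \<epsilon>) \<le> b \<longrightarrow> b \<le> T powr (q + \<epsilon>) \<longrightarrow>
       (\<forall>z\<in>J. psi (1 / s j) z (\<xi> z \<omega>) \<in> {b..b + cw * T powr (q - \<epsilon>')}) \<longrightarrow> \<omega> \<in> G)"
    proof
      fix j
      have "0 \<le> 1 / s j" using s_ge[of j] T by simp
      then show "\<exists>G\<in>events. prob G \<le> T powr (- (\<beta> + x4)) \<and>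
      (\<forall>\<omega>\<in>space M. \<forall>J b. J \<subseteq> Bl (2 * T) \<longrightarrow> card J = 3 \<longrightarrow> 1 / 2 * T powr (q - \<epsilon>) \<le> b \<longrightarrow> b \<le> T powr (q + \<epsilon>) \<longrightarrow>
       (\<forall>z\<in>J. psi (1 / s j) z (\<xi> z \<omega>) \<in> {b..b + cw * T powr (q - \<epsilon>')}) \<longrightarrow> \<omega> \<in> G)"
        using elim(6) by blast
    qed
    then obtain G2 where G2: "\<And>j. G2 j \<in> events" "\<And>j. prob (G2 j) \<le> T powr (- (\<beta> + x4))"
      "\<And>\<omega> J b j. \<omega> \<in> space M \<Longrightarrow> J \<subseteq> Bl (2 * T) \<Longrightarrow> card J = 3 \<Longrightarrow> 1 / 2 * T powr (q - \<epsilon>) \<le> b \<Longrightarrow> b \<le> T powr (q + \<epsilon>) \<Longrightarrow>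
       \<forall>z\<in>J. psi (1 / s j) z (\<xi> z \<omega>) \<in> {b..b + cw * T powr (q - \<epsilon>')} \<Longrightarrow> \<omega> \<in> G2 j" by metis
    define N where "N = nat \<lfloor>T powr \<beta>\<rfloor>"
    define G where "G = G1 \<union> (\<Union>j\<in>{..N}. G2 j)"
    have U: "(\<Union>j\<in>{..N}. G2 j) \<in> events" using G2(1) by auto
    have "prob (\<Union>j\<in>{..N}. G2 j) \<le> (\<Sum>j\<in>{..N}. prob (G2 j))"
      using G2(1) by (intro finite_measure_subadditive_finite) auto
    also have "\<dots> \<le> (\<Sum>j\<in>{..N}. T powr (- (\<beta> + x4)))" by (intro sum_mono G2(2))
    also have "\<dots> = (real N + 1) * T powr (- (\<beta> + x4))" by simp
    also have "\<dots> \<le> (2 * T powr \<beta>) * T powr (- (\<beta> + x4))"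
    proof (rule mult_right_mono)
      have "real N \<le> T powr \<beta>" by (simp add: N_def of_nat_floor)
      moreover have "1 \<le> T powr \<beta>" using T ex by (intro ge_one_powr_ge_zero) (auto simp: \<beta>_def)
      ultimately show "real N + 1 \<le> 2 * T powr \<beta>" by simp
    qed simp
    also have "\<dots> = 2 * T powr (- x4)" by (simp flip: powr_add)
    finally have "prob G \<le> T powr (- x)"
      unfolding G_def using measure_Un_le[OF G1(1) U] G1(2) elim(1) by linarith
    moreover have False
      if \<omega>: "\<omega> \<in> space M" "\<omega> \<notin> G" and t: "t \<in> {T..2 * T}"
        and J: "J \<subseteq> Bl t" "card J = 3" "t powr (q - \<epsilon>) \<le> A"
        "\<forall>z\<in>J. psi (1 / t) z (\<xi> z \<omega>) \<in> {A - t powr (q - \<epsilon>')..A}" for \<omega> t J A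
    proof -
      define w0 where "w0 = T powr (q - \<epsilon>')"
      have sub: "Bl t \<subseteq> Bl (2 * T)" using t T by (intro Bl_mono) auto
      define j where "j = nat \<lfloor>(t / T - 1) * T powr \<beta>\<rfloor>"
      have tT: "0 \<le> t / T - 1" "t / T - 1 \<le> 1" using t T by (auto simp: field_simps)
      have j: "real j \<le> (t / T - 1) * T powr \<beta>" "(t / T - 1) * T powr \<beta> \<le> real j + 1"
        using tT by (auto simp: j_def of_nat_floor)
      have "(t / T - 1) * T powr \<beta> \<le> 1 * T powr \<beta>" using tT by (intro mult_right_mono) auto
      then have jN: "j \<le> N" unfolding j_def N_def by (intro nat_mono floor_mono) simp
      have "real j * T powr (- \<beta>) \<le> (t / T - 1) * T powr \<beta> * T powr (- \<beta>)"
        by (intro mult_right_mono j) simp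
      then have st: "s j \<le> t" using T by (simp add: s_def field_simps powr_minus)
      have "(t / T - 1) * T powr \<beta> * T powr (- \<beta>) \<le> (real j + 1) * T powr (- \<beta>)"
        by (intro mult_right_mono j) simp
      then have ts: "t - s j \<le> T * T powr (- \<beta>)" using T by (simp add: s_def field_simps powr_minus)
      define e where "e = 1 / s j - 1 / t"
      have e0: "e \<ge> 0" unfolding e_def using st s_ge[of j] T by (simp add: frac_le)
      have "e = (t - s j) / (s j * t)" unfolding e_def using s_ge[of j] t T by (simp add: field_simps)
      also have "\<dots> \<le> T * T powr (- \<beta>) / (T * T)"
        using ts t T s_ge[of j] st by (intro frac_le mult_mono) auto
      also have "\<dots> = T powr (- 1 - \<beta>)" using T by (simp add: powr_diff powr_minus field_simps)
      finally have e1: "e \<le> T powr (- 1 - \<beta>)" .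
      have gt: "t powr (q - \<epsilon>') \<le> 2 powr (q - \<epsilon>') * w0"
      proof -
        have "t powr (q - \<epsilon>') \<le> (2 * T) powr (q - \<epsilon>')" using t T ex by (intro powr_mono2) auto
        then show ?thesis using T by (simp add: w0_def powr_mult)
      qed
      define b where "b = A - t powr (q - \<epsilon>') - w0"
      have "T powr (q - \<epsilon>) \<le> t powr (q - \<epsilon>)" using t T ex by (intro powr_mono2) auto
      moreover have "t powr (q - \<epsilon>') + w0 \<le> cw * w0" using gt by (simp add: cw_def distrib_right)
      moreover have "2 * (cw * w0) \<le> T powr (q - \<epsilon>)" using elim(2) by (simp add: w0_def)
      ultimately have bl: "1 / 2 * T powr (q - \<epsilon>) \<le> b" and bw: "A \<le> b + cw * w0"
        using J(3) by (auto simp: b_def)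
      have win: "psi (1 / s j) z (\<xi> z \<omega>) \<in> {b..b + cw * w0}" if z: "z \<in> J" for z
      proof -
        let ?v = "\<xi> z \<omega>"
        define m where "m = max 0 (real (nrm z) * ln ?v - path_entropy z)"
        have pz: "psi (1 / t) z ?v \<in> {A - t powr (q - \<epsilon>')..A}" using J(4) z by blast
        have "psi (1 / t) z ?v \<le> ?v" using t T by (intro psi_le) auto
        moreover have "w0 \<ge> 0" by (simp add: w0_def)
        ultimately have v1: "?v \<ge> 1" using pz bl elim(4) by (auto simp: b_def)
        have v2: "?v \<le> T powr (q + \<epsilon>)" using G1(3)[of \<omega> z] \<omega> z J sub by (auto simp: G_def)
        have "real (nrm z) * ln ?v \<le> (2 * T) powr (p + \<epsilon>) * ln (T powr (q + \<epsilon>))"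
        proof (intro mult_mono ln_mono)
          show "real (nrm z) \<le> (2 * T) powr (p + \<epsilon>)" using z J sub by (auto simp: ballz_iff)
        qed (use v1 v2 in auto)
        moreover have "0 \<le> (2 * T) powr (p + \<epsilon>) * ln (T powr (q + \<epsilon>))"
          using T pq ex by (intro mult_nonneg_nonneg ln_ge_zero ge_one_powr_ge_zero) auto
        ultimately have m: "m \<le> (2 * T) powr (p + \<epsilon>) * ln (T powr (q + \<epsilon>))" "m \<ge> 0"
          using path_entropy_nonneg[of z] by (auto simp: m_def)
        have "e * m \<le> T powr (- 1 - \<beta>) * ((2 * T) powr (p + \<epsilon>) * ln (T powr (q + \<epsilon>)))"
          using e1 m e0 by (intro mult_mono) auto
        then have "e * m \<le> w0" using elim(3) by (simp add: w0_def)
        moreover have "e * m \<ge> 0" using e0 m by simp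
        moreover have "psi (1 / s j) z ?v = psi (1 / t) z ?v - e * m"
          by (simp add: psi_def e_def m_def algebra_simps)
        ultimately show ?thesis using pz bw by (auto simp: b_def)
      qed
      obtain z where z: "z \<in> J" using J by fastforce
      have "0 \<le> 1 / s j" using s_ge[of j] T by simp
      then have "b \<le> \<xi> z \<omega>" using win[OF z] psi_le[of "1 / s j" z "\<xi> z \<omega>"] by auto
      also have "\<dots> \<le> T powr (q + \<epsilon>)" using G1(3)[of \<omega> z] \<omega> z J sub by (auto simp: G_def)
      finally have "\<omega> \<in> G2 j" using \<omega> J sub bl win unfolding w0_def
        by (intro G2(3)[of \<omega> J b]) auto
      then show False using \<omega> jN by (auto simp: G_def)
    qed
    moreover have "G \<in> events" using G1(1) U by (simp add: G_def)
    ultimately show ?case by blast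
  qed
  moreover have "x > 0" using x14 by (simp add: x_def)
  ultimately show ?thesis by blast
qed

text \<open>In a ball of radius \<open>T powr (p - \<epsilon> - \<theta>)\<close> the distance term
  of \<open>psi\<close> is at most \<open>T powr (q - \<epsilon> - \<theta>)\<close> times a
  logarithm, which is negligible; \<theta> is there for the logarithm. This ball is still large
  enough to contain, up to a stretched exponential probability, a site higher than twice the
  required level.\<close>

lemma psi_max_ev:
  "\<forall>\<^sub>F T in at_top. \<exists>G\<in>events. prob G \<le> T powr (- (\<epsilon> * (\<alpha> - d) / 4)) \<and>
    (\<forall>\<omega>\<in>space M. \<omega> \<notin> G \<longrightarrow> (\<forall>t\<in>{T..2 * T}. \<exists>z\<in>Bl t. psi (1 / t) z (\<xi> z \<omega>) \<ge> t powr (q - \<epsilon>)))"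
proof -
  define x1 where "x1 = \<epsilon> * (\<alpha> - d) / 2"
  define x where "x = x1 / 2"
  have x1: "x1 > 0" using ex \<alpha>_gt_d by (simp add: x1_def)
  define e where "e = \<epsilon> * (\<alpha> - d) - \<theta> * d"
  have e: "e > 0" using ex_max by (simp add: e_def)
  define c where "c = (2 * 2 powr (q - \<epsilon>)) powr (- \<alpha>) * (1 / d) powr d"
  have c: "c > 0" using d_ge_1 by (simp add: c_def)
  have "\<forall>\<^sub>F T in at_top. T powr (- x1) \<le> T powr (- x) / 2" using x1 by (simp add: x_def) real_asymp
  moreover have "\<forall>\<^sub>F T in at_top. exp (- (c * T powr e)) \<le> T powr (- x) / 2" using c e by real_asymp
  moreover have "\<forall>\<^sub>F T in at_top. T powr (q - \<epsilon> - \<theta>) * ln (T powr (q + \<epsilon>)) \<le> (2 * T) powr (q - \<epsilon>)"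
    using ex ex_max by real_asymp
  ultimately have "\<forall>\<^sub>F T in at_top. \<exists>G\<in>events. prob G \<le> T powr (- x) \<and>
    (\<forall>\<omega>\<in>space M. \<omega> \<notin> G \<longrightarrow> (\<forall>t\<in>{T..2 * T}. \<exists>z\<in>Bl t. psi (1 / t) z (\<xi> z \<omega>) \<ge> t powr (q - \<epsilon>)))"
    using max_ev[folded x1_def] eventually_ge_at_top[of 1]
  proof eventually_elim
    case (elim T)
    have T: "T \<ge> 1" by (rule elim)
    obtain G1 where G1: "G1 \<in> events" "prob G1 \<le> T powr (- x1)"
      "\<And>\<omega> z. \<omega> \<in> space M \<Longrightarrow> \<omega> \<notin> G1 \<Longrightarrow> z \<in> Bl (2 * T) \<Longrightarrow> \<xi> z \<omega> \<le> T powr (q + \<epsilon>)"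
      using elim(4) by blast
    define r where "r = T powr (p - \<epsilon> - \<theta>)"
    define h where "h = 2 * (2 * T) powr (q - \<epsilon>)"
    let ?b = "ballz r :: (int ^ 'd) set"
    define G2 where "G2 = {\<omega> \<in> space M. \<forall>z\<in>?b. \<xi> z \<omega> \<in> {..<h}}"
    have "1 \<le> (2 * T) powr (q - \<epsilon>)" using T ex by (intro ge_one_powr_ge_zero) auto
    then have h1: "h \<ge> 1" by (simp add: h_def)
    have G2m: "G2 \<in> events" unfolding G2_def using finite_ballz by measurable
    have "prob G2 = (\<Prod>z\<in>?b. prob {\<omega> \<in> space M. \<xi> z \<omega> \<in> {..<h}})"
      unfolding G2_def by (rule prob_Ball) (auto simp: finite_ballz)
    also have "\<dots> = (1 - h powr (- \<alpha>)) ^ card ?b" using h1 by (simp add: tail)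
    also have "\<dots> \<le> exp (- (h powr (- \<alpha>))) ^ card ?b"
    proof (rule power_mono)
      show "1 - h powr (- \<alpha>) \<le> exp (- (h powr (- \<alpha>)))" using exp_ge_add_one_self[of "- (h powr (- \<alpha>))"] by simp
      show "0 \<le> 1 - h powr (- \<alpha>)" using tail[OF h1, of 0] by (metis measure_nonneg)
    qed
    also have "\<dots> = exp (- (card ?b * h powr (- \<alpha>)))" by (simp flip: exp_of_nat_mult)
    also have "\<dots> \<le> exp (- ((r / d) powr d * h powr (- \<alpha>)))"
    proof -
      have "(r / d) powr d \<le> card ?b"
        using card_ballz_ge[of r, where 'd = 'd] d_ge_1 T
        by (simp add: d_eq r_def powr_realpow)
      then show ?thesis by (simp add: mult_right_mono)
    qed
    also have "(r / d) powr d * h powr (- \<alpha>) = c * T powr e"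
    proof -
      have e_eq: "e = (p - \<epsilon> - \<theta>) * d + (q - \<epsilon>) * (- \<alpha>)" using pq(3) by (simp add: e_def algebra_simps)
      have "T powr e = T powr ((p - \<epsilon> - \<theta>) * d) * T powr ((q - \<epsilon>) * (- \<alpha>))"
        unfolding e_eq by (rule powr_add)
      moreover have "(r / d) powr d = T powr ((p - \<epsilon> - \<theta>) * d) * (1 / d) powr d"
        using d_ge_1 by (simp add: r_def powr_powr powr_divide)
      moreover have "h powr (- \<alpha>) = (2 * 2 powr (q - \<epsilon>)) powr (- \<alpha>) * T powr ((q - \<epsilon>) * (- \<alpha>))"
        using T by (simp add: h_def powr_mult powr_powr)
      ultimately show ?thesis by (simp only: c_def mult_ac)
    qed
    finally have "prob G2 \<le> T powr (- x) / 2" using elim(2) by linarith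
    then have "prob (G1 \<union> G2) \<le> T powr (- x)"
      using measure_Un_le[OF G1(1) G2m] G1(2) elim(1) by linarith
    moreover have "\<exists>z\<in>Bl t. psi (1 / t) z (\<xi> z \<omega>) \<ge> t powr (q - \<epsilon>)"
      if \<omega>: "\<omega> \<in> space M" "\<omega> \<notin> G1 \<union> G2" and t: "t \<in> {T..2 * T}" for \<omega> t
    proof -
      obtain z where z: "z \<in> ?b" "\<xi> z \<omega> \<ge> h" using \<omega> by (auto simp: G2_def not_less)
      have "r \<le> T powr (p + \<epsilon>)" unfolding r_def using T ex ex_max by (intro powr_mono) auto
      also have "\<dots> \<le> t powr (p + \<epsilon>)" using t T pq ex by (intro powr_mono2) auto
      finally have zt: "z \<in> Bl t" using z ballz_mono by blast
      have "Bl t \<subseteq> Bl (2 * T)" using t T by (intro Bl_mono) auto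
      then have v: "\<xi> z \<omega> \<le> T powr (q + \<epsilon>)" using G1(3)[of \<omega> z] \<omega> zt by auto
      have ln0: "ln (T powr (q + \<epsilon>)) \<ge> 0" using T pq ex by (intro ln_ge_zero ge_one_powr_ge_zero) auto
      have "real (nrm z) * ln (\<xi> z \<omega>) \<le> r * ln (T powr (q + \<epsilon>))"
        using z v h1 ln0 by (intro mult_mono ln_mono) (auto simp: ballz_iff)
      then have "max 0 (real (nrm z) * ln (\<xi> z \<omega>) - path_entropy z) \<le> r * ln (T powr (q + \<epsilon>))"
        using path_entropy_nonneg[of z] ln0 by (auto simp: r_def)
      then have "1 / t * max 0 (real (nrm z) * ln (\<xi> z \<omega>) - path_entropy z) \<le> 1 / T * (r * ln (T powr (q + \<epsilon>)))"
        using t T by (intro mult_mono frac_le) auto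
      also have "\<dots> = T powr (q - \<epsilon> - \<theta>) * ln (T powr (q + \<epsilon>))"
        using T by (simp add: r_def pq powr_add powr_diff)
      also note elim(3)
      finally have "psi (1 / t) z (\<xi> z \<omega>) \<ge> (2 * T) powr (q - \<epsilon>)"
        using z(2) by (simp add: psi_def h_def)
      moreover have "t powr (q - \<epsilon>) \<le> (2 * T) powr (q - \<epsilon>)" using t T ex by (intro powr_mono2) auto
      ultimately have "t powr (q - \<epsilon>) \<le> psi (1 / t) z (\<xi> z \<omega>)" by (rule order_trans[rotated])
      then show ?thesis using zt by blast
    qed
    ultimately show ?case using G1(1) G2m by (intro bexI[of _ "G1 \<union> G2"]) blast+
  qed
  then show ?thesis by (simp add: x_def x1_def)
qed

text \<open>Borel-Cantelli once more, with T now the radius of a ball: the maximum over radius T is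
  at most \<open>T powr \<gamma>\<close> because \<open>\<gamma> * \<alpha> > d\<close>.\<close>

lemma AE_growth: "AE \<omega> in M. \<exists>C>0. \<forall>z. \<xi> z \<omega> \<le> C * (1 + nrm z) powr \<gamma>"
proof -
  define x where "x = (\<gamma> * \<alpha> - d) / 2"
  have x: "x > 0" using \<gamma> by (simp add: x_def)
  have "d + \<gamma> * (- \<alpha>) < - x" using x by (simp add: x_def field_simps)
  then have "\<forall>\<^sub>F T in at_top. 3 powr d * T powr (d + \<gamma> * (- \<alpha>)) \<le> T powr (- x)"
    by (intro eventually_powr_le) auto
  then have "\<forall>\<^sub>F T in at_top. \<exists>G\<in>events. prob G \<le> T powr (- x) \<and>
    (\<forall>\<omega>\<in>space M. \<omega> \<notin> G \<longrightarrow> (\<forall>z\<in>ballz T. \<xi> z \<omega> \<le> T powr \<gamma>))"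
    using eventually_ge_at_top[of 1]
  proof eventually_elim
    case (elim T)
    let ?G = "{\<omega> \<in> space M. \<exists>z\<in>ballz T. \<xi> z \<omega> \<ge> T powr \<gamma>}"
    have "prob ?G \<le> card (ballz T :: (int ^ 'd) set) * (T powr \<gamma>) powr (- \<alpha>)"
      using elim \<gamma> by (intro prob_exceed finite_ballz ge_one_powr_ge_zero) auto
    also have "\<dots> \<le> (3 * T) powr d * (T powr \<gamma>) powr (- \<alpha>)"
      using card_ballz_le[OF elim(2), where 'd = 'd] elim by (intro mult_right_mono) (auto simp: d_eq powr_realpow)
    also have "\<dots> = 3 powr d * T powr (d + \<gamma> * (- \<alpha>))"
      using elim by (simp only: powr_mult powr_powr powr_add)
    also note elim(1)
    finally have "prob ?G \<le> T powr (- x)" .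
    moreover have "?G \<in> events" using finite_ballz by measurable
    ultimately show ?case by (intro bexI[of _ ?G]) (auto simp: not_le intro: less_imp_le)
  qed
  from AE_eventually_dyadic[OF x this] show ?thesis
  proof eventually_elim
    case (elim \<omega>)
    then obtain K where K: "\<And>k z. k \<ge> K \<Longrightarrow> z \<in> ballz (2 ^ k) \<Longrightarrow> \<xi> z \<omega> \<le> (2 ^ k) powr \<gamma>"
      unfolding eventually_sequentially by blast
    define C where "C = (2 ^ K) powr \<gamma> * 2 powr \<gamma>"
    have "\<xi> z \<omega> \<le> C * (1 + nrm z) powr \<gamma>" for z
    proof -
      define n where "n = 1 + real (nrm z)"
      \<comment> \<open>A dyadic radius that covers z and is not smaller than \<open>2 ^ K\<close>,
        from where on the bound holds. In either case \<open>2 ^ k \<le> 2 ^ K * (2 * n)\<close>, so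
        the small balls only enlarge the constant C.\<close>
      define k where "k = max K (nat \<lceil>log 2 n\<rceil>)"
      have n: "n \<ge> 1" by (simp add: n_def)
      have "log 2 n \<le> k" using n by (simp add: k_def le_max_iff_disj) linarith
      then have "n \<le> 2 ^ k" using n by (simp add: log_le_iff powr_realpow)
      then have "real (nrm z) \<le> 2 ^ k" unfolding n_def by linarith
      then have "z \<in> ballz (2 ^ k)" by (simp only: ballz_iff)
      then have "\<xi> z \<omega> \<le> (2 ^ k) powr \<gamma>" by (intro K) (simp add: k_def)
      also have "(2::real) ^ k \<le> 2 ^ K * (2 * n)"
      proof (cases "K \<le> nat \<lceil>log 2 n\<rceil>")
        case True
        have "real (nat \<lceil>log 2 n\<rceil>) \<le> log 2 n + 1" using n by simp
        then have "2 powr real k \<le> 2 powr (log 2 n + 1)" using True by (simp add: k_def)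
        then have "2 ^ k \<le> 2 * n" using n by (simp add: powr_add powr_realpow)
        also have "\<dots> \<le> 2 ^ K * (2 * n)" using n by simp
        finally show ?thesis .
      next
        case False
        then show ?thesis using n by (simp add: k_def)
      qed
      then have "(2 ^ k) powr \<gamma> \<le> (2 ^ K * (2 * n)) powr \<gamma>" using \<gamma> by (intro powr_mono2) auto
      also have "\<dots> = C * n powr \<gamma>" using n by (simp add: C_def powr_mult)
      finally show ?thesis by (simp add: n_def)
    qed
    moreover have "C > 0" by (simp add: C_def)
    ultimately show ?case by blast
  qed
qed

end

section \<open>Almost sure and in-probability concentration\<close>

text \<open>A newly inserted site is compared with the maximiser chosen so far. The value at a
  random index is measurable because the index type is countable.\<close>

lemma measurable_argmax:
  fixes Y :: "'i::countable \<Rightarrow> 'a \<Rightarrow> real"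
  assumes "finite B" "B \<noteq> {}" "\<And>x. Y x \<in> borel_measurable M"
  shows "\<exists>Z. Z \<in> measurable M (count_space UNIV) \<and> (\<forall>\<omega>. Z \<omega> \<in> B \<and> (\<forall>x\<in>B. Y x \<omega> \<le> Y (Z \<omega>) \<omega>))"
  using assms(1,2)
proof (induction rule: finite_ne_induct)
  case (singleton b)
  then show ?case by (intro exI[of _ "\<lambda>_. b"]) auto
next
  case (insert b B)
  then obtain Z where Z: "Z \<in> measurable M (count_space UNIV)" "\<And>\<omega>. Z \<omega> \<in> B" "\<And>\<omega> x. x \<in> B \<Longrightarrow> Y x \<omega> \<le> Y (Z \<omega>) \<omega>"
    by blast
  note [measurable] = Z(1) assms(3)
  have [measurable]: "(\<lambda>\<omega>. Y (Z \<omega>) \<omega>) \<in> borel_measurable M"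
    by (rule measurable_compose_countable) measurable
  have "(\<lambda>\<omega>. if Y (Z \<omega>) \<omega> \<le> Y b \<omega> then b else Z \<omega>) \<in> measurable M (count_space UNIV)"
    by measurable
  moreover have "\<forall>\<omega>. (if Y (Z \<omega>) \<omega> \<le> Y b \<omega> then b else Z \<omega>) \<in> insert b B \<and>
    (\<forall>x\<in>insert b B. Y x \<omega> \<le> Y (if Y (Z \<omega>) \<omega> \<le> Y b \<omega> then b else Z \<omega>) \<omega>)"
    using Z(2,3) by (auto intro: order_trans less_imp_le)
  ultimately show ?case by blast
qed

lemma ratio_bounds:
  fixes f :: "'i \<Rightarrow> real"
  assumes nn: "\<And>x. f x \<ge> 0" and Zs: "finite Zs" "(\<Sum>z\<in>Zs. f z) > 0" and e: "e \<ge> 0"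
    and le: "\<And>A. finite A \<Longrightarrow> A \<inter> Zs = {} \<Longrightarrow> (\<Sum>z\<in>A. f z) \<le> e * (\<Sum>z\<in>Zs. f z)"
  shows "f summable_on UNIV" "1 / (1 + e) \<le> (\<Sum>z\<in>Zs. f z) / infsum f UNIV" "(\<Sum>z\<in>Zs. f z) / infsum f UNIV \<le> 1"
proof -
  let ?S = "\<Sum>z\<in>Zs. f z"
  have fin: "(\<Sum>z\<in>F. f z) \<le> (1 + e) * ?S" if "finite F" for F
  proof -
    have "(\<Sum>z\<in>F. f z) = (\<Sum>z\<in>F \<inter> Zs. f z) + (\<Sum>z\<in>F - Zs. f z)"
      using that by (metis sum.Int_Diff)
    also have "(\<Sum>z\<in>F \<inter> Zs. f z) \<le> ?S" using Zs nn by (intro sum_mono2) auto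
    also have "(\<Sum>z\<in>F - Zs. f z) \<le> e * ?S" using that by (intro le) auto
    finally show ?thesis by (simp add: algebra_simps)
  qed
  show sm: "f summable_on UNIV"
    using nn fin by (intro nonneg_bdd_above_summable_on) (auto intro!: bdd_aboveI2[of _ _ "(1 + e) * ?S"])
  have up: "infsum f UNIV \<le> (1 + e) * ?S"
    using fin by (intro infsum_le_finite_sums[OF sm]) auto
  have low: "?S \<le> infsum f UNIV"
    using nn Zs by (intro finite_sum_le_infsum sm) auto
  show "1 / (1 + e) \<le> ?S / infsum f UNIV" using up low Zs e by (simp add: field_simps)
  show "?S / infsum f UNIV \<le> 1" using low Zs by simp
qed

text \<open>Sets that differ by a subset of a null set are measurable together in the completion.
  This is for the solution, which is arbitrary on a null set.\<close>

lemma borel_measurable_completion_AE: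
  fixes f g :: "'a \<Rightarrow> real"
  assumes [measurable]: "f \<in> borel_measurable M" and ae: "AE x in M. f x = g x"
  shows "g \<in> borel_measurable (completion M)"
proof (rule measurableI)
  fix A :: "real set" assume A: "A \<in> sets borel"
  have "AE x in M. \<not> (f x \<noteq> g x)" using ae by simp
  from sets_completion_AE[OF this] have 1: "{x\<in>space M. f x \<noteq> g x} \<in> sets (completion M)"
    by (simp add: pred_def)
  have "AE x in M. \<not> (f x \<noteq> g x \<and> g x \<in> A)" using ae by auto
  from sets_completion_AE[OF this] have 2: "{x\<in>space M. f x \<noteq> g x \<and> g x \<in> A} \<in> sets (completion M)"
    by (simp add: pred_def)
  have 3: "f -` A \<inter> space M \<in> sets (completion M)"
    using measurable_sets[OF assms(1) A] by auto
  have "g -` A \<inter> space (completion M) = ((f -` A \<inter> space M) - {x\<in>space M. f x \<noteq> g x}) \<union> {x\<in>space M. f x \<noteq> g x \<and> g x \<in> A}"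
    by auto
  then show "g -` A \<inter> space (completion M) \<in> sets (completion M)"
    using 1 2 3 by auto
qed auto

lemma filterlim_ballz: "filterlim (\<lambda>n. ballz (real n) :: (int ^ 'd::finite) set) (finite_subsets_at_top UNIV) sequentially"
  unfolding filterlim_finite_subsets_at_top
proof (intro allI impI)
  fix X :: "(int ^ 'd) set" assume X: "finite X \<and> X \<subseteq> UNIV"
  have "\<forall>\<^sub>F n in sequentially. \<forall>x\<in>X. nrm x \<le> n"
    using X by (intro eventually_ball_finite) (auto intro: eventually_ge_at_top)
  then show "\<forall>\<^sub>F n in sequentially. finite (ballz (real n) :: (int ^ 'd) set) \<and> X \<subseteq> ballz (real n) \<and> ballz (real n) \<subseteq> UNIV"
    by eventually_elim (auto simp: finite_ballz ballz_iff)
qed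

text \<open>Writes the unordered sum as the limit of a sequence of finite sums, which makes its
  measurability evident.\<close>

lemma infsum_eq_lim_ballz:
  fixes f :: "int ^ 'd::finite \<Rightarrow> real"
  assumes "f summable_on UNIV"
  shows "lim (\<lambda>n. \<Sum>z\<in>ballz (real n). f z) = infsum f UNIV"
proof -
  have "(sum f \<longlongrightarrow> infsum f UNIV) (finite_subsets_at_top UNIV)"
    using has_sum_infsum[OF assms] by (simp add: has_sum_def)
  from filterlim_compose[OF this filterlim_ballz] show ?thesis by (rule limI)
qed

lemma (in prob_space) prob_tendsto_0:
  fixes A :: "real \<Rightarrow> 'a set"
  assumes [measurable]: "\<And>t. A t \<in> events" and ae: "AE \<omega> in M. \<forall>\<^sub>F t in at_top. \<omega> \<notin> A t"
  shows "((\<lambda>t. prob (A t)) \<longlongrightarrow> 0) at_top"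
proof (rule tendsto_at_topI_sequentially)
  fix X :: "nat \<Rightarrow> real" assume X: "filterlim X at_top sequentially"
  have "(\<lambda>n. \<integral>\<omega>. indicator (A (X n)) \<omega> \<partial>M) \<longlonglongrightarrow> (\<integral>\<omega>. (0::real) \<partial>M)"
  proof (rule integral_dominated_convergence[where w = "\<lambda>_. 1"])
    show "AE \<omega> in M. (\<lambda>n. indicator (A (X n)) \<omega>) \<longlonglongrightarrow> (0::real)"
      using ae
    proof eventually_elim
      case (elim \<omega>)
      then have "\<forall>\<^sub>F n in sequentially. \<omega> \<notin> A (X n)"
        by (rule eventually_compose_filterlim[OF _ X])
      then show ?case by (intro tendsto_eventually) (auto elim!: eventually_mono)
    qed
  qed auto
  then show "(\<lambda>n. prob (A (X n))) \<longlonglongrightarrow> 0" by simp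
qed

section \<open>The solution at the two largest maximisers\<close>

context pam_params
begin

text \<open>Radius at least 1 ensures two different sites in the ball at every t > 0, so that both
  maximisers exist; for t \<ge> 1 nothing changes.\<close>

definition pam_ball :: "real \<Rightarrow> (int ^ 'd) set" where
  "pam_ball t = ballz (max 1 (t powr (p + \<epsilon>)))"

lemma pam_ball_eq:
  assumes "t \<ge> 1" shows "pam_ball t = Bl t"
proof -
  have "1 \<le> t powr (p + \<epsilon>)" using assms pq ex by (intro ge_one_powr_ge_zero) auto
  then show ?thesis by (simp add: pam_ball_def max_def)
qed

lemma pam_ball_two: "pam_ball t - {z} \<noteq> {}"
proof
  assume "pam_ball t - {z} = {}"
  moreover have "0 \<in> pam_ball t" "axis undefined 1 \<in> pam_ball t"
    by (auto simp: pam_ball_def ballz_def l1_norm_axis)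
  ultimately have "axis undefined 1 = (0 :: int ^ 'd)" by blast
  then show False by (simp add: axis_eq_0_iff)
qed

definition good_potential :: "'a \<Rightarrow> real \<Rightarrow> bool" where
  "good_potential \<omega> t \<longleftrightarrow> t \<ge> 1 \<and>
    card {x\<in>Bl t. \<xi> x \<omega> > t powr (q - \<delta>)} \<le> t powr \<kappa> \<and>
    (\<forall>x\<in>Bl t. \<forall>y\<in>Bl t. \<xi> x \<omega> > t powr (q - \<delta>) \<longrightarrow> x \<noteq> y \<longrightarrow> \<xi> y \<omega> \<le> \<xi> x \<omega> \<longrightarrow> \<xi> y \<omega> + t powr \<sigma> \<le> \<xi> x \<omega>) \<and>
    (\<forall>J A. J \<subseteq> Bl t \<longrightarrow> card J = 3 \<longrightarrow> t powr (q - \<epsilon>) \<le> A \<longrightarrow>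
        \<not> (\<forall>z\<in>J. psi (1 / t) z (\<xi> z \<omega>) \<in> {A - t powr (q - \<epsilon>')..A})) \<and>
    (\<exists>z\<in>Bl t. psi (1 / t) z (\<xi> z \<omega>) \<ge> t powr (q - \<epsilon>))"

lemma AE_good: "AE \<omega> in M. \<forall>\<^sub>F t in at_top. good_potential \<omega> t"
proof -
  obtain x1 where x1: "x1 > 0" "\<forall>\<^sub>F T in at_top. \<exists>G\<in>events. prob G \<le> T powr (- x1) \<and>
    (\<forall>\<omega>\<in>space M. \<omega> \<notin> G \<longrightarrow> (\<forall>t\<in>{T..2 * T}. \<forall>x\<in>Bl t. \<forall>y\<in>Bl t.
        \<xi> x \<omega> > t powr (q - \<delta>) \<longrightarrow> x \<noteq> y \<longrightarrow> \<xi> y \<omega> \<le> \<xi> x \<omega> \<longrightarrow> \<xi> y \<omega> + t powr \<sigma> \<le> \<xi> x \<omega>))"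
    using gap_ev by blast
  obtain x2 where x2: "x2 > 0" "\<forall>\<^sub>F T in at_top. \<exists>G\<in>events. prob G \<le> T powr (- x2) \<and>
    (\<forall>\<omega>\<in>space M. \<omega> \<notin> G \<longrightarrow> (\<forall>t\<in>{T..2 * T}. \<forall>J A. J \<subseteq> Bl t \<longrightarrow> card J = 3 \<longrightarrow> t powr (q - \<epsilon>) \<le> A \<longrightarrow>
        \<not> (\<forall>z\<in>J. psi (1 / t) z (\<xi> z \<omega>) \<in> {A - t powr (q - \<epsilon>')..A})))"
    using triple_ev by blast
  have x3: "(\<kappa> - (\<epsilon> * d + \<delta> * \<alpha>)) / 2 > 0" using ex_card by simp
  have x4: "\<epsilon> * (\<alpha> - d) / 4 > 0" using ex \<alpha>_gt_d by simp
  show ?thesis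
    using AE_eventually_block[OF x1] AE_eventually_block[OF x2] AE_eventually_block[OF x3 card_ev]
      AE_eventually_block[OF x4 psi_max_ev]
  proof eventually_elim
    case (elim \<omega>)
    then show ?case using eventually_ge_at_top[of 1] unfolding good_potential_def
      by eventually_elim blast
  qed
qed

context
  fixes u :: "real \<Rightarrow> int ^ 'd \<Rightarrow> 'a \<Rightarrow> real" and U :: "real \<Rightarrow> 'a \<Rightarrow> real"
  assumes sol: "AE \<omega> in M. nonneg_pam_solution (\<lambda>z. \<xi> z \<omega>) (\<lambda>t z. u t z \<omega>)"
    and U: "\<And>t \<omega>. U t \<omega> = (\<Sum>\<^sub>\<infinity>z\<in>UNIV. u t z \<omega>)"
begin

text \<open>An explicit, hence measurable, function of the potential, which off a null set is the
  solution up to the factor \<open>exp (2 * d * t)\<close>.\<close>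

definition weight :: "real \<Rightarrow> int ^ 'd \<Rightarrow> 'a \<Rightarrow> real" where
  "weight t z \<omega> = wsum (\<lambda>z. \<xi> z \<omega>) t z"

text \<open>The exceptional null set is the one where the equation or the bound \<xi> \<ge> 1 fails,
  so it is the same for all t and z.\<close>

lemma AE_solution: "AE \<omega> in M. \<forall>t\<ge>0. \<forall>z.
   summable (\<lambda>k. walk (\<lambda>z. \<xi> z \<omega>) UNIV k z * t ^ k / fact k) \<and> u t z \<omega> = exp (- (2 * d * t)) * weight t z \<omega>"
  using sol AE_ge_1
proof eventually_elim
  case (elim \<omega>)
  show ?case
  proof (intro allI impI)
    fix t :: real and z :: "int ^ 'd" assume t: "t \<ge> 0"
    have "\<xi> z \<omega> \<ge> 0" for z using elim(2) by (meson order_trans zero_le_one)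
    from nonneg_pam_solution_sums[OF elim(1) this t, of z]
    have s: "(\<lambda>k. walk (\<lambda>z. \<xi> z \<omega>) UNIV k z * t ^ k / fact k) sums (exp (2 * d * t) * u t z \<omega>)"
      by (simp add: d_eq)
    then have "weight t z \<omega> = exp (2 * d * t) * u t z \<omega>"
      unfolding weight_def wsum_def by (rule sums_unique[symmetric])
    then show "summable (\<lambda>k. walk (\<lambda>z. \<xi> z \<omega>) UNIV k z * t ^ k / fact k) \<and> u t z \<omega> = exp (- (2 * d * t)) * weight t z \<omega>"
      using s by (auto simp: sums_iff exp_minus)
  qed
qed

lemma weight_measurable [measurable]: "weight t z \<in> borel_measurable M"
proof -
  have [measurable]: "(\<lambda>\<omega>. walk (\<lambda>z. \<xi> z \<omega>) UNIV k z) \<in> borel_measurable M" for k z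
  proof (induction k arbitrary: z)
    case (Suc k)
    note [measurable] = Suc
    show ?case by simp
  qed simp
  show ?thesis unfolding weight_def wsum_def by measurable
qed

lemma weight_nonneg: "AE \<omega> in M. \<forall>t\<ge>0. \<forall>z. weight t z \<omega> \<ge> 0"
  using AE_solution AE_ge_1
proof eventually_elim
  case (elim \<omega>)
  have "\<xi> z \<omega> \<ge> 0" for z using elim(2) by (meson order_trans zero_le_one)
  then show ?case using elim(1) unfolding weight_def wsum_def
    by (auto intro!: suminf_nonneg simp: walk_nonneg)
qed

text \<open>The set \<open>Zs\<close> stays universally quantified, because the statement is used
  with both maximisers and with the first one alone.\<close>

lemma AE_concentration:
  assumes e: "e > 0"
  shows "AE \<omega> in M. \<forall>\<^sub>F t in at_top. good_potential \<omega> t \<and> (\<forall>Zs Z. Z \<in> Zs \<longrightarrow> finite Zs \<longrightarrow> Zs \<subseteq> Bl t \<longrightarrow>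
     psi (1 / t) Z (\<xi> Z \<omega>) \<ge> t powr (q - \<epsilon>) \<longrightarrow>
     (\<forall>z\<in>Bl t - Zs. psi (1 / t) z (\<xi> z \<omega>) \<le> psi (1 / t) Z (\<xi> Z \<omega>) - t powr (q - \<epsilon>')) \<longrightarrow>
     (\<lambda>z. u t z \<omega>) summable_on UNIV \<and> \<bar>(\<Sum>z\<in>Zs. u t z \<omega>) / U t \<omega> - 1\<bar> \<le> e)"
  using AE_solution weight_nonneg AE_growth AE_good AE_ge_1
proof eventually_elim
  case (elim \<omega>)
  let ?V = "\<lambda>z. \<xi> z \<omega>"
  obtain C where C: "C > 0" "\<And>z. ?V z \<le> C * (1 + nrm z) powr \<gamma>" using elim(3) by blast
  have V0: "?V z \<ge> 0" for z using elim(5) by (meson order_trans zero_le_one)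
  show ?case
    using concentration[where 'd = 'd, OF e C(1) pq(1,2) ex \<gamma>(1-4)] elim(4)
  proof eventually_elim
    case (elim t)
    have t: "t \<ge> 1" using elim(2) by (simp add: good_potential_def)
    show ?case
    proof (intro conjI allI impI elim(2))
      fix Zs Z assume Z: "Z \<in> Zs" "finite Zs" "Zs \<subseteq> Bl t" "psi (1 / t) Z (\<xi> Z \<omega>) \<ge> t powr (q - \<epsilon>)"
        "\<forall>z\<in>Bl t - Zs. psi (1 / t) z (\<xi> z \<omega>) \<le> psi (1 / t) Z (\<xi> Z \<omega>) - t powr (q - \<epsilon>')"
      have le: "(\<Sum>z\<in>A. weight t z \<omega>) \<le> e * (\<Sum>z\<in>Zs. weight t z \<omega>)" if "finite A" "A \<inter> Zs = {}" for A
        unfolding weight_def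
        by (rule elim(1)[rule_format, where V = ?V and Z = Z])
          (use V0 C \<open>\<forall>t\<ge>0. \<forall>z. summable _ \<and> _\<close> elim(2) Z that t in \<open>auto simp: good_potential_def\<close>)
      have w0: "weight t z \<omega> \<ge> 0" for z using \<open>\<forall>t\<ge>0. \<forall>z. weight t z \<omega> \<ge> 0\<close> t by simp
      have u_eq: "u t z \<omega> = exp (- (2 * d * t)) * weight t z \<omega>" for z
        using \<open>\<forall>t\<ge>0. \<forall>z. summable _ \<and> _\<close> t by simp
      \<comment> \<open>The path without moves gives weight at least 1 to the origin. Hence the
        weight of \<open>Zs\<close> cannot vanish, and the ratio is not a division by zero.\<close>
      have w_origin: "weight t 0 \<omega> \<ge> 1"
      proof -
        have "(\<Sum>k<1. walk ?V UNIV k 0 * t ^ k / fact k) \<le> weight t 0 \<omega>"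
          unfolding weight_def wsum_def using \<open>\<forall>t\<ge>0. \<forall>z. summable _ \<and> _\<close> t V0
          by (intro sum_le_suminf) (auto simp: walk_nonneg)
        then show ?thesis by simp
      qed
      have S: "(\<Sum>z\<in>Zs. weight t z \<omega>) > 0"
      proof (cases "0 \<in> Zs")
        case True
        then have "weight t 0 \<omega> \<le> (\<Sum>z\<in>Zs. weight t z \<omega>)" using Z w0 by (intro member_le_sum) auto
        then show ?thesis using w_origin by linarith
      next
        case False
        then have "1 \<le> e * (\<Sum>z\<in>Zs. weight t z \<omega>)" using le[of "{0}"] w_origin by simp
        then show ?thesis using e by (smt (verit) mult_nonneg_nonpos)
      qed
      have sum_u: "(\<Sum>z\<in>A. u t z \<omega>) = exp (- (2 * d * t)) * (\<Sum>z\<in>A. weight t z \<omega>)" for A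
        by (simp add: u_eq sum_distrib_left)
      note rb = ratio_bounds[of "\<lambda>z. u t z \<omega>" Zs e]
      have prem: "\<And>x. u t x \<omega> \<ge> 0" "(\<Sum>z\<in>Zs. u t z \<omega>) > 0" "e \<ge> 0"
        "\<And>A. finite A \<Longrightarrow> A \<inter> Zs = {} \<Longrightarrow> (\<Sum>z\<in>A. u t z \<omega>) \<le> e * (\<Sum>z\<in>Zs. u t z \<omega>)"
        using w0 S e le unfolding sum_u by (auto simp: u_eq mult_ac)
      show "(\<lambda>z. u t z \<omega>) summable_on UNIV" by (rule rb(1)) (use prem Z in auto)
      have "1 / (1 + e) \<le> (\<Sum>z\<in>Zs. u t z \<omega>) / U t \<omega>" "(\<Sum>z\<in>Zs. u t z \<omega>) / U t \<omega> \<le> 1"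
        unfolding U by (rule rb(2,3); use prem Z in auto)+
      moreover have "1 - e \<le> 1 / (1 + e)" using e by (simp add: field_simps)
      ultimately show "\<bar>(\<Sum>z\<in>Zs. u t z \<omega>) / U t \<omega> - 1\<bar> \<le> e" using e by linarith
    qed
  qed
qed

context
  fixes Z1 Z2 :: "real \<Rightarrow> 'a \<Rightarrow> int ^ 'd"
  assumes Z1m [measurable]: "\<And>t. t > 0 \<Longrightarrow> Z1 t \<in> measurable M (count_space UNIV)"
    and Z1: "\<And>t \<omega>. t > 0 \<Longrightarrow> Z1 t \<omega> \<in> pam_ball t"
      "\<And>t \<omega> z. t > 0 \<Longrightarrow> z \<in> pam_ball t \<Longrightarrow> psi (1 / t) z (\<xi> z \<omega>) \<le> psi (1 / t) (Z1 t \<omega>) (\<xi> (Z1 t \<omega>) \<omega>)"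
    and Z2: "\<And>t \<omega>. t > 0 \<Longrightarrow> Z2 t \<omega> \<in> pam_ball t - {Z1 t \<omega>}"
      "\<And>t \<omega> z. t > 0 \<Longrightarrow> z \<in> pam_ball t - {Z1 t \<omega>} \<Longrightarrow> psi (1 / t) z (\<xi> z \<omega>) \<le> psi (1 / t) (Z2 t \<omega>) (\<xi> (Z2 t \<omega>) \<omega>)"
begin

lemma psi_Z1:
  assumes "good_potential \<omega> t"
  shows "psi (1 / t) (Z1 t \<omega>) (\<xi> (Z1 t \<omega>) \<omega>) \<ge> t powr (q - \<epsilon>)" "Z1 t \<omega> \<in> Bl t" "Z2 t \<omega> \<in> Bl t"
proof -
  have t: "t \<ge> 1" using assms by (simp add: good_potential_def)
  obtain z where "z \<in> Bl t" "psi (1 / t) z (\<xi> z \<omega>) \<ge> t powr (q - \<epsilon>)" using assms by (auto simp: good_potential_def)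
  then show "psi (1 / t) (Z1 t \<omega>) (\<xi> (Z1 t \<omega>) \<omega>) \<ge> t powr (q - \<epsilon>)"
    using Z1(2)[of t z \<omega>] t by (simp add: pam_ball_eq)
  show "Z1 t \<omega> \<in> Bl t" "Z2 t \<omega> \<in> Bl t" using Z1(1)[of t \<omega>] Z2(1)[of t \<omega>] t by (simp_all add: pam_ball_eq)
qed

text \<open>A third site too close to the maximum would force the second maximiser to be as close,
  and three sites would share a window below the maximum.\<close>

lemma AE_two_cities_le:
  assumes e: "e > 0"
  shows "AE \<omega> in M. \<forall>\<^sub>F t in at_top. (\<lambda>z. u t z \<omega>) summable_on UNIV \<and>
    \<bar>(u t (Z1 t \<omega>) \<omega> + u t (Z2 t \<omega>) \<omega>) / U t \<omega> - 1\<bar> \<le> e"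
  using AE_concentration[OF e]
proof eventually_elim
  case (elim \<omega>)
  then show ?case
  proof eventually_elim
    case (elim t)
    have g: "good_potential \<omega> t" and t: "t \<ge> 1" using elim by (auto simp: good_potential_def)
    let ?Zs = "{Z1 t \<omega>, Z2 t \<omega>}" and ?p = "\<lambda>z. psi (1 / t) z (\<xi> z \<omega>)"
    have ne: "Z1 t \<omega> \<noteq> Z2 t \<omega>" using Z2(1)[of t \<omega>] t by auto
    have "?p z \<le> ?p (Z1 t \<omega>) - t powr (q - \<epsilon>')" if z: "z \<in> Bl t - ?Zs" for z
    proof (rule ccontr)
      assume *: "\<not> ?p z \<le> ?p (Z1 t \<omega>) - t powr (q - \<epsilon>')"
      have 1: "?p z \<le> ?p (Z2 t \<omega>)" using Z2(2)[of t z \<omega>] z t by (simp add: pam_ball_eq)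
      have 2: "?p (Z2 t \<omega>) \<le> ?p (Z1 t \<omega>)" using Z1(2)[of t "Z2 t \<omega>" \<omega>] psi_Z1(3)[OF g] t by (simp add: pam_ball_eq)
      have "card {Z1 t \<omega>, Z2 t \<omega>, z} = 3" using ne z by auto
      moreover have "{Z1 t \<omega>, Z2 t \<omega>, z} \<subseteq> Bl t" using psi_Z1[OF g] z by auto
      ultimately have "\<not> (\<forall>y\<in>{Z1 t \<omega>, Z2 t \<omega>, z}. ?p y \<in> {?p (Z1 t \<omega>) - t powr (q - \<epsilon>')..?p (Z1 t \<omega>)})"
        using g psi_Z1(1)[OF g] unfolding good_potential_def by blast
      moreover have "t powr (q - \<epsilon>') \<ge> 0" by simp
      ultimately show False using * 1 2 by auto
    qed
    then show ?case
      using elim[THEN conjunct2, rule_format, where Z = "Z1 t \<omega>" and Zs = ?Zs] psi_Z1[OF g] ne by simp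
  qed
qed

theorem AE_two_cities:
  "AE \<omega> in M. ((\<lambda>t. (u t (Z1 t \<omega>) \<omega> + u t (Z2 t \<omega>) \<omega>) / U t \<omega>) \<longlongrightarrow> 1) at_top"
proof -
  have "AE \<omega> in M. \<forall>n. \<forall>\<^sub>F t in at_top. (\<lambda>z. u t z \<omega>) summable_on UNIV \<and>
      \<bar>(u t (Z1 t \<omega>) \<omega> + u t (Z2 t \<omega>) \<omega>) / U t \<omega> - 1\<bar> \<le> 1 / real (Suc n)"
    by (subst AE_all_countable, intro allI AE_two_cities_le) simp
  then show ?thesis
  proof eventually_elim
    case (elim \<omega>)
    show ?case
    proof (rule tendstoI)
      fix e :: real assume "e > 0"
      then obtain n where "1 / real (Suc n) < e" using nat_approx_posE by (metis of_nat_Suc)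
      with elim[rule_format, of n] show "\<forall>\<^sub>F t in at_top. dist ((u t (Z1 t \<omega>) \<omega> + u t (Z2 t \<omega>) \<omega>) / U t \<omega>) 1 < e"
        by (auto simp: dist_real_def elim!: eventually_mono)
    qed
  qed
qed


text \<open>The unordered sum is 0 by default if it diverges, so the measurable version of U needs
  summability at all times. The weights increase with t; summability at a large time therefore
  passes to all earlier ones.\<close>

lemma AE_summable: "AE \<omega> in M. \<forall>t\<ge>0. (\<lambda>z. u t z \<omega>) summable_on UNIV"
  using AE_two_cities_le[of 1, simplified] AE_solution AE_ge_1
proof eventually_elim
  case (elim \<omega>)
  let ?V = "\<lambda>z. \<xi> z \<omega>"
  have V0: "?V z \<ge> 0" for z using elim(3) by (meson order_trans zero_le_one)
  show ?case
  proof (intro allI impI)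
    fix t :: real assume t: "t \<ge> 0"
    have "\<forall>\<^sub>F s in at_top. s \<ge> t \<and> (\<lambda>z. u s z \<omega>) summable_on UNIV"
      using elim(1) eventually_ge_at_top[of t] by eventually_elim auto
    then obtain s where s: "s \<ge> t" "(\<lambda>z. u s z \<omega>) summable_on UNIV"
      using eventually_happens'[OF trivial_limit_at_top_linorder] by blast
    have w_mono: "weight t z \<omega> \<le> weight s z \<omega>" for z
      unfolding weight_def wsum_def using elim(2) s t V0
      by (intro suminf_le) (auto intro!: divide_right_mono mult_left_mono power_mono walk_nonneg)
    have w0: "weight t z \<omega> \<ge> 0" for z
      unfolding weight_def wsum_def using elim(2) t V0 by (intro suminf_nonneg) (auto simp: walk_nonneg)
    have "(\<lambda>z. exp (2 * d * s) * u s z \<omega>) summable_on UNIV"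
      using s by (intro summable_on_cmult_right)
    moreover have "exp (2 * d * s) * u s z \<omega> = weight s z \<omega>" for z
      using elim(2) s t by (simp add: mult.assoc[symmetric] flip: exp_add)
    ultimately have "(\<lambda>z. weight s z \<omega>) summable_on UNIV" by simp
    then have "(\<lambda>z. weight t z \<omega>) summable_on UNIV"
      by (rule summable_on_comparison_test) (use w_mono w0 in auto)
    then have "(\<lambda>z. exp (- (2 * d * t)) * weight t z \<omega>) summable_on UNIV"
      by (rule summable_on_cmult_right)
    then show "(\<lambda>z. u t z \<omega>) summable_on UNIV" using elim(2) t by simp
  qed
qed

theorem in_probability:
  "converges_in_probability (completion M) (\<lambda>t \<omega>. u t (Z1 t \<omega>) \<omega> / U t \<omega>) 1"
proof -
  \<comment> \<open>Measurable versions of the solution, its sum and the ratio, which agree with the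
    originals for all t \<ge> 0 off one null set.\<close>
  define uu where "uu = (\<lambda>t z \<omega>. exp (- (2 * d * t)) * weight t z \<omega>)"
  define UU where "UU = (\<lambda>t \<omega>. lim (\<lambda>n. \<Sum>z\<in>ballz (real n). uu t z \<omega>))"
  define Y where "Y = (\<lambda>t \<omega>. u t (Z1 t \<omega>) \<omega> / U t \<omega>)"
  define YY where "YY = (\<lambda>t \<omega>. uu t (Z1 t \<omega>) \<omega> / UU t \<omega>)"
  have [measurable]: "uu t z \<in> borel_measurable M" for t z unfolding uu_def by measurable
  have [measurable]: "UU t \<in> borel_measurable M" for t unfolding UU_def by measurable
  have YY_meas: "YY t \<in> borel_measurable M" if "t > 0" for t
  proof -
    have [measurable]: "(\<lambda>\<omega>. uu t (Z1 t \<omega>) \<omega>) \<in> borel_measurable M"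
      by (rule measurable_compose_countable[OF _ Z1m[OF that]]) measurable
    show ?thesis unfolding YY_def by measurable
  qed
  have eq: "AE \<omega> in M. \<forall>t\<ge>0. YY t \<omega> = Y t \<omega>"
    using AE_solution AE_summable
  proof eventually_elim
    case (elim \<omega>)
    show ?case
    proof (intro allI impI)
      fix t :: real assume t: "t \<ge> 0"
      have uu: "uu t z \<omega> = u t z \<omega>" for z using elim(1) t by (simp add: uu_def)
      have "UU t \<omega> = U t \<omega>" unfolding UU_def uu U using elim(2) t by (intro infsum_eq_lim_ballz) auto
      then show "YY t \<omega> = Y t \<omega>" by (simp add: YY_def Y_def uu)
    qed
  qed
  have eq_t: "AE \<omega> in M. YY t \<omega> = Y t \<omega>" if "t > 0" for t
    using eq by eventually_elim (use that in auto)
  have Y_meas: "Y t \<in> borel_measurable (completion M)" if "t > 0" for t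
    by (rule borel_measurable_completion_AE[OF YY_meas eq_t]) (use that in auto)
  obtain x where x: "x > 0" and ev: "\<forall>\<^sub>F t in at_top. \<exists>G\<in>events. prob G \<le> t powr (- x) \<and>
    (\<forall>\<omega>\<in>space M. \<omega> \<notin> G \<longrightarrow> (\<forall>J A. J \<subseteq> Bl t \<longrightarrow> card J = 2 \<longrightarrow> t powr (q - \<epsilon>) \<le> A \<longrightarrow>
        \<not> (\<forall>z\<in>J. psi (1 / t) z (\<xi> z \<omega>) \<in> {A - t powr (q - \<epsilon>')..A})))"
    using pair_ev by blast
  then obtain t0 where "\<forall>t\<ge>t0. \<exists>G\<in>events. prob G \<le> t powr (- x) \<and>
    (\<forall>\<omega>\<in>space M. \<omega> \<notin> G \<longrightarrow> (\<forall>J A. J \<subseteq> Bl t \<longrightarrow> card J = 2 \<longrightarrow> t powr (q - \<epsilon>) \<le> A \<longrightarrow>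
        \<not> (\<forall>z\<in>J. psi (1 / t) z (\<xi> z \<omega>) \<in> {A - t powr (q - \<epsilon>')..A})))"
    unfolding eventually_at_top_linorder by blast
  then obtain G where G: "\<And>t. t \<ge> t0 \<Longrightarrow> G t \<in> events" "\<And>t. t \<ge> t0 \<Longrightarrow> prob (G t) \<le> t powr (- x)"
    "\<And>t \<omega> J A. t \<ge> t0 \<Longrightarrow> \<omega> \<in> space M \<Longrightarrow> \<omega> \<notin> G t \<Longrightarrow> J \<subseteq> Bl t \<Longrightarrow> card J = 2 \<Longrightarrow> t powr (q - \<epsilon>) \<le> A \<Longrightarrow>
        \<not> (\<forall>z\<in>J. psi (1 / t) z (\<xi> z \<omega>) \<in> {A - t powr (q - \<epsilon>')..A})"
    by metis
  have "((\<lambda>t. measure (completion M) {\<omega> \<in> space (completion M). \<bar>Y t \<omega> - 1\<bar> > e}) \<longlongrightarrow> 0) at_top" if e: "e > 0" for e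
  proof -
    define E where "E = (\<lambda>t. {\<omega> \<in> space M. \<bar>YY t \<omega> - 1\<bar> > e})"
    have E_meas: "E t \<in> events" if "t > 0" for t
      unfolding E_def using YY_meas[OF that] by measurable
    \<comment> \<open>Pairs of nearly maximal sites may recur at arbitrarily large times, so the
      ratio at \<open>Z1\<close> alone is not treated almost surely. Off the pair event
      \<open>G t\<close>, however, a large deviation stops occurring almost surely; this gives
      \<open>prob (A t)\<close> the limit 0, and \<open>G t\<close> is small at each time.\<close>
    define A where "A = (\<lambda>t. if t > 0 \<and> t \<ge> t0 then E t - G t else {})"
    have A_meas: "A t \<in> events" for t using E_meas[of t] G(1)[of t] by (auto simp: A_def)
    have "AE \<omega> in M. \<forall>\<^sub>F t in at_top. \<omega> \<notin> A t"
      using AE_concentration[OF e] eq AE_space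
    proof eventually_elim
      case (elim \<omega>)
      show ?case
        using elim(1) eventually_ge_at_top[of t0]
      proof eventually_elim
        case (elim t)
        have g: "good_potential \<omega> t" and t: "t \<ge> 1" using elim by (auto simp: good_potential_def)
        let ?p = "\<lambda>z. psi (1 / t) z (\<xi> z \<omega>)"
        have "\<bar>Y t \<omega> - 1\<bar> \<le> e" if nG: "\<omega> \<notin> G t"
        proof -
          have "?p z \<le> ?p (Z1 t \<omega>) - t powr (q - \<epsilon>')" if z: "z \<in> Bl t - {Z1 t \<omega>}" for z
          proof (rule ccontr)
            assume *: "\<not> ?p z \<le> ?p (Z1 t \<omega>) - t powr (q - \<epsilon>')"
            have 1: "?p z \<le> ?p (Z1 t \<omega>)" using Z1(2)[of t z \<omega>] z t by (simp add: pam_ball_eq)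
            have "card {Z1 t \<omega>, z} = 2" using z by auto
            moreover have "{Z1 t \<omega>, z} \<subseteq> Bl t" using psi_Z1[OF g] z by auto
            ultimately have "\<not> (\<forall>y\<in>{Z1 t \<omega>, z}. ?p y \<in> {?p (Z1 t \<omega>) - t powr (q - \<epsilon>')..?p (Z1 t \<omega>)})"
              using G(3)[OF elim(2) \<open>\<omega> \<in> space M\<close> nG] psi_Z1(1)[OF g] by blast
            moreover have "t powr (q - \<epsilon>') \<ge> 0" by simp
            ultimately show False using * 1 by auto
          qed
          then show ?thesis
            using elim(1)[THEN conjunct2, rule_format, where Z = "Z1 t \<omega>" and Zs = "{Z1 t \<omega>}"] psi_Z1[OF g]
            by (simp add: Y_def)
        qed
        then show ?case using \<open>\<forall>t\<ge>0. YY t \<omega> = Y t \<omega>\<close> t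
          by (cases "\<omega> \<in> G t") (auto simp: A_def E_def)
      qed
    qed
    then have A0: "((\<lambda>t. prob (A t)) \<longlongrightarrow> 0) at_top" by (rule prob_tendsto_0[OF A_meas])
    have lim: "((\<lambda>t. prob (A t) + t powr (- x)) \<longlongrightarrow> 0) at_top"
      using tendsto_add[OF A0 tendsto_neg_powr[of "- x", OF _ filterlim_ident]] x by simp
    have "\<forall>\<^sub>F t in at_top. measure (completion M) {\<omega> \<in> space (completion M). \<bar>Y t \<omega> - 1\<bar> > e} \<le> prob (A t) + t powr (- x)"
      using eventually_gt_at_top[of 0] eventually_ge_at_top[of t0]
    proof eventually_elim
      case (elim t)
      note [measurable] = Y_meas[OF elim(1)]
      have Ym: "{\<omega> \<in> space (completion M). \<bar>Y t \<omega> - 1\<bar> > e} \<in> sets (completion M)" by measurable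
      have "measure (completion M) {\<omega> \<in> space (completion M). \<bar>Y t \<omega> - 1\<bar> > e} = measure (completion M) (E t)"
      proof (rule measure_eq_AE)
        show "AE \<omega> in completion M. (\<omega> \<in> {\<omega> \<in> space (completion M). \<bar>Y t \<omega> - 1\<bar> > e}) = (\<omega> \<in> E t)"
          using AE_completion[OF eq_t[OF elim(1)]] by eventually_elim (auto simp: E_def)
      qed (use E_meas[OF elim(1)] Ym in \<open>auto intro: sets_completionI_sets\<close>)
      also have "\<dots> = prob (E t)" using E_meas[OF elim(1)] by simp
      also have "\<dots> \<le> prob (A t \<union> G t)"
      proof (rule finite_measure_mono)
        show "E t \<subseteq> A t \<union> G t" using elim by (simp add: A_def)
        show "A t \<union> G t \<in> events" using A_meas[of t] G(1)[OF elim(2)] by (rule sets.Un)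
      qed
      also have "\<dots> \<le> prob (A t) + prob (G t)" by (intro measure_Un_le A_meas G elim)
      also have "\<dots> \<le> prob (A t) + t powr (- x)" using G(2)[OF elim(2)] by simp
      finally show ?case .
    qed
    then show ?thesis by (intro Lim_null_comparison[OF _ lim]) simp
  qed
  then show ?thesis
    using Y_meas by (simp add: converges_in_probability_def Y_def)
qed

end

end

end

section \<open>Integrals over lattice cells\<close>

lemma l1_norm_inner: "l1_norm (x :: real ^ 'd::finite) = (\<Sum>b\<in>Basis. \<bar>x \<bullet> b\<bar>)"
proof -
  have "(\<Sum>b\<in>Basis. \<bar>x \<bullet> b\<bar>) = (\<Sum>i\<in>UNIV. \<bar>x \<bullet> axis i 1\<bar>)"
    by (simp add: Basis_vec_def UNION_singleton_eq_range sum.reindex inj_on_def axis_eq_axis)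
  then show ?thesis by (simp add: l1_norm_def inner_axis)
qed

lemma l1_norm_measurable [measurable]: "(l1_norm :: real ^ 'd::finite \<Rightarrow> real) \<in> borel_measurable borel"
  unfolding l1_norm_inner by measurable

section \<open>Gamma integrals with the l1-norm\<close>

lemma nn_integral_powr_exp:
  fixes b c :: real
  assumes b: "b > 0" and c: "c > 0"
  shows "(\<integral>\<^sup>+ s. ennreal (s powr (b - 1) * exp (- (c * s))) * indicator {0<..} s \<partial>lborel) = ennreal (Gamma b * c powr (- b))"
proof -
  let ?f = "\<lambda>t::real. ennreal (t powr (b - 1) / exp t) * indicator {0<..} t"
  have "(\<integral>\<^sup>+ t. ?f t \<partial>lborel) = (\<integral>\<^sup>+ t. ennreal (t powr (b - 1) / exp t) * indicator {0..} t \<partial>lborel)"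
    by (intro nn_integral_cong) (auto simp: indicator_def)
  also have "\<dots> = ennreal (Gamma b)"
    by (rule nn_integral_has_integral_lebesgue'[OF _ Gamma_integral_real[OF b]]) auto
  finally have 1: "ennreal (Gamma b) = (\<integral>\<^sup>+ t. ?f t \<partial>lborel)" ..
  also have "\<dots> = ennreal \<bar>c\<bar> * (\<integral>\<^sup>+ s. ?f (0 + c * s) \<partial>lborel)"
    using c by (intro nn_integral_real_affine) auto
  also have "\<dots> = ennreal (c powr b) * (\<integral>\<^sup>+ s. ennreal (s powr (b - 1) * exp (- (c * s))) * indicator {0<..} s \<partial>lborel)"
  proof -
    have eq: "ennreal c * ?f (0 + c * s) = ennreal (c powr b) * (ennreal (s powr (b - 1) * exp (- (c * s))) * indicator {0<..} s)" for s
    proof (cases "s > 0")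
      case True
      have "c * ((c * s) powr (b - 1) / exp (c * s)) = c powr b * (s powr (b - 1) * exp (- (c * s)))"
        using c True by (simp add: powr_mult powr_diff exp_minus field_simps)
      then show ?thesis using c True by (simp add: zero_less_mult_iff flip: ennreal_mult)
    qed (use c in \<open>auto simp: zero_less_mult_iff\<close>)
    have "ennreal c * (\<integral>\<^sup>+ s. ?f (0 + c * s) \<partial>lborel) = (\<integral>\<^sup>+ s. ennreal c * ?f (0 + c * s) \<partial>lborel)"
      by (rule nn_integral_cmult[symmetric]) measurable
    also have "\<dots> = (\<integral>\<^sup>+ s. ennreal (c powr b) * (ennreal (s powr (b - 1) * exp (- (c * s))) * indicator {0<..} s) \<partial>lborel)"
      by (simp only: eq)
    also have "\<dots> = ennreal (c powr b) * (\<integral>\<^sup>+ s. ennreal (s powr (b - 1) * exp (- (c * s))) * indicator {0<..} s \<partial>lborel)"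
      by (rule nn_integral_cmult) measurable
    finally show ?thesis using c by simp
  qed
  finally have "ennreal (Gamma b) = ennreal (c powr b) * (\<integral>\<^sup>+ s. ennreal (s powr (b - 1) * exp (- (c * s))) * indicator {0<..} s \<partial>lborel)" .
  then have "ennreal (c powr (- b)) * ennreal (Gamma b) = (ennreal (c powr (- b)) * ennreal (c powr b)) * (\<integral>\<^sup>+ s. ennreal (s powr (b - 1) * exp (- (c * s))) * indicator {0<..} s \<partial>lborel)"
    by (simp add: mult.assoc)
  also have "ennreal (c powr (- b)) * ennreal (c powr b) = 1"
    using c by (simp flip: ennreal_mult powr_add)
  finally show ?thesis by (simp add: mult.commute flip: ennreal_mult'')
qed

lemma nn_integral_exp_abs:
  assumes c: "(c::real) > 0"
  shows "(\<integral>\<^sup>+ x. ennreal (exp (- (c * \<bar>x\<bar>))) \<partial>lborel) = ennreal (2 / c)"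
proof -
  let ?g = "\<lambda>x::real. ennreal (exp (- (c * x))) * indicator {0<..} x"
  have 1: "(\<integral>\<^sup>+ x. ?g x \<partial>lborel) = ennreal (1 / c)"
  proof -
    have "(\<integral>\<^sup>+ x. ?g x \<partial>lborel) = (\<integral>\<^sup>+ s. ennreal (s powr (1 - 1) * exp (- (c * s))) * indicator {0<..} s \<partial>lborel)"
      by (intro nn_integral_cong) (auto simp: indicator_def)
    also have "\<dots> = ennreal (1 / c)"
      using nn_integral_powr_exp[of 1 c] c by (simp add: powr_minus divide_inverse)
    finally show ?thesis .
  qed
  have 2: "(\<integral>\<^sup>+ x. ?g x \<partial>lborel) = (\<integral>\<^sup>+ x. ?g (- x) \<partial>lborel)"
    using nn_integral_real_affine[of ?g "-1" 0] by simp
  have "AE x in lborel. ennreal (exp (- (c * \<bar>x\<bar>))) = ?g x + ?g (- x)"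
    using AE_lborel_singleton[of "0::real"]
    by eventually_elim (auto simp: indicator_def)
  then have "(\<integral>\<^sup>+ x. ennreal (exp (- (c * \<bar>x\<bar>))) \<partial>lborel) = (\<integral>\<^sup>+ x. ?g x + ?g (- x) \<partial>lborel)"
    by (rule nn_integral_cong_AE)
  also have "\<dots> = (\<integral>\<^sup>+ x. ?g x \<partial>lborel) + (\<integral>\<^sup>+ x. ?g (- x) \<partial>lborel)"
    by (rule nn_integral_add) measurable
  also have "\<dots> = ennreal (1 / c) + ennreal (1 / c)" by (simp only: 1 2[symmetric])
  also have "\<dots> = ennreal (2 / c)" using c by (simp flip: ennreal_plus)
  finally show ?thesis .
qed

lemma nn_integral_exp_l1:
  assumes c: "(c::real) > 0"
  shows "(\<integral>\<^sup>+ x. ennreal (exp (- (c * l1_norm (x :: real ^ 'd::finite)))) \<partial>lborel) = ennreal ((2 / c) ^ CARD('d))"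
proof -
  have "(\<integral>\<^sup>+ x. ennreal (exp (- (c * l1_norm (x :: real ^ 'd)))) \<partial>lborel)
     = (\<integral>\<^sup>+ x. (\<Prod>b\<in>(Basis :: (real ^ 'd) set). ennreal (exp (- (c * \<bar>x \<bullet> b\<bar>)))) \<partial>lborel)"
    by (intro nn_integral_cong) (simp add: l1_norm_inner sum_distrib_left prod_ennreal exp_sum flip: sum_negf)
  also have "\<dots> = (\<Prod>b\<in>(Basis :: (real ^ 'd) set). \<integral>\<^sup>+ x. ennreal (exp (- (c * \<bar>x\<bar>))) \<partial>lborel)"
    by (intro nn_integral_lborel_prod) auto
  also have "\<dots> = ennreal ((2 / c) ^ CARD('d))"
    using c by (simp add: nn_integral_exp_abs ennreal_power)
  finally show ?thesis .
qed

text \<open>Write the power as a Gamma integral over s of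
  \<open>exp (- (\<sigma> + k * l1_norm x) * s)\<close> and exchange the integrals. The integral
  over x splits into coordinates and gives \<open>(2 / (k * s)) ^ CARD('d)\<close>, and what is left
  is a Gamma integral with parameter lowered by the dimension.\<close>

lemma nn_integral_l1_powr:
  fixes \<sigma> k \<beta> :: real
  assumes \<sigma>: "\<sigma> > 0" and k: "k > 0" and \<beta>: "\<beta> > CARD('d)"
  shows "(\<integral>\<^sup>+ x. ennreal ((\<sigma> + k * l1_norm (x :: real ^ 'd::finite)) powr (- \<beta>)) \<partial>lborel) =
    ennreal ((2 / k) ^ CARD('d) * (Gamma (\<beta> - CARD('d)) / Gamma \<beta>) * \<sigma> powr (CARD('d) - \<beta>))"
proof -
  let ?d = "real CARD('d)"
  have \<beta>0: "\<beta> > 0" using \<beta> by (simp add: dual_order.strict_trans2[OF _ of_nat_0_le_iff] order.strict_trans1[OF of_nat_0_le_iff])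
  define F where "F = (\<lambda>(x :: real ^ 'd) s. ennreal (s powr (\<beta> - 1) * exp (- ((\<sigma> + k * l1_norm x) * s))) * indicator {0<..} s)"
  have pos: "\<sigma> + k * l1_norm (x :: real ^ 'd) > 0" for x using \<sigma> k by (intro add_pos_nonneg) auto
  have G: "Gamma \<beta> > 0" using \<beta>0 by (rule Gamma_real_pos)
  have inner: "(\<integral>\<^sup>+ s. F x s \<partial>lborel) = ennreal (Gamma \<beta>) * ennreal ((\<sigma> + k * l1_norm x) powr (- \<beta>))" for x
    unfolding F_def nn_integral_powr_exp[OF \<beta>0 pos] using G by (simp add: ennreal_mult'')
  have "ennreal (Gamma \<beta>) * (\<integral>\<^sup>+ x. ennreal ((\<sigma> + k * l1_norm (x :: real ^ 'd)) powr (- \<beta>)) \<partial>lborel)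
     = (\<integral>\<^sup>+ x. \<integral>\<^sup>+ s. F x s \<partial>lborel \<partial>lborel)"
    unfolding inner by (subst nn_integral_cmult) auto
  also have "\<dots> = (\<integral>\<^sup>+ s. \<integral>\<^sup>+ x. F x s \<partial>lborel \<partial>lborel)"
    unfolding F_def by (intro lborel_pair.Fubini') auto
  also have "\<dots> = (\<integral>\<^sup>+ s. ennreal ((2 / k) ^ CARD('d)) * (ennreal (s powr (\<beta> - ?d - 1) * exp (- (\<sigma> * s))) * indicator {0<..} s) \<partial>lborel)"
  proof (intro nn_integral_cong)
    fix s :: real
    show "(\<integral>\<^sup>+ x. F x s \<partial>lborel) = ennreal ((2 / k) ^ CARD('d)) * (ennreal (s powr (\<beta> - ?d - 1) * exp (- (\<sigma> * s))) * indicator {0<..} s)"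
    proof (cases "s > 0")
      case True
      have "(\<integral>\<^sup>+ x. F x s \<partial>lborel) = (\<integral>\<^sup>+ x. ennreal (s powr (\<beta> - 1) * exp (- (\<sigma> * s))) * ennreal (exp (- ((k * s) * l1_norm (x :: real ^ 'd)))) \<partial>lborel)"
        using True by (intro nn_integral_cong) (simp add: F_def algebra_simps flip: ennreal_mult'' exp_add)
      also have "\<dots> = ennreal (s powr (\<beta> - 1) * exp (- (\<sigma> * s))) * ennreal ((2 / (k * s)) ^ CARD('d))"
        using True k by (subst nn_integral_cmult) (auto simp: nn_integral_exp_l1)
      also have "\<dots> = ennreal ((2 / k) ^ CARD('d)) * ennreal (s powr (\<beta> - ?d - 1) * exp (- (\<sigma> * s)))"
      proof -
        have "s powr (\<beta> - 1) = s powr (\<beta> - ?d - 1) * s ^ CARD('d)"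
          using True by (simp flip: powr_realpow powr_add)
        then have "s powr (\<beta> - 1) * exp (- (\<sigma> * s)) * (2 / (k * s)) ^ CARD('d) =
           (2 / k) ^ CARD('d) * (s powr (\<beta> - ?d - 1) * exp (- (\<sigma> * s)))"
          using True k by (simp add: power_divide power_mult_distrib field_simps)
        then show ?thesis using True k by (simp flip: ennreal_mult)
      qed
      finally show ?thesis using True by simp
    qed (simp add: F_def)
  qed
  also have "\<dots> = ennreal ((2 / k) ^ CARD('d)) * ennreal (Gamma (\<beta> - ?d) * \<sigma> powr (- (\<beta> - ?d)))"
    using \<beta> \<sigma> nn_integral_powr_exp[of "\<beta> - ?d" \<sigma>] by (subst nn_integral_cmult) auto
  finally have eq: "ennreal (Gamma \<beta>) * (\<integral>\<^sup>+ x. ennreal ((\<sigma> + k * l1_norm (x :: real ^ 'd)) powr (- \<beta>)) \<partial>lborel)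
     = ennreal ((2 / k) ^ CARD('d)) * ennreal (Gamma (\<beta> - ?d) * \<sigma> powr (- (\<beta> - ?d)))" .
  have "(\<integral>\<^sup>+ x. ennreal ((\<sigma> + k * l1_norm (x :: real ^ 'd)) powr (- \<beta>)) \<partial>lborel)
     = ennreal (1 / Gamma \<beta>) * (ennreal (Gamma \<beta>) * (\<integral>\<^sup>+ x. ennreal ((\<sigma> + k * l1_norm (x :: real ^ 'd)) powr (- \<beta>)) \<partial>lborel))"
    using G by (simp add: mult.assoc[symmetric] flip: ennreal_mult)
  also have "\<dots> = ennreal ((2 / k) ^ CARD('d) * (Gamma (\<beta> - ?d) / Gamma \<beta>) * \<sigma> powr (?d - \<beta>))"
    unfolding eq using G k \<beta> by (simp add: mult_ac flip: ennreal_mult)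
  finally show ?thesis .
qed

section \<open>Cells of the rescaled lattice\<close>

definition cell :: "real \<Rightarrow> real ^ 'd::finite \<Rightarrow> int ^ 'd" where
  "cell r x = (\<chi> i. \<lfloor>r * x $ i\<rfloor>)"

lemma cell_eq_iff: "cell r x = z \<longleftrightarrow> (\<forall>i. of_int (z $ i) \<le> r * x $ i \<and> r * x $ i < of_int (z $ i) + 1)"
  unfolding cell_def vec_eq_iff by (simp add: floor_eq_iff)

lemma cell_measurable [measurable]: "(cell r :: real ^ 'd::finite \<Rightarrow> _) \<in> measurable borel (count_space UNIV)"
proof (rule measurable_count_space_eq2_countable[THEN iffD2])
  show "(cell r :: real ^ 'd \<Rightarrow> _) \<in> (space borel \<rightarrow> UNIV) \<and> (\<forall>a\<in>UNIV. cell r -` {a} \<inter> space borel \<in> sets (borel :: (real ^ 'd) measure))"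
  proof (intro conjI ballI)
    fix z :: "int ^ 'd"
    have "cell r -` {z} \<inter> space borel = {x \<in> space (borel :: (real ^ 'd) measure). \<forall>i. of_int (z $ i) \<le> r * x $ i \<and> r * x $ i < of_int (z $ i) + 1}"
      unfolding cell_eq_iff[symmetric] by auto
    also have "\<dots> \<in> sets borel" by measurable
    finally show "cell r -` {z} \<inter> space borel \<in> sets (borel :: (real ^ 'd) measure)" .
  qed auto
qed

lemma emeasure_cell:
  assumes r: "r > 0"
  shows "emeasure lborel {x :: real ^ 'd::finite. cell r x = z} = ennreal ((1 / r) ^ CARD('d))"
proof (rule antisym)
  let ?l = "(\<chi> i. of_int (z $ i) / r) :: real ^ 'd" and ?u = "(\<chi> i. (of_int (z $ i) + 1) / r) :: real ^ 'd"
  let ?C = "{x :: real ^ 'd. cell r x = z}"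
  have ord: "?l \<bullet> b \<le> ?u \<bullet> b" if "b \<in> Basis" for b
    using that r by (auto simp: Basis_vec_def inner_axis divide_right_mono)
  have prod: "(\<Prod>b\<in>Basis. (?u - ?l) \<bullet> b) = (1 / r) ^ CARD('d)"
  proof -
    have "(?u - ?l) \<bullet> b = 1 / r" if "b \<in> Basis" for b
      using that by (auto simp: Basis_vec_def inner_axis diff_divide_distrib[symmetric])
    then show ?thesis by simp
  qed
  have C: "?C \<in> sets lborel"
  proof -
    have "?C = cell r -` {z} \<inter> space borel" by auto
    also have "\<dots> \<in> sets borel" by (rule measurable_sets[OF cell_measurable]) auto
    finally show ?thesis by simp
  qed
  have "box ?l ?u \<subseteq> ?C" using r by (auto simp: mem_box_cart cell_eq_iff field_simps intro: less_imp_le)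
  then have "emeasure lborel (box ?l ?u) \<le> emeasure lborel ?C" using C by (rule emeasure_mono)
  then show "ennreal ((1 / r) ^ CARD('d)) \<le> emeasure lborel ?C"
    by (simp only: emeasure_lborel_box[OF ord] prod)
  have "?C \<subseteq> cbox ?l ?u"
  proof
    fix x :: "real ^ 'd" assume "x \<in> ?C"
    then have "of_int (z $ i) \<le> r * x $ i" "r * x $ i \<le> of_int (z $ i) + 1" for i
      by (auto simp: cell_eq_iff intro: less_imp_le)
    then show "x \<in> cbox ?l ?u" using r by (simp add: mem_box_cart field_simps)
  qed
  then have "emeasure lborel ?C \<le> emeasure lborel (cbox ?l ?u)" by (rule emeasure_mono) simp
  then show "emeasure lborel ?C \<le> ennreal ((1 / r) ^ CARD('d))"
    using emeasure_lborel_cbox[OF ord] prod by simp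
qed

text \<open>All cells have volume \<open>(1 / r) ^ CARD('d)\<close>. Lattice sums at different times
  thus become integrals over one fixed space, to which Fatou's lemma applies.\<close>

lemma sum_eq_nn_integral_cell:
  fixes g :: "int ^ 'd::finite \<Rightarrow> ennreal"
  assumes r: "r > 0" and B: "finite B"
  shows "(\<Sum>z\<in>B. g z) = ennreal (r ^ CARD('d)) * (\<integral>\<^sup>+ x. g (cell r x) * indicator B (cell r x) \<partial>lborel)"
proof -
  have C: "{x :: real ^ 'd. cell r x = z} \<in> sets lborel" for z
  proof -
    have "{x :: real ^ 'd. cell r x = z} = cell r -` {z} \<inter> space borel" by auto
    also have "\<dots> \<in> sets borel" by (rule measurable_sets[OF cell_measurable]) auto
    finally show ?thesis by simp
  qed
  have "(\<integral>\<^sup>+ x. g (cell r x) * indicator B (cell r x) \<partial>lborel) =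
      (\<integral>\<^sup>+ x. (\<Sum>z\<in>B. g z * indicator {x. cell r x = z} x) \<partial>lborel)"
  proof (intro nn_integral_cong)
    fix x
    have "(\<Sum>z\<in>B. g z * indicator {x. cell r x = z} x) = (\<Sum>z\<in>B. if z = cell r x then g z else 0)"
      by (intro sum.cong) (auto simp: indicator_def)
    also have "\<dots> = g (cell r x) * indicator B (cell r x)" using B by (simp add: indicator_def)
    finally show "g (cell r x) * indicator B (cell r x) = (\<Sum>z\<in>B. g z * indicator {x. cell r x = z} x)" ..
  qed
  also have "\<dots> = (\<Sum>z\<in>B. g z * ennreal ((1 / r) ^ CARD('d)))"
    using C r by (simp add: nn_integral_sum nn_integral_cmult_indicator emeasure_cell)
  also have "\<dots> = (\<Sum>z\<in>B. g z) * ennreal ((1 / r) ^ CARD('d))" by (simp add: sum_distrib_right)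
  finally have eq: "(\<integral>\<^sup>+ x. g (cell r x) * indicator B (cell r x) \<partial>lborel) = (\<Sum>z\<in>B. g z) * ennreal ((1 / r) ^ CARD('d))" .
  have "ennreal (r ^ CARD('d)) * ennreal ((1 / r) ^ CARD('d)) = 1"
    using r by (simp add: power_divide flip: ennreal_mult)
  then show ?thesis unfolding eq by (simp add: mult.left_commute mult.assoc[symmetric] mult.commute)
qed

section \<open>The distribution of the maximiser\<close>

definition pareto :: "real \<Rightarrow> real \<Rightarrow> real" where
  "pareto \<alpha> v = indicator {1..} v * (\<alpha> * v powr (- \<alpha> - 1))"

lemma pareto_measurable [measurable]: "pareto \<alpha> \<in> borel_measurable borel"
  unfolding pareto_def by measurable

context pareto_field
begin

text \<open>The given distribution function is about strict inequality; its continuity excludes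
  atoms.\<close>

lemma prob_le:
  assumes a: "a \<ge> 1" shows "prob {\<omega> \<in> space M. \<xi> z \<omega> \<le> a} = 1 - a powr (- \<alpha>)"
proof (rule antisym)
  have "1 - a powr (- \<alpha>) = prob {\<omega> \<in> space M. \<xi> z \<omega> < a}" using tail[OF a] by simp
  also have "\<dots> \<le> prob {\<omega> \<in> space M. \<xi> z \<omega> \<le> a}" by (intro finite_measure_mono) auto
  finally show "1 - a powr (- \<alpha>) \<le> prob {\<omega> \<in> space M. \<xi> z \<omega> \<le> a}" .
  have le: "prob {\<omega> \<in> space M. \<xi> z \<omega> \<le> a} \<le> 1 - (a + w) powr (- \<alpha>)" if "w > 0" for w
  proof -
    have "prob {\<omega> \<in> space M. \<xi> z \<omega> \<le> a} \<le> prob {\<omega> \<in> space M. \<xi> z \<omega> < a + w}"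
      using that by (intro finite_measure_mono) auto
    then show ?thesis using tail[of "a + w" z] a that by simp
  qed
  have "((\<lambda>w. 1 - (a + w) powr (- \<alpha>)) \<longlongrightarrow> 1 - (a + 0) powr (- \<alpha>)) (at_right 0)"
    using a by (intro tendsto_intros) auto
  then have lim: "((\<lambda>w. 1 - (a + w) powr (- \<alpha>)) \<longlongrightarrow> 1 - a powr (- \<alpha>)) (at_right 0)" by simp
  show "prob {\<omega> \<in> space M. \<xi> z \<omega> \<le> a} \<le> 1 - a powr (- \<alpha>)"
  proof (rule tendsto_lowerbound[OF lim])
    show "\<forall>\<^sub>F w in at_right 0. prob {\<omega> \<in> space M. \<xi> z \<omega> \<le> a} \<le> 1 - (a + w) powr (- \<alpha>)"
      using eventually_at_right_less[of "0::real"] by eventually_elim (rule le)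
  qed simp
qed

lemma distributed_\<xi>: "distributed M lborel (\<xi> z) (pareto \<alpha>)"
proof (rule distributedI_borel_atMost)
  show "(\<integral>\<^sup>+ v. pareto \<alpha> v * indicator {..a} v \<partial>lborel) = ennreal (if a \<ge> 1 then 1 - a powr (- \<alpha>) else 0)" for a
  proof (cases "a \<ge> 1")
    case True
    have "(\<integral>\<^sup>+ v. pareto \<alpha> v * indicator {..a} v \<partial>lborel) = (\<integral>\<^sup>+ v. ennreal (\<alpha> * v powr (- \<alpha> - 1)) * indicator {1..a} v \<partial>lborel)"
      by (intro nn_integral_cong) (auto simp: pareto_def indicator_def)
    also have "\<dots> = ennreal (- (a powr (- \<alpha>)) - (- (1 powr (- \<alpha>))))"
    proof (rule nn_integral_FTC_Icc[where F = "\<lambda>v. - (v powr (- \<alpha>))"])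
      fix v assume v: "v \<in> {1..a}"
      then show "0 \<le> \<alpha> * v powr (- \<alpha> - 1)" using \<alpha>_pos by simp
      have "((\<lambda>v. - (v powr (- \<alpha>))) has_real_derivative - (- \<alpha> * v powr (- \<alpha> - 1))) (at v)"
        using v by (intro DERIV_minus has_real_derivative_powr) auto
      then show "((\<lambda>v. - (v powr (- \<alpha>))) has_real_derivative \<alpha> * v powr (- \<alpha> - 1)) (at v)" by simp
    qed (use True in auto)
    finally show ?thesis using True by simp
  next
    case False
    have "(\<integral>\<^sup>+ v. pareto \<alpha> v * indicator {..a} v \<partial>lborel) = (\<integral>\<^sup>+ v. 0 \<partial>(lborel :: real measure))"
      by (intro nn_integral_cong) (use False in \<open>auto simp: pareto_def indicator_def\<close>)
    then show ?thesis using False by simp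
  qed
  show "emeasure M {\<omega> \<in> space M. \<xi> z \<omega> \<le> a} = ennreal (if a \<ge> 1 then 1 - a powr (- \<alpha>) else 0)" for a
  proof (cases "a \<ge> 1")
    case True then show ?thesis by (simp add: emeasure_eq_measure prob_le)
  next
    case False
    have "prob {\<omega> \<in> space M. \<xi> z \<omega> \<le> a} \<le> prob {\<omega> \<in> space M. \<xi> z \<omega> < 1}"
      using False by (intro finite_measure_mono) auto
    then have "prob {\<omega> \<in> space M. \<xi> z \<omega> \<le> a} = 0" using tail[of 1 z] measure_nonneg[of M] by (simp add: order_antisym)
    then show ?thesis using False by (simp add: emeasure_eq_measure)
  qed
qed (use \<alpha>_pos in \<open>auto simp: pareto_def\<close>)

text \<open>The joint law on \<open>B\<close> is a product measure. Integrate first over the other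
  sites with the value v at z fixed: the strict inequalities then concern independent
  variables.\<close>

lemma emeasure_strict_max:
  assumes B: "finite B" "z \<in> B"
  shows "emeasure M {\<omega> \<in> space M. \<forall>x\<in>B - {z}. psi c x (\<xi> x \<omega>) < psi c z (\<xi> z \<omega>)} =
    (\<integral>\<^sup>+ v. ennreal (pareto \<alpha> v) * (\<Prod>x\<in>B - {z}. emeasure M {\<omega> \<in> space M. psi c x (\<xi> x \<omega>) < psi c z v}) \<partial>lborel)"
proof -
  let ?I = "B - {z}"
  define D where "D = (\<lambda>x. distr M borel (\<xi> x))"
  have D_prob: "prob_space (D x)" for x unfolding D_def by (intro prob_space_distr) auto
  interpret D: product_prob_space D
    by (rule product_prob_spaceI) (rule D_prob)
  have D_sets [measurable_cong]: "sets (D x) = sets borel" for x by (simp add: D_def)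
  have ins: "insert z ?I = B" using B by auto
  have Bne: "B \<noteq> {}" using B by auto
  have indepB: "indep_vars (\<lambda>_. borel) \<xi> B" using indep_vars_subset[OF indep] by simp
  have PiM: "distr M (\<Pi>\<^sub>M i\<in>B. borel) (\<lambda>\<omega>. \<lambda>i\<in>B. \<xi> i \<omega>) = (\<Pi>\<^sub>M i\<in>B. D i)"
    using indepB indep_vars_iff_distr_eq_PiM'[OF Bne, where M' = "\<lambda>_. borel" and X = \<xi>] by (simp add: D_def)
  define S where "S = {f \<in> space (\<Pi>\<^sub>M i\<in>B. borel :: real measure). \<forall>x\<in>?I. psi c x (f x) < psi c z (f z)}"
  have S_meas: "S \<in> sets (\<Pi>\<^sub>M i\<in>B. borel)"
    unfolding S_def using B by measurable
  have S_meas': "S \<in> sets (\<Pi>\<^sub>M i\<in>B. D i)"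
    using S_meas sets_PiM_cong[OF refl, of B "\<lambda>_. borel :: real measure" D] D_sets by simp
  have "{\<omega> \<in> space M. \<forall>x\<in>?I. psi c x (\<xi> x \<omega>) < psi c z (\<xi> z \<omega>)} = (\<lambda>\<omega>. \<lambda>i\<in>B. \<xi> i \<omega>) -` S \<inter> space M"
    using B by (auto simp: S_def space_PiM)
  then have "emeasure M {\<omega> \<in> space M. \<forall>x\<in>?I. psi c x (\<xi> x \<omega>) < psi c z (\<xi> z \<omega>)} =
     emeasure (distr M (\<Pi>\<^sub>M i\<in>B. borel) (\<lambda>\<omega>. \<lambda>i\<in>B. \<xi> i \<omega>)) S"
    using S_meas by (subst emeasure_distr) (auto intro!: measurable_restrict)
  also have "\<dots> = (\<integral>\<^sup>+ f. indicator S f \<partial>PiM (insert z ?I) D)"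
    unfolding PiM ins using S_meas' by simp
  also have "\<dots> = (\<integral>\<^sup>+ v. \<integral>\<^sup>+ f. indicator S (f(z := v)) \<partial>PiM ?I D \<partial>D z)"
  proof (rule D.product_nn_integral_insert_rev)
    show "indicator S \<in> borel_measurable (PiM (insert z ?I) D)"
      unfolding ins using S_meas' by (rule borel_measurable_indicator)
  qed (use B in auto)
  also have "\<dots> = (\<integral>\<^sup>+ v. (\<Prod>x\<in>?I. emeasure M {\<omega> \<in> space M. psi c x (\<xi> x \<omega>) < psi c z v}) \<partial>D z)"
  proof (intro nn_integral_cong)
    fix v
    have A: "{y. psi c x y < psi c z v} \<in> sets borel" for x by measurable
    have "(\<integral>\<^sup>+ f. indicator S (f(z := v)) \<partial>PiM ?I D) = (\<integral>\<^sup>+ f. indicator (Pi\<^sub>E ?I (\<lambda>x. {y. psi c x y < psi c z v})) f \<partial>PiM ?I D)"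
    proof (intro nn_integral_cong)
      fix f assume "f \<in> space (PiM ?I D)"
      then have "f \<in> extensional ?I" by (simp add: space_PiM PiE_iff)
      then have "f(z := v) \<in> S \<longleftrightarrow> f \<in> Pi\<^sub>E ?I (\<lambda>x. {y. psi c x y < psi c z v})"
        using B by (auto simp: S_def space_PiM PiE_iff extensional_def)
      then show "indicator S (f(z := v)) = (indicator (Pi\<^sub>E ?I (\<lambda>x. {y. psi c x y < psi c z v})) f :: ennreal)"
        by (simp add: indicator_def)
    qed
    also have "\<dots> = emeasure (PiM ?I D) (Pi\<^sub>E ?I (\<lambda>x. {y. psi c x y < psi c z v}))"
      using B A D_sets by (intro nn_integral_indicator sets_PiM_I_finite) auto
    also have "\<dots> = (\<Prod>x\<in>?I. emeasure (D x) {y. psi c x y < psi c z v})"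
      using B A D_sets by (intro D.emeasure_PiM) auto
    also have "\<dots> = (\<Prod>x\<in>?I. emeasure M {\<omega> \<in> space M. psi c x (\<xi> x \<omega>) < psi c z v})"
      using A by (intro prod.cong refl) (auto simp: D_def emeasure_distr intro!: arg_cong2[where f = emeasure])
    finally show "(\<integral>\<^sup>+ f. indicator S (f(z := v)) \<partial>PiM ?I D) = \<dots>" .
  qed
  also have "\<dots> = (\<integral>\<^sup>+ v. ennreal (pareto \<alpha> v) * (\<Prod>x\<in>?I. emeasure M {\<omega> \<in> space M. psi c x (\<xi> x \<omega>) < psi c z v}) \<partial>lborel)"
  proof -
    define h where "h = (\<lambda>v. \<Prod>x\<in>?I. emeasure M {\<omega> \<in> space M. psi c x (\<xi> x \<omega>) < psi c z v})"
    have cdf: "(\<lambda>y::real. emeasure M {\<omega> \<in> space M. psi c x (\<xi> x \<omega>) < y}) \<in> borel_measurable borel" for x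
      unfolding emeasure_eq_measure
      by (intro measurable_compose[OF _ measurable_ennreal] borel_measurable_mono monoI finite_measure_mono) auto
    have hm: "h \<in> borel_measurable borel"
      unfolding h_def by (intro borel_measurable_prod_ennreal measurable_compose[OF psi_measurable cdf])
    then have "(\<integral>\<^sup>+ v. h v \<partial>D z) = (\<integral>\<^sup>+ \<omega>. h (\<xi> z \<omega>) \<partial>M)"
      unfolding D_def by (intro nn_integral_distr) auto
    also have "\<dots> = (\<integral>\<^sup>+ v. ennreal (pareto \<alpha> v) * h v \<partial>lborel)"
      using distributed_nn_integral[OF distributed_\<xi>[of z], of h] hm by simp
    finally show ?thesis by (simp only: h_def)
  qed
  finally show ?thesis .
qed

text \<open>\<open>psi \<ge> y\<close> forces \<open>v \<ge> y\<close> and hence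
  \<open>ln v \<ge> ln y\<close>; with the linear bound on the entropy the distance term is at least
  \<open>c * nrm z * (ln y - d)\<close>, d being the dimension. The second bound is uniform in
  z.\<close>

lemma prob_psi_ge_le:
  fixes c y :: real
  assumes c: "c \<ge> 0" and y: "y \<ge> exp (real CARD('d))"
  shows "prob {\<omega> \<in> space M. psi c z (\<xi> z \<omega>) \<ge> y} \<le> (y + c * nrm z * (ln y - CARD('d))) powr (- \<alpha>)"
    "prob {\<omega> \<in> space M. psi c z (\<xi> z \<omega>) \<ge> y} \<le> y powr (- \<alpha>)"
proof -
  let ?d = "real CARD('d)"
  have y1: "y \<ge> 1" "y > 0" using y one_le_exp_iff[of ?d] by linarith+
  have lny: "ln y \<ge> ?d" using y y1 by (simp add: ln_ge_iff)
  have ge: "v \<ge> y + c * nrm z * (ln y - ?d)" if "psi c z v \<ge> y" for v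
  proof -
    have vy: "v \<ge> y" using that psi_le[OF c, of z v] by simp
    have "nrm z * (ln y - ?d) \<le> nrm z * ln v - path_entropy z"
    proof -
      have "nrm z * ln y \<le> nrm z * ln v" using vy y1 by (intro mult_left_mono) auto
      moreover have "path_entropy z \<le> ?d * nrm z" using path_entropy_le[of z] by simp
      ultimately show ?thesis by (simp add: algebra_simps)
    qed
    then have "c * (nrm z * (ln y - ?d)) \<le> c * max 0 (nrm z * ln v - path_entropy z)"
      using c by (intro mult_left_mono) auto
    then show ?thesis using that by (simp add: psi_def mult.assoc)
  qed
  have nn: "c * nrm z * (ln y - ?d) \<ge> 0" using c lny by simp
  have "prob {\<omega> \<in> space M. psi c z (\<xi> z \<omega>) \<ge> y} \<le> prob {\<omega> \<in> space M. \<xi> z \<omega> \<ge> y + c * nrm z * (ln y - ?d)}"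
    using ge by (intro finite_measure_mono) auto
  also have "\<dots> = (y + c * nrm z * (ln y - ?d)) powr (- \<alpha>)"
    using nn y1 by (intro prob_ge) linarith
  finally show 1: "prob {\<omega> \<in> space M. psi c z (\<xi> z \<omega>) \<ge> y} \<le> (y + c * nrm z * (ln y - ?d)) powr (- \<alpha>)" .
  also have "\<dots> \<le> y powr (- \<alpha>)" using nn y1 \<alpha>_pos by (intro powr_mono2') auto
  finally show "prob {\<omega> \<in> space M. psi c z (\<xi> z \<omega>) \<ge> y} \<le> y powr (- \<alpha>)" .
qed

text \<open>Compare the sum with an integral over unit cells. A point and its cell differ by at most
  1 in each coordinate, thus by at most the dimension in l1-norm, which is compensated by lowering
  y.\<close>

lemma sum_prob_psi_ge_le:
  fixes c y :: real
  assumes c: "c > 0" and y: "y > exp (real CARD('d))" and B: "finite B"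
    and \<sigma>: "y - c * CARD('d) * (ln y - CARD('d)) > 0"
  shows "(\<Sum>z\<in>B. prob {\<omega> \<in> space M. psi c z (\<xi> z \<omega>) \<ge> y}) \<le>
    (2 / (c * (ln y - CARD('d)))) ^ CARD('d) * (Gamma (\<alpha> - CARD('d)) / Gamma \<alpha>) *
    (y - c * CARD('d) * (ln y - CARD('d))) powr (CARD('d) - \<alpha>)"
proof -
  let ?d = "real CARD('d)"
  define k where "k = c * (ln y - ?d)"
  define \<sigma>' where "\<sigma>' = y - c * ?d * (ln y - ?d)"
  have y0: "y > 0" using y exp_gt_zero[of ?d] by linarith
  have "ln (exp ?d) < ln y" using y y0 by (subst ln_less_cancel_iff) auto
  then have k: "k > 0" using c by (simp add: k_def)
  have "ennreal (\<Sum>z\<in>B. prob {\<omega> \<in> space M. psi c z (\<xi> z \<omega>) \<ge> y}) = (\<Sum>z\<in>B. ennreal (prob {\<omega> \<in> space M. psi c z (\<xi> z \<omega>) \<ge> y}))"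
    by (simp add: sum_ennreal)
  also have "\<dots> \<le> (\<Sum>z\<in>B. ennreal ((y + k * nrm z) powr (- \<alpha>)))"
  proof (intro sum_mono ennreal_leI)
    fix z :: "int ^ 'd"
    have "c * nrm z * (ln y - ?d) = k * nrm z" by (simp add: k_def)
    with prob_psi_ge_le(1)[of c y z] c y
    show "prob {\<omega> \<in> space M. psi c z (\<xi> z \<omega>) \<ge> y} \<le> (y + k * nrm z) powr (- \<alpha>)"
      by (simp only: less_imp_le)
  qed
  also have "\<dots> = ennreal (1 ^ CARD('d)) * (\<integral>\<^sup>+ x. ennreal ((y + k * nrm (cell 1 x)) powr (- \<alpha>)) * indicator B (cell 1 x) \<partial>lborel)"
    using sum_eq_nn_integral_cell[OF zero_less_one B, of "\<lambda>z. ennreal ((y + k * nrm z) powr (- \<alpha>))"] by simp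
  also have "\<dots> \<le> (\<integral>\<^sup>+ x. ennreal ((\<sigma>' + k * l1_norm (x :: real ^ 'd)) powr (- \<alpha>)) \<partial>lborel)"
  proof -
    have "ennreal ((y + k * nrm (cell 1 x)) powr (- \<alpha>)) * indicator B (cell 1 x) \<le> ennreal ((\<sigma>' + k * l1_norm x) powr (- \<alpha>))" for x :: "real ^ 'd"
    proof -
      have "l1_norm x \<le> real (nrm (cell 1 x)) + ?d"
      proof -
        have "l1_norm x \<le> (\<Sum>i\<in>UNIV. \<bar>real_of_int (cell 1 x $ i)\<bar> + 1)"
          unfolding l1_norm_def
        proof (rule sum_mono)
          fix i
          have "real_of_int (cell 1 x $ i) \<le> x $ i" "x $ i < real_of_int (cell 1 x $ i) + 1"
            using cell_eq_iff[of 1 x "cell 1 x"] by auto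
          then show "\<bar>x $ i\<bar> \<le> \<bar>real_of_int (cell 1 x $ i)\<bar> + 1" by linarith
        qed
        also have "\<dots> = real (nrm (cell 1 x)) + ?d" by (simp add: sum.distrib nrm_def)
        finally show ?thesis .
      qed
      then have "k * l1_norm x \<le> k * (real (nrm (cell 1 x)) + ?d)" using k by (intro mult_left_mono) auto
      then have "\<sigma>' + k * l1_norm x \<le> y + k * nrm (cell 1 x)" by (simp add: \<sigma>'_def k_def algebra_simps)
      moreover have "\<sigma>' + k * l1_norm x > 0" using \<sigma> k by (intro add_pos_nonneg) (auto simp: \<sigma>'_def)
      ultimately have "(y + k * nrm (cell 1 x)) powr (- \<alpha>) \<le> (\<sigma>' + k * l1_norm x) powr (- \<alpha>)"
        using \<alpha>_pos by (intro powr_mono2') auto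
      then show ?thesis by (auto simp: indicator_def intro: ennreal_leI)
    qed
    then show ?thesis by (simp add: nn_integral_mono)
  qed
  also have "\<dots> = ennreal ((2 / k) ^ CARD('d) * (Gamma (\<alpha> - ?d) / Gamma \<alpha>) * \<sigma>' powr (?d - \<alpha>))"
    using \<sigma> k \<alpha> by (intro nn_integral_l1_powr) (auto simp: \<sigma>'_def)
  finally show ?thesis
    using k \<alpha> \<alpha>_pos by (subst (asm) ennreal_le_iff) (auto simp: k_def \<sigma>'_def intro!: mult_nonneg_nonneg divide_nonneg_nonneg Gamma_real_nonneg)
qed

text \<open>If P is at most \<eta> < 1, then \<open>1 - P \<ge> exp (- (P / (1 - P))) \<ge> exp (-
  (P / (1 - \<eta>)))\<close>; the uniform \<eta> makes the exponents add up to the sum just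
  bounded.\<close>

lemma prod_prob_psi_less_ge:
  fixes c y :: real
  assumes c: "c > 0" and y: "y > exp (real CARD('d))" and B: "finite B"
    and \<sigma>: "y - c * CARD('d) * (ln y - CARD('d)) > 0"
  shows "exp (- ((2 / (c * (ln y - CARD('d)))) ^ CARD('d) * (Gamma (\<alpha> - CARD('d)) / Gamma \<alpha>) *
    (y - c * CARD('d) * (ln y - CARD('d))) powr (CARD('d) - \<alpha>) / (1 - y powr (- \<alpha>))))
    \<le> (\<Prod>z\<in>B. prob {\<omega> \<in> space M. psi c z (\<xi> z \<omega>) < y})"
proof -
  let ?P = "\<lambda>z. prob {\<omega> \<in> space M. psi c z (\<xi> z \<omega>) \<ge> y}"
  define \<eta> where "\<eta> = y powr (- \<alpha>)"
  have y1: "y > 1" using y one_le_exp_iff[of "real CARD('d)"] by linarith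
  have \<eta>: "\<eta> < 1" "\<eta> \<ge> 0" unfolding \<eta>_def using y1 \<alpha>_pos by (auto intro: powr_less_one)
  have P_le: "?P z \<le> \<eta>" for z unfolding \<eta>_def using prob_psi_ge_le(2)[of c y z] c y by simp
  have "exp (- ((\<Sum>z\<in>B. ?P z) / (1 - \<eta>))) = (\<Prod>z\<in>B. exp (- (?P z / (1 - \<eta>))))"
    using B by (simp add: exp_sum sum_divide_distrib flip: sum_negf)
  also have "\<dots> \<le> (\<Prod>z\<in>B. prob {\<omega> \<in> space M. psi c z (\<xi> z \<omega>) < y})"
  proof (intro prod_mono conjI)
    fix z
    have "{\<omega> \<in> space M. psi c z (\<xi> z \<omega>) < y} = space M - {\<omega> \<in> space M. psi c z (\<xi> z \<omega>) \<ge> y}" by auto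
    then have eq: "prob {\<omega> \<in> space M. psi c z (\<xi> z \<omega>) < y} = 1 - ?P z"
      by (simp add: prob_compl)
    have P1: "1 - ?P z > 0" using P_le[of z] \<eta> by linarith
    have "ln (1 / (1 - ?P z)) \<le> 1 / (1 - ?P z) - 1" using P1 by (intro ln_le_minus_one) auto
    also have "\<dots> = ?P z / (1 - ?P z)" using P1 by (simp add: field_simps)
    also have "\<dots> \<le> ?P z / (1 - \<eta>)" using P_le[of z] \<eta> P1 by (intro divide_left_mono mult_pos_pos) auto
    finally have "- (?P z / (1 - \<eta>)) \<le> ln (1 - ?P z)" using P1 by (simp add: ln_divide_pos)
    then have "exp (- (?P z / (1 - \<eta>))) \<le> exp (ln (1 - ?P z))" by simp
    then show "exp (- (?P z / (1 - \<eta>))) \<le> prob {\<omega> \<in> space M. psi c z (\<xi> z \<omega>) < y}"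
      using P1 eq by simp
  qed simp
  finally have 1: "exp (- ((\<Sum>z\<in>B. ?P z) / (1 - \<eta>))) \<le> (\<Prod>z\<in>B. prob {\<omega> \<in> space M. psi c z (\<xi> z \<omega>) < y})" .
  have "(\<Sum>z\<in>B. ?P z) / (1 - \<eta>) \<le> (2 / (c * (ln y - CARD('d)))) ^ CARD('d) * (Gamma (\<alpha> - CARD('d)) / Gamma \<alpha>) *
    (y - c * CARD('d) * (ln y - CARD('d))) powr (CARD('d) - \<alpha>) / (1 - \<eta>)"
    using \<eta> by (intro divide_right_mono sum_prob_psi_ge_le assms) auto
  then show ?thesis unfolding \<eta>_def[symmetric] by (intro order_trans[OF _ 1]) simp
qed

end

section \<open>The limiting density\<close>

lemma lattice_embed_l1: "l1_norm (lattice_embed z) = real (nrm z)"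
  by (simp add: l1_norm_def lattice_embed_def nrm_def)

lemma tendsto_cell:
  fixes x :: "real ^ 'd::finite"
  assumes "filterlim r at_top F"
  shows "((\<lambda>t. (1 / r t) *\<^sub>R lattice_embed (cell (r t) x)) \<longlongrightarrow> x) F"
proof (rule vec_tendstoI)
  fix i
  have r0: "\<forall>\<^sub>F t in F. r t > 0" using assms by (simp add: filterlim_at_top_dense)
  have inv: "((\<lambda>t. 1 / r t) \<longlongrightarrow> 0) F"
    using tendsto_inverse_0_at_top[OF assms] by (simp add: inverse_eq_divide)
  have "((\<lambda>t. x $ i - 1 / r t) \<longlongrightarrow> x $ i - 0) F" by (intro tendsto_intros inv)
  then have lower: "((\<lambda>t. x $ i - 1 / r t) \<longlongrightarrow> x $ i) F" by simp
  have comp: "((1 / r t) *\<^sub>R lattice_embed (cell (r t) x)) $ i = of_int \<lfloor>r t * x $ i\<rfloor> / r t" for t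
    by (simp add: lattice_embed_def cell_def)
  show "((\<lambda>t. ((1 / r t) *\<^sub>R lattice_embed (cell (r t) x)) $ i) \<longlongrightarrow> x $ i) F"
    unfolding comp
  proof (rule tendsto_sandwich[OF _ _ lower tendsto_const])
    show "\<forall>\<^sub>F t in F. x $ i - 1 / r t \<le> of_int \<lfloor>r t * x $ i\<rfloor> / r t"
      using r0
    proof eventually_elim
      case (elim t)
      have "r t * x $ i - 1 \<le> of_int \<lfloor>r t * x $ i\<rfloor>" by linarith
      then have "(r t * x $ i - 1) / r t \<le> of_int \<lfloor>r t * x $ i\<rfloor> / r t" using elim by (intro divide_right_mono) auto
      then show ?case using elim by (simp add: diff_divide_distrib)
    qed
    show "\<forall>\<^sub>F t in F. of_int \<lfloor>r t * x $ i\<rfloor> / r t \<le> x $ i"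
      using r0
    proof eventually_elim
      case (elim t)
      have "of_int \<lfloor>r t * x $ i\<rfloor> / r t \<le> (r t * x $ i) / r t" using elim by (intro divide_right_mono) auto
      then show ?case using elim by simp
    qed
  qed
qed

lemma tendsto_l1_norm:
  fixes g :: "'b \<Rightarrow> real ^ 'd::finite"
  shows "(g \<longlongrightarrow> x) F \<Longrightarrow> ((\<lambda>t. l1_norm (g t)) \<longlongrightarrow> l1_norm x) F"
  unfolding l1_norm_def by (intro tendsto_intros)

section \<open>Total mass of the limiting density\<close>

context pam_params
begin

text \<open>The constant of the theorem with the Beta function written as a Gamma quotient; this is
  the form produced by \<open>nn_integral_l1_powr\<close>.\<close>

definition \<Theta> :: real where
  "\<Theta> = (2 / q) ^ CARD('d) * (Gamma (\<alpha> - d) / Gamma \<alpha>)"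

definition kern :: "real ^ 'd \<Rightarrow> real \<Rightarrow> real" where
  "kern x y = indicator {0<..} y * (exp (- \<Theta> * y powr (d - \<alpha>)) / (y + q * l1_norm x) powr (\<alpha> + 1))"

lemma q_eq: "q = d / (\<alpha> - d)"
  using pq \<alpha>_gt_d by (simp add: field_simps)

lemma pam_q_eq: "pam_q CARD('d) \<alpha> = q"
  using q_eq by (simp add: pam_q_def d_eq)

lemma pam_theta_eq: "pam_theta CARD('d) \<alpha> = \<Theta>"
proof -
  have "Gamma d = fact (CARD('d) - 1)"
    using Gamma_fact[of "CARD('d) - 1", where 'a = real] by (simp add: d_eq of_nat_diff Suc_leI)
  then show ?thesis
    by (simp add: pam_theta_def pam_q_eq \<Theta>_def Beta_def power_divide flip: d_eq)
qed

lemma \<Theta>_pos: "\<Theta> > 0"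
  using pq \<alpha>_gt_d \<alpha>_pos by (auto simp: \<Theta>_def intro!: mult_pos_pos divide_pos_pos Gamma_real_pos zero_less_power)

lemma kern_measurable [measurable]: "case_prod kern \<in> borel_measurable (borel \<Otimes>\<^sub>M borel)"
  unfolding kern_def by measurable

lemma kern_nonneg: "kern x y \<ge> 0" by (simp add: kern_def)

text \<open>The integrand is the derivative of
  \<open>exp (- \<Theta> * y powr (d - \<alpha>))\<close>, which tends to 0 at 0 and to 1 at
  infinity. As the power is singular at 0, the half-line is exhausted by intervals bounded away from
  0.\<close>

lemma nn_integral_stretched:
  "(\<integral>\<^sup>+ y. ennreal ((\<alpha> - d) * \<Theta> * y powr (d - \<alpha> - 1) * exp (- \<Theta> * y powr (d - \<alpha>))) * indicator {0<..} y \<partial>lborel) = 1"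
proof -
  define f where "f = (\<lambda>y. ennreal ((\<alpha> - d) * \<Theta> * y powr (d - \<alpha> - 1) * exp (- \<Theta> * y powr (d - \<alpha>))))"
  define A where "A = (\<lambda>n::nat. {1 / real (Suc n)..})"
  have [measurable]: "f \<in> borel_measurable borel" unfolding f_def by measurable
  have int: "(\<integral>\<^sup>+ y. f y * indicator (A n) y \<partial>lborel) = ennreal (1 - exp (- \<Theta> * (1 / real (Suc n)) powr (d - \<alpha>)))" for n
  proof -
    let ?F = "\<lambda>y. exp (- \<Theta> * y powr (d - \<alpha>))"
    have "(?F \<longlongrightarrow> exp (- \<Theta> * 0)) at_top"
      using \<alpha>_gt_d by (intro tendsto_intros tendsto_neg_powr filterlim_ident) auto
    then have lim: "(?F \<longlongrightarrow> 1) at_top" by simp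
    show ?thesis unfolding f_def A_def
    proof (rule nn_integral_FTC_atLeast[OF _ _ _ lim])
      fix y :: real assume "1 / real (Suc n) \<le> y"
      then have y: "y > 0" by (smt (verit) divide_pos_pos of_nat_0_less_iff zero_less_Suc)
      show "0 \<le> (\<alpha> - d) * \<Theta> * y powr (d - \<alpha> - 1) * exp (- \<Theta> * y powr (d - \<alpha>))"
        using \<alpha>_gt_d \<Theta>_pos by simp
      have "(?F has_real_derivative exp (- \<Theta> * y powr (d - \<alpha>)) * (- \<Theta> * ((d - \<alpha>) * y powr (d - \<alpha> - 1)))) (at y)"
        using y by (intro DERIV_chain2[OF DERIV_exp] DERIV_cmult has_real_derivative_powr)
      then show "(?F has_real_derivative (\<alpha> - d) * \<Theta> * y powr (d - \<alpha> - 1) * exp (- \<Theta> * y powr (d - \<alpha>))) (at y)"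
        by (simp add: algebra_simps)
    qed measurable
  qed
  have "(\<lambda>n. emeasure (density lborel f) (A n)) \<longlonglongrightarrow> emeasure (density lborel f) (\<Union>n. A n)"
    by (intro Lim_emeasure_incseq) (auto simp: A_def incseq_def frac_le)
  moreover have "(\<Union>n. A n) = {0<..}"
  proof (intro equalityI subsetI)
    fix y :: real assume "y \<in> {0<..}"
    then obtain n where "1 / real (Suc n) < y" using nat_approx_posE[of y] by (auto simp: of_nat_Suc)
    then show "y \<in> (\<Union>n. A n)" by (auto simp: A_def intro!: exI[of _ n])
  next
    fix y assume "y \<in> (\<Union>n. A n)"
    then obtain n where "1 / real (Suc n) \<le> y" by (auto simp: A_def)
    moreover have "1 / real (Suc n) > 0" by simp
    ultimately show "y \<in> {0<..}" by (simp only: greaterThan_iff)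
  qed
  moreover have "emeasure (density lborel f) (A n) = ennreal (1 - exp (- \<Theta> * (1 / real (Suc n)) powr (d - \<alpha>)))" for n
    using int[of n] by (subst emeasure_density) (simp_all add: A_def)
  moreover have "emeasure (density lborel f) {0<..} = (\<integral>\<^sup>+ y. f y * indicator {0<..} y \<partial>lborel)"
    by (subst emeasure_density) simp_all
  ultimately have 1: "(\<lambda>n. ennreal (1 - exp (- \<Theta> * (1 / real (Suc n)) powr (d - \<alpha>)))) \<longlonglongrightarrow> (\<integral>\<^sup>+ y. f y * indicator {0<..} y \<partial>lborel)"
    by (simp only:)
  have "(\<lambda>n. ennreal (1 - exp (- \<Theta> * (1 / real (Suc n)) powr (d - \<alpha>)))) \<longlonglongrightarrow> ennreal (1 - 0)"
  proof (intro tendsto_ennrealI tendsto_diff tendsto_const)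
    have "(\<lambda>n. exp (- \<Theta> * (1 / (real n + 1)) powr (d - \<alpha>))) \<longlonglongrightarrow> 0"
      using \<Theta>_pos \<alpha>_gt_d by real_asymp
    then show "(\<lambda>n. exp (- \<Theta> * (1 / real (Suc n)) powr (d - \<alpha>))) \<longlonglongrightarrow> 0" by (simp add: add.commute)
  qed
  then show ?thesis using LIMSEQ_unique[OF 1] by (simp add: f_def)
qed

text \<open>Integrating over x first, with exponent \<open>\<alpha> + 1\<close>, leaves a function
  of y: by the functional equation of Gamma it is the density of the distribution function
  \<open>exp (- \<Theta> * y powr (d - \<alpha>))\<close>, the limit law of the rescaled maximum of
  \<open>psi\<close>.\<close>

lemma nn_integral_kern: "(\<integral>\<^sup>+ x. \<integral>\<^sup>+ y. ennreal (\<alpha> * kern x y) \<partial>lborel \<partial>lborel) = 1"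
proof -
  have "(\<integral>\<^sup>+ x. \<integral>\<^sup>+ y. ennreal (\<alpha> * kern x y) \<partial>lborel \<partial>lborel) = (\<integral>\<^sup>+ y. \<integral>\<^sup>+ x. ennreal (\<alpha> * kern x y) \<partial>lborel \<partial>lborel)"
    by (intro lborel_pair.Fubini') measurable
  also have "\<dots> = (\<integral>\<^sup>+ y. ennreal ((\<alpha> - d) * \<Theta> * y powr (d - \<alpha> - 1) * exp (- \<Theta> * y powr (d - \<alpha>))) * indicator {0<..} y \<partial>lborel)"
  proof (intro nn_integral_cong)
    fix y :: real
    show "(\<integral>\<^sup>+ x. ennreal (\<alpha> * kern x y) \<partial>lborel) = ennreal ((\<alpha> - d) * \<Theta> * y powr (d - \<alpha> - 1) * exp (- \<Theta> * y powr (d - \<alpha>))) * indicator {0<..} y"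
    proof (cases "y > 0")
      case True
      let ?E = "exp (- \<Theta> * y powr (d - \<alpha>))"
      have "(\<integral>\<^sup>+ x. ennreal (\<alpha> * kern x y) \<partial>lborel) = (\<integral>\<^sup>+ x. ennreal (\<alpha> * ?E) * ennreal ((y + q * l1_norm (x :: real ^ 'd)) powr (- (\<alpha> + 1))) \<partial>lborel)"
      proof (intro nn_integral_cong)
        fix x :: "real ^ 'd"
        have "\<alpha> * kern x y = (\<alpha> * ?E) * (y + q * l1_norm x) powr (- (\<alpha> + 1))"
          unfolding powr_minus using True by (simp add: kern_def divide_inverse)
        then show "ennreal (\<alpha> * kern x y) = ennreal (\<alpha> * ?E) * ennreal ((y + q * l1_norm x) powr (- (\<alpha> + 1)))"
          using ennreal_mult[of "\<alpha> * ?E" "(y + q * l1_norm x) powr (- (\<alpha> + 1))"] \<alpha>_pos by (simp add: mult.assoc)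
      qed
      also have "\<dots> = ennreal (\<alpha> * ?E) * ennreal ((2 / q) ^ CARD('d) * (Gamma ((\<alpha> + 1) - d) / Gamma (\<alpha> + 1)) * y powr (d - (\<alpha> + 1)))"
      proof -
        have "real CARD('d) < \<alpha> + 1" using \<alpha> by simp
        from nn_integral_l1_powr[OF True pq(2) this]
        have I: "(\<integral>\<^sup>+ x. ennreal ((y + q * l1_norm (x :: real ^ 'd)) powr (- (\<alpha> + 1))) \<partial>lborel) =
            ennreal ((2 / q) ^ CARD('d) * (Gamma ((\<alpha> + 1) - d) / Gamma (\<alpha> + 1)) * y powr (d - (\<alpha> + 1)))"
          unfolding d_eq .
        have "(\<integral>\<^sup>+ x. ennreal (\<alpha> * ?E) * ennreal ((y + q * l1_norm (x :: real ^ 'd)) powr (- (\<alpha> + 1))) \<partial>lborel)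
            = ennreal (\<alpha> * ?E) * (\<integral>\<^sup>+ x. ennreal ((y + q * l1_norm (x :: real ^ 'd)) powr (- (\<alpha> + 1))) \<partial>lborel)"
          by (rule nn_integral_cmult) measurable
        then show ?thesis by (simp only: I)
      qed
      also have "\<dots> = ennreal ((\<alpha> * ?E) * ((2 / q) ^ CARD('d) * (Gamma ((\<alpha> + 1) - d) / Gamma (\<alpha> + 1)) * y powr (d - (\<alpha> + 1))))"
        using \<alpha>_pos by (intro ennreal_mult'[symmetric]) simp
      also have "(\<alpha> * ?E) * ((2 / q) ^ CARD('d) * (Gamma ((\<alpha> + 1) - d) / Gamma (\<alpha> + 1)) * y powr (d - (\<alpha> + 1))) =
          (\<alpha> - d) * \<Theta> * y powr (d - \<alpha> - 1) * ?E"
      proof -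
        have "Gamma (\<alpha> + 1) = \<alpha> * Gamma \<alpha>" using \<alpha>_pos by (intro Gamma_plus1) (auto elim: nonpos_Ints_cases)
        moreover have "Gamma ((\<alpha> - d) + 1) = (\<alpha> - d) * Gamma (\<alpha> - d)"
          using \<alpha>_gt_d by (intro Gamma_plus1) (auto elim: nonpos_Ints_cases)
        moreover have "(\<alpha> + 1) - d = (\<alpha> - d) + 1" "d - (\<alpha> + 1) = d - \<alpha> - 1" by simp_all
        ultimately show ?thesis using \<alpha>_pos by (simp only: \<Theta>_def) simp
      qed
      finally show ?thesis using True by simp
    qed (simp add: kern_def)
  qed
  also have "\<dots> = 1" by (rule nn_integral_stretched)
  finally show ?thesis .
qed

lemma pam_density_eq: "pam_density \<alpha> (x :: real ^ 'd) = \<alpha> * (\<integral> y. kern x y \<partial>lborel)"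
  by (simp add: pam_density_def pam_theta_eq pam_q_eq kern_def set_lebesgue_integral_def flip: d_eq)

lemma pam_density_measurable [measurable]: "(pam_density \<alpha> :: real ^ 'd \<Rightarrow> real) \<in> borel_measurable borel"
proof -
  have "(\<lambda>x. \<integral> y. kern x y \<partial>lborel) \<in> borel_measurable borel"
    by (rule lborel.borel_measurable_lebesgue_integral) simp
  then show ?thesis unfolding pam_density_eq[abs_def] by measurable
qed

text \<open>A Bochner integral defaults to 0 without integrability. The finite total mass guarantees
  integrability for almost every x, which is enough inside an integral over x.\<close>

lemma AE_pam_density: "AE x in lborel. (\<integral>\<^sup>+ y. ennreal (\<alpha> * kern x y) \<partial>lborel) = ennreal (pam_density \<alpha> (x :: real ^ 'd))"
proof -
  have "AE x in lborel. (\<integral>\<^sup>+ y. ennreal (\<alpha> * kern (x :: real ^ 'd) y) \<partial>lborel) \<noteq> \<infinity>"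
    by (rule nn_integral_noteq_infinite) (auto simp: nn_integral_kern)
  then show ?thesis
  proof eventually_elim
    case (elim x)
    have "(\<integral>\<^sup>+ y. ennreal (\<alpha> * kern x y) \<partial>lborel) = ennreal (\<integral> y. \<alpha> * kern x y \<partial>lborel)"
    proof (rule nn_integral_eq_integral)
      show "integrable lborel (\<lambda>y. \<alpha> * kern x y)"
        using elim \<alpha>_pos by (intro integrableI_nonneg) (auto simp: kern_nonneg top.not_eq_extremum)
    qed (use \<alpha>_pos in \<open>auto simp: kern_nonneg\<close>)
    also have "(\<integral> y. \<alpha> * kern x y \<partial>lborel) = pam_density \<alpha> x"
      by (simp only: pam_density_eq integral_mult_right_zero)
    finally show ?case .
  qed
qed

lemma prob_space_pam_density: "prob_space (density lborel (\<lambda>x :: real ^ 'd. ennreal (pam_density \<alpha> x)))"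
proof (rule prob_spaceI)
  have "emeasure (density lborel (\<lambda>x :: real ^ 'd. ennreal (pam_density \<alpha> x))) (space lborel) = (\<integral>\<^sup>+ x. ennreal (pam_density \<alpha> (x :: real ^ 'd)) \<partial>lborel)"
    by (subst emeasure_density) auto
  also have "\<dots> = (\<integral>\<^sup>+ x. \<integral>\<^sup>+ y. ennreal (\<alpha> * kern (x :: real ^ 'd) y) \<partial>lborel \<partial>lborel)"
    using AE_pam_density by (intro nn_integral_cong_AE) auto
  finally show "emeasure (density lborel (\<lambda>x :: real ^ 'd. ennreal (pam_density \<alpha> x))) (space (density lborel (\<lambda>x :: real ^ 'd. ennreal (pam_density \<alpha> x)))) = 1"
    by (simp add: nn_integral_kern)
qed

text \<open>The two scales satisfy \<open>site_scale t / (t * height_scale t) = 1 / ln t\<close>, so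
  that the distance term of \<open>psi\<close>, with its logarithm, has the order of the
  height.\<close>

definition site_scale :: "real \<Rightarrow> real" where "site_scale t = (t / ln t) powr p"
definition height_scale :: "real \<Rightarrow> real" where "height_scale t = (t / ln t) powr q"

text \<open>By independence this is the probability that all sites of the ball are below y. Not
  leaving out the maximiser makes it independent of the position.\<close>

definition all_below :: "real \<Rightarrow> real \<Rightarrow> ennreal" where
  "all_below t y = (\<Prod>x\<in>pam_ball t. emeasure M {\<omega> \<in> space M. psi (1 / t) x (\<xi> x \<omega>) < y})"

lemma finite_pam_ball: "finite (pam_ball t)"
  by (simp add: pam_ball_def finite_ballz)

lemma all_below_measurable [measurable]: "all_below t \<in> borel_measurable borel"
proof -
  have "(\<lambda>y::real. emeasure M {\<omega> \<in> space M. psi (1 / t) x (\<xi> x \<omega>) < y}) \<in> borel_measurable borel" for x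
    unfolding emeasure_eq_measure
    by (intro measurable_compose[OF _ measurable_ennreal] borel_measurable_mono monoI finite_measure_mono) auto
  then show ?thesis unfolding all_below_def[abs_def] by (intro borel_measurable_prod_ennreal)
qed

text \<open>
  The contribution of rescaled position \<open>x\<close> and height \<open>w\<close> to the mean of \<open>g\<close> at the maximiser,
  on the event that the maximiser is strict.
\<close>

definition win_density :: "real \<Rightarrow> (int ^ 'd \<Rightarrow> ennreal) \<Rightarrow> real ^ 'd \<Rightarrow> real \<Rightarrow> ennreal" where
  "win_density t g x w = ennreal (site_scale t ^ CARD('d) * height_scale t) *
     (g (cell (site_scale t) x) * indicator (pam_ball t) (cell (site_scale t) x) *
       (ennreal (pareto \<alpha> (height_scale t * w)) * all_below t (psi (1 / t) (cell (site_scale t) x) (height_scale t * w))))"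

lemma win_density_measurable: "win_density t g x \<in> borel_measurable borel"
proof -
  have [measurable]: "(\<lambda>w. all_below t (psi (1 / t) (cell (site_scale t) x) (height_scale t * w))) \<in> borel_measurable borel"
  proof (rule measurable_compose[OF _ all_below_measurable])
    show "(\<lambda>w. psi (1 / t) (cell (site_scale t) x) (height_scale t * w)) \<in> borel_measurable borel"
      by (rule measurable_compose[OF _ psi_measurable]) measurable
  qed
  show ?thesis unfolding win_density_def[abs_def] by measurable
qed

text \<open>The integral depends on x only through its cell, that is, through a countable type, so
  joint measurability in x and w need not be considered.\<close>

lemma win_density_integral_measurable: "(\<lambda>x. \<integral>\<^sup>+ w. win_density t g x w \<partial>lborel) \<in> borel_measurable borel"
proof -
  have "(\<lambda>x. \<integral>\<^sup>+ w. win_density t g x w \<partial>lborel) = (\<lambda>z. \<integral>\<^sup>+ w. ennreal (site_scale t ^ CARD('d) * height_scale t) *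
     (g z * indicator (pam_ball t) z *
       (ennreal (pareto \<alpha> (height_scale t * w)) * all_below t (psi (1 / t) z (height_scale t * w)))) \<partial>lborel) \<circ> cell (site_scale t)"
    by (simp add: win_density_def fun_eq_iff)
  then show ?thesis by (simp only:) (rule measurable_comp[OF cell_measurable], simp)
qed

text \<open>If z is the strict maximiser then the given Z is z, so the events \<open>E z\<close>
  contribute at most the mean of \<open>g\<close> at Z. This is only an inequality, since ties are
  dropped and \<open>all_below\<close> contains an additional factor, at most 1, for z
  itself.\<close>

lemma win_density_le:
  assumes t: "t > 1" and Zm: "Z \<in> measurable M (count_space UNIV)"
    and Z: "\<And>\<omega>. Z \<omega> \<in> pam_ball t"
      "\<And>\<omega> z. z \<in> pam_ball t \<Longrightarrow> psi (1 / t) z (\<xi> z \<omega>) \<le> psi (1 / t) (Z \<omega>) (\<xi> (Z \<omega>) \<omega>)"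
  shows "(\<integral>\<^sup>+ x. \<integral>\<^sup>+ w. win_density t g x w \<partial>lborel \<partial>lborel) \<le> (\<integral>\<^sup>+ \<omega>. g (Z \<omega>) \<partial>M)"
proof -
  let ?B = "pam_ball t" and ?c = "1 / t" and ?a = "height_scale t" and ?r = "site_scale t"
  have ar: "?a > 0" "?r > 0" using t by (simp_all add: height_scale_def site_scale_def)
  define E where "E = (\<lambda>z. {\<omega> \<in> space M. \<forall>x\<in>?B - {z}. psi ?c x (\<xi> x \<omega>) < psi ?c z (\<xi> z \<omega>)})"
  have E_meas: "E z \<in> events" for z unfolding E_def using finite_pam_ball[of t] by measurable
  have psi_m: "(\<lambda>w. psi ?c z (?a * w)) \<in> borel_measurable borel" for z
    by (rule measurable_compose[OF _ psi_measurable]) measurable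
  have below_m [measurable]: "(\<lambda>v. all_below t (psi ?c z v)) \<in> borel_measurable borel" for z
    by (rule measurable_compose[OF psi_measurable all_below_measurable])
  have below_m' [measurable]: "(\<lambda>w. all_below t (psi ?c z (?a * w))) \<in> borel_measurable borel" for z
    by (rule measurable_compose[OF psi_m all_below_measurable])
  define h where "h = (\<lambda>z :: int ^ 'd. \<integral>\<^sup>+ v. ennreal (pareto \<alpha> v) * all_below t (psi ?c z v) \<partial>lborel)"
  have h_le: "h z \<le> emeasure M (E z)" if z: "z \<in> ?B" for z
    unfolding E_def emeasure_strict_max[OF finite_pam_ball z] h_def
  proof (intro nn_integral_mono mult_left_mono)
    fix v
    have "all_below t (psi ?c z v) = emeasure M {\<omega> \<in> space M. psi ?c z (\<xi> z \<omega>) < psi ?c z v} *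
        (\<Prod>x\<in>?B - {z}. emeasure M {\<omega> \<in> space M. psi ?c x (\<xi> x \<omega>) < psi ?c z v})"
      unfolding all_below_def by (rule prod.remove[OF finite_pam_ball z])
    also have "\<dots> \<le> 1 * (\<Prod>x\<in>?B - {z}. emeasure M {\<omega> \<in> space M. psi ?c x (\<xi> x \<omega>) < psi ?c z v})"
      by (intro mult_right_mono emeasure_le_1) auto
    finally show "all_below t (psi ?c z v) \<le> (\<Prod>x\<in>?B - {z}. emeasure M {\<omega> \<in> space M. psi ?c x (\<xi> x \<omega>) < psi ?c z v})" by simp
  qed simp
  have h_scale: "h z = ennreal ?a * (\<integral>\<^sup>+ w. ennreal (pareto \<alpha> (?a * w)) * all_below t (psi ?c z (?a * w)) \<partial>lborel)" for z
    unfolding h_def using ar by (subst nn_integral_real_affine[where c = ?a and t = 0]) auto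
  have inner: "(\<integral>\<^sup>+ w. win_density t g x w \<partial>lborel) = ennreal (?r ^ CARD('d)) * (g (cell ?r x) * h (cell ?r x) * indicator ?B (cell ?r x))" for x
  proof -
    have "(\<integral>\<^sup>+ w. win_density t g x w \<partial>lborel) = ennreal (?r ^ CARD('d) * ?a) *
     (g (cell ?r x) * indicator ?B (cell ?r x) *
       (\<integral>\<^sup>+ w. ennreal (pareto \<alpha> (?a * w)) * all_below t (psi ?c (cell ?r x) (?a * w)) \<partial>lborel))"
      unfolding win_density_def by (subst nn_integral_cmult, measurable, subst nn_integral_cmult, measurable)
    then show ?thesis unfolding h_scale using ar by (simp add: ennreal_mult mult_ac)
  qed
  have meas: "(\<lambda>x. g (cell ?r x) * h (cell ?r x) * indicator ?B (cell ?r x)) \<in> borel_measurable borel"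
  proof -
    have "(\<lambda>x. g (cell ?r x) * h (cell ?r x) * indicator ?B (cell ?r x)) = (\<lambda>z. g z * h z * indicator ?B z) \<circ> cell ?r" by auto
    then show ?thesis by (simp only:) (rule measurable_comp[OF cell_measurable], simp)
  qed
  have "(\<integral>\<^sup>+ x. \<integral>\<^sup>+ w. win_density t g x w \<partial>lborel \<partial>lborel) = ennreal (?r ^ CARD('d)) * (\<integral>\<^sup>+ x. g (cell ?r x) * h (cell ?r x) * indicator ?B (cell ?r x) \<partial>lborel)"
    unfolding inner using meas by (intro nn_integral_cmult) simp
  also have "\<dots> = (\<Sum>z\<in>?B. g z * h z)"
    using sum_eq_nn_integral_cell[OF ar(2) finite_pam_ball, of "\<lambda>z. g z * h z"] by simp
  also have "\<dots> \<le> (\<Sum>z\<in>?B. g z * emeasure M (E z))"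
    by (intro sum_mono mult_left_mono h_le) auto
  also have "\<dots> = (\<integral>\<^sup>+ \<omega>. (\<Sum>z\<in>?B. g z * indicator (E z) \<omega>) \<partial>M)"
    using E_meas by (simp add: nn_integral_sum nn_integral_cmult_indicator)
  also have "\<dots> \<le> (\<integral>\<^sup>+ \<omega>. g (Z \<omega>) \<partial>M)"
  proof (intro nn_integral_mono)
    fix \<omega> assume "\<omega> \<in> space M"
    have "g z * indicator (E z) \<omega> = 0" if "z \<in> ?B" "z \<noteq> Z \<omega>" for z
      using that Z(1)[of \<omega>] Z(2)[of z \<omega>] by (auto simp: E_def indicator_def not_less)
    then have "(\<Sum>z\<in>?B. g z * indicator (E z) \<omega>) = (\<Sum>z\<in>{Z \<omega>}. g z * indicator (E z) \<omega>)"
      using Z(1)[of \<omega>] finite_pam_ball by (intro sum.mono_neutral_right) auto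
    then show "(\<Sum>z\<in>?B. g z * indicator (E z) \<omega>) \<le> g (Z \<omega>)"
      by (cases "\<omega> \<in> E (Z \<omega>)") auto
  qed
  finally show ?thesis .
qed

text \<open>At rescaled height w and position x, \<open>psi\<close> divided by
  \<open>height_scale t\<close> tends to s = \<open>w - q * l1_norm x\<close>. The powers of
  \<open>t / ln t\<close> in the Pareto density cancel by \<open>q * \<alpha> = p * d\<close>. For
  \<open>all_below\<close> only a lower bound is shown, which is all that Fatou's lemma
  requires.\<close>

lemma win_density_liminf:
  fixes f :: "real ^ 'd \<Rightarrow> real" and x :: "real ^ 'd"
  assumes f: "continuous_on UNIV f" "\<And>x. f x \<ge> 0" and w: "w > q * l1_norm x"
  defines "g \<equiv> \<lambda>t z. ennreal (f ((1 / site_scale t) *\<^sub>R lattice_embed z))"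
  defines "s \<equiv> w - q * l1_norm x"
  shows "\<exists>l. (l \<longlongrightarrow> f x * (\<alpha> * w powr (- \<alpha> - 1)) * exp (- \<Theta> * s powr (d - \<alpha>))) at_top \<and>
    (\<forall>\<^sub>F t in at_top. ennreal (l t) \<le> win_density t (g t) x w)"
proof -
  have s: "s > 0" using w by (simp add: s_def)
  have w0: "w > 0" using w pq l1_norm_nonneg[of x] by (smt (verit) mult_nonneg_nonneg)
  have q0: "q > 0" and p0: "p > 0" using pq by auto
  have t1: "\<forall>\<^sub>F t in at_top. (t::real) > 1" by (rule eventually_gt_at_top)
  have r_top: "filterlim site_scale at_top at_top" unfolding site_scale_def using p0 by real_asymp
  have a_top: "filterlim height_scale at_top at_top" unfolding height_scale_def using q0 by real_asymp
  define z where "z = (\<lambda>t. cell (site_scale t) x)"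
  have zlim: "((\<lambda>t. (1 / site_scale t) *\<^sub>R lattice_embed (z t)) \<longlongrightarrow> x) at_top"
    unfolding z_def by (rule tendsto_cell[OF r_top])
  have n_eq: "l1_norm ((1 / site_scale t) *\<^sub>R lattice_embed (z t)) = nrm (z t) / site_scale t" for t
  proof -
    have "l1_norm (c *\<^sub>R v) = \<bar>c\<bar> * l1_norm v" for c and v :: "real ^ 'd"
      by (simp add: l1_norm_def abs_mult sum_distrib_left)
    then show ?thesis by (simp add: lattice_embed_l1 site_scale_def)
  qed
  have nlim: "((\<lambda>t. nrm (z t) / site_scale t) \<longlongrightarrow> l1_norm x) at_top"
    using tendsto_l1_norm[OF zlim] by (simp add: n_eq)
  have flim: "((\<lambda>t. f ((1 / site_scale t) *\<^sub>R lattice_embed (z t))) \<longlongrightarrow> f x) at_top"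
    using f(1) by (intro isCont_tendsto_compose[OF _ zlim]) (simp add: continuous_on_eq_continuous_at)
  have rta: "\<forall>\<^sub>F t in at_top. site_scale t / (t * height_scale t) = 1 / ln t"
    using t1
  proof eventually_elim
    case (elim t)
    then have "site_scale t = (t / ln t) * height_scale t" unfolding site_scale_def height_scale_def unfolding pq(1) by (simp add: powr_add)
    then show ?case using elim by (simp add: height_scale_def)
  qed
  have lnlim: "((\<lambda>t. ln (height_scale t * w) / ln t) \<longlongrightarrow> q) at_top"
    unfolding height_scale_def using q0 w0 by real_asymp
  have X: "((\<lambda>t. (nrm (z t) * ln (height_scale t * w) - path_entropy (z t)) / (t * height_scale t)) \<longlongrightarrow> q * l1_norm x) at_top"
  proof -
    have inv: "((\<lambda>t. 1 / ln t) \<longlongrightarrow> (0::real)) at_top" by real_asymp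
    have "((\<lambda>t. d * (nrm (z t) / site_scale t) * (1 / ln t)) \<longlongrightarrow> d * l1_norm x * 0) at_top"
      by (intro tendsto_intros nlim inv)
    then have up: "((\<lambda>t. d * (nrm (z t) / site_scale t) * (1 / ln t)) \<longlongrightarrow> 0) at_top" by simp
    have ent: "((\<lambda>t. path_entropy (z t) / (t * height_scale t)) \<longlongrightarrow> 0) at_top"
    proof (rule tendsto_sandwich[OF _ _ tendsto_const up])
      show "\<forall>\<^sub>F t in at_top. 0 \<le> path_entropy (z t) / (t * height_scale t)"
        using t1 by eventually_elim (simp add: path_entropy_nonneg height_scale_def)
      show "\<forall>\<^sub>F t in at_top. path_entropy (z t) / (t * height_scale t) \<le> d * (nrm (z t) / site_scale t) * (1 / ln t)"
        using t1 rta
      proof eventually_elim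
        case (elim t)
        have r0: "site_scale t > 0" using elim by (simp add: site_scale_def)
        have "path_entropy (z t) / (t * height_scale t) \<le> d * nrm (z t) / (t * height_scale t)"
          using path_entropy_le[of "z t"] elim by (intro divide_right_mono) (auto simp: d_eq height_scale_def)
        also have "\<dots> = d * (nrm (z t) / site_scale t) * (site_scale t / (t * height_scale t))" using r0 by simp
        finally show ?case by (simp only: elim)
      qed
    qed
    have "((\<lambda>t. (nrm (z t) / site_scale t) * (ln (height_scale t * w) / ln t) - path_entropy (z t) / (t * height_scale t)) \<longlongrightarrow> l1_norm x * q - 0) at_top"
      by (intro tendsto_intros nlim lnlim ent)
    moreover have "\<forall>\<^sub>F t in at_top. (nrm (z t) / site_scale t) * (ln (height_scale t * w) / ln t) - path_entropy (z t) / (t * height_scale t)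
        = (nrm (z t) * ln (height_scale t * w) - path_entropy (z t)) / (t * height_scale t)"
      using t1 rta
    proof eventually_elim
      case (elim t)
      have r0: "site_scale t > 0" using elim by (simp add: site_scale_def)
      have "(nrm (z t) / site_scale t) * (ln (height_scale t * w) / ln t) = (nrm (z t) / site_scale t) * ln (height_scale t * w) * (site_scale t / (t * height_scale t))"
        unfolding elim(2) by simp
      also have "\<dots> = nrm (z t) * ln (height_scale t * w) / (t * height_scale t)" using r0 by simp
      finally show ?case by (simp add: diff_divide_distrib)
    qed
    ultimately show ?thesis by (simp add: tendsto_cong mult.commute)
  qed
  define S where "S = (\<lambda>t. psi (1 / t) (z t) (height_scale t * w) / height_scale t)"
  have S: "(S \<longlongrightarrow> s) at_top"
  proof -
    have "((\<lambda>t. w - max 0 ((nrm (z t) * ln (height_scale t * w) - path_entropy (z t)) / (t * height_scale t))) \<longlongrightarrow> w - max 0 (q * l1_norm x)) at_top"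
      by (intro tendsto_intros X)
    moreover have "max 0 (q * l1_norm x) = q * l1_norm x" using q0 by simp
    moreover have "\<forall>\<^sub>F t in at_top. w - max 0 ((nrm (z t) * ln (height_scale t * w) - path_entropy (z t)) / (t * height_scale t)) = S t"
      using t1
    proof eventually_elim
      case (elim t)
      have a0: "height_scale t > 0" using elim by (simp add: height_scale_def)
      have "max 0 (Y / (t * height_scale t)) = 1 / t * max 0 Y / height_scale t" for Y
      proof -
        have "t * height_scale t > 0" using elim a0 by simp
        then have "max 0 (Y / (t * height_scale t)) = max 0 Y / (t * height_scale t)"
          by (cases "0 \<le> Y") (auto simp: max_def zero_le_divide_iff)
        then show ?thesis by simp
      qed
      then show ?case unfolding S_def psi_def using a0 by (simp add: diff_divide_distrib[of "height_scale t * w"])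
    qed
    ultimately show ?thesis by (simp add: tendsto_cong s_def)
  qed
  define y where "y = (\<lambda>t. height_scale t * S t)"
  have y_eq: "\<forall>\<^sub>F t in at_top. y t = psi (1 / t) (z t) (height_scale t * w)"
    using t1 by eventually_elim (simp add: y_def S_def height_scale_def)
  have y_top: "filterlim y at_top at_top"
    unfolding y_def by (rule filterlim_at_top_mult_tendsto_pos[OF S s a_top])
  have lny: "((\<lambda>t. (ln (y t) - d) / ln t) \<longlongrightarrow> q) at_top"
  proof -
    have 1: "((\<lambda>t. ln (height_scale t) / ln t) \<longlongrightarrow> q) at_top" unfolding height_scale_def using q0 by real_asymp
    have inv: "((\<lambda>t. 1 / ln t) \<longlongrightarrow> (0::real)) at_top" by real_asymp
    have "((\<lambda>t. ln (height_scale t) / ln t + (ln (S t) - d) * (1 / ln t)) \<longlongrightarrow> q + (ln s - d) * 0) at_top"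
      using s by (intro tendsto_intros 1 inv S) auto
    moreover have "\<forall>\<^sub>F t in at_top. ln (height_scale t) / ln t + (ln (S t) - d) * (1 / ln t) = (ln (y t) - d) / ln t"
      using t1 order_tendstoD(1)[OF S s]
    proof eventually_elim
      case (elim t)
      have "ln (y t) = ln (height_scale t) + ln (S t)"
        unfolding y_def using elim by (intro ln_mult_pos) (auto simp: height_scale_def)
      then show ?case by (simp add: add_divide_distrib diff_divide_distrib)
    qed
    ultimately show ?thesis by (simp add: tendsto_cong)
  qed
  \<comment> \<open>The exponent of \<open>prod_prob_psi_less_ge\<close> at level \<open>y t\<close>
    with slope \<open>1 / t\<close>, after the powers of \<open>t / ln t\<close> have cancelled by
    \<open>d + q * (d - \<alpha>) = 0\<close>. In this form every ingredient converges.\<close>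
  define T where "T = (\<lambda>t. (2 / ((ln (y t) - d) / ln t)) ^ CARD('d) * (Gamma (\<alpha> - d) / Gamma \<alpha>) *
      (S t - d * ((ln (y t) - d) / ln t) * (ln t / (t * height_scale t))) powr (d - \<alpha>) / (1 - y t powr (- \<alpha>)))"
  have T: "(T \<longlongrightarrow> \<Theta> * s powr (d - \<alpha>)) at_top"
  proof -
    have z1: "((\<lambda>t. ln t / (t * height_scale t)) \<longlongrightarrow> 0) at_top" unfolding height_scale_def using q0 by real_asymp
    have z2: "((\<lambda>t. y t powr (- \<alpha>)) \<longlongrightarrow> 0) at_top"
      using y_top \<alpha>_pos by (intro tendsto_neg_powr) auto
    have "(T \<longlongrightarrow> (2 / q) ^ CARD('d) * (Gamma (\<alpha> - d) / Gamma \<alpha>) * (s - d * q * 0) powr (d - \<alpha>) / (1 - 0)) at_top"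
      unfolding T_def using q0 s by (intro tendsto_intros lny S z1 z2) auto
    then show ?thesis by (simp add: \<Theta>_def)
  qed
  have below: "\<forall>\<^sub>F t in at_top. ennreal (exp (- T t)) \<le> all_below t (y t)"
  proof -
    have "\<forall>\<^sub>F t in at_top. y t > exp d" using y_top by (simp add: filterlim_at_top_dense)
    moreover have "\<forall>\<^sub>F t in at_top. S t - d * ((ln (y t) - d) / ln t) * (ln t / (t * height_scale t)) > 0"
    proof -
      have z1: "((\<lambda>t. ln t / (t * height_scale t)) \<longlongrightarrow> 0) at_top" unfolding height_scale_def using q0 by real_asymp
      have "((\<lambda>t. S t - d * ((ln (y t) - d) / ln t) * (ln t / (t * height_scale t))) \<longlongrightarrow> s - d * q * 0) at_top"
        by (intro tendsto_intros S lny z1)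
      then show ?thesis using s by (intro order_tendstoD(1)) auto
    qed
    ultimately show ?thesis using t1 order_tendstoD(1)[OF S s]
    proof eventually_elim
      case (elim t)
      have a0: "height_scale t > 0" and lt: "ln t > 0" using elim by (auto simp: height_scale_def)
      define L where "L = ln (y t) - d"
      define \<sigma>' where "\<sigma>' = S t - d * (L / ln t) * (ln t / (t * height_scale t))"
      have \<sigma>_eq: "y t - 1 / t * d * L = height_scale t * \<sigma>'"
        using a0 lt elim by (simp add: \<sigma>'_def y_def field_simps)
      have \<sigma>0: "\<sigma>' > 0" using elim(2) by (simp add: \<sigma>'_def L_def)
      have key: "(2 / (1 / t * L)) ^ CARD('d) * (height_scale t * \<sigma>') powr (d - \<alpha>) = (2 / (L / ln t)) ^ CARD('d) * \<sigma>' powr (d - \<alpha>)"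
      proof -
        have "2 / (1 / t * L) = 2 / (L / ln t) * (t / ln t)" using lt elim by simp
        then have "(2 / (1 / t * L)) ^ CARD('d) = (2 / (L / ln t)) ^ CARD('d) * (t / ln t) powr d"
          using elim lt by (simp only: power_mult_distrib) (simp add: d_eq powr_realpow)
        moreover have "(height_scale t * \<sigma>') powr (d - \<alpha>) = (t / ln t) powr (q * (d - \<alpha>)) * \<sigma>' powr (d - \<alpha>)"
          using a0 \<sigma>0 by (simp add: powr_mult height_scale_def powr_powr)
        moreover have "(t / ln t) powr d * (t / ln t) powr (q * (d - \<alpha>)) = 1"
        proof -
          have "d + q * (d - \<alpha>) = 0" using pq by (simp add: algebra_simps)
          then show ?thesis using elim lt by (simp flip: powr_add)
        qed
        moreover have "X = A * B \<Longrightarrow> Y = C * D \<Longrightarrow> B * C = 1 \<Longrightarrow> X * Y = A * D" for X Y A B C D :: real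
          by (simp add: mult.assoc[symmetric])
        ultimately show ?thesis by blast
      qed
      have "exp (- ((2 / (1 / t * (ln (y t) - CARD('d)))) ^ CARD('d) * (Gamma (\<alpha> - CARD('d)) / Gamma \<alpha>) *
        (y t - 1 / t * CARD('d) * (ln (y t) - CARD('d))) powr (CARD('d) - \<alpha>) / (1 - y t powr (- \<alpha>))))
        \<le> (\<Prod>z\<in>pam_ball t. prob {\<omega> \<in> space M. psi (1 / t) z (\<xi> z \<omega>) < y t})"
        using elim finite_pam_ball \<sigma>_eq a0 \<sigma>0
        by (intro prod_prob_psi_less_ge) (auto simp: L_def simp flip: d_eq)
      also have "(2 / (1 / t * (ln (y t) - CARD('d)))) ^ CARD('d) * (Gamma (\<alpha> - CARD('d)) / Gamma \<alpha>) *
        (y t - 1 / t * CARD('d) * (ln (y t) - CARD('d))) powr (CARD('d) - \<alpha>) / (1 - y t powr (- \<alpha>)) = T t"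
      proof -
        have "(2 / (1 / t * L)) ^ CARD('d) * G * (height_scale t * \<sigma>') powr (d - \<alpha>) = (2 / (L / ln t)) ^ CARD('d) * G * \<sigma>' powr (d - \<alpha>)" for G
          using key by (simp add: mult_ac)
        then show ?thesis unfolding T_def d_eq[symmetric] L_def[symmetric] \<sigma>_eq \<sigma>'_def[symmetric] by simp
      qed
      finally have "ennreal (exp (- T t)) \<le> ennreal (\<Prod>z\<in>pam_ball t. prob {\<omega> \<in> space M. psi (1 / t) z (\<xi> z \<omega>) < y t})"
        by (rule ennreal_leI)
      then show ?case by (simp add: all_below_def emeasure_eq_measure prod_ennreal)
    qed
  qed
  have inball: "\<forall>\<^sub>F t in at_top. z t \<in> pam_ball t"
  proof -
    have "\<forall>\<^sub>F t in at_top. nrm (z t) / site_scale t < l1_norm x + 1"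
      using nlim by (intro order_tendstoD(2)) auto
    moreover have "\<forall>\<^sub>F t in at_top. (l1_norm x + 1) * site_scale t \<le> t powr (p + \<epsilon>)"
    proof -
      define C where "C = l1_norm x + 1"
      have "C > 0" by (simp add: C_def add_nonneg_pos)
      then have "\<forall>\<^sub>F t in at_top. C * (t / ln t) powr p \<le> t powr (p + \<epsilon>)" using p0 ex(1) by real_asymp
      then show ?thesis by (simp add: C_def site_scale_def)
    qed
    ultimately show ?thesis using t1
    proof eventually_elim
      case (elim t)
      have "site_scale t > 0" using elim by (simp add: site_scale_def)
      then have "nrm (z t) < (l1_norm x + 1) * site_scale t" using elim(1) by (simp add: pos_divide_less_eq)
      then have "real (nrm (z t)) \<le> t powr (p + \<epsilon>)" using elim(2) by linarith
      then show ?case using elim by (simp add: pam_ball_eq ballz_iff)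
    qed
  qed
  define l where "l = (\<lambda>t. f ((1 / site_scale t) *\<^sub>R lattice_embed (z t)) * (\<alpha> * w powr (- \<alpha> - 1)) * exp (- T t))"
  have "(l \<longlongrightarrow> f x * (\<alpha> * w powr (- \<alpha> - 1)) * exp (- (\<Theta> * s powr (d - \<alpha>)))) at_top"
    unfolding l_def by (intro tendsto_intros flim T)
  moreover have "\<forall>\<^sub>F t in at_top. height_scale t * w \<ge> 1"
  proof -
    have "\<forall>\<^sub>F t in at_top. height_scale t \<ge> 1 / w" using a_top by (simp add: filterlim_at_top)
    then show ?thesis by eventually_elim (use w0 in \<open>simp add: field_simps\<close>)
  qed
  then have "\<forall>\<^sub>F t in at_top. ennreal (l t) \<le> win_density t (g t) x w"
    using t1 inball below y_eq
  proof eventually_elim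
    case (elim t)
    have a0: "height_scale t > 0" and r0: "site_scale t > 0" using elim by (auto simp: height_scale_def site_scale_def)
    have zt: "cell (site_scale t) x = z t" by (simp add: z_def)
    have "site_scale t ^ CARD('d) * height_scale t * pareto \<alpha> (height_scale t * w) = \<alpha> * w powr (- \<alpha> - 1)"
    proof -
      have e1: "site_scale t ^ CARD('d) = (t / ln t) powr (p * d)"
        using r0 by (simp add: site_scale_def d_eq powr_powr flip: powr_realpow)
      have "height_scale t * (height_scale t) powr (- \<alpha> - 1) = height_scale t powr (- \<alpha>)" using a0 by (simp add: powr_diff powr_minus)
      also have "\<dots> = (t / ln t) powr (- (p * d))" using pq(3) by (simp add: height_scale_def powr_powr)
      finally have "site_scale t ^ CARD('d) * (height_scale t * (height_scale t) powr (- \<alpha> - 1)) = 1"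
        unfolding e1 using elim by (simp flip: powr_add)
      then show ?thesis using elim(1) a0 w0
        by (simp add: pareto_def powr_mult mult_ac)
    qed
    then have "ennreal (l t) = ennreal (site_scale t ^ CARD('d) * height_scale t) * (ennreal (f ((1 / site_scale t) *\<^sub>R lattice_embed (z t))) * (ennreal (pareto \<alpha> (height_scale t * w)) * ennreal (exp (- T t))))"
      using f(2) a0 r0 \<alpha>_pos by (simp add: l_def pareto_def mult_ac flip: ennreal_mult)
    also have "\<dots> \<le> win_density t (g t) x w"
      using elim by (auto simp: win_density_def g_def zt intro!: mult_left_mono)
    finally show ?case .
  qed
  ultimately show ?thesis by auto
qed

section \<open>Fatou's lemma and convergence in distribution\<close>

context
  fixes Z :: "real \<Rightarrow> 'a \<Rightarrow> int ^ 'd"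
  assumes Zm [measurable]: "\<And>t. t > 0 \<Longrightarrow> Z t \<in> measurable M (count_space UNIV)"
    and Z: "\<And>t \<omega>. t > 0 \<Longrightarrow> Z t \<omega> \<in> pam_ball t"
      "\<And>t \<omega> z. t > 0 \<Longrightarrow> z \<in> pam_ball t \<Longrightarrow> psi (1 / t) z (\<xi> z \<omega>) \<le> psi (1 / t) (Z t \<omega>) (\<xi> (Z t \<omega>) \<omega>)"
begin

lemma rescaled_measurable:
  assumes "t > 0"
  shows "(\<lambda>\<omega>. c *\<^sub>R (lattice_embed (Z t \<omega>) :: real ^ 'd)) \<in> borel_measurable M"
  by (rule measurable_compose[OF Zm[OF assms]]) simp

text \<open>Fatou's lemma is used for the integral over w and again for that over x. The
  substitution \<open>y = w - q * l1_norm x\<close> turns the pointwise lower limit into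
  \<open>kern\<close>; heights with y \<le> 0 contribute nothing there.\<close>

lemma nn_integral_liminf_scaled_argmax:
  fixes f :: "real ^ 'd \<Rightarrow> real"
  assumes f: "continuous_on UNIV f" "\<And>x. f x \<ge> 0" and X: "filterlim X at_top sequentially"
  shows "(\<integral>\<^sup>+ x. ennreal (f x) * ennreal (pam_density \<alpha> x) \<partial>lborel)
    \<le> liminf (\<lambda>n. \<integral>\<^sup>+ \<omega>. ennreal (f ((1 / site_scale (X n)) *\<^sub>R lattice_embed (Z (X n) \<omega>))) \<partial>M)"
proof -
  define g where "g = (\<lambda>t z. ennreal (f ((1 / site_scale t) *\<^sub>R lattice_embed (z :: int ^ 'd))))"
  have [measurable]: "f \<in> borel_measurable borel" using f(1) by (rule borel_measurable_continuous_onI)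
  have "ennreal (f x) * (\<integral>\<^sup>+ y. ennreal (\<alpha> * kern x y) \<partial>lborel)
      \<le> liminf (\<lambda>n. \<integral>\<^sup>+ w. win_density (X n) (g (X n)) x w \<partial>lborel)" for x
  proof -
    have "ennreal (f x * (\<alpha> * kern x (w - q * l1_norm x))) \<le> liminf (\<lambda>n. win_density (X n) (g (X n)) x w)" for w
    proof (cases "w > q * l1_norm x")
      case True
      define s where "s = w - q * l1_norm x"
      have s: "s > 0" using True by (simp add: s_def)
      obtain l where l: "(l \<longlongrightarrow> f x * (\<alpha> * w powr (- \<alpha> - 1)) * exp (- \<Theta> * s powr (d - \<alpha>))) at_top"
        "\<forall>\<^sub>F t in at_top. ennreal (l t) \<le> win_density t (g t) x w"
        using win_density_liminf[OF f True] unfolding g_def s_def by blast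
      have "w powr (- \<alpha> - 1) = 1 / w powr (\<alpha> + 1)"
        using powr_minus_divide[of w "\<alpha> + 1"] by simp
      then have "f x * (\<alpha> * kern x s) = f x * (\<alpha> * w powr (- \<alpha> - 1)) * exp (- \<Theta> * s powr (d - \<alpha>))"
        using s by (simp add: kern_def s_def)
      then have "(\<lambda>n. ennreal (l (X n))) \<longlonglongrightarrow> ennreal (f x * (\<alpha> * kern x s))"
        using filterlim_compose[OF l(1) X] by (intro tendsto_ennrealI) (simp only:)
      then have "ennreal (f x * (\<alpha> * kern x s)) = liminf (\<lambda>n. ennreal (l (X n)))"
        by (intro lim_imp_Liminf[symmetric]) auto
      also have "\<dots> \<le> liminf (\<lambda>n. win_density (X n) (g (X n)) x w)"
        using eventually_compose_filterlim[OF l(2) X] by (rule Liminf_mono)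
      finally show ?thesis by (simp add: s_def)
    qed (simp add: kern_def)
    then have "(\<integral>\<^sup>+ w. ennreal (f x * (\<alpha> * kern x (w - q * l1_norm x))) \<partial>lborel)
        \<le> (\<integral>\<^sup>+ w. liminf (\<lambda>n. win_density (X n) (g (X n)) x w) \<partial>lborel)"
      by (intro nn_integral_mono)
    also have "\<dots> \<le> liminf (\<lambda>n. \<integral>\<^sup>+ w. win_density (X n) (g (X n)) x w \<partial>lborel)"
      using win_density_measurable by (intro nn_integral_liminf) simp
    also have "(\<integral>\<^sup>+ w. ennreal (f x * (\<alpha> * kern x (w - q * l1_norm x))) \<partial>lborel)
        = (\<integral>\<^sup>+ y. ennreal (f x * (\<alpha> * kern x y)) \<partial>lborel)"
      using nn_integral_real_affine[of "\<lambda>w. ennreal (f x * (\<alpha> * kern x (w - q * l1_norm x)))" 1 "q * l1_norm x"] by simp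
    also have "\<dots> = ennreal (f x) * (\<integral>\<^sup>+ y. ennreal (\<alpha> * kern x y) \<partial>lborel)"
      using f(2)[of x] \<alpha>_pos kern_nonneg by (subst nn_integral_cmult[symmetric]) (auto simp: ennreal_mult)
    finally show ?thesis .
  qed
  then have "(\<integral>\<^sup>+ x. ennreal (f x) * (\<integral>\<^sup>+ y. ennreal (\<alpha> * kern x y) \<partial>lborel) \<partial>lborel)
      \<le> (\<integral>\<^sup>+ x. liminf (\<lambda>n. \<integral>\<^sup>+ w. win_density (X n) (g (X n)) x w \<partial>lborel) \<partial>lborel)"
    by (intro nn_integral_mono)
  also have "\<dots> \<le> liminf (\<lambda>n. \<integral>\<^sup>+ x. \<integral>\<^sup>+ w. win_density (X n) (g (X n)) x w \<partial>lborel \<partial>lborel)"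
    using win_density_integral_measurable by (intro nn_integral_liminf) simp
  also have "\<dots> \<le> liminf (\<lambda>n. \<integral>\<^sup>+ \<omega>. g (X n) (Z (X n) \<omega>) \<partial>M)"
  proof (rule Liminf_mono)
    have "\<forall>\<^sub>F n in sequentially. X n > 1" using X by (simp add: filterlim_at_top_dense)
    then show "\<forall>\<^sub>F n in sequentially. (\<integral>\<^sup>+ x. \<integral>\<^sup>+ w. win_density (X n) (g (X n)) x w \<partial>lborel \<partial>lborel)
        \<le> (\<integral>\<^sup>+ \<omega>. g (X n) (Z (X n) \<omega>) \<partial>M)"
      by eventually_elim (use Z Zm in \<open>intro win_density_le, auto\<close>)
  qed
  also have "(\<integral>\<^sup>+ x. ennreal (f x) * (\<integral>\<^sup>+ y. ennreal (\<alpha> * kern x y) \<partial>lborel) \<partial>lborel)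
      = (\<integral>\<^sup>+ x. ennreal (f x) * ennreal (pam_density \<alpha> x) \<partial>lborel)"
    using AE_pam_density by (intro nn_integral_cong_AE) auto
  finally show ?thesis by (simp add: g_def)
qed

theorem scaled_argmax_in_distribution:
  "converges_in_distribution M (\<lambda>t \<omega>. ((ln t / t) powr p) *\<^sub>R lattice_embed (Z t \<omega>))
     (density lborel (\<lambda>x :: real ^ 'd. ennreal (pam_density \<alpha> x))) (\<lambda>x. x)"
  unfolding converges_in_distribution_def
proof (intro conjI allI impI)
  let ?N = "density lborel (\<lambda>x :: real ^ 'd. ennreal (pam_density \<alpha> x))"
  let ?Y = "\<lambda>t \<omega>. ((ln t / t) powr p) *\<^sub>R (lattice_embed (Z t \<omega>) :: real ^ 'd)"
  show Ym: "?Y t \<in> borel_measurable M" if "t > 0" for t by (rule rescaled_measurable[OF that])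
  show "(\<lambda>x. x) \<in> borel_measurable ?N" by simp
  fix f :: "real ^ 'd \<Rightarrow> real" assume f: "continuous_on UNIV f" "bounded (range f)"
  obtain K where K: "\<And>x. \<bar>f x\<bar> \<le> K" using f(2) by (auto simp: bounded_iff)
  have [measurable]: "f \<in> borel_measurable borel" using f(1) by (rule borel_measurable_continuous_onI)
  interpret N: prob_space ?N by (rule prob_space_pam_density)
  have lower: "\<forall>\<^sub>F n in sequentially. (\<integral>\<omega>. h (?Y (X n) \<omega>) \<partial>M) > a"
    if h: "continuous_on UNIV h" "\<And>x. h x \<ge> 0" "\<And>x. h x \<le> C" and X: "filterlim X at_top sequentially"
      and a: "a < (\<integral>x. h x \<partial>?N)" for h :: "real ^ 'd \<Rightarrow> real" and C X a
  \<comment> \<open>A negative a is treated apart because \<open>ennreal a\<close> is then 0 and the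
    strict inequality could be lost.\<close>
  proof (cases "a < 0")
    case True
    have "0 \<le> (\<integral>\<omega>. h (?Y (X n) \<omega>) \<partial>M)" for n using h(2) by (intro integral_nonneg_AE) auto
    then show ?thesis using True by (intro always_eventually allI) (meson less_le_trans)
  next
    case False
    have [measurable]: "h \<in> borel_measurable borel" using h(1) by (rule borel_measurable_continuous_onI)
    have "integrable ?N h" using h by (intro N.integrable_const_bound[of _ C]) auto
    then have "ennreal (\<integral>x. h x \<partial>?N) = (\<integral>\<^sup>+ x. ennreal (h x) \<partial>?N)"
      using h by (intro nn_integral_eq_integral[symmetric]) auto
    also have "\<dots> = (\<integral>\<^sup>+ x. ennreal (h x) * ennreal (pam_density \<alpha> x) \<partial>lborel)"
      by (subst nn_integral_density) (auto simp: mult.commute)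
    also have "\<dots> \<le> liminf (\<lambda>n. \<integral>\<^sup>+ \<omega>. ennreal (h ((1 / site_scale (X n)) *\<^sub>R lattice_embed (Z (X n) \<omega>))) \<partial>M)"
      using h X by (intro nn_integral_liminf_scaled_argmax)
    finally have "ennreal a < liminf (\<lambda>n. \<integral>\<^sup>+ \<omega>. ennreal (h ((1 / site_scale (X n)) *\<^sub>R lattice_embed (Z (X n) \<omega>))) \<partial>M)"
      using a False by (elim less_le_trans[rotated]) (simp add: ennreal_less_iff)
    then have "\<forall>\<^sub>F n in sequentially. ennreal a < (\<integral>\<^sup>+ \<omega>. ennreal (h ((1 / site_scale (X n)) *\<^sub>R lattice_embed (Z (X n) \<omega>))) \<partial>M)"
      by (rule less_LiminfD)
    moreover have "\<forall>\<^sub>F n in sequentially. X n > 1" using X by (simp add: filterlim_at_top_dense)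
    ultimately show ?thesis
    proof eventually_elim
      case (elim n)
      have "1 / site_scale (X n) = (ln (X n) / X n) powr p"
        using elim(2) by (simp add: site_scale_def powr_divide)
      moreover have "integrable M (\<lambda>\<omega>. h (?Y (X n) \<omega>))"
        using h elim(2) by (intro integrable_const_bound[of _ C] measurable_compose[OF Ym]) auto
      then have "(\<integral>\<^sup>+ \<omega>. ennreal (h (?Y (X n) \<omega>)) \<partial>M) = ennreal (\<integral>\<omega>. h (?Y (X n) \<omega>) \<partial>M)"
        using h by (intro nn_integral_eq_integral) auto
      ultimately show ?case using elim(1) False by (simp add: ennreal_less_iff)
    qed
  qed
  show "((\<lambda>t. \<integral>\<omega>. f (?Y t \<omega>) \<partial>M) \<longlongrightarrow> (\<integral>\<omega>. f \<omega> \<partial>?N)) at_top"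
  proof (rule tendsto_at_topI_sequentially)
    fix X :: "nat \<Rightarrow> real" assume X: "filterlim X at_top sequentially"
    have fN: "integrable ?N f" using K by (intro N.integrable_const_bound[of _ K]) auto
    have fM: "integrable M (\<lambda>\<omega>. f (?Y t \<omega>))" if "t > 0" for t
      using K that by (intro integrable_const_bound[of _ K] measurable_compose[OF Ym]) auto
    have X0: "\<forall>\<^sub>F n in sequentially. X n > 0" using X by (simp add: filterlim_at_top_dense)
    have 1: "(\<integral>x. K + f x \<partial>?N) = K + (\<integral>x. f x \<partial>?N)" "(\<integral>x. K - f x \<partial>?N) = K - (\<integral>x. f x \<partial>?N)"
      using N.prob_space by (simp_all add: Bochner_Integration.integral_add[OF N.integrable_const fN]
          Bochner_Integration.integral_diff[OF N.integrable_const fN])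
    have 2: "(\<integral>\<omega>. K + f (?Y t \<omega>) \<partial>M) = K + (\<integral>\<omega>. f (?Y t \<omega>) \<partial>M)"
      "(\<integral>\<omega>. K - f (?Y t \<omega>) \<partial>M) = K - (\<integral>\<omega>. f (?Y t \<omega>) \<partial>M)" if "t > 0" for t
      using prob_space by (simp_all add: Bochner_Integration.integral_add[OF integrable_const fM[OF that]]
          Bochner_Integration.integral_diff[OF integrable_const fM[OF that]])
    have bd: "0 \<le> K + f x" "K + f x \<le> 2 * K" "0 \<le> K - f x" "K - f x \<le> 2 * K" for x
      using K[of x] by auto
    show "(\<lambda>n. \<integral>\<omega>. f (?Y (X n) \<omega>) \<partial>M) \<longlonglongrightarrow> (\<integral>\<omega>. f \<omega> \<partial>?N)"
    proof (rule order_tendstoI)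
      fix a assume "a < (\<integral>\<omega>. f \<omega> \<partial>?N)"
      then have "\<forall>\<^sub>F n in sequentially. (\<integral>\<omega>. K + f (?Y (X n) \<omega>) \<partial>M) > K + a"
        using bd f 1 by (intro lower[of "\<lambda>x. K + f x" "2 * K" X] X continuous_intros) auto
      then show "\<forall>\<^sub>F n in sequentially. a < (\<integral>\<omega>. f (?Y (X n) \<omega>) \<partial>M)"
        using X0 by eventually_elim (simp add: 2)
    next
      fix a assume "a > (\<integral>\<omega>. f \<omega> \<partial>?N)"
      then have "\<forall>\<^sub>F n in sequentially. (\<integral>\<omega>. K - f (?Y (X n) \<omega>) \<partial>M) > K - a"
        using bd f 1 by (intro lower[of "\<lambda>x. K - f x" "2 * K" X] X continuous_intros) auto
      then show "\<forall>\<^sub>F n in sequentially. (\<integral>\<omega>. f (?Y (X n) \<omega>) \<partial>M) < a"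
        using X0 by eventually_elim (simp add: 2)
    qed
  qed
qed

end

end

section \<open>Choice of the exponents and of the maximisers\<close>

text \<open>A hierarchy of small numbers: \<delta> is a small fraction of q, \<epsilon> a small
  fraction of \<delta>, and \<epsilon>' is just large enough for the cluster estimates. For \<kappa>
  and \<sigma> there is ample room.\<close>

lemma pam_params_exist:
  fixes M :: "'a measure" and \<xi> :: "int ^ 'd::finite \<Rightarrow> 'a \<Rightarrow> real"
  assumes "pareto_field M \<alpha> \<xi>"
  shows "\<exists>d p q \<epsilon> \<epsilon>' \<delta> \<gamma> \<kappa> \<sigma> \<theta>. pam_params M \<alpha> \<xi> d p q \<epsilon> \<epsilon>' \<delta> \<gamma> \<kappa> \<sigma> \<theta>"
proof -
  interpret pareto_field M \<alpha> \<xi> by fact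
  define d where "d = real CARD('d)"
  have d: "d \<ge> 1" "\<alpha> > d" using \<alpha> by (auto simp: d_def Suc_leI)
  define q where "q = d / (\<alpha> - d)"
  have q: "q > 0" and q_eq: "q * (\<alpha> - d) = d" using d by (auto simp: q_def)
  define p where "p = q + 1"
  have p: "p > 0" "q * \<alpha> = p * d" using q q_eq unfolding p_def right_diff_distrib distrib_right by linarith+
  define \<delta> where "\<delta> = q / (8 * (\<alpha> + 1))"
  have \<delta>0: "\<delta> > 0" using q d by (simp add: \<delta>_def)
  have "\<delta> * (8 * (\<alpha> + 1)) = q" using d by (simp add: \<delta>_def)
  then have \<delta>\<alpha>: "\<delta> * \<alpha> + \<delta> = q / 8" by (simp add: algebra_simps)
  have \<delta>d: "\<delta> \<le> \<delta> * d" "\<delta> * d < \<delta> * \<alpha>" using d \<delta>0 by auto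
  \<comment> \<open>With \<open>\<epsilon>' = \<epsilon> * (3 * d + 3 * \<alpha> + 7)\<close>, as
    chosen below, \<open>\<epsilon> + \<epsilon>' = \<epsilon> * D = \<delta> / 2\<close>.\<close>
  define D where "D = 3 * d + 3 * \<alpha> + 8"
  have D0: "D > 0" using d by (simp add: D_def)
  define \<epsilon> where "\<epsilon> = \<delta> / (2 * D)"
  have \<epsilon>0: "\<epsilon> > 0" and "\<epsilon> * D = \<delta> / 2" using \<delta>0 D0 by (simp_all add: \<epsilon>_def)
  then have \<epsilon>D: "3 * (\<epsilon> * d) + 3 * (\<epsilon> * \<alpha>) + 8 * \<epsilon> = \<delta> / 2" by (simp add: D_def algebra_simps)
  have \<epsilon>d: "0 < \<epsilon> * d" "\<epsilon> * d < \<epsilon> * \<alpha>" using d \<epsilon>0 by auto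
  define \<theta> where "\<theta> = \<epsilon> * (\<alpha> - d) / (2 * d)"
  have \<theta>d: "\<theta> * d = \<epsilon> * (\<alpha> - d) / 2" using d by (simp add: \<theta>_def)
  have \<theta>0: "\<theta> > 0" using d \<epsilon>0 by (simp add: \<theta>_def)
  have \<theta>1: "\<theta> < 1"
  proof -
    have "\<theta> \<le> \<theta> * d" using d \<theta>0 by simp
    also have "\<dots> < \<epsilon> * (\<alpha> - d)" using d \<epsilon>0 unfolding \<theta>d by simp
    also have "\<dots> \<le> q * (\<alpha> - d)" using \<epsilon>D \<epsilon>d \<delta>\<alpha> \<delta>d \<epsilon>0 \<delta>0 d by (intro mult_right_mono) linarith+
    finally have "\<theta> < d" by (simp add: q_eq)
    have "\<theta> * q * 2 = \<epsilon> * (q * (\<alpha> - d)) / d" by (simp add: \<theta>_def)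
    then have "\<theta> * q * 2 = \<epsilon>" unfolding q_eq using d by simp
    moreover have "\<epsilon> < q" using \<epsilon>D \<epsilon>d \<delta>\<alpha> \<delta>d \<epsilon>0 \<delta>0 by linarith
    ultimately have "\<theta> * (q * 2) < 1 * (q * 2)" using q by (simp add: mult.assoc)
    then show ?thesis using q by (simp only: mult_less_cancel_right)
  qed
  \<comment> \<open>The lower limit for \<gamma> is \<open>d / \<alpha> = q / p\<close>. At this
    value \<open>(p + \<epsilon>) * \<gamma>\<close> is below \<open>q + \<epsilon>\<close> by
    \<open>\<epsilon> / p\<close>, and the surplus uses half of that room.\<close>
  define \<gamma> where "\<gamma> = d / \<alpha> + \<epsilon> / (2 * p * (p + \<epsilon>))"
  have \<gamma>1: "\<gamma> * \<alpha> > d"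
  proof -
    have "\<gamma> * \<alpha> = d + \<epsilon> / (2 * p * (p + \<epsilon>)) * \<alpha>" using d by (simp add: \<gamma>_def distrib_right)
    moreover have "\<epsilon> / (2 * p * (p + \<epsilon>)) * \<alpha> > 0" using \<epsilon>0 p d by (intro mult_pos_pos divide_pos_pos) auto
    ultimately show ?thesis by simp
  qed
  have \<gamma>2: "(p + \<epsilon>) * \<gamma> < q + \<epsilon>"
  proof -
    have da: "d / \<alpha> = q / p" using p d by (simp add: field_simps)
    have "(p + \<epsilon>) * \<gamma> = (p + \<epsilon>) * (q / p) + \<epsilon> / (2 * p)"
    proof -
      have p0: "p + \<epsilon> \<noteq> 0" using p \<epsilon>0 by linarith
      have "(p + \<epsilon>) * (\<epsilon> / (2 * p * (p + \<epsilon>))) = \<epsilon> / (2 * p)" using p0 by simp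
      then show ?thesis unfolding \<gamma>_def da distrib_left by simp
    qed
    then have "p * ((p + \<epsilon>) * \<gamma>) = (p + \<epsilon>) * q + \<epsilon> / 2" using p by (simp add: field_simps)
    also have "\<dots> < p * (q + \<epsilon>)" using \<epsilon>0 by (simp add: p_def algebra_simps)
    finally show ?thesis using p by simp
  qed
  have \<gamma>3: "(p + \<epsilon>) * (1 - \<gamma>) > 1" using \<gamma>2 by (simp add: p_def algebra_simps)
  have \<gamma>4: "\<gamma> < 1"
  proof (rule ccontr)
    assume "\<not> \<gamma> < 1"
    then have "(p + \<epsilon>) * (1 - \<gamma>) \<le> 0" using p \<epsilon>0 by (intro mult_nonneg_nonpos) auto
    then show False using \<gamma>3 by simp
  qed
  have "\<gamma> > 0" using p d \<epsilon>0 unfolding \<gamma>_def by (intro add_pos_pos divide_pos_pos mult_pos_pos) auto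
  have "pam_params M \<alpha> \<xi> d p q \<epsilon> (\<epsilon> * (3 * d + 3 * \<alpha> + 7)) \<delta> \<gamma> (p / 2) (q / 4) \<theta>"
  proof unfold_locales
    show "d = real CARD('d)" by (simp add: d_def)
    show "p = q + 1" by (simp add: p_def)
    show "0 < \<epsilon> * (3 * d + 3 * \<alpha> + 7)" using \<epsilon>0 d by simp
    have \<epsilon>': "\<epsilon> * (3 * d + 3 * \<alpha> + 7) = \<delta> / 2 - \<epsilon>" using \<epsilon>D by (simp add: algebra_simps)
    show "\<epsilon> + \<epsilon> * (3 * d + 3 * \<alpha> + 7) < \<delta>" using \<delta>0 unfolding \<epsilon>' by simp
    show "3 * \<delta> + \<epsilon> < q" using \<epsilon>D \<epsilon>d \<delta>\<alpha> \<delta>d \<epsilon>0 \<delta>0 by linarith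
    show "p / 2 < p - \<epsilon> * (3 * d + 3 * \<alpha> + 7)"
      unfolding \<epsilon>' using p_def \<epsilon>D \<epsilon>d \<delta>\<alpha> \<delta>d \<epsilon>0 \<delta>0 by linarith
    show "\<epsilon> * d + \<delta> * \<alpha> < p / 2"
      using p_def \<epsilon>D \<epsilon>d \<delta>\<alpha> \<delta>d \<epsilon>0 \<delta>0 by linarith
    show "\<epsilon> * (1 + 2 * d) + 2 * \<delta> * (\<alpha> + 1) + q / 4 < q"
    proof -
      have "\<epsilon> * (1 + 2 * d) = \<epsilon> + 2 * (\<epsilon> * d)" "2 * \<delta> * (\<alpha> + 1) = 2 * (\<delta> * \<alpha>) + 2 * \<delta>"
        by (simp_all add: algebra_simps)
      then show ?thesis using \<epsilon>D \<epsilon>d \<delta>\<alpha> \<delta>d \<epsilon>0 \<delta>0 by linarith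
    qed
    show "\<epsilon> * (3 * d + 3 * \<alpha> + 6) < \<epsilon> * (3 * d + 3 * \<alpha> + 7)" using \<epsilon>0 by simp
    show "\<theta> * d < \<epsilon> * (\<alpha> - d)" using \<epsilon>0 d unfolding \<theta>d by simp
    show "\<epsilon> + \<theta> < p" using p_def \<theta>1 \<epsilon>D \<epsilon>d \<delta>\<alpha> \<delta>d \<epsilon>0 \<delta>0 by linarith
    show "0 < q / 4" "0 < p / 2" using q p(1) by simp_all
  qed (fact p q \<epsilon>0 \<theta>0 \<gamma>1 \<gamma>2 \<gamma>3 \<gamma>4 \<open>\<gamma> > 0\<close>)+
  then show ?thesis by blast
qed

text \<open>A measurable maximiser is fixed for every finite set, and the second one is that of the
  ball without the first. It is measurable because the first takes countably many values.\<close>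

lemma (in pam_params) cities_exist:
  "\<exists>Z1 Z2. \<forall>t. Z1 t \<in> measurable M (count_space UNIV) \<and> Z2 t \<in> measurable M (count_space UNIV) \<and>
     (\<forall>\<omega>. Z1 t \<omega> \<in> pam_ball t \<and>
       (\<forall>z\<in>pam_ball t. psi (1 / t) z (\<xi> z \<omega>) \<le> psi (1 / t) (Z1 t \<omega>) (\<xi> (Z1 t \<omega>) \<omega>)) \<and>
       Z2 t \<omega> \<in> pam_ball t - {Z1 t \<omega>} \<and>
       (\<forall>z\<in>pam_ball t - {Z1 t \<omega>}. psi (1 / t) z (\<xi> z \<omega>) \<le> psi (1 / t) (Z2 t \<omega>) (\<xi> (Z2 t \<omega>) \<omega>)))"
  (is "\<exists>Z1 Z2. \<forall>t. ?P t (Z1 t) (Z2 t)")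
proof -
  have "\<exists>Z1 Z2. ?P t Z1 Z2" for t
  proof -
    let ?Y = "\<lambda>z \<omega>. psi (1 / t) z (\<xi> z \<omega>)"
    have Y: "?Y z \<in> borel_measurable M" for z by (rule measurable_compose[OF _ psi_measurable]) measurable
    define A where "A = (\<lambda>B. SOME Z. Z \<in> measurable M (count_space UNIV) \<and>
        (\<forall>\<omega>. Z \<omega> \<in> B \<and> (\<forall>z\<in>B. ?Y z \<omega> \<le> ?Y (Z \<omega>) \<omega>)))"
    have A: "A B \<in> measurable M (count_space UNIV) \<and> (\<forall>\<omega>. A B \<omega> \<in> B \<and> (\<forall>z\<in>B. ?Y z \<omega> \<le> ?Y (A B \<omega>) \<omega>))"
      if "finite B" "B \<noteq> {}" for B
      unfolding A_def by (rule someI_ex[OF measurable_argmax[where Y = ?Y, OF that Y]])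
    have b1: "finite (pam_ball t)" "pam_ball t \<noteq> {}" using finite_pam_ball pam_ball_two[of t] by auto
    have b2: "finite (pam_ball t - {z})" "pam_ball t - {z} \<noteq> {}" for z
      by (rule finite_Diff[OF finite_pam_ball], rule pam_ball_two)
    define Z1 where "Z1 = A (pam_ball t)"
    define Z2 where "Z2 = (\<lambda>\<omega>. A (pam_ball t - {Z1 \<omega>}) \<omega>)"
    have "Z1 \<in> measurable M (count_space UNIV)"
      unfolding Z1_def using A[OF b1] by (rule conjunct1)
    moreover have "Z2 \<in> measurable M (count_space UNIV)"
      unfolding Z2_def using A[OF b2, THEN conjunct1] \<open>Z1 \<in> _\<close> by (rule measurable_compose_countable)
    ultimately have "?P t Z1 Z2"
      using A[OF b1, THEN conjunct2, folded Z1_def] A[OF b2, THEN conjunct2] unfolding Z2_def by blast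
    then show ?thesis by (intro exI)
  qed
  then have "\<forall>t. \<exists>Z. ?P t (fst Z) (snd Z)" by simp
  then obtain Z where "\<forall>t. ?P t (fst (Z t)) (snd (Z t))" by (rule choice[THEN exE])
  then show ?thesis by (intro exI[of _ "\<lambda>t. fst (Z t)"] exI[of _ "\<lambda>t. snd (Z t)"])
qed

theorem theorem1p3:
  fixes M :: "'a measure"
    and \<alpha> :: real
    and \<xi> :: "int ^ 'd::finite \<Rightarrow> 'a \<Rightarrow> real"
    and u :: "real \<Rightarrow> int ^ 'd \<Rightarrow> 'a \<Rightarrow> real"
    and U :: "real \<Rightarrow> 'a \<Rightarrow> real"
  assumes "prob_space M"
    and "\<alpha> > real CARD('d)"
    and "prob_space.indep_vars M (\<lambda>_. borel) \<xi> UNIV"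
    and "\<And>z x. x \<ge> 1 \<Longrightarrow> measure M {\<omega> \<in> space M. \<xi> z \<omega> < x} = 1 - x powr (- \<alpha>)"
    and "AE \<omega> in M. nonneg_pam_solution (\<lambda>z. \<xi> z \<omega>) (\<lambda>t z. u t z \<omega>)"
    and "\<And>t \<omega>. U t \<omega> = (\<Sum>\<^sub>\<infinity>z\<in>UNIV. u t z \<omega>)"
  shows "\<exists>Z1 Z2 :: real \<Rightarrow> 'a \<Rightarrow> int ^ 'd.
     (\<forall>t>0. Z1 t \<in> measurable M (count_space UNIV)) \<and>
     (\<forall>t>0. Z2 t \<in> measurable M (count_space UNIV)) \<and>
     (\<forall>t>0. \<forall>\<omega>\<in>space M. Z1 t \<omega> \<noteq> Z2 t \<omega>) \<and>
     (AE \<omega> in M.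
        ((\<lambda>t. (u t (Z1 t \<omega>) \<omega> + u t (Z2 t \<omega>) \<omega>) / U t \<omega>) \<longlongrightarrow> 1) at_top) \<and>
     converges_in_probability (completion M) (\<lambda>t \<omega>. u t (Z1 t \<omega>) \<omega> / U t \<omega>) 1 \<and>
     (\<exists>(N :: (real ^ 'd) measure) (X1 :: real ^ 'd \<Rightarrow> real ^ 'd).
        prob_space N \<and>
        distributed N lborel X1 (\<lambda>x. ennreal (pam_density \<alpha> x)) \<and>
        converges_in_distribution M
          (\<lambda>t \<omega>. ((ln t / t) powr (pam_q CARD('d) \<alpha> + 1)) *\<^sub>R lattice_embed (Z1 t \<omega>)) N X1)"
proof -
  have "pareto_field M \<alpha> \<xi>"
    using assms(1-4) by (simp add: pareto_field_def pareto_field_axioms_def)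
  from pam_params_exist[OF this] obtain d p q \<epsilon> \<epsilon>' \<delta> \<gamma> \<kappa> \<sigma> \<theta> where "pam_params M \<alpha> \<xi> d p q \<epsilon> \<epsilon>' \<delta> \<gamma> \<kappa> \<sigma> \<theta>"
    by (elim exE) iprover
  then interpret pam_params M \<alpha> \<xi> d p q \<epsilon> \<epsilon>' \<delta> \<gamma> \<kappa> \<sigma> \<theta> .
  obtain Z1 Z2 where Z: "\<forall>t. Z1 t \<in> measurable M (count_space UNIV) \<and> Z2 t \<in> measurable M (count_space UNIV) \<and>
     (\<forall>\<omega>. Z1 t \<omega> \<in> pam_ball t \<and>
       (\<forall>z\<in>pam_ball t. psi (1 / t) z (\<xi> z \<omega>) \<le> psi (1 / t) (Z1 t \<omega>) (\<xi> (Z1 t \<omega>) \<omega>)) \<and>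
       Z2 t \<omega> \<in> pam_ball t - {Z1 t \<omega>} \<and>
       (\<forall>z\<in>pam_ball t - {Z1 t \<omega>}. psi (1 / t) z (\<xi> z \<omega>) \<le> psi (1 / t) (Z2 t \<omega>) (\<xi> (Z2 t \<omega>) \<omega>)))"
    using cities_exist by (elim exE)
  have Zm: "Z1 t \<in> measurable M (count_space UNIV)" "Z2 t \<in> measurable M (count_space UNIV)"
    and Zs: "Z1 t \<omega> \<in> pam_ball t"
      "z \<in> pam_ball t \<Longrightarrow> psi (1 / t) z (\<xi> z \<omega>) \<le> psi (1 / t) (Z1 t \<omega>) (\<xi> (Z1 t \<omega>) \<omega>)"
      "Z2 t \<omega> \<in> pam_ball t - {Z1 t \<omega>}"
      "z \<in> pam_ball t - {Z1 t \<omega>} \<Longrightarrow> psi (1 / t) z (\<xi> z \<omega>) \<le> psi (1 / t) (Z2 t \<omega>) (\<xi> (Z2 t \<omega>) \<omega>)"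
    for t \<omega> z using Z[THEN spec, of t] by blast+
  \<comment> \<open>The limit variable is realised as the identity on the space that carries the
    limiting law.\<close>
  let ?N = "density lborel (\<lambda>x :: real ^ 'd. ennreal (pam_density \<alpha> x))"
  have "distributed ?N lborel (\<lambda>x. x) (\<lambda>x. ennreal (pam_density \<alpha> x))"
    by (simp add: distributed_def distr_id2)
  moreover have "converges_in_distribution M
      (\<lambda>t \<omega>. ((ln t / t) powr (pam_q CARD('d) \<alpha> + 1)) *\<^sub>R lattice_embed (Z1 t \<omega>)) ?N (\<lambda>x. x)"
    unfolding pam_q_eq pq(1)[symmetric] by (rule scaled_argmax_in_distribution[of Z1]) (rule Zm Zs | assumption)+
  moreover have "AE \<omega> in M. ((\<lambda>t. (u t (Z1 t \<omega>) \<omega> + u t (Z2 t \<omega>) \<omega>) / U t \<omega>) \<longlongrightarrow> 1) at_top"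
    by (rule AE_two_cities[OF assms(5,6), of Z1 Z2]) (rule Zm Zs | assumption)+
  moreover have "converges_in_probability (completion M) (\<lambda>t \<omega>. u t (Z1 t \<omega>) \<omega> / U t \<omega>) 1"
    by (rule in_probability[OF assms(5,6), of Z1 Z2]) (rule Zm Zs | assumption)+
  moreover have "Z1 t \<omega> \<noteq> Z2 t \<omega>" for t \<omega> using Zs(3)[of t \<omega>] by auto
  ultimately show ?thesis
    using Zm prob_space_pam_density
    by - (rule exI[of _ Z1], rule exI[of _ Z2], intro conjI exI[of _ ?N] exI[of _ "\<lambda>x. x"] allI ballI impI, assumption+)
qed

end
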